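(* Let $\sigma,\tau:\mathbb R_+\to\mathbb R$ satisfy $\sup_{x>0}\int_x^{x+1}\sigma(t)^2\,dt<\infty$ and $\sup_{x>0}\int_x^{x+1}|\tau(t)|\,dt<\infty$, and suppose that $$\lim_{x\to\infty}\int_x^{x+1}\left(\sigma^2(t)+|\tau(t)|\right)dt=0.$$ Then, for arbitrary $\alpha\in[0,\pi)$, $\mathrm{Spec}_{\mathrm{ess}}(H^\alpha)=[0,\infty)$.
   Context: $\mathbb R_+=(0,\infty)$. For $u\in AC_{\mathrm{loc}}(\mathbb R_+)$ put $u^{[1]}:=u'-\sigma u$, let $\mathfrak D:=\{u\in AC_{\mathrm{loc}}(\mathbb R_+): u^{[1]}\in AC_{\mathrm{loc}}(\mathbb R_+)\}$ and, for $u\in\mathfrak D$, $\ell u:=-(u^{[1]})'-\sigma u^{[1]}+(\tau-\sigma^2)u$. The endpoint $0$ is regular, so $u(0),u^{[1]}(0)$ exist as limits whenever $u\in L^2(\mathbb R_+)\cap\mathfrak D$ and $\ell u\in L^2(\mathbb R_+)$; the endpoint $\infty$ is limit point. $H^\alpha$ is the self-adjoint operator in $L^2(\mathbb R_+)$ given by $H^\alpha u=\ell u$ on $\mathrm{dom}(H^\alpha)=\{u\in L^2(\mathbb R_+): u\in\mathfrak D,\ \ell u\in L^2(\mathbb R_+),\ u(0)\cos\alpha+u^{[1]}(0)\sin\alpha=0\}$. $\mathrm{Spec}_{\mathrm{ess}}$ denotes the essential spectrum. *)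

theory Defs
  imports "HOL-Analysis.Analysis"
begin

section \<open>The complex Hilbert space of square integrable functions on the half-line\<close>

abbreviation half_line :: "real measure" where
  "half_line \<equiv> lebesgue_on {0<..}"

definition square_integrable :: "(real \<Rightarrow> complex) \<Rightarrow> bool" where
  "square_integrable f \<longleftrightarrow>
     f \<in> borel_measurable half_line \<and> integrable half_line (\<lambda>x. (cmod (f x))\<^sup>2)"

definition l2_rel :: "(real \<Rightarrow> complex) \<Rightarrow> (real \<Rightarrow> complex) \<Rightarrow> bool" where
  "l2_rel f g \<longleftrightarrow> square_integrable f \<and> square_integrable g \<and> (AE x in half_line. f x = g x)"

lemma square_integrable_zero: "square_integrable (\<lambda>x. 0)"
  by (simp add: square_integrable_def)

lemma square_integrable_scale:
  assumes "square_integrable f"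
  shows "square_integrable (\<lambda>x. c * f x)"
  using assms by (auto simp: square_integrable_def norm_mult power_mult_distrib)

lemma square_integrable_add:
  assumes f: "square_integrable f" and g: "square_integrable g"
  shows "square_integrable (\<lambda>x. f x + g x)"
proof -
  have [measurable]: "f \<in> borel_measurable half_line" "g \<in> borel_measurable half_line"
    using f g by (auto simp: square_integrable_def)
  have "integrable half_line (\<lambda>x. (cmod (f x + g x))\<^sup>2)"
  proof (rule Bochner_Integration.integrable_bound)
    show "integrable half_line (\<lambda>x. 2 * ((cmod (f x))\<^sup>2 + (cmod (g x))\<^sup>2))"
      using f g by (auto simp: square_integrable_def)
    have "(cmod (f x + g x))\<^sup>2 \<le> 2 * ((cmod (f x))\<^sup>2 + (cmod (g x))\<^sup>2)" for x
    proof -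
      have "(cmod (f x + g x))\<^sup>2 \<le> (cmod (f x) + cmod (g x))\<^sup>2"
        by (intro power_mono norm_triangle_ineq) auto
      also have "\<dots> \<le> 2 * ((cmod (f x))\<^sup>2 + (cmod (g x))\<^sup>2)"
        using zero_le_power2[of "cmod (f x) - cmod (g x)"]
        by (simp add: power2_sum power2_diff)
      finally show ?thesis .
    qed
    then show "AE x in half_line. norm ((cmod (f x + g x))\<^sup>2)
        \<le> norm (2 * ((cmod (f x))\<^sup>2 + (cmod (g x))\<^sup>2))"
      by auto
  qed measurable
  then show ?thesis by (simp add: square_integrable_def)
qed

lemma integrable_inner_square_integrable:
  assumes f: "square_integrable f" and g: "square_integrable g"
  shows "integrable half_line (\<lambda>x. f x \<bullet> g x)"
proof -
  have [measurable]: "f \<in> borel_measurable half_line" "g \<in> borel_measurable half_line"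
    using f g by (auto simp: square_integrable_def)
  show ?thesis
  proof (rule Bochner_Integration.integrable_bound)
    show "integrable half_line (\<lambda>x. (cmod (f x))\<^sup>2 + (cmod (g x))\<^sup>2)"
      using f g by (auto simp: square_integrable_def)
    have "\<bar>f x \<bullet> g x\<bar> \<le> (cmod (f x))\<^sup>2 + (cmod (g x))\<^sup>2" for x
    proof -
      have "\<bar>f x \<bullet> g x\<bar> \<le> cmod (f x) * cmod (g x)"
        by (rule Cauchy_Schwarz_ineq2)
      also have "\<dots> \<le> (cmod (f x))\<^sup>2 + (cmod (g x))\<^sup>2"
        using zero_le_power2[of "cmod (f x) - cmod (g x)"]
          zero_le_power2[of "cmod (f x)"] zero_le_power2[of "cmod (g x)"]
        unfolding power2_diff by linarith
      finally show ?thesis .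
    qed
    then show "AE x in half_line. norm (f x \<bullet> g x)
        \<le> norm ((cmod (f x))\<^sup>2 + (cmod (g x))\<^sup>2)"
      by auto
  qed measurable
qed

quotient_type l2 = "real \<Rightarrow> complex" / partial: l2_rel
proof (rule part_equivpI)
  show "\<exists>f. l2_rel f f"
    by (rule exI[of _ "\<lambda>x. 0"]) (simp add: l2_rel_def square_integrable_zero)
  show "symp l2_rel"
    by (auto simp: symp_def l2_rel_def)
  show "transp l2_rel"
    by (auto simp: transp_def l2_rel_def)
qed

lift_definition scaleC :: "complex \<Rightarrow> l2 \<Rightarrow> l2" (infixr "*\<^sub>C" 75)
  is "\<lambda>c f x. c * f x"
  by (auto simp: l2_rel_def square_integrable_scale)

instantiation l2 :: real_inner
begin

lift_definition zero_l2 :: l2 is "\<lambda>x. 0"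
  by (simp add: l2_rel_def square_integrable_zero)

lift_definition plus_l2 :: "l2 \<Rightarrow> l2 \<Rightarrow> l2" is "\<lambda>f g x. f x + g x"
  by (auto simp: l2_rel_def square_integrable_add)

lift_definition inner_l2 :: "l2 \<Rightarrow> l2 \<Rightarrow> real" is
  "\<lambda>f g. \<integral>x. f x \<bullet> g x \<partial>half_line"
proof -
  fix f f' g g' :: "real \<Rightarrow> complex"
  assume f: "l2_rel f f'" and g: "l2_rel g g'"
  then have "AE x in half_line. f x = f' x" "AE x in half_line. g x = g' x"
    by (auto simp: l2_rel_def)
  then have "AE x in half_line. f x \<bullet> g x = f' x \<bullet> g' x"
    by eventually_elim simp
  moreover have "f \<in> borel_measurable half_line" "f' \<in> borel_measurable half_line"
    "g \<in> borel_measurable half_line" "g' \<in> borel_measurable half_line"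
    using f g by (auto simp: l2_rel_def square_integrable_def)
  ultimately show "(\<integral>x. f x \<bullet> g x \<partial>half_line) = (\<integral>x. f' x \<bullet> g' x \<partial>half_line)"
    by (intro integral_cong_AE borel_measurable_inner)
qed

definition uminus_l2 :: "l2 \<Rightarrow> l2" where "uminus_l2 u = (-1) *\<^sub>C u"
definition minus_l2 :: "l2 \<Rightarrow> l2 \<Rightarrow> l2" where "minus_l2 u v = u + - v"
definition scaleR_l2 :: "real \<Rightarrow> l2 \<Rightarrow> l2" where "scaleR_l2 r u = complex_of_real r *\<^sub>C u"
definition norm_l2 :: "l2 \<Rightarrow> real" where "norm_l2 u = sqrt (u \<bullet> u)"
definition sgn_l2 :: "l2 \<Rightarrow> l2" where
  "sgn_l2 u = complex_of_real (inverse (norm u)) *\<^sub>C u"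
definition dist_l2 :: "l2 \<Rightarrow> l2 \<Rightarrow> real" where "dist_l2 u v = norm (u - v)"
definition uniformity_l2 :: "(l2 \<times> l2) filter" where
  "uniformity_l2 = (INF e\<in>{0<..}. principal {(x, y). dist x y < e})"
definition open_l2 :: "l2 set \<Rightarrow> bool" where
  "open_l2 U \<longleftrightarrow> (\<forall>x\<in>U. \<forall>\<^sub>F (x', y) in uniformity. x' = x \<longrightarrow> y \<in> U)"

instance
proof
  fix u v w :: l2 and r s :: real
  show "u + v + w = u + (v + w)"
    by transfer (auto simp: l2_rel_def ac_simps intro!: square_integrable_add)
  show "u + v = v + u"
    by transfer (auto simp: l2_rel_def ac_simps intro!: square_integrable_add)
  show "0 + u = u"
    by transfer (auto simp: l2_rel_def)
  show "- u + u = 0"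
    unfolding uminus_l2_def
    by transfer (auto simp: l2_rel_def square_integrable_zero)
  show "u - v = u + - v" by (rule minus_l2_def)
  show "r *\<^sub>R (u + v) = r *\<^sub>R u + r *\<^sub>R v"
    unfolding scaleR_l2_def
    by transfer (auto simp: l2_rel_def distrib_left
        intro!: square_integrable_add square_integrable_scale
          square_integrable_add[OF square_integrable_scale square_integrable_scale])
  show "(r + s) *\<^sub>R u = r *\<^sub>R u + s *\<^sub>R u"
    unfolding scaleR_l2_def
    by transfer (auto simp: l2_rel_def distrib_right intro!: square_integrable_add square_integrable_scale)
  show "r *\<^sub>R s *\<^sub>R u = (r * s) *\<^sub>R u"
    unfolding scaleR_l2_def
    by transfer (auto simp: l2_rel_def mult.assoc intro!: square_integrable_scale)
  show "1 *\<^sub>R u = u"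
    unfolding scaleR_l2_def by transfer (auto simp: l2_rel_def)
  show "dist u v = norm (u - v)" by (rule dist_l2_def)
  show "sgn u = inverse (norm u) *\<^sub>R u" by (simp add: sgn_l2_def scaleR_l2_def)
  show "(uniformity :: (l2 \<times> l2) filter) = (INF e\<in>{0<..}. principal {(x, y). dist x y < e})"
    by (rule uniformity_l2_def)
  show "open U \<longleftrightarrow> (\<forall>x\<in>U. \<forall>\<^sub>F (x', y) in uniformity. x' = x \<longrightarrow> y \<in> U)" for U :: "l2 set"
    by (rule open_l2_def)
  show "norm u = sqrt (u \<bullet> u)" by (rule norm_l2_def)
  show "u \<bullet> v = v \<bullet> u"
    by transfer (simp add: inner_commute)
  show "(u + v) \<bullet> w = u \<bullet> w + v \<bullet> w"
    by transfer (simp add: l2_rel_def inner_add_left integrable_inner_square_integrable)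
  show "r *\<^sub>R u \<bullet> v = r * (u \<bullet> v)"
    unfolding scaleR_l2_def
    by transfer (simp add: scaleR_conv_of_real[symmetric])
  show "0 \<le> u \<bullet> u"
    by transfer simp
  show "u \<bullet> u = 0 \<longleftrightarrow> u = 0"
  proof (transfer, goal_cases)
    case (1 f)
    then have "square_integrable f" by (simp add: l2_rel_def)
    with integrable_inner_square_integrable[OF this this] show ?case
      by (simp add: integral_nonneg_eq_0_iff_AE l2_rel_def square_integrable_zero)
  qed
qed

end

lemma vector_space_scaleC: "vector_space scaleC"
proof
  fix u v :: l2 and a b :: complex
  show "a *\<^sub>C (u + v) = a *\<^sub>C u + a *\<^sub>C v"
    by transfer (auto simp: l2_rel_def distrib_left intro!: square_integrable_add
        square_integrable_add[OF square_integrable_scale square_integrable_scale] square_integrable_scale)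
  show "(a + b) *\<^sub>C u = a *\<^sub>C u + b *\<^sub>C u"
    by transfer (auto simp: l2_rel_def distrib_right intro!: square_integrable_add square_integrable_scale)
  show "a *\<^sub>C b *\<^sub>C u = (a * b) *\<^sub>C u"
    by transfer (auto simp: l2_rel_def mult.assoc intro!: square_integrable_scale)
  show "1 *\<^sub>C u = u"
    by transfer (auto simp: l2_rel_def)
qed


section \<open>Spectra of unbounded operators\<close>

text \<open>An operator \<open>T\<close>, possibly unbounded and defined only on a subspace, is given by its graph
  \<open>{(u, T u) | u. u \<in> dom T}\<close>.\<close>

text \<open>The map \<open>R\<close> below is the everywhere defined bounded inverse of \<open>T - z\<close>.\<close>

definition resolvent_set :: "(l2 \<times> l2) set \<Rightarrow> complex set" where
  "resolvent_set T = {z. \<exists>R. bounded_linear R \<and>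
     (\<forall>f u. R f = u \<longleftrightarrow> (\<exists>v. (u, v) \<in> T \<and> f = v - z *\<^sub>C u))}"

definition spectrum :: "(l2 \<times> l2) set \<Rightarrow> complex set" where
  "spectrum T = - resolvent_set T"

definition eigenspace :: "(l2 \<times> l2) set \<Rightarrow> complex \<Rightarrow> l2 set" where
  "eigenspace T z = {u. (u, z *\<^sub>C u) \<in> T}"

text \<open>The discrete spectrum consists of the isolated points of the spectrum that are eigenvalues of
  finite multiplicity. This is the usual notion for self-adjoint operators, where geometric and
  algebraic multiplicities agree.\<close>

definition discrete_spectrum :: "(l2 \<times> l2) set \<Rightarrow> complex set" where
  "discrete_spectrum T = {z \<in> spectrum T. \<not> z islimpt spectrum T \<and>
     (\<exists>u. u \<noteq> 0 \<and> u \<in> eigenspace T z) \<and>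
     (\<exists>B. finite B \<and> eigenspace T z \<subseteq> module.span scaleC B)}"

definition essential_spectrum :: "(l2 \<times> l2) set \<Rightarrow> complex set" where
  "essential_spectrum T = spectrum T - discrete_spectrum T"


section \<open>The Sturm--Liouville operator\<close>

text \<open>For a division into nonoverlapping compact intervals \<open>K\<close>, the endpoints of \<open>K\<close> are \<open>Inf K\<close>
  and \<open>Sup K\<close>; so this is the usual epsilon-delta definition of absolute continuity.\<close>

definition abs_continuous_on :: "real set \<Rightarrow> (real \<Rightarrow> complex) \<Rightarrow> bool" where
  "abs_continuous_on S u \<longleftrightarrow>
     (\<forall>\<epsilon>>0. \<exists>\<delta>>0. \<forall>\<D> A. \<D> division_of A \<and> A \<subseteq> S \<and> (\<Sum>K\<in>\<D>. Sup K - Inf K) < \<delta> \<longrightarrow>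
        (\<Sum>K\<in>\<D>. cmod (u (Sup K) - u (Inf K))) < \<epsilon>)"

text \<open>Here and below, only the values of functions on the open half-line matter.\<close>

definition AC_loc :: "(real \<Rightarrow> complex) \<Rightarrow> bool" where
  "AC_loc u \<longleftrightarrow> (\<forall>a b. 0 < a \<and> a < b \<longrightarrow> abs_continuous_on {a..b} u)"

text \<open>For locally absolutely continuous \<open>u\<close>, the expression \<open>u' - \<sigma> u\<close> is defined only almost
  everywhere; \<open>w\<close> is its locally absolutely continuous representative, which is unique
  on the open half-line if it exists.\<close>

definition is_quasi_derivative ::
    "(real \<Rightarrow> real) \<Rightarrow> (real \<Rightarrow> complex) \<Rightarrow> (real \<Rightarrow> complex) \<Rightarrow> bool" where
  "is_quasi_derivative \<sigma> u w \<longleftrightarrow> AC_loc w \<and>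
     (AE x in half_line. w x = vector_derivative u (at x) - complex_of_real (\<sigma> x) * u x)"

definition \<DD> :: "(real \<Rightarrow> real) \<Rightarrow> (real \<Rightarrow> complex) set" where
  "\<DD> \<sigma> = {u. AC_loc u \<and> (\<exists>w. is_quasi_derivative \<sigma> u w)}"

definition quasi_derivative :: "(real \<Rightarrow> real) \<Rightarrow> (real \<Rightarrow> complex) \<Rightarrow> real \<Rightarrow> complex" where
  "quasi_derivative \<sigma> u = (SOME w. is_quasi_derivative \<sigma> u w)"

definition ell :: "(real \<Rightarrow> real) \<Rightarrow> (real \<Rightarrow> real) \<Rightarrow> (real \<Rightarrow> complex) \<Rightarrow> real \<Rightarrow> complex" where
  "ell \<sigma> \<tau> u x =
     - vector_derivative (quasi_derivative \<sigma> u) (at x)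
     - complex_of_real (\<sigma> x) * quasi_derivative \<sigma> u x
     + complex_of_real (\<tau> x - (\<sigma> x)\<^sup>2) * u x"

text \<open>The boundary values at the regular endpoint 0 are one-sided limits.\<close>

definition dom_H :: "(real \<Rightarrow> real) \<Rightarrow> (real \<Rightarrow> real) \<Rightarrow> real \<Rightarrow> (real \<Rightarrow> complex) set" where
  "dom_H \<sigma> \<tau> \<alpha> = {u. square_integrable u \<and> u \<in> \<DD> \<sigma> \<and> square_integrable (ell \<sigma> \<tau> u) \<and>
     Lim (at_right 0) u * complex_of_real (cos \<alpha>)
       + Lim (at_right 0) (quasi_derivative \<sigma> u) * complex_of_real (sin \<alpha>) = 0}"

definition H :: "(real \<Rightarrow> real) \<Rightarrow> (real \<Rightarrow> real) \<Rightarrow> real \<Rightarrow> (l2 \<times> l2) set" where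
  "H \<sigma> \<tau> \<alpha> = {(abs_l2 u, abs_l2 (ell \<sigma> \<tau> u)) | u. u \<in> dom_H \<sigma> \<tau> \<alpha>}"

end

theory Submission
  imports Defs
begin

text \<open>In the variables \<open>u\<close> and \<open>w = u' - \<sigma> u\<close> the equation \<open>(\<ell> - z) u = f\<close> is the system
  \<open>u' = \<sigma> u + w\<close>, \<open>w' = - \<sigma> w + (\<tau> - \<sigma>\<^sup>2 - z) u - f\<close>, whose coefficients are close to constant near infinity.
  For \<open>z \<notin> [0,\<infinity>)\<close> the constant coefficient system has an exponential dichotomy, which persists: the
  square integrable solutions of the homogeneous equation are the multiples of one exponentially decaying
  solution \<open>\<psi>\<close>, and the inhomogeneous equation has a solution whose norm is bounded by that of \<open>f\<close>. If
  \<open>\<psi>\<close> violates the boundary condition, correcting by a multiple of \<open>\<psi>\<close> gives the resolvent. Otherwise \<open>z\<close> is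
  a simple eigenvalue. It is isolated: an eigenfunction \<open>v\<close> for \<open>z' \<noteq> z\<close> near \<open>z\<close> solves \<open>(\<ell> - z) v = (z' - z) v\<close>,
  hence is the bounded particular solution plus a multiple of \<open>\<psi>\<close>; as \<open>v\<close> is orthogonal to \<open>\<psi>\<close>, this gives
  \<open>\<parallel>v\<parallel> \<le> K \<bar>z' - z\<bar> \<parallel>v\<parallel>\<close>. For \<open>z = k\<^sup>2 \<ge> 0\<close>, solutions close to \<open>exp (\<i> k x)\<close> on long intervals far out, cut off
  smoothly, form a Weyl sequence; so \<open>[0,\<infinity>)\<close> lies in the spectrum and none of its points is isolated.\<close>

section \<open>Primitives and absolute continuity\<close>

text \<open>Near infinity \<sigma> and \<tau> are small only in the mean over unit intervals, never
  pointwise, and for \<sigma> it is the square that is controlled. Every differential equation is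
  therefore read as an integral equation with an integrable density, and all perturbation estimates
  use integrals of the coefficients: a kernel \<open>exp (- r * \<bar>x - t\<bar>)\<close> varies by
  a bounded factor on each unit interval, so it turns smallness in the mean into a uniformly small
  integral over the line. Absolute continuity, which is defined by divisions, is tied to this
  integral form once, by way of total variation and the Radon--Nikodym theorem. A second obstacle is
  that the norm of \<open>u\<close> does not control the quasi-derivative, so the Wronskian of a
  square integrable solution with \<psi> is not seen to vanish at infinity; it is averaged against a
  weight that removes the quasi-derivative of the unknown solution. Since \<open>H\<close> is given
  only as a graph, reality of eigenvalues and orthogonality of eigenfunctions are read off from the
  Wronskian and the boundary condition.\<close>

definition primitive_on :: "real set \<Rightarrow> (real \<Rightarrow> 'a::euclidean_space) \<Rightarrow> (real \<Rightarrow> 'a) \<Rightarrow> bool" where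
  "primitive_on S u g \<longleftrightarrow> (\<forall>a\<in>S. \<forall>b\<in>S. a \<le> b \<longrightarrow>
     g absolutely_integrable_on {a..b} \<and> u b - u a = integral {a..b} g)"

lemma primitive_onD:
  assumes "primitive_on S u g" "a \<in> S" "b \<in> S" "a \<le> b"
  shows "g absolutely_integrable_on {a..b}" "u b - u a = integral {a..b} g"
  using assms by (auto simp: primitive_on_def)

lemma primitive_on_subset: "primitive_on S u g \<Longrightarrow> T \<subseteq> S \<Longrightarrow> primitive_on T u g"
  by (auto simp: primitive_on_def)

lemma primitive_on_Icc:
  assumes "g absolutely_integrable_on {a..b}"
    and "\<And>x. x \<in> {a..b} \<Longrightarrow> u x = u a + integral {a..x} g"
  shows "primitive_on {a..b} u g"
  unfolding primitive_on_def
proof (intro ballI impI conjI)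
  fix c d assume cd: "c \<in> {a..b}" "d \<in> {a..b}" "c \<le> d"
  show "g absolutely_integrable_on {c..d}"
    using absolutely_integrable_on_subinterval[OF assms(1)] cd by auto
  have "g integrable_on {a..d}"
    using absolutely_integrable_on_subinterval[OF assms(1), of a d] cd
    by (auto simp: absolutely_integrable_on_def)
  then have "integral {a..c} g + integral {c..d} g = integral {a..d} g"
    using cd by (intro Henstock_Kurzweil_Integration.integral_combine) auto
  then show "u d - u c = integral {c..d} g"
    using assms(2)[OF cd(1)] assms(2)[OF cd(2)] by (simp add: algebra_simps)
qed

text \<open>Lebesgue's differentiation theorem. \<open>integrable_ccontinuous_explicit\<close>
  concerns averages over intervals that start at the point, hence it gives the right derivative; the
  left derivative comes from the same theorem for the reflected density.\<close>

lemma primitive_on_AE_derivative: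
  fixes u :: "real \<Rightarrow> 'a::euclidean_space"
  assumes "primitive_on {a..b} u g"
  shows "AE x in lebesgue. x \<in> {a<..<b} \<longrightarrow> (u has_vector_derivative g x) (at x)"
proof (cases "a < b")
  case False
  then show ?thesis by auto
next
  case True
  \<comment> \<open>Extension by zero makes the density integrable on every interval, including
    those that leave \<open>{a..b}\<close>.\<close>
  define g' where "g' x = (if x \<in> {a..b} then g x else 0)" for x
  have gab: "g absolutely_integrable_on {a..b}"
    using assms True by (auto simp: primitive_on_def)
  have "g' absolutely_integrable_on UNIV"
    unfolding g'_def using absolutely_integrable_restrict_UNIV gab by blast
  then have g'_int: "g' absolutely_integrable_on {c..d}" for c d
    using absolutely_integrable_on_subinterval by blast
  then have int1: "g' integrable_on cbox c d" for c d
    by (simp add: cbox_interval absolutely_integrable_on_def)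
  then have int2: "(\<lambda>x. g' (- x)) integrable_on cbox c d" for c d
    using Henstock_Kurzweil_Integration.integrable_reflect[of g' "-c" "-d"] by simp
  obtain N1 where N1: "negligible N1"
    "\<And>x e. \<lbrakk>x \<notin> N1; 0 < e\<rbrakk> \<Longrightarrow> \<exists>d>0. \<forall>h. 0 < h \<and> h < d \<longrightarrow>
        norm (integral (cbox x (x + h *\<^sub>R One)) g' /\<^sub>R h ^ DIM(real) - g' x) < e"
    using integrable_ccontinuous_explicit[OF int1] by metis
  obtain N2 where N2: "negligible N2"
    "\<And>x e. \<lbrakk>x \<notin> N2; 0 < e\<rbrakk> \<Longrightarrow> \<exists>d>0. \<forall>h. 0 < h \<and> h < d \<longrightarrow>
        norm (integral (cbox x (x + h *\<^sub>R One)) (\<lambda>x. g' (- x)) /\<^sub>R h ^ DIM(real) - g' (- x)) < e"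
    using integrable_ccontinuous_explicit[OF int2] by metis
  have "negligible (uminus ` N2)"
    by (rule negligible_differentiable_image_negligible[OF _ N2(1)]) (auto simp: differentiable_on_def)
  then have neg: "negligible (N1 \<union> uminus ` N2)"
    using N1(1) by auto
  have eq: "integral {c..d} g' = u d - u c" if "a \<le> c" "c \<le> d" "d \<le> b" for c d
  proof -
    have "integral {c..d} g' = integral {c..d} g"
      by (rule integral_cong) (use that in \<open>auto simp: g'_def\<close>)
    then show ?thesis using assms that by (auto simp: primitive_on_def)
  qed
  have "(u has_vector_derivative g x) (at x)" if x: "x \<in> {a<..<b}" "x \<notin> N1 \<union> uminus ` N2" for x
    unfolding has_vector_derivative_def has_derivative_at_alt
  proof (intro conjI allI impI bounded_linear_scaleR_left)
    fix e :: real assume "0 < e"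
    have x1: "x \<notin> N1" and x2: "- x \<notin> N2"
      using x(2) by (auto simp: image_iff) 
    have [simp]: "g' x = g x" using x by (auto simp: g'_def)
    obtain d1 where d1: "d1 > 0" "\<And>h. 0 < h \<Longrightarrow> h < d1 \<Longrightarrow>
        norm (integral {x..x + h} g' /\<^sub>R h - g x) < e"
      using N1(2)[OF x1 \<open>0 < e\<close>] by (auto simp: cbox_interval)
    obtain d2 where d2: "d2 > 0" "\<And>h. 0 < h \<Longrightarrow> h < d2 \<Longrightarrow>
        norm (integral {- x..- x + h} (\<lambda>x. g' (- x)) /\<^sub>R h - g x) < e"
      using N2(2)[OF x2 \<open>0 < e\<close>] by (auto simp: cbox_interval)
    define d where "d = Min {d1, d2, x - a, b - x}"
    have d: "d > 0" "d \<le> d1" "d \<le> d2" "d \<le> x - a" "d \<le> b - x"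
      using d1 d2 x by (auto simp: d_def)
    show "\<exists>d>0. \<forall>y. norm (y - x) < d \<longrightarrow> norm (u y - u x - (y - x) *\<^sub>R g x) \<le> e * norm (y - x)"
    proof (intro exI conjI allI impI)
      show "d > 0" by fact
      fix y assume y: "norm (y - x) < d"
      have *: "norm (v - h *\<^sub>R g x) \<le> e * h" if "norm (v /\<^sub>R h - g x) < e" "h > 0" for v :: 'a and h
      proof -
        have "v - h *\<^sub>R g x = h *\<^sub>R (v /\<^sub>R h - g x)"
          using that by (simp add: algebra_simps)
        then have "norm (v - h *\<^sub>R g x) = h * norm (v /\<^sub>R h - g x)"
          using that by (metis abs_of_pos norm_scaleR)
        then show ?thesis using that by (simp add: mult.commute less_imp_le)
      qed
      consider "y = x" | "y > x" | "y < x" by linarith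
      then show "norm (u y - u x - (y - x) *\<^sub>R g x) \<le> e * norm (y - x)"
      proof cases
        case 2
        have "norm (integral {x..x + (y - x)} g' /\<^sub>R (y - x) - g x) < e"
          using d1(2)[of "y - x"] 2 y d by auto
        with *[where v = "u y - u x" and h = "y - x"] show ?thesis
          using 2 y d x eq[of x y] by auto
      next
        case 3
        have "norm (integral {- x..- x + (x - y)} (\<lambda>x. g' (- x)) /\<^sub>R (x - y) - g x) < e"
          using d2(2)[of "x - y"] 3 y d by auto
        also have "integral {- x..- x + (x - y)} (\<lambda>x. g' (- x)) = integral {y..x} g'"
          using Henstock_Kurzweil_Integration.integral_reflect_real[of x y g'] by simp
        finally have "norm ((u x - u y) - (x - y) *\<^sub>R g x) \<le> e * (x - y)"
          using 3 y d x eq[of y x] *[where v = "u x - u y" and h = "x - y"] by auto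
        moreover have "norm ((u x - u y) - (x - y) *\<^sub>R g x) = norm (u y - u x - (y - x) *\<^sub>R g x)"
          by (metis (no_types, opaque_lifting) minus_diff_eq minus_diff_minus norm_minus_commute scaleR_left.minus)
        ultimately show ?thesis using 3 by auto
      qed auto
    qed
  qed
  then have "AE x in lebesgue. x \<notin> N1 \<union> uminus ` N2 \<and> True \<longrightarrow> (x \<in> {a<..<b} \<longrightarrow> (u has_vector_derivative g x) (at x))"
    by auto
  moreover have "AE x in lebesgue. x \<notin> N1 \<union> uminus ` N2"
    by (rule AE_not_in) (use neg in \<open>simp only: negligible_iff_null_sets\<close>)
  ultimately show ?thesis by eventually_elim auto
qed

text \<open>The part of \<open>f\<close> where it exceeds a height \<open>n\<close> has integral
  below \<open>e / 2\<close> for large \<open>n\<close>, by dominated convergence; elsewhere the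
  integral over \<open>A\<close> is at most \<open>n\<close> times the measure of
  \<open>A\<close>.\<close>

lemma integral_absolutely_continuous:
  fixes f :: "real \<Rightarrow> real"
  assumes f: "integrable lebesgue f" "\<And>x. f x \<ge> 0" and "e > 0"
  obtains d where "d > 0"
    "\<And>A. A \<in> sets lebesgue \<Longrightarrow> emeasure lebesgue A < ennreal d \<Longrightarrow> (LINT x:A|lebesgue. f x) < e"
proof -
  define t where "t n x = (if f x > real n then f x else 0)" for n :: nat and x
  have [measurable]: "f \<in> borel_measurable lebesgue" using f by auto
  have "(\<lambda>n. \<integral>x. t n x \<partial>lebesgue) \<longlonglongrightarrow> integral\<^sup>L (lebesgue :: real measure) (\<lambda>x. 0 :: real)"
  proof (rule Bochner_Integration.integral_dominated_convergence[where w=f])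
    show "AE x in lebesgue. (\<lambda>n. t n x) \<longlonglongrightarrow> 0"
    proof (rule AE_I2)
      fix x
      obtain m :: nat where m: "f x \<le> real m" using real_arch_simple by blast
      have "\<forall>\<^sub>F n in sequentially. t n x = 0"
        using eventually_ge_at_top[of m] by eventually_elim (use m in \<open>auto simp: t_def\<close>)
      then show "(\<lambda>n. t n x) \<longlonglongrightarrow> 0" by (rule tendsto_eventually)
    qed
  qed (use f in \<open>auto simp: t_def\<close>)
  then have "\<forall>\<^sub>F n in sequentially. integral\<^sup>L lebesgue (t n) < e / 2"
    using \<open>e > 0\<close> by (intro order_tendstoD(2)) auto
  then obtain n where n: "integral\<^sup>L lebesgue (t n) < e / 2"
    by (meson eventually_sequentially order_refl)
  have tint: "integrable lebesgue (t n)"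
    by (rule Bochner_Integration.integrable_bound[OF f(1)]) (auto simp: t_def[abs_def])
  show thesis
  proof
    \<comment> \<open>\<open>n + 1\<close> instead of \<open>n\<close>, since the height
      \<open>n\<close> may be 0.\<close>
    show "e / (2 * real (n + 1)) > 0" using \<open>e > 0\<close> by auto
    fix A :: "real set" assume A: "A \<in> sets lebesgue" "emeasure lebesgue A < ennreal (e / (2 * real (n + 1)))"
    have fin: "emeasure lebesgue A < \<infinity>" using A(2) by (metis ennreal_less_top less_trans infinity_ennreal_def)
    have m: "measure lebesgue A < e / (2 * real (n + 1))"
      using A(2) fin \<open>e > 0\<close> by (simp add: Sigma_Algebra.measure_def enn2real_less_iff)
    have i1: "integrable lebesgue (\<lambda>x. indicator A x * real n)"
      using A fin by (intro integrable_mult_left integrable_real_indicator) auto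
    have "(LINT x:A|lebesgue. f x) \<le> (\<integral>x. t n x + indicator A x * real n \<partial>lebesgue)"
      unfolding set_lebesgue_integral_def
    proof (rule integral_mono)
      show "integrable lebesgue (\<lambda>x. indicat_real A x *\<^sub>R f x)"
        using integrable_mult_indicator[OF A(1) f(1)] .
      show "integrable lebesgue (\<lambda>x. t n x + indicator A x * real n)"
        using tint i1 by auto
      show "indicat_real A x *\<^sub>R f x \<le> t n x + indicator A x * real n" for x
        using f(2)[of x] by (auto simp: t_def indicator_def)
    qed
    also have "\<dots> = integral\<^sup>L lebesgue (t n) + measure lebesgue A * real n"
      using tint i1 by simp
    also have "\<dots> < e / 2 + e / 2"
    proof (rule add_less_le_mono[OF n])
      have "measure lebesgue A * real n \<le> e / (2 * real (n + 1)) * real (n + 1)"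
        using m \<open>e > 0\<close> by (intro mult_mono) auto
      also have "\<dots> = e / 2" by (simp add: field_simps)
      finally show "measure lebesgue A * real n \<le> e / 2" .
    qed
    finally show "(LINT x:A|lebesgue. f x) < e" by simp
  qed
qed

text \<open>Each increment is at most the integral of \<open>cmod (g x)\<close> over its interval,
  so the sum of increments is at most an integral over \<open>A\<close>, and \<open>A\<close> has
  small measure.\<close>

lemma primitive_on_imp_abs_continuous_on:
  assumes "primitive_on {a..b} u g"
  shows "abs_continuous_on {a..b} u"
proof (cases "a \<le> b")
  case False
  then have [simp]: "{a..b} = {}" by auto
  have "(\<Sum>K\<in>\<D>. cmod (u (Sup K) - u (Inf K))) = 0" if "\<D> division_of A" "A \<subseteq> {a..b}" for \<D> A
    using that by (auto simp: division_of_def)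
  then show ?thesis by (auto simp: abs_continuous_on_def intro: exI[of _ 1])
next
  case True
  define f where "f x = indicator {a..b} x *\<^sub>R cmod (g x)" for x
  have "g absolutely_integrable_on {a..b}" using assms True by (auto simp: primitive_on_def)
  then have "(\<lambda>x. cmod (g x)) absolutely_integrable_on {a..b}"
    by (auto simp: absolutely_integrable_on_def)
  then have f: "integrable lebesgue f" "\<And>x. f x \<ge> 0"
    by (auto simp: set_integrable_def f_def[abs_def])
  show ?thesis
    unfolding abs_continuous_on_def
  proof (intro allI impI)
    fix e :: real assume "e > 0"
    obtain d where d: "d > 0"
      "\<And>A. A \<in> sets lebesgue \<Longrightarrow> emeasure lebesgue A < ennreal d \<Longrightarrow> (LINT x:A|lebesgue. f x) < e"
      using integral_absolutely_continuous[OF f \<open>e > 0\<close>] by metis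
    show "\<exists>\<delta>>0. \<forall>\<D> A. \<D> division_of A \<and> A \<subseteq> {a..b} \<and> (\<Sum>K\<in>\<D>. Sup K - Inf K) < \<delta> \<longrightarrow>
        (\<Sum>K\<in>\<D>. cmod (u (Sup K) - u (Inf K))) < e"
    proof (intro exI conjI allI impI)
      show "d > 0" by fact
      fix \<D> A assume *: "\<D> division_of A \<and> A \<subseteq> {a..b} \<and> (\<Sum>K\<in>\<D>. Sup K - Inf K) < d"
      note D = division_ofD[OF conjunct1[OF *]]
      have K: "\<exists>c d. K = {c..d} \<and> c \<le> d \<and> a \<le> c \<and> d \<le> b" if "K \<in> \<D>" for K
        using D(2)[OF that] D(3)[OF that] D(4)[OF that] * by (fastforce simp: cbox_interval)
      have fA: "f absolutely_integrable_on A" "f absolutely_integrable_on K" if "K \<in> \<D>" for K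
      proof -
        have "A = \<Union>\<D>" using D(6) by simp
        then have "A \<in> sets lebesgue" using D(1) K by (force intro!: sets.finite_Union)
        then show "f absolutely_integrable_on A"
          unfolding set_integrable_def by (rule integrable_mult_indicator) (rule f)
        show "f absolutely_integrable_on K"
          unfolding set_integrable_def using K[OF that] by (intro integrable_mult_indicator f) auto
      qed
      show "(\<Sum>K\<in>\<D>. cmod (u (Sup K) - u (Inf K))) < e"
      proof (cases "\<D> = {}")
        case True then show ?thesis using \<open>e > 0\<close> by simp
      next
        case False
        \<comment> \<open>A member is picked because \<open>fA\<close> takes one as its
          premise.\<close>
        then obtain K0 where K0: "K0 \<in> \<D>" by blast
        have Aset: "A \<in> sets lebesgue"
        proof -
          have "A = \<Union>\<D>" using D(6) by simp
          then show ?thesis using D(1) K by (force intro!: sets.finite_Union)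
        qed
        have "(\<Sum>K\<in>\<D>. cmod (u (Sup K) - u (Inf K))) \<le> (\<Sum>K\<in>\<D>. integral K f)"
        proof (rule sum_mono)
          fix L assume L: "L \<in> \<D>"
          then obtain c d' where cd: "L = {c..d'}" "c \<le> d'" "a \<le> c" "d' \<le> b" using K by blast
          have gcd: "g absolutely_integrable_on {c..d'}" "u d' - u c = integral {c..d'} g"
            using assms cd by (auto simp: primitive_on_def)
          have "cmod (integral {c..d'} g) \<le> integral {c..d'} (\<lambda>x. cmod (g x))"
            using gcd(1) by (simp add: absolutely_integrable_on_def integral_norm_bound_integral)
          also have "\<dots> = integral {c..d'} f"
            by (rule integral_cong) (use cd in \<open>auto simp: f_def\<close>)
          finally show "cmod (u (Sup L) - u (Inf L)) \<le> integral L f"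
            using cd gcd by simp
        qed
        also have "\<dots> = integral A f"
          using integral_combine_division_topdown[of f A \<D>] fA(1)[OF K0] *
          by (simp add: absolutely_integrable_on_def)
        also have "\<dots> = (LINT x:A|lebesgue. f x)"
          using set_lebesgue_integral_eq_integral(2)[OF fA(1)[OF K0]] by simp
        also have "\<dots> < e"
        proof (rule d(2)[OF Aset])
          have "emeasure lebesgue A \<le> (\<Sum>K\<in>\<D>. emeasure lebesgue K)"
            unfolding D(6)[symmetric] using D(1) K by (intro emeasure_subadditive_finite[of \<D> "\<lambda>x. x", simplified]) force+
          also have "\<dots> = (\<Sum>K\<in>\<D>. ennreal (Sup K - Inf K))"
            by (rule sum.cong) (use K in force)+
          also have "\<dots> = ennreal (\<Sum>K\<in>\<D>. Sup K - Inf K)"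
            by (rule sum_ennreal) (use K in force)
          also have "\<dots> < ennreal d" using * \<open>d > 0\<close> by (simp add: ennreal_lessI)
          finally show "emeasure lebesgue A < ennreal d" .
        qed
        finally show ?thesis .
      qed
    qed
  qed
qed

section \<open>Total variation of an absolutely continuous function\<close>

definition interval_packing :: "real \<Rightarrow> real \<Rightarrow> (real \<times> real) set \<Rightarrow> bool" where
  "interval_packing a b P \<longleftrightarrow> finite P \<and> (\<forall>p\<in>P. a \<le> fst p \<and> fst p < snd p \<and> snd p \<le> b) \<and>
     (\<forall>p\<in>P. \<forall>q\<in>P. p \<noteq> q \<longrightarrow> snd p \<le> fst q \<or> snd q \<le> fst p)"

text \<open>The measure of a disjoint union of open intervals; the closed ones may share end
  points.\<close>

lemma packing_length_le:
  assumes "interval_packing a b P" "a \<le> b"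
  shows "(\<Sum>p\<in>P. snd p - fst p) \<le> b - a"
proof -
  have "(\<Sum>p\<in>P. snd p - fst p) = (\<Sum>p\<in>P. measure lborel {fst p<..<snd p})"
    using assms by (intro sum.cong) (auto simp: interval_packing_def less_imp_le)
  also have "\<dots> = measure lborel (\<Union>p\<in>P. {fst p<..<snd p})"
    using assms by (intro measure_finite_Union[symmetric]) (fastforce simp: interval_packing_def disjoint_family_on_def)+
  also have "\<dots> \<le> measure lborel {a..b}"
    using assms by (intro measure_mono_fmeasurable) (force simp: interval_packing_def fmeasurable_def)+
  finally show ?thesis using assms by simp
qed

text \<open>Pairs of end points are easier to clip, unite and refine than the interval sets of a
  division, and the strict inequality inside each pair rules out degenerate members. The closed
  intervals of a packing form a division of their union, so \<open>abs_continuous_on\<close> applies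
  to it.\<close>

lemma abs_continuous_on_packing:
  assumes "abs_continuous_on {a..b} u" "e > 0"
  obtains d where "d > 0" "\<And>P. interval_packing a b P \<Longrightarrow> (\<Sum>p\<in>P. snd p - fst p) < d \<Longrightarrow>
    (\<Sum>p\<in>P. cmod (u (snd p) - u (fst p))) < e"
proof -
  obtain d where d: "d > 0" "\<And>\<D> A. \<D> division_of A \<Longrightarrow> A \<subseteq> {a..b} \<Longrightarrow> (\<Sum>K\<in>\<D>. Sup K - Inf K) < d \<Longrightarrow>
        (\<Sum>K\<in>\<D>. cmod (u (Sup K) - u (Inf K))) < e"
    using assms unfolding abs_continuous_on_def by metis
  have "(\<Sum>p\<in>P. cmod (u (snd p) - u (fst p))) < e"
    if P: "interval_packing a b P" and len: "(\<Sum>p\<in>P. snd p - fst p) < d" for P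
  proof -
    define I :: "real \<times> real \<Rightarrow> real set" where "I p = {fst p..snd p}" for p
    have inj: "inj_on I P"
      using P by (force simp: inj_on_def I_def interval_packing_def Icc_eq_Icc prod_eq_iff)
    have [simp]: "Sup (I p) = snd p" "Inf (I p) = fst p" if "p \<in> P" for p
      using P that by (auto simp: I_def interval_packing_def less_imp_le)
    have "I ` P division_of \<Union>(I ` P)"
    proof (rule division_ofI)
      show "finite (I ` P)" using P by (auto simp: interval_packing_def)
      show "K \<subseteq> \<Union>(I ` P)" if "K \<in> I ` P" for K using that by auto
      show "K \<noteq> {}" "\<exists>a b. K = cbox a b" if "K \<in> I ` P" for K
        using that P by (auto simp: I_def interval_packing_def less_imp_le cbox_interval)
      show "interior K1 \<inter> interior K2 = {}" if "K1 \<in> I ` P" "K2 \<in> I ` P" "K1 \<noteq> K2" for K1 K2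
        using that P by (fastforce simp: I_def interval_packing_def)
    qed simp
    moreover have "\<Union>(I ` P) \<subseteq> {a..b}"
      using P by (force simp: I_def interval_packing_def)
    ultimately have "(\<Sum>K\<in>I ` P. cmod (u (Sup K) - u (Inf K))) < e"
      by (rule d(2)) (use len in \<open>simp add: sum.reindex[OF inj]\<close>)
    then show ?thesis by (simp add: sum.reindex[OF inj])
  qed
  then show thesis using that d(1) by blast
qed

lemma packing_Un:
  assumes "interval_packing a b P" "interval_packing b c Q" "a \<le> b" "b \<le> c"
  shows "interval_packing a c (P \<union> Q)" "P \<inter> Q = {}"
proof -
  have P: "finite P" "\<And>p. p \<in> P \<Longrightarrow> a \<le> fst p \<and> fst p < snd p \<and> snd p \<le> b"
    "\<And>p q. p \<in> P \<Longrightarrow> q \<in> P \<Longrightarrow> p \<noteq> q \<Longrightarrow> snd p \<le> fst q \<or> snd q \<le> fst p"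
    using assms(1) by (auto simp: interval_packing_def)
  have Q: "finite Q" "\<And>p. p \<in> Q \<Longrightarrow> b \<le> fst p \<and> fst p < snd p \<and> snd p \<le> c"
    "\<And>p q. p \<in> Q \<Longrightarrow> q \<in> Q \<Longrightarrow> p \<noteq> q \<Longrightarrow> snd p \<le> fst q \<or> snd q \<le> fst p"
    using assms(2) by (auto simp: interval_packing_def)
  have PQ: "snd p \<le> fst q" if "p \<in> P" "q \<in> Q" for p q
    using P(2)[OF that(1)] Q(2)[OF that(2)] by linarith
  show "P \<inter> Q = {}"
  proof (rule ccontr)
    assume "P \<inter> Q \<noteq> {}"
    then obtain p where "p \<in> P" "p \<in> Q" by blast
    with PQ[of p p] P(2)[of p] show False by linarith
  qed
  show "interval_packing a c (P \<union> Q)"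
    unfolding interval_packing_def
  proof (intro conjI ballI impI)
    show "finite (P \<union> Q)" using P(1) Q(1) by simp
    show "a \<le> fst p" "fst p < snd p" "snd p \<le> c" if "p \<in> P \<union> Q" for p
      using that P(2)[of p] Q(2)[of p] assms(3,4) by auto
    show "snd p \<le> fst q \<or> snd q \<le> fst p" if "p \<in> P \<union> Q" "q \<in> P \<union> Q" "p \<noteq> q" for p q
      using that P(3)[of p q] Q(3)[of p q] PQ[of p q] PQ[of q p] by blast
  qed
qed

text \<open>An interval that contains \<open>b\<close> in its interior is cut there; by the triangle
  inequality this can only enlarge the sum.\<close>

lemma packing_split:
  fixes u :: "real \<Rightarrow> complex"
  assumes P: "interval_packing a c P" and ab: "a \<le> b" "b \<le> c"
  obtains P1 P2 where "interval_packing a b P1" "interval_packing b c P2"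
    "(\<Sum>p\<in>P. cmod (u (snd p) - u (fst p))) \<le>
       (\<Sum>p\<in>P1. cmod (u (snd p) - u (fst p))) + (\<Sum>p\<in>P2. cmod (u (snd p) - u (fst p)))"
proof -
  define L where "L p = (fst p, min (snd p) b)" for p :: "real \<times> real"
  define R where "R p = (max (fst p) b, snd p)" for p :: "real \<times> real"
  \<comment> \<open>Intervals on one side of \<open>b\<close> are left alone by \<open>L\<close> or
    \<open>R\<close>; \<open>PL\<close> and \<open>PR\<close> keep those that do not become
    degenerate.\<close>
  define PL where "PL = {p \<in> P. fst p < b}"
  define PR where "PR = {p \<in> P. b < snd p}"
  define h where "h p = cmod (u (snd p) - u (fst p))" for p
  have fin: "finite P" "finite PL" "finite PR" using P by (auto simp: interval_packing_def PL_def PR_def)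
  have P': "\<And>p. p \<in> P \<Longrightarrow> a \<le> fst p \<and> fst p < snd p \<and> snd p \<le> c"
    "\<And>p q. p \<in> P \<Longrightarrow> q \<in> P \<Longrightarrow> p \<noteq> q \<Longrightarrow> snd p \<le> fst q \<or> snd q \<le> fst p"
    using P by (auto simp: interval_packing_def)
  have injL: "inj_on L PL"
  proof (rule inj_onI)
    fix p q assume "p \<in> PL" "q \<in> PL" "L p = L q"
    then show "p = q" using P'(1)[of p] P'(1)[of q] P'(2)[of p q] by (auto simp: L_def PL_def)
  qed
  have injR: "inj_on R PR"
  proof (rule inj_onI)
    fix p q assume "p \<in> PR" "q \<in> PR" "R p = R q"
    then show "p = q" using P'(1)[of p] P'(1)[of q] P'(2)[of p q] by (auto simp: R_def PR_def)
  qed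
  have 1: "interval_packing a b (L ` PL)"
    unfolding interval_packing_def
  proof (intro conjI ballI impI)
    show "snd p \<le> fst q \<or> snd q \<le> fst p" if pq: "p \<in> L ` PL" "q \<in> L ` PL" "p \<noteq> q" for p q
    proof -
      obtain p' q' where *: "p' \<in> P" "q' \<in> P" "p = L p'" "q = L q'" "p' \<noteq> q'"
        using pq unfolding PL_def by blast
      then show ?thesis using P'(2)[of p' q'] by (auto simp: L_def)
    qed
  qed (use fin P' in \<open>auto simp: L_def PL_def\<close>)
  have 2: "interval_packing b c (R ` PR)"
    unfolding interval_packing_def
  proof (intro conjI ballI impI)
    show "snd p \<le> fst q \<or> snd q \<le> fst p" if pq: "p \<in> R ` PR" "q \<in> R ` PR" "p \<noteq> q" for p q
    proof -
      obtain p' q' where *: "p' \<in> P" "q' \<in> P" "p = R p'" "q = R q'" "p' \<noteq> q'"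
        using pq unfolding PR_def by blast
      then show ?thesis using P'(2)[of p' q'] by (auto simp: R_def)
    qed
  qed (use fin P' in \<open>auto simp: R_def PR_def\<close>)
  have "(\<Sum>p\<in>P. h p) \<le> (\<Sum>p\<in>P. (if fst p < b then h (L p) else 0) + (if b < snd p then h (R p) else 0))"
  proof (rule sum_mono)
    fix p assume "p \<in> P"
    have "h p \<le> cmod (u b - u (fst p)) + cmod (u (snd p) - u b)"
      unfolding h_def using norm_triangle_ineq[of "u b - u (fst p)" "u (snd p) - u b"] by simp
    then show "h p \<le> (if fst p < b then h (L p) else 0) + (if b < snd p then h (R p) else 0)"
      using P'(1)[OF \<open>p \<in> P\<close>] by (auto simp: h_def L_def R_def min_def max_def)
  qed
  also have "\<dots> = (\<Sum>p\<in>PL. h (L p)) + (\<Sum>p\<in>PR. h (R p))"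
    using fin by (simp add: sum.distrib PL_def PR_def sum.inter_filter)
  also have "\<dots> = (\<Sum>p\<in>L ` PL. h p) + (\<Sum>p\<in>R ` PR. h p)"
    using injL injR by (simp add: sum.reindex)
  finally show thesis using that[OF 1 2] by (simp add: h_def)
qed

definition var_sums :: "(real \<Rightarrow> complex) \<Rightarrow> real \<Rightarrow> real \<Rightarrow> real set" where
  "var_sums u a b = {(\<Sum>p\<in>P. cmod (u (snd p) - u (fst p))) | P. interval_packing a b P}"

lemma var_sumsI: "interval_packing a b P \<Longrightarrow> (\<Sum>p\<in>P. cmod (u (snd p) - u (fst p))) \<in> var_sums u a b"
  by (auto simp: var_sums_def)

lemma packing_mono: "interval_packing c d P \<Longrightarrow> a \<le> c \<Longrightarrow> d \<le> b \<Longrightarrow> interval_packing a b P"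
  by (force simp: interval_packing_def)

lemma packing_empty: "interval_packing a b {}"
  by (simp add: interval_packing_def)

lemma var_sums_mono: "a \<le> c \<Longrightarrow> d \<le> b \<Longrightarrow> var_sums u c d \<subseteq> var_sums u a b"
  unfolding var_sums_def using packing_mono by blast

text \<open>Bisection: on an interval shorter than the \<delta> that belongs to \<epsilon> = 1 every
  sum is below 1, and by \<open>packing_split\<close> the bounds for adjacent intervals add
  up.\<close>

lemma bdd_var_sums:
  assumes ac: "abs_continuous_on {a..b} u" and "a \<le> b"
  shows "bdd_above (var_sums u a b)"
proof -
  obtain d where d: "d > 0" "\<And>P. interval_packing a b P \<Longrightarrow> (\<Sum>p\<in>P. snd p - fst p) < d \<Longrightarrow>
    (\<Sum>p\<in>P. cmod (u (snd p) - u (fst p))) < 1"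
    by (rule abs_continuous_on_packing[OF ac zero_less_one]) (rule that)
  \<comment> \<open>The two premises keep the subintervals of the bisection inside
    \<open>{a..b}\<close>; for \<open>{a..b}\<close> itself they are trivial.\<close>
  have "a \<le> a \<longrightarrow> b \<le> b \<longrightarrow> bdd_above (var_sums u a b)" using \<open>a \<le> b\<close>
  proof (rule Bolzano[where P="\<lambda>x y. a \<le> x \<longrightarrow> y \<le> b \<longrightarrow> bdd_above (var_sums u x y)"])
    fix x y z assume xyz: "a \<le> x \<longrightarrow> y \<le> b \<longrightarrow> bdd_above (var_sums u x y)"
      "a \<le> y \<longrightarrow> z \<le> b \<longrightarrow> bdd_above (var_sums u y z)" "x \<le> y" "y \<le> z"
    show "a \<le> x \<longrightarrow> z \<le> b \<longrightarrow> bdd_above (var_sums u x z)"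
    proof (intro impI)
      assume "a \<le> x" "z \<le> b"
      then obtain B1 B2 where B: "\<And>s. s \<in> var_sums u x y \<Longrightarrow> s \<le> B1" "\<And>s. s \<in> var_sums u y z \<Longrightarrow> s \<le> B2"
        using xyz by (auto simp: bdd_above_def)
      have "s \<le> B1 + B2" if s: "s \<in> var_sums u x z" for s
      proof -
        obtain P where P: "interval_packing x z P" "s = (\<Sum>p\<in>P. cmod (u (snd p) - u (fst p)))"
          using s by (auto simp: var_sums_def)
        obtain P1 P2 where "interval_packing x y P1" "interval_packing y z P2"
          "s \<le> (\<Sum>p\<in>P1. cmod (u (snd p) - u (fst p))) + (\<Sum>p\<in>P2. cmod (u (snd p) - u (fst p)))"
          unfolding P(2) by (rule packing_split[OF P(1) xyz(3,4), where u=u])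
        then show ?thesis using B(1)[OF var_sumsI] B(2)[OF var_sumsI] by fastforce
      qed
      then show "bdd_above (var_sums u x z)" by (rule bdd_aboveI)
    qed
  next
    fix x assume "a \<le> x" "x \<le> b"
    show "\<exists>d>0. \<forall>a' b'. a' \<le> x \<and> x \<le> b' \<and> b' - a' < d \<longrightarrow> a \<le> a' \<longrightarrow> b' \<le> b \<longrightarrow> bdd_above (var_sums u a' b')"
    proof (intro exI conjI allI impI)
      show "d > 0" by fact
      fix a' b' assume *: "a' \<le> x \<and> x \<le> b' \<and> b' - a' < d" "a \<le> a'" "b' \<le> b"
      show "bdd_above (var_sums u a' b')"
      proof (rule bdd_aboveI)
        fix s assume "s \<in> var_sums u a' b'"
        then obtain P where P: "interval_packing a' b' P" "s = (\<Sum>p\<in>P. cmod (u (snd p) - u (fst p)))"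
          by (auto simp: var_sums_def)
        have "(\<Sum>p\<in>P. snd p - fst p) \<le> b' - a'" using packing_length_le[OF P(1)] * by auto
        then show "s \<le> 1"
          using d(2)[OF packing_mono[OF P(1)]] * P(2) by auto
      qed
    qed
  qed
  then show ?thesis by simp
qed

definition total_var :: "(real \<Rightarrow> complex) \<Rightarrow> real \<Rightarrow> real \<Rightarrow> real" where
  "total_var u a b = Sup (var_sums u a b)"

lemma total_var_upper:
  assumes "abs_continuous_on {a..b} u" "a \<le> c" "c \<le> d" "d \<le> b" "interval_packing c d P"
  shows "(\<Sum>p\<in>P. cmod (u (snd p) - u (fst p))) \<le> total_var u c d"
  unfolding total_var_def
proof (rule cSup_upper)
  show "bdd_above (var_sums u c d)"
    using bdd_var_sums[OF assms(1)] var_sums_mono[OF assms(2,4)] assms(2-4)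
    by (meson bdd_above_mono order_trans)
qed (use assms var_sumsI in auto)

lemma total_var_approx:
  assumes "e > 0"
  obtains P where "interval_packing c d P" "total_var u c d - e < (\<Sum>p\<in>P. cmod (u (snd p) - u (fst p)))"
proof -
  have "var_sums u c d \<noteq> {}" using var_sumsI[OF packing_empty] by blast
  then obtain s where "s \<in> var_sums u c d" "total_var u c d - e < s"
    using less_cSupD[of "var_sums u c d" "total_var u c d - e"] assms by (auto simp: total_var_def)
  then show thesis using that by (auto simp: var_sums_def)
qed

lemma total_var_ge:
  assumes "abs_continuous_on {a..b} u" "a \<le> c" "c \<le> d" "d \<le> b"
  shows "cmod (u d - u c) \<le> total_var u c d"
proof (cases "c = d")
  case True
  then show ?thesis using total_var_upper[OF assms packing_empty] by simp
next
  case False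
  then have "interval_packing c d {(c, d)}" using assms by (auto simp: interval_packing_def)
  from total_var_upper[OF assms this] show ?thesis by simp
qed

text \<open>Splitting a packing at \<open>x\<close> gives one inequality, uniting nearly optimal
  packings of the two pieces the other.\<close>

lemma total_var_add:
  assumes ac: "abs_continuous_on {a..b} u" and o: "a \<le> x" "x \<le> y" "y \<le> b"
  shows "total_var u a y = total_var u a x + total_var u x y"
proof (rule antisym)
  show "total_var u a y \<le> total_var u a x + total_var u x y"
  proof (rule field_le_epsilon)
    fix e :: real assume "e > 0"
    obtain P where P: "interval_packing a y P" "total_var u a y - e < (\<Sum>p\<in>P. cmod (u (snd p) - u (fst p)))"
      by (rule total_var_approx[OF \<open>e > 0\<close>, where c=a and d=y and u=u])
    obtain P1 P2 where P12: "interval_packing a x P1" "interval_packing x y P2"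
          "(\<Sum>p\<in>P. cmod (u (snd p) - u (fst p))) \<le> (\<Sum>p\<in>P1. cmod (u (snd p) - u (fst p))) + (\<Sum>p\<in>P2. cmod (u (snd p) - u (fst p)))"
          by (rule packing_split[OF P(1) o(1,2), where u=u])
    show "total_var u a y \<le> total_var u a x + total_var u x y + e"
      using P(2) P12(3) total_var_upper[OF ac _ _ _ P12(1)] total_var_upper[OF ac _ _ _ P12(2)] o by linarith
  qed
  show "total_var u a x + total_var u x y \<le> total_var u a y"
  proof (rule field_le_epsilon)
    fix e :: real assume "e > 0"
    then have "e / 2 > 0" by simp
    obtain P where P: "interval_packing a x P" "total_var u a x - e / 2 < (\<Sum>p\<in>P. cmod (u (snd p) - u (fst p)))"
      by (rule total_var_approx[OF \<open>e / 2 > 0\<close>, where c=a and d=x and u=u])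
    obtain Q where Q: "interval_packing x y Q" "total_var u x y - e / 2 < (\<Sum>p\<in>Q. cmod (u (snd p) - u (fst p)))"
      by (rule total_var_approx[OF \<open>e / 2 > 0\<close>, where c=x and d=y and u=u])
    note PQ = packing_Un[OF P(1) Q(1) o(1,2)]
    have "(\<Sum>p\<in>P \<union> Q. cmod (u (snd p) - u (fst p))) = (\<Sum>p\<in>P. cmod (u (snd p) - u (fst p))) + (\<Sum>p\<in>Q. cmod (u (snd p) - u (fst p)))"
      using P(1) Q(1) PQ(2) by (intro sum.union_disjoint) (auto simp: interval_packing_def)
    then show "total_var u a x + total_var u x y \<le> total_var u a y + e"
      using P(2) Q(2) total_var_upper[OF ac _ _ _ PQ(1)] o by linarith
  qed
qed

text \<open>The total variation inherits absolute continuity: each interval of a packing is replaced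
  by a nearly optimal packing inside it, and the refined packing has no larger total length.\<close>

lemma total_var_packing:
  assumes ac: "abs_continuous_on {a..b} u" and "e > 0"
  obtains d where "d > 0" "\<And>P. interval_packing a b P \<Longrightarrow> (\<Sum>p\<in>P. snd p - fst p) < d \<Longrightarrow>
    (\<Sum>p\<in>P. total_var u (fst p) (snd p)) < e"
proof -
  have "e / 2 > 0" using \<open>e > 0\<close> by simp
  obtain d where d: "d > 0" "\<And>P. interval_packing a b P \<Longrightarrow> (\<Sum>p\<in>P. snd p - fst p) < d \<Longrightarrow>
    (\<Sum>p\<in>P. cmod (u (snd p) - u (fst p))) < e / 2"
    by (rule abs_continuous_on_packing[OF ac \<open>e / 2 > 0\<close>]) (rule that)
  have "(\<Sum>p\<in>P. total_var u (fst p) (snd p)) < e"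
    if P: "interval_packing a b P" and len: "(\<Sum>p\<in>P. snd p - fst p) < d" for P
  proof -
    \<comment> \<open>The error \<open>r\<close> per interval adds up to at most
      \<open>e / 2\<close>; the added 1 covers the empty packing.\<close>
    define r where "r = e / (2 * real (card P + 1))"
    have "r > 0" using \<open>e > 0\<close> by (simp add: r_def)
    have P': "finite P" "\<And>p. p \<in> P \<Longrightarrow> a \<le> fst p \<and> fst p < snd p \<and> snd p \<le> b"
      "\<And>p q. p \<in> P \<Longrightarrow> q \<in> P \<Longrightarrow> p \<noteq> q \<Longrightarrow> snd p \<le> fst q \<or> snd q \<le> fst p"
      using P by (auto simp: interval_packing_def)
    have "\<forall>p. \<exists>Q. interval_packing (fst p) (snd p) Q \<and>
        total_var u (fst p) (snd p) - r < (\<Sum>q\<in>Q. cmod (u (snd q) - u (fst q)))"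
    proof
      fix p
      show "\<exists>Q. interval_packing (fst p) (snd p) Q \<and> total_var u (fst p) (snd p) - r < (\<Sum>q\<in>Q. cmod (u (snd q) - u (fst q)))"
        by (rule total_var_approx[OF \<open>r > 0\<close>, where c="fst p" and d="snd p" and u=u]) blast
    qed
    from choice[OF this] obtain Q where Q0: "\<forall>p. interval_packing (fst p) (snd p) (Q p) \<and>
        total_var u (fst p) (snd p) - r < (\<Sum>q\<in>Q p. cmod (u (snd q) - u (fst q)))" ..
    have Q: "interval_packing (fst p) (snd p) (Q p)"
        "total_var u (fst p) (snd p) - r < (\<Sum>q\<in>Q p. cmod (u (snd q) - u (fst q)))" for p
      using spec[OF Q0, of p] by blast+
    have Q': "finite (Q p)" "\<And>q. q \<in> Q p \<Longrightarrow> fst p \<le> fst q \<and> fst q < snd q \<and> snd q \<le> snd p"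
      "\<And>q q'. q \<in> Q p \<Longrightarrow> q' \<in> Q p \<Longrightarrow> q \<noteq> q' \<Longrightarrow> snd q \<le> fst q' \<or> snd q' \<le> fst q" for p
      using Q(1)[of p] by (auto simp: interval_packing_def)
    have sep: "snd q \<le> fst q' \<or> snd q' \<le> fst q" if "p \<in> P" "p' \<in> P" "p \<noteq> p'" "q \<in> Q p" "q' \<in> Q p'" for p p' q q'
      using P'(3)[OF that(1-3)] Q'(2)[OF that(4)] Q'(2)[OF that(5)] by linarith
    have U: "interval_packing a b (\<Union>p\<in>P. Q p)"
      unfolding interval_packing_def
    proof (intro conjI ballI impI)
      show "finite (\<Union>p\<in>P. Q p)" using P'(1) Q'(1) by auto
      fix q assume "q \<in> (\<Union>p\<in>P. Q p)"
      then obtain p where p: "p \<in> P" "q \<in> Q p" by blast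
      show "a \<le> fst q" "fst q < snd q" "snd q \<le> b"
        using P'(2)[OF p(1)] Q'(2)[OF p(2)] by linarith+
      fix q' assume "q' \<in> (\<Union>p\<in>P. Q p)" "q \<noteq> q'"
      then obtain p' where p': "p' \<in> P" "q' \<in> Q p'" by blast
      show "snd q \<le> fst q' \<or> snd q' \<le> fst q"
        using sep[OF p(1) p'(1) _ p(2) p'(2)] Q'(3)[of q p q'] p p' \<open>q \<noteq> q'\<close> by blast
    qed
    have disj: "Q p \<inter> Q p' = {}" if "p \<in> P" "p' \<in> P" "p \<noteq> p'" for p p'
    proof (rule ccontr)
      assume "Q p \<inter> Q p' \<noteq> {}"
      then obtain q where "q \<in> Q p" "q \<in> Q p'" by blast
      then show False using sep[OF that, of q q] Q'(2)[of q p] by auto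
    qed
    have sumU: "(\<Sum>q\<in>(\<Union>p\<in>P. Q p). f q) = (\<Sum>p\<in>P. \<Sum>q\<in>Q p. f q)" for f :: "real \<times> real \<Rightarrow> real"
      using P'(1) Q'(1) disj by (intro sum.UNION_disjoint) auto
    have "(\<Sum>q\<in>(\<Union>p\<in>P. Q p). snd q - fst q) \<le> (\<Sum>p\<in>P. snd p - fst p)"
      unfolding sumU using packing_length_le[OF Q(1)] P'(2) by (intro sum_mono) (auto simp: less_imp_le)
    then have "(\<Sum>q\<in>(\<Union>p\<in>P. Q p). cmod (u (snd q) - u (fst q))) < e / 2"
      using d(2)[OF U] len by linarith
    moreover have "(\<Sum>p\<in>P. total_var u (fst p) (snd p) - r) \<le> (\<Sum>q\<in>(\<Union>p\<in>P. Q p). cmod (u (snd q) - u (fst q)))"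
      unfolding sumU using Q(2) by (intro sum_mono) (auto simp: less_imp_le)
    ultimately have "(\<Sum>p\<in>P. total_var u (fst p) (snd p)) < e / 2 + real (card P) * r"
      by (simp add: sum_subtractf)
    also have "real (card P) * r \<le> e / 2"
      using \<open>e > 0\<close> by (simp add: r_def field_simps)
    finally show ?thesis by simp
  qed
  then show thesis using that d(1) by blast
qed

section \<open>Densities of increasing absolutely continuous functions\<close>

text \<open>The increasing function \<open>F\<close> is the distribution function of a measure that is absolutely continuous with
  respect to Lebesgue measure, and \<open>f\<close> is its Radon--Nikodym density.\<close>

lemma real_primitive_of_mono_packing:
  fixes F :: "real \<Rightarrow> real"
  assumes ab: "a < b" and mono: "\<And>x y. a \<le> x \<Longrightarrow> x \<le> y \<Longrightarrow> y \<le> b \<Longrightarrow> F x \<le> F y"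
    and ac: "\<And>e. e > 0 \<Longrightarrow> \<exists>d>0. \<forall>P. interval_packing a b P \<and> (\<Sum>p\<in>P. snd p - fst p) < d \<longrightarrow>
      (\<Sum>p\<in>P. F (snd p) - F (fst p)) < e"
  obtains f where "f absolutely_integrable_on {a..b}" "\<And>x. x \<in> {a..b} \<Longrightarrow> F x = F a + integral {a..x} f"
proof -
  \<comment> \<open>\<open>interval_measure\<close> takes a monotone function on the whole line, so
    \<open>F\<close> is continued by constants.\<close>
  define G where "G x = F (max a (min b x))" for x
  have G_mono: "G x \<le> G y" if "x \<le> y" for x y
    unfolding G_def using that ab by (intro mono) auto
  have G_eq: "G x = F x" if "x \<in> {a..b}" for x using that by (auto simp: G_def)
  have contF: "continuous_on {a..b} F"
    unfolding continuous_on_iff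
  proof (intro ballI allI impI)
    fix x e :: real assume x: "x \<in> {a..b}" and "e > 0"
    obtain d where d: "d > 0" "\<And>P. interval_packing a b P \<Longrightarrow> (\<Sum>p\<in>P. snd p - fst p) < d \<Longrightarrow>
      (\<Sum>p\<in>P. F (snd p) - F (fst p)) < e" using ac[OF \<open>e > 0\<close>] by blast
    have *: "F v - F u < e" if "a \<le> u" "u < v" "v \<le> b" "v - u < d" for u v
      using d(2)[of "{(u, v)}"] that by (auto simp: interval_packing_def)
    show "\<exists>d>0. \<forall>x'\<in>{a..b}. dist x' x < d \<longrightarrow> dist (F x') (F x) < e"
    proof (intro exI conjI ballI impI)
      fix y assume y: "y \<in> {a..b}" "dist y x < d"
      consider "y = x" | "x < y" | "y < x" by linarith
      then show "dist (F y) (F x) < e"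
        using *[of x y] *[of y x] mono[of x y] mono[of y x] x y \<open>e > 0\<close>
        by cases (auto simp: dist_real_def)
    qed (rule d)
  qed
  have "continuous_on UNIV (F \<circ> (\<lambda>x. max a (min b x)))"
    by (rule continuous_on_compose)
      (use ab in \<open>auto intro!: continuous_intros continuous_on_subset[OF contF]\<close>)
  then have G_cont: "continuous_on UNIV G" by (simp add: G_def[abs_def] o_def)
  define IM where "IM = interval_measure G"
  have IM_Icc: "emeasure IM {x..y} = ennreal (G y - G x)" if "x \<le> y" for x y
    unfolding IM_def by (rule emeasure_interval_measure_Icc[OF that G_mono G_cont]) 
  have IM_sets[measurable_cong, simp]: "sets IM = sets borel" by (simp add: IM_def)
  have IM_pt: "emeasure IM {x} = 0" for x using IM_Icc[of x x] by simp
  have IM_Ioo: "emeasure IM {x<..<y} = ennreal (G y - G x)" if "x \<le> y" for x y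
  proof -
    have "emeasure IM {x<..<y} = emeasure IM {x..y}"
    proof (rule emeasure_eq_AE)
      have "AE z in IM. z \<notin> {x}" by (rule AE_not_in) (simp add: null_sets_def IM_pt)
      moreover have "AE z in IM. z \<notin> {y}" by (rule AE_not_in) (simp add: null_sets_def IM_pt)
      ultimately show "AE z in IM. (z \<in> {x<..<y}) = (z \<in> {x..y})"
        by eventually_elim auto
    qed auto
    then show ?thesis using IM_Icc that by simp
  qed
  \<comment> \<open>The restriction makes the measure finite and moves every null set into the open
    interval, where coverings by small intervals stay within \<open>{a..b}\<close>.\<close>
  define \<mu> where "\<mu> = density IM (indicator {a<..<b})"
  have \<mu>_sets[measurable_cong, simp]: "sets \<mu> = sets borel" by (simp add: \<mu>_def)
  have \<mu>_em: "emeasure \<mu> A = emeasure IM (A \<inter> {a<..<b})" if "A \<in> sets borel" for A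
  proof -
    have "emeasure \<mu> A = (\<integral>\<^sup>+x. indicator {a<..<b} x * indicator A x \<partial>IM)"
      unfolding \<mu>_def by (rule emeasure_density) (use that in auto)
    also have "\<dots> = (\<integral>\<^sup>+x. indicator (A \<inter> {a<..<b}) x \<partial>IM)"
      by (intro nn_integral_cong) (auto simp: indicator_def)
    also have "\<dots> = emeasure IM (A \<inter> {a<..<b})"
      by (rule nn_integral_indicator) (use that in auto)
    finally show ?thesis .
  qed
  have \<mu>_fin: "emeasure \<mu> (space \<mu>) \<noteq> \<infinity>"
  proof -
    have "space \<mu> = UNIV" by (simp add: \<mu>_def IM_def)
    then have "emeasure \<mu> (space \<mu>) = emeasure IM {a<..<b}" using \<mu>_em[of UNIV] by simp
    then show ?thesis using IM_Ioo[of a b] ab by simp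
  qed
  \<comment> \<open>A compact null set lies in an open set of measure below \<open>d\<close>; by
    compactness finitely many closed intervals inside that open set cover it, and absolute
    continuity of \<open>F\<close> makes their mass less than \<open>e\<close>.\<close>
  have compact_null: "emeasure \<mu> K = 0" if K: "compact K" "K \<subseteq> {a<..<b}" "emeasure lborel K = 0" for K
  proof -
    have Kb: "K \<in> sets borel" using K(1) by (simp add: compact_imp_closed)
    have "emeasure \<mu> K \<le> ennreal e" if "e > 0" for e
    proof -
      obtain d where d: "d > 0" "\<And>P. interval_packing a b P \<Longrightarrow> (\<Sum>p\<in>P. snd p - fst p) < d \<Longrightarrow>
        (\<Sum>p\<in>P. F (snd p) - F (fst p)) < e" using ac[OF \<open>e > 0\<close>] by blast
      obtain U where U: "open U" "K \<subseteq> U" "emeasure lborel (U - K) < ennreal d"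
        using outer_regular_lborel[OF Kb d(1)] by blast
      define U' where "U' = U \<inter> {a<..<b}"
      have U': "open U'" "K \<subseteq> U'" using U K by (auto simp: U'_def)
      have "emeasure lborel U' \<le> emeasure lborel ((U - K) \<union> K)"
        using U(1) Kb by (intro emeasure_mono) (auto simp: U'_def)
      also have "\<dots> \<le> emeasure lborel (U - K) + emeasure lborel K"
        using U(1) Kb by (intro emeasure_subadditive) auto
      also have "\<dots> < ennreal d" using U(3) K(3) by simp
      finally have U'_small: "emeasure lborel U' < ennreal d" .
      have "\<forall>x\<in>K. \<exists>r>0. cball x r \<subseteq> U'"
        using U' open_contains_cball by blast
      then obtain r where r: "\<And>x. x \<in> K \<Longrightarrow> r x > 0" "\<And>x. x \<in> K \<Longrightarrow> cball x (r x) \<subseteq> U'" by metis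
      have "K \<subseteq> (\<Union>x\<in>K. ball x (r x))" using r(1) by force
      then obtain X where X: "X \<subseteq> K" "finite X" "K \<subseteq> (\<Union>x\<in>X. ball x (r x))"
        using compactE_image[OF K(1), of K "\<lambda>x. ball x (r x)"] by auto
      define \<F> where "\<F> = (\<lambda>x. cball x (r x)) ` X"
      have \<F>: "finite \<F>" "\<And>s. s \<in> \<F> \<Longrightarrow> \<exists>a b. s = cbox a b" "\<Union>\<F> \<subseteq> U'" "K \<subseteq> \<Union>\<F>"
      proof -
        show "finite \<F>" using X by (simp add: \<F>_def)
        show "\<exists>a b. s = cbox a b" if "s \<in> \<F>" for s
          using that by (auto simp: \<F>_def cball_eq_atLeastAtMost cbox_interval)
        show "\<Union>\<F> \<subseteq> U'" using r(2) X(1) by (auto simp: \<F>_def)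
        show "K \<subseteq> \<Union>\<F>" using X(3) ball_subset_cball unfolding \<F>_def by blast
      qed
      \<comment> \<open>The covering intervals overlap; a division of their union has nonoverlapping
        members, as a packing needs.\<close>
      obtain p where p: "p division_of \<Union>\<F>"
        using elementary_unions_intervals[OF \<F>(1,2)] by metis
      note pD = division_ofD[OF p]
      have pI: "\<exists>c d. k = {c..d} \<and> c \<le> d \<and> a < c \<and> d < b" if kp: "k \<in> p" for k
      proof -
        obtain c d where cd: "k = {c..d}" using pD(4)[OF kp] by (auto simp: cbox_interval)
        moreover have "c \<le> d" using cd pD(3)[OF kp] by auto
        moreover have "{c..d} \<subseteq> {a<..<b}" using pD(2)[OF kp] \<F>(3) cd by (auto simp: U'_def)
        ultimately show ?thesis by force
      qed
      \<comment> \<open>A division may contain single points, which packings exclude; they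
        contribute nothing to the sums.\<close>
      define q where "q = {k \<in> p. Inf k < Sup k}"
      define J where "J k = (Inf k, Sup k)" for k :: "real set"
      have inj: "inj_on J q"
      proof (rule inj_onI)
        fix k k' assume "k \<in> q" "k' \<in> q" "J k = J k'"
        then show "k = k'" using pI[of k] pI[of k'] by (auto simp: q_def J_def)
      qed
      have pack: "interval_packing a b (J ` q)"
        unfolding interval_packing_def
      proof (intro conjI ballI impI)
        show "finite (J ` q)" using pD(1) by (simp add: q_def)
        show "a \<le> fst x" "fst x < snd x" "snd x \<le> b" if "x \<in> J ` q" for x
          using that pI by (force simp: q_def J_def)+
        show "snd x \<le> fst y \<or> snd y \<le> fst x" if xy: "x \<in> J ` q" "y \<in> J ` q" "x \<noteq> y" for x y
        proof -
          obtain k k' where k: "k \<in> p" "k' \<in> p" "Inf k < Sup k" "Inf k' < Sup k'" "x = J k" "y = J k'"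
            using xy unfolding q_def by blast
          then have "interior k \<inter> interior k' = {}" using pD(5)[of k k'] xy(3) by blast
          then show ?thesis using k pI[of k] pI[of k'] by (auto simp: J_def greaterThanLessThan_eq_iff Int_greaterThanLessThan)
        qed
      qed
      have "(\<Sum>x\<in>J ` q. snd x - fst x) = (\<Sum>k\<in>q. Sup k - Inf k)"
        unfolding sum.reindex[OF inj] by (simp add: J_def)
      also have "\<dots> = (\<Sum>k\<in>p. Sup k - Inf k)"
      proof (rule sum.mono_neutral_left)
        show "\<forall>k\<in>p - q. Sup k - Inf k = 0"
        proof
          fix k assume "k \<in> p - q"
          then show "Sup k - Inf k = 0" using pI[of k] by (auto simp: q_def)
        qed
      qed (use pD(1) in \<open>auto simp: q_def\<close>)
      also have "\<dots> = (\<Sum>k\<in>p. measure lebesgue k)"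
      proof (rule sum.cong)
        fix k assume "k \<in> p"
        then show "Sup k - Inf k = measure lebesgue k" using pI[of k] by auto
      qed simp
      also have "\<dots> = measure lebesgue (\<Union>\<F>)" using content_division[OF p] by simp
      also have "\<dots> = measure lborel (\<Union>\<F>)"
        by (rule measure_completion) (use \<F>(1) in \<open>auto simp: \<F>_def\<close>)
      also have "\<dots> < d"
      proof -
        have "emeasure lborel (\<Union>\<F>) \<le> emeasure lborel U'"
          using \<F>(3) U'(1) by (intro emeasure_mono) auto
        then have "emeasure lborel (\<Union>\<F>) < ennreal d" using U'_small by simp
        moreover from this have "emeasure lborel (\<Union>\<F>) < \<infinity>"
          by (metis ennreal_less_top less_trans infinity_ennreal_def)
        ultimately show ?thesis
          using \<open>d > 0\<close> by (simp add: Sigma_Algebra.measure_def enn2real_less_iff)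
      qed
      finally have "(\<Sum>x\<in>J ` q. F (snd x) - F (fst x)) < e" by (rule d(2)[OF pack])
      have kb: "k \<in> sets borel" if "k \<in> p" for k using pI[OF that] by auto
      have "emeasure \<mu> K \<le> emeasure IM (\<Union>p)"
      proof -
        have "\<Union>p \<in> sets IM" using pD(1) kb by (intro sets.finite_Union) auto
        moreover have "K \<inter> {a<..<b} \<subseteq> \<Union>p" using \<F>(4) pD(6) by auto
        ultimately show ?thesis unfolding \<mu>_em[OF Kb] by (intro emeasure_mono)
      qed
      also have "\<dots> \<le> (\<Sum>k\<in>p. emeasure IM k)"
        using pD(1) kb by (intro emeasure_subadditive_finite[of p "\<lambda>x. x", simplified]) auto
      also have "\<dots> = (\<Sum>k\<in>p. ennreal (F (Sup k) - F (Inf k)))"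
      proof (rule sum.cong)
        fix k assume "k \<in> p"
        then obtain c d where "k = {c..d}" "c \<le> d" "a < c" "d < b" using pI by blast
        then show "emeasure IM k = ennreal (F (Sup k) - F (Inf k))"
          using IM_Icc[of c d] G_eq[of c] G_eq[of d] by auto
      qed simp
      also have "\<dots> = (\<Sum>k\<in>q. ennreal (F (Sup k) - F (Inf k)))"
      proof (rule sum.mono_neutral_right)
        show "\<forall>k\<in>p - q. ennreal (F (Sup k) - F (Inf k)) = 0"
        proof
          fix k assume "k \<in> p - q"
          then have "Sup k = Inf k" using pI[of k] by (auto simp: q_def)
          then show "ennreal (F (Sup k) - F (Inf k)) = 0" by simp
        qed
      qed (use pD(1) in \<open>auto simp: q_def\<close>)
      also have "\<dots> = ennreal (\<Sum>k\<in>q. F (Sup k) - F (Inf k))"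
      proof (rule sum_ennreal)
        fix k assume "k \<in> q"
        then have "a \<le> Inf k" "Inf k \<le> Sup k" "Sup k \<le> b" using pI[of k] by (auto simp: q_def)
        then show "0 \<le> F (Sup k) - F (Inf k)" using mono by auto
      qed
      also have "(\<Sum>k\<in>q. F (Sup k) - F (Inf k)) = (\<Sum>x\<in>J ` q. F (snd x) - F (fst x))"
        unfolding sum.reindex[OF inj] by (simp add: J_def)
      also have "ennreal \<dots> \<le> ennreal e"
        using \<open>(\<Sum>x\<in>J ` q. F (snd x) - F (fst x)) < e\<close> by (intro ennreal_leI) simp
      finally show ?thesis .
    qed
    then show ?thesis
      by (metis ennreal_le_epsilon add.left_neutral le_zero_eq)
  qed
  have "absolutely_continuous lborel \<mu>"
    unfolding absolutely_continuous_def
  proof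
    fix N :: "real set" assume N: "N \<in> null_sets lborel"
    have Nb: "N \<in> sets borel" "N \<inter> {a<..<b} \<in> sets borel" using N by auto
    have "emeasure \<mu> N = emeasure \<mu> (N \<inter> {a<..<b})"
      unfolding \<mu>_em[OF Nb(1)] \<mu>_em[OF Nb(2)] by (simp add: Int_assoc)
    \<comment> \<open>Inner regularity of the finite measure \<mu> reduces arbitrary null sets to
      compact ones.\<close>
    also have "\<dots> = (SUP K \<in> {K. K \<subseteq> N \<inter> {a<..<b} \<and> compact K}. emeasure \<mu> K)"
      by (rule inner_regular) (use \<mu>_fin Nb in auto)
    also have "\<dots> \<le> 0"
    proof (rule SUP_least)
      fix K assume K: "K \<in> {K. K \<subseteq> N \<inter> {a<..<b} \<and> compact K}"
      have "emeasure lborel K \<le> emeasure lborel N" using K N by (intro emeasure_mono) auto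
      then have "emeasure lborel K = 0" using N by auto
      then show "emeasure \<mu> K \<le> 0" using compact_null[of K] K by auto
    qed
    finally show "N \<in> null_sets \<mu>" using Nb by (auto simp: null_sets_def)
  qed
  then obtain f0 where f0: "f0 \<in> borel_measurable lborel" "density lborel f0 = \<mu>"
    using sigma_finite_measure.Radon_Nikodym[OF sigma_finite_lborel, of \<mu>] by auto
  have f0_int: "(\<integral>\<^sup>+x. f0 x * indicator A x \<partial>lborel) = emeasure IM (A \<inter> {a<..<b})" if "A \<in> sets borel" for A
    using emeasure_density[OF f0(1), of A] that \<mu>_em[OF that] f0(2) by simp
  have f0_fin: "AE x in lborel. f0 x \<noteq> \<infinity>"
  proof (rule nn_integral_PInf_AE[OF f0(1)])
    show "integral\<^sup>N lborel f0 \<noteq> \<infinity>" using f0_int[of UNIV] IM_Ioo[of a b] ab by simp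
  qed
  \<comment> \<open>The density is finite almost everywhere, so passing to real values changes it on
    a null set only.\<close>
  define f where "f x = enn2real (f0 x)" for x
  have f_meas[measurable]: "f \<in> borel_measurable borel" using f0(1) by (simp add: f_def[abs_def])
  have f_pos: "f x \<ge> 0" for x by (simp add: f_def)
  have hb: "has_bochner_integral lborel (\<lambda>t. indicator {a..x} t * f t) (F x - F a)" if x: "x \<in> {a..b}" for x
  proof (rule has_bochner_integral_nn_integral)
    have "(\<integral>\<^sup>+t. ennreal (indicator {a..x} t * f t) \<partial>lborel) = (\<integral>\<^sup>+t. f0 t * indicator {a..x} t \<partial>lborel)"
      by (rule nn_integral_cong_AE, use f0_fin in eventually_elim) (auto simp: f_def indicator_def less_top)
    also have "\<dots> = emeasure IM ({a..x} \<inter> {a<..<b})" by (rule f0_int) auto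
    also have "\<dots> = emeasure IM {a<..<x}"
    proof (rule emeasure_eq_AE)
      have "AE z in IM. z \<notin> {x}" by (rule AE_not_in) (simp add: null_sets_def IM_pt)
      then show "AE z in IM. (z \<in> {a..x} \<inter> {a<..<b}) = (z \<in> {a<..<x})"
        by eventually_elim (use x in auto)
    qed auto
    also have "\<dots> = ennreal (F x - F a)" using IM_Ioo[of a x] x G_eq[of x] G_eq[of a] by auto
    finally show "(\<integral>\<^sup>+t. ennreal (indicator {a..x} t * f t) \<partial>lborel) = ennreal (F x - F a)" .
    show "0 \<le> F x - F a" using mono[of a x] x by auto
  qed (auto simp: f_pos)
  have si: "set_integrable lborel {a..x} f" "(LINT t:{a..x}|lborel. f t) = F x - F a" if "x \<in> {a..b}" for x
    using hb[OF that] by (auto simp: has_bochner_integral_iff set_integrable_def set_lebesgue_integral_def)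
  show thesis
  proof (rule that)
    show "f absolutely_integrable_on {a..b}"
      using si(1)[of b] ab by (auto simp: set_integrable_def integrable_completion)
    show "F x = F a + integral {a..x} f" if "x \<in> {a..b}" for x
      using si[OF that] set_borel_integral_eq_integral(2)[OF si(1)[OF that]] by simp
  qed
qed

section \<open>Calculus of primitives: linearity, gluing, products\<close>

lemma primitive_on_interval_iff:
  "is_interval S \<Longrightarrow> primitive_on S u g \<longleftrightarrow> (\<forall>a\<in>S. \<forall>b\<in>S. a \<le> b \<longrightarrow> primitive_on {a..b} u g)"
proof
  assume "is_interval S" "primitive_on S u g"
  then show "\<forall>a\<in>S. \<forall>b\<in>S. a \<le> b \<longrightarrow> primitive_on {a..b} u g"
    by (meson atLeastAtMost_iff is_interval_1 primitive_on_subset subsetI)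
next
  assume *: "\<forall>a\<in>S. \<forall>b\<in>S. a \<le> b \<longrightarrow> primitive_on {a..b} u g"
  show "primitive_on S u g"
    unfolding primitive_on_def
  proof (intro ballI impI)
    fix a b assume "a \<in> S" "b \<in> S" "a \<le> b"
    then show "g absolutely_integrable_on {a..b} \<and> u b - u a = integral {a..b} g"
      using * primitive_onD[of "{a..b}" u g a b] by auto
  qed
qed

lemma primitive_on_linear:
  assumes "primitive_on S u g" "bounded_linear h"
  shows "primitive_on S (\<lambda>x. h (u x)) (\<lambda>x. h (g x))"
  unfolding primitive_on_def
proof (intro ballI impI conjI)
  fix a b assume ab: "a \<in> S" "b \<in> S" "a \<le> b"
  note g = primitive_onD[OF assms(1) ab]
  show "(\<lambda>x. h (g x)) absolutely_integrable_on {a..b}"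
    using absolutely_integrable_linear[OF g(1) assms(2)] by (simp add: o_def)
  have "g integrable_on {a..b}" using g(1) by (auto simp: absolutely_integrable_on_def)
  then have "integral {a..b} (h \<circ> g) = h (integral {a..b} g)"
    by (rule integral_linear) (rule assms)
  then show "h (u b) - h (u a) = integral {a..b} (\<lambda>x. h (g x))"
    using g(2) linear_diff[OF bounded_linear.linear[OF assms(2)], of "u b" "u a"] by (simp add: o_def)
qed

lemma primitive_on_add:
  assumes "primitive_on S u g" "primitive_on S v h"
  shows "primitive_on S (\<lambda>x. u x + v x) (\<lambda>x. g x + h x)"
  unfolding primitive_on_def
proof (intro ballI impI conjI)
  fix a b assume ab: "a \<in> S" "b \<in> S" "a \<le> b"
  note g = primitive_onD[OF assms(1) ab] and h = primitive_onD[OF assms(2) ab]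
  show "(\<lambda>x. g x + h x) absolutely_integrable_on {a..b}"
    using g h by (intro set_integral_add)
  show "u b + v b - (u a + v a) = integral {a..b} (\<lambda>x. g x + h x)"
    using g h by (subst Henstock_Kurzweil_Integration.integral_add)
      (auto simp: absolutely_integrable_on_def algebra_simps)
qed

lemmas primitive_on_cmult = primitive_on_linear[OF _ bounded_linear_mult_right]

lemma primitive_on_diff:
  assumes "primitive_on S u g" "primitive_on S v h"
  shows "primitive_on S (\<lambda>x. u x - v x) (\<lambda>x. g x - h x)"
  using primitive_on_add[OF assms(1) primitive_on_linear[OF assms(2) bounded_linear_minus[OF bounded_linear_ident]]]
  by simp

lemma primitive_on_cong:
  assumes "\<And>x. x \<in> S \<Longrightarrow> u x = v x" "is_interval S" "\<And>x. x \<in> S \<Longrightarrow> g x = h x"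
  shows "primitive_on S u g \<longleftrightarrow> primitive_on S v h"
proof -
  have "primitive_on S v h" if *: "primitive_on S u g" "\<And>x. x \<in> S \<Longrightarrow> u x = v x" "\<And>x. x \<in> S \<Longrightarrow> g x = h x"
    for u v g h
    unfolding primitive_on_def
  proof (intro ballI impI)
    fix a b assume ab: "a \<in> S" "b \<in> S" "a \<le> b"
    then have sub: "{a..b} \<subseteq> S"
      using \<open>is_interval S\<close> by (meson atLeastAtMost_iff is_interval_1 subsetI)
    have "h absolutely_integrable_on {a..b}"
      using primitive_onD(1)[OF *(1) ab] sub *(3)
      by (subst set_integrable_cong[OF refl refl, of "{a..b}" h g]) auto
    moreover have "integral {a..b} h = integral {a..b} g"
      using sub *(3) by (intro integral_cong) auto
    ultimately show "h absolutely_integrable_on {a..b} \<and> v b - v a = integral {a..b} h"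
      using primitive_onD(2)[OF *(1) ab] *(2) ab by auto
  qed
  then show ?thesis using assms by metis
qed

text \<open>Equations that hold almost everywhere, such as those for
  \<open>vector_derivative\<close>, enter the integral form through this rule.\<close>

lemma primitive_on_AE_cong:
  assumes "primitive_on S u g" "AE x in lebesgue. x \<in> S \<longrightarrow> g x = h x" "is_interval S"
  shows "primitive_on S u h"
  unfolding primitive_on_def
proof (intro ballI impI)
  fix a b assume ab: "a \<in> S" "b \<in> S" "a \<le> b"
  then have sub: "{a..b} \<subseteq> S"
    using \<open>is_interval S\<close> by (meson atLeastAtMost_iff is_interval_1 subsetI)
  obtain N where N: "negligible N" "{x. \<not> (x \<in> S \<longrightarrow> g x = h x)} \<subseteq> N"
    using assms(2) unfolding eventually_ae_filter by (auto simp: negligible_iff_null_sets)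
  then have eq: "h x = g x" if "x \<in> {a..b} - N" for x using that sub N(2) by force
  have "h absolutely_integrable_on {a..b}"
    using absolutely_integrable_spike[OF primitive_onD(1)[OF assms(1) ab] N(1) eq] .
  moreover have "integral {a..b} h = integral {a..b} g"
    using integral_spike[OF N(1), of "{a..b}" g h] eq by metis
  ultimately show "h absolutely_integrable_on {a..b} \<and> u b - u a = integral {a..b} h"
    using primitive_onD(2)[OF assms(1) ab] by simp
qed

lemma primitive_on_Icc_continuous:
  assumes "primitive_on {a..b} u g"
  shows "continuous_on {a..b} u"
proof (cases "a \<le> b")
  case True
  have "g integrable_on {a..b}"
    using primitive_onD(1)[OF assms, of a b] True by (auto simp: absolutely_integrable_on_def)
  then have "continuous_on {a..b} (\<lambda>x. u a + integral {a..x} g)"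
    by (intro continuous_intros indefinite_integral_continuous_1)
  then show ?thesis
  proof (rule continuous_on_eq)
    fix x assume "x \<in> {a..b}"
    then show "u a + integral {a..x} g = u x"
      using primitive_onD(2)[OF assms, of a x] by (auto simp: algebra_simps)
  qed
qed auto

lemma primitive_on_continuous:
  assumes "primitive_on {a..} u g"
  shows "continuous_on {a..} u"
  unfolding continuous_on_eq_continuous_within
proof
  fix x assume x: "x \<in> {a..}"
  have "continuous_on {a..x + 1} u"
    using primitive_on_Icc_continuous primitive_on_subset[OF assms] by (metis atLeastAtMost_subset_contains_Inf Icc_subset_Ici_iff order_refl primitive_on_def)
  then have "continuous (at x within {a..x+1}) u" using x by (auto simp: continuous_on_eq_continuous_within)
  moreover have "at x within {a..x + 1} = at x within {a..}"
    by (rule at_within_nhd[of _ "{..<x+1}"]) auto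
  ultimately show "continuous (at x within {a..}) u" by simp
qed

lemma primitive_on_join:
  assumes "primitive_on {a..b} u g" "primitive_on {b..c} u g" "a \<le> b" "b \<le> c"
  shows "primitive_on {a..c} u g"
proof (rule primitive_on_Icc)
  have g: "g absolutely_integrable_on {a..b}" "g absolutely_integrable_on {b..c}"
    using assms by (auto simp: primitive_on_def)
  then have "g absolutely_integrable_on ({a..b} \<union> {b..c})"
    by (intro absolutely_integrable_Un) auto
  then show abs: "g absolutely_integrable_on {a..c}"
    using assms by (simp add: ivl_disj_un_two_touch)
  show "u x = u a + integral {a..x} g" if "x \<in> {a..c}" for x
  proof (cases "x \<le> b")
    case True
    then show ?thesis using primitive_onD(2)[OF assms(1), of a x] that by (auto simp: algebra_simps)
  next
    case False
    have "g integrable_on {a..x}" using absolutely_integrable_on_subinterval[OF abs, of a x] that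
      by (auto simp: absolutely_integrable_on_def)
    then have "integral {a..b} g + integral {b..x} g = integral {a..x} g"
      using False assms by (intro Henstock_Kurzweil_Integration.integral_combine) auto
    then show ?thesis
      using primitive_onD(2)[OF assms(1), of a b] primitive_onD(2)[OF assms(2), of b x] False that assms
      by (auto simp: algebra_simps)
  qed
qed

lemma primitive_on_join_Ici:
  assumes "primitive_on {a..b} u g" "primitive_on {b..} u g" "a \<le> b"
  shows "primitive_on {a..} u g"
  unfolding primitive_on_interval_iff[OF is_interval_ci]
proof (intro ballI impI)
  fix c d assume cd: "c \<in> {a..}" "d \<in> {a..}" "c \<le> d"
  have "primitive_on {b..max b d} u g" using assms(2) by (rule primitive_on_subset) auto
  then have "primitive_on {a..max b d} u g"
    using primitive_on_join[OF assms(1)] assms(3) by auto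
  then show "primitive_on {c..d} u g" by (rule primitive_on_subset) (use cd in auto)
qed

lemma primitive_on_ftc:
  assumes "finite X" "continuous_on S u" "g absolutely_integrable_on {a..b} \<or> continuous_on S g" "S = {a..b}"
    "\<And>x. x \<in> {a<..<b} - X \<Longrightarrow> (u has_vector_derivative g x) (at x)"
  shows "primitive_on {a..b} u g"
proof -
  have abs: "g absolutely_integrable_on {a..b}"
    using assms(3,4) absolutely_integrable_continuous_real by blast
  show ?thesis
  proof (rule primitive_on_Icc[OF abs])
    fix x assume x: "x \<in> {a..b}"
    have "(g has_integral u x - u a) {a..x}"
      by (rule fundamental_theorem_of_calculus_interior_strong[OF assms(1)])
        (use x assms continuous_on_subset[of S u "{a..x}"] in auto)
    then show "u x = u a + integral {a..x} g" by (simp add: integral_unique)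
  qed
qed

text \<open>Jordan decomposition: the total variation \<open>V\<close>, \<open>V - Re u\<close> and
  \<open>V - Im u\<close> are increasing and absolutely continuous, so each of them has a density,
  and \<open>u\<close> is a linear combination of the three.\<close>

lemma abs_continuous_on_imp_primitive:
  assumes ac: "abs_continuous_on {a..b} u" and ab: "a < b"
  obtains g where "primitive_on {a..b} u g"
proof -
  define V where "V x = total_var u a x" for x
  have V_add: "V y - V x = total_var u x y" if "a \<le> x" "x \<le> y" "y \<le> b" for x y
    using total_var_add[OF ac that] by (simp add: V_def)
  have ex: "\<exists>f. primitive_on {a..b} (\<lambda>x. V x - r x) f"
    if r: "\<And>x y. \<bar>r y - r x\<bar> \<le> cmod (u y - u x)" for r :: "real \<Rightarrow> real"
  proof -
    have r': "\<bar>r y - r x\<bar> \<le> total_var u x y" if "a \<le> x" "x \<le> y" "y \<le> b" for x y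
      using r[of y x] total_var_ge[OF ac that] by linarith
    obtain f where f: "f absolutely_integrable_on {a..b}"
      "\<And>x. x \<in> {a..b} \<Longrightarrow> V x - r x = V a - r a + integral {a..x} f"
    proof (rule real_primitive_of_mono_packing[OF ab, of "\<lambda>x. V x - r x"])
      show "V x - r x \<le> V y - r y" if "a \<le> x" "x \<le> y" "y \<le> b" for x y
        using V_add[OF that] r'[OF that] by linarith
    next
      fix e :: real assume "e > 0"
      then have "e / 2 > 0" by simp
      obtain d where d: "d > 0" "\<And>P. interval_packing a b P \<Longrightarrow> (\<Sum>p\<in>P. snd p - fst p) < d \<Longrightarrow>
        (\<Sum>p\<in>P. total_var u (fst p) (snd p)) < e / 2"
        by (rule total_var_packing[OF ac \<open>e / 2 > 0\<close>]) (rule that)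
      show "\<exists>d>0. \<forall>P. interval_packing a b P \<and> (\<Sum>p\<in>P. snd p - fst p) < d \<longrightarrow>
          (\<Sum>p\<in>P. (V (snd p) - r (snd p)) - (V (fst p) - r (fst p))) < e"
      proof (intro exI conjI allI impI)
        fix P assume P: "interval_packing a b P \<and> (\<Sum>p\<in>P. snd p - fst p) < d"
        \<comment> \<open>The increment of \<open>r\<close> is itself at most the variation over the
          interval, whence the factor 2.\<close>
        have "(\<Sum>p\<in>P. (V (snd p) - r (snd p)) - (V (fst p) - r (fst p))) \<le> (\<Sum>p\<in>P. 2 * total_var u (fst p) (snd p))"
        proof (rule sum_mono)
          fix p assume "p \<in> P"
          then have "a \<le> fst p" "fst p \<le> snd p" "snd p \<le> b" using P by (auto simp: interval_packing_def less_imp_le)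
          from V_add[OF this] r'[OF this]
          show "(V (snd p) - r (snd p)) - (V (fst p) - r (fst p)) \<le> 2 * total_var u (fst p) (snd p)" by linarith
        qed
        also have "\<dots> < e" using d(2)[of P] P by (simp add: sum_distrib_left[symmetric])
        finally show "(\<Sum>p\<in>P. (V (snd p) - r (snd p)) - (V (fst p) - r (fst p))) < e" .
      qed (rule d(1))
    qed (rule that)
    then show ?thesis using primitive_on_Icc[where g=f and a=a and b=b and u="\<lambda>x. V x - r x"] by blast
  qed
  obtain f0 where f0: "primitive_on {a..b} (\<lambda>x. V x - 0) f0" using ex[of "\<lambda>x. 0"] by auto
  obtain f1 where f1: "primitive_on {a..b} (\<lambda>x. V x - Re (u x)) f1"
    using ex[of "\<lambda>x. Re (u x)"] abs_Re_le_cmod[of "u y - u x" for x y] by auto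
  obtain f2 where f2: "primitive_on {a..b} (\<lambda>x. V x - Im (u x)) f2"
    using ex[of "\<lambda>x. Im (u x)"] abs_Im_le_cmod[of "u y - u x" for x y] by auto
  have 1: "primitive_on {a..b} (\<lambda>x. complex_of_real (Re (u x))) (\<lambda>x. complex_of_real (f0 x - f1 x))"
    using primitive_on_linear[OF primitive_on_diff[OF f0 f1] bounded_linear_of_real] by simp
  have 2: "primitive_on {a..b} (\<lambda>x. complex_of_real (Im (u x))) (\<lambda>x. complex_of_real (f0 x - f2 x))"
    using primitive_on_linear[OF primitive_on_diff[OF f0 f2] bounded_linear_of_real] by simp
  have "(\<lambda>x. complex_of_real (Re (u x)) + \<i> * complex_of_real (Im (u x))) = u"
    by (auto simp: fun_eq_iff complex_eq_iff)
  then show thesis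
    using that primitive_on_add[OF 1 primitive_on_cmult[OF 2, of \<i>]] by simp
qed

lemma primitive_on_unique_derivative:
  fixes u :: "real \<Rightarrow> 'a::euclidean_space"
  assumes "primitive_on {a..b} u g" "AE x in lebesgue. x \<in> {a<..<b} \<longrightarrow> (u has_vector_derivative h x) (at x)"
  shows "primitive_on {a..b} u h"
proof (rule primitive_on_AE_cong[OF assms(1)])
  have "AE x in lebesgue. x \<notin> {a}" "AE x in lebesgue. x \<notin> {b}"
    by (rule AE_not_in, simp)+
  with assms(2) primitive_on_AE_derivative[OF assms(1)]
  show "AE x in lebesgue. x \<in> {a..b} \<longrightarrow> g x = h x"
    by eventually_elim (auto intro: vector_derivative_unique_at)
qed simp

lemma abs_continuous_on_mult:
  assumes u: "abs_continuous_on {a..b} u" "continuous_on {a..b} u"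
    and v: "abs_continuous_on {a..b} v" "continuous_on {a..b} v"
  shows "abs_continuous_on {a..b} (\<lambda>x. u x * v x)"
  unfolding abs_continuous_on_def
proof (intro allI impI)
  fix e :: real assume "e > 0"
  have "bounded (u ` {a..b})" "bounded (v ` {a..b})"
    using u(2) v(2) by (auto intro!: compact_imp_bounded compact_continuous_image)
  then obtain M1 M2 where M12: "\<forall>y\<in>u ` {a..b}. cmod y \<le> M1" "\<forall>y\<in>v ` {a..b}. cmod y \<le> M2"
    unfolding bounded_iff by blast
  then have M: "\<And>x. x \<in> {a..b} \<Longrightarrow> cmod (u x) \<le> M1" "\<And>x. x \<in> {a..b} \<Longrightarrow> cmod (v x) \<le> M2"
    by blast+
  define M where "M = \<bar>M1\<bar> + \<bar>M2\<bar> + 1"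
  have M: "M > 0" "\<And>x. x \<in> {a..b} \<Longrightarrow> cmod (u x) \<le> M" "\<And>x. x \<in> {a..b} \<Longrightarrow> cmod (v x) \<le> M"
    using M(1) M(2) by (simp add: M_def, fastforce simp: M_def, fastforce simp: M_def)
  have "e / (2 * M) > 0" using \<open>e > 0\<close> M by simp
  note pos = this
  obtain d1 where d1: "d1 > 0" "\<And>\<D> A. \<D> division_of A \<Longrightarrow> A \<subseteq> {a..b} \<Longrightarrow> (\<Sum>K\<in>\<D>. Sup K - Inf K) < d1 \<Longrightarrow>
        (\<Sum>K\<in>\<D>. cmod (u (Sup K) - u (Inf K))) < e / (2 * M)"
    using u(1) pos unfolding abs_continuous_on_def by metis
  obtain d2 where d2: "d2 > 0" "\<And>\<D> A. \<D> division_of A \<Longrightarrow> A \<subseteq> {a..b} \<Longrightarrow> (\<Sum>K\<in>\<D>. Sup K - Inf K) < d2 \<Longrightarrow>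
        (\<Sum>K\<in>\<D>. cmod (v (Sup K) - v (Inf K))) < e / (2 * M)"
    using v(1) pos unfolding abs_continuous_on_def by metis
  show "\<exists>d>0. \<forall>\<D> A. \<D> division_of A \<and> A \<subseteq> {a..b} \<and> (\<Sum>K\<in>\<D>. Sup K - Inf K) < d \<longrightarrow>
        (\<Sum>K\<in>\<D>. cmod (u (Sup K) * v (Sup K) - u (Inf K) * v (Inf K))) < e"
  proof (intro exI conjI allI impI)
    show "min d1 d2 > 0" using d1 d2 by simp
    fix \<D> A assume *: "\<D> division_of A \<and> A \<subseteq> {a..b} \<and> (\<Sum>K\<in>\<D>. Sup K - Inf K) < min d1 d2"
    have K: "Sup K \<in> {a..b}" "Inf K \<in> {a..b}" if KD: "K \<in> \<D>" for K
    proof -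
      obtain c d where "K = {c..d}"
        using division_ofD(4)[OF conjunct1[OF *] KD] by (auto simp: cbox_interval)
      moreover have "K \<noteq> {}" "K \<subseteq> {a..b}"
        using division_ofD(2,3)[OF conjunct1[OF *] KD] * by blast+
      ultimately show "Sup K \<in> {a..b}" "Inf K \<in> {a..b}" by auto
    qed
    have "(\<Sum>K\<in>\<D>. cmod (u (Sup K) * v (Sup K) - u (Inf K) * v (Inf K)))
      \<le> (\<Sum>K\<in>\<D>. M * cmod (u (Sup K) - u (Inf K)) + M * cmod (v (Sup K) - v (Inf K)))"
    proof (rule sum_mono)
      fix L assume L: "L \<in> \<D>"
      have "u (Sup L) * v (Sup L) - u (Inf L) * v (Inf L) =
          v (Sup L) * (u (Sup L) - u (Inf L)) + u (Inf L) * (v (Sup L) - v (Inf L))"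
        by (simp add: algebra_simps)
      then have "cmod (u (Sup L) * v (Sup L) - u (Inf L) * v (Inf L)) \<le>
         cmod (v (Sup L)) * cmod (u (Sup L) - u (Inf L)) + cmod (u (Inf L)) * cmod (v (Sup L) - v (Inf L))"
        by (metis norm_mult norm_triangle_ineq)
      also have "\<dots> \<le> M * cmod (u (Sup L) - u (Inf L)) + M * cmod (v (Sup L) - v (Inf L))"
        using M K[OF L] by (intro add_mono mult_right_mono) auto
      finally show "cmod (u (Sup L) * v (Sup L) - u (Inf L) * v (Inf L)) \<le>
        M * cmod (u (Sup L) - u (Inf L)) + M * cmod (v (Sup L) - v (Inf L))" .
    qed
    also have "\<dots> = M * (\<Sum>K\<in>\<D>. cmod (u (Sup K) - u (Inf K))) + M * (\<Sum>K\<in>\<D>. cmod (v (Sup K) - v (Inf K)))"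
      by (simp add: sum.distrib sum_distrib_left)
    also have "\<dots> < M * (e / (2 * M)) + M * (e / (2 * M))"
      using d1(2)[of \<D> A] d2(2)[of \<D> A] * M by (intro add_strict_mono mult_strict_left_mono) auto
    also have "\<dots> = e" using M by simp
    finally show "(\<Sum>K\<in>\<D>. cmod (u (Sup K) * v (Sup K) - u (Inf K) * v (Inf K))) < e" .
  qed
qed

text \<open>The product is absolutely continuous and so has some density; the product rule, valid at
  almost every point, identifies that density.\<close>

lemma primitive_on_mult:
  fixes u v :: "real \<Rightarrow> complex"
  assumes "is_interval S" "primitive_on S u g" "primitive_on S v h"
  shows "primitive_on S (\<lambda>x. u x * v x) (\<lambda>x. g x * v x + u x * h x)"
  unfolding primitive_on_interval_iff[OF assms(1)]
proof (intro ballI impI)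
  fix a b assume ab: "a \<in> S" "b \<in> S" "a \<le> b"
  have u: "primitive_on {a..b} u g" and v: "primitive_on {a..b} v h"
    using assms(2,3) ab unfolding primitive_on_interval_iff[OF assms(1)] by auto
  show "primitive_on {a..b} (\<lambda>x. u x * v x) (\<lambda>x. g x * v x + u x * h x)"
  proof (cases "a = b")
    \<comment> \<open>A one-point interval is treated apart, since
      \<open>abs_continuous_on_imp_primitive\<close> takes \<open>a < b\<close>.\<close>
    case True
    have "(\<lambda>x. g x * v x + u x * h x) absolutely_integrable_on {b..b}"
      using absolutely_integrable_on_null[of b b] by simp
    then show ?thesis using True by (auto simp: primitive_on_def)
  next
    case False
    have "abs_continuous_on {a..b} (\<lambda>x. u x * v x)"
      using u v by (intro abs_continuous_on_mult primitive_on_imp_abs_continuous_on primitive_on_Icc_continuous)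
    then obtain k where k: "primitive_on {a..b} (\<lambda>x. u x * v x) k"
      by (rule abs_continuous_on_imp_primitive) (use False ab in auto)
    show ?thesis
    proof (rule primitive_on_unique_derivative[OF k])
      show "AE x in lebesgue. x \<in> {a<..<b} \<longrightarrow>
          ((\<lambda>x. u x * v x) has_vector_derivative g x * v x + u x * h x) (at x)"
        using primitive_on_AE_derivative[OF u] primitive_on_AE_derivative[OF v]
        by eventually_elim (auto intro!: derivative_eq_intros)
    qed
  qed
qed

lemma primitive_on_imp_AC_loc:
  assumes "primitive_on {0<..} u g"
  shows "AC_loc u"
  unfolding AC_loc_def
proof (intro allI impI)
  fix a b :: real assume "0 < a \<and> a < b"
  then have "{a..b} \<subseteq> {0<..}" by auto
  from primitive_on_imp_abs_continuous_on[OF primitive_on_subset[OF assms this]]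
  show "abs_continuous_on {a..b} u" .
qed

text \<open>The bridge to the operator: quasi-derivatives and \<open>ell\<close> are phrased with
  \<open>vector_derivative\<close>, which agrees almost everywhere with whatever density absolute
  continuity provides.\<close>

lemma AC_loc_iff_primitive:
  "AC_loc u \<longleftrightarrow> primitive_on {0<..} u (\<lambda>x. vector_derivative u (at x))"
proof
  assume ac: "AC_loc u"
  show "primitive_on {0<..} u (\<lambda>x. vector_derivative u (at x))"
    unfolding primitive_on_interval_iff[OF is_interval_oi]
  proof (intro ballI impI)
    fix a b :: real assume "a \<in> {0<..}" "b \<in> {0<..}" "a \<le> b"
    \<comment> \<open>The interval is prolonged to \<open>b + 1\<close> because \<open>a = b\<close>
      may occur here.\<close>
    then obtain g where g: "primitive_on {a..b+1} u g"
      using abs_continuous_on_imp_primitive[of a "b+1" u] ac unfolding AC_loc_def by force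
    have "AE x in lebesgue. x \<in> {a<..<b+1} \<longrightarrow> (u has_vector_derivative vector_derivative u (at x)) (at x)"
      using primitive_on_AE_derivative[OF g] by eventually_elim (auto simp: vector_derivative_at)
    from primitive_on_unique_derivative[OF g this]
    show "primitive_on {a..b} u (\<lambda>x. vector_derivative u (at x))" by (rule primitive_on_subset) auto
  qed
qed (rule primitive_on_imp_AC_loc)

lemma primitive_on_AE_derivative_Ioi:
  assumes "primitive_on {0<..} u g"
  shows "AE x in half_line. (u has_vector_derivative g x) (at x)"
proof -
  \<comment> \<open>Countably many intervals exhaust the half-line, so the exceptional null sets can
    be united.\<close>
  have "AE x in lebesgue. \<forall>n::nat. x \<in> {1 / real (Suc n)<..<real (Suc n)} \<longrightarrow> (u has_vector_derivative g x) (at x)"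
    unfolding AE_all_countable
    proof
    fix n
    have "0 < 1 / real (Suc n)" by simp
    then have "{1 / real (Suc n)..real (Suc n)} \<subseteq> {0<..}"
      by (metis atLeastAtMost_iff greaterThan_iff less_le_trans subsetI)
    from primitive_on_AE_derivative[OF primitive_on_subset[OF assms this]]
    show "AE x in lebesgue. x \<in> {1 / real (Suc n)<..<real (Suc n)} \<longrightarrow> (u has_vector_derivative g x) (at x)" .
  qed
  then have "AE x in lebesgue. x \<in> {0<..} \<longrightarrow> (u has_vector_derivative g x) (at x)"
  proof eventually_elim
    fix x assume *: "\<forall>n::nat. x \<in> {1 / real (Suc n)<..<real (Suc n)} \<longrightarrow> (u has_vector_derivative g x) (at x)"
    show "x \<in> {0<..} \<longrightarrow> (u has_vector_derivative g x) (at x)"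
    proof
      assume "x \<in> {0<..}"
      obtain n :: nat where n: "max x (1 / x) < real n" using reals_Archimedean2 by blast
      then have "1 / x < real (Suc n)" "x < real (Suc n)" by auto
      then have "1 / real (Suc n) < x" using \<open>x \<in> {0<..}\<close> by (simp add: field_simps)
      then show "(u has_vector_derivative g x) (at x)" using * \<open>x < real (Suc n)\<close> by auto
    qed
  qed
  then show ?thesis by (subst AE_restrict_space_iff) auto
qed

section \<open>Picard iteration and Gronwall's inequality for integrable coefficients\<close>

section \<open>Integral equations\<close>

text \<open>Banach's fixed point theorem in the complete space of bounded continuous functions,
  phrased for plain functions so that \<open>T\<close> can be given by integrals.\<close>

lemma bounded_continuous_fixpoint:
  fixes T :: "(real \<Rightarrow> 'a::banach) \<Rightarrow> real \<Rightarrow> 'a"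
  assumes T: "\<And>y. continuous_on UNIV y \<Longrightarrow> bounded (range y) \<Longrightarrow>
      continuous_on UNIV (T y) \<and> bounded (range (T y))"
    and contr: "\<And>y y' M x. \<lbrakk>continuous_on UNIV y; bounded (range y); continuous_on UNIV y';
      bounded (range y'); \<And>t. norm (y t - y' t) \<le> M\<rbrakk> \<Longrightarrow> norm (T y x - T y' x) \<le> M / 2"
  obtains y where "continuous_on UNIV y" "bounded (range y)" "\<And>x. T y x = y x"
proof -
  define F where "F Y = Bcontfun (T (apply_bcontfun Y))" for Y :: "real \<Rightarrow>\<^sub>C 'a"
  have bc: "continuous_on UNIV (apply_bcontfun Y)" "bounded (range (apply_bcontfun Y))" for Y :: "real \<Rightarrow>\<^sub>C 'a"
    using apply_bcontfun[of Y] by (auto simp: bcontfun_def)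
  have F: "apply_bcontfun (F Y) = T (apply_bcontfun Y)" for Y
    unfolding F_def by (rule Bcontfun_inverse) (use T[OF bc] in \<open>auto simp: bcontfun_def\<close>)
  have "\<exists>!Y. F Y = Y"
  proof (rule banach_fix_type[of "1/2"])
    show "\<forall>Y Z. dist (F Y) (F Z) \<le> 1 / 2 * dist Y Z"
    proof (intro allI dist_bound)
      fix Y Z :: "real \<Rightarrow>\<^sub>C 'a" and x
      have "norm (apply_bcontfun Y t - apply_bcontfun Z t) \<le> dist Y Z" for t
        using dist_bounded[of Y t Z] by (simp add: dist_norm)
      then have "norm (T (apply_bcontfun Y) x - T (apply_bcontfun Z) x) \<le> dist Y Z / 2"
        using contr[of "apply_bcontfun Y" "apply_bcontfun Z" "dist Y Z" x] bc by blast
      then show "dist (apply_bcontfun (F Y) x) (apply_bcontfun (F Z) x) \<le> 1 / 2 * dist Y Z"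
        by (simp add: F dist_norm)
    qed
  qed auto
  then obtain Y where "F Y = Y" by auto
  then show thesis using that[OF bc, of Y] F[of Y] by simp
qed

lemma primitive_on_integral:
  assumes "g absolutely_integrable_on {a..b}"
  shows "primitive_on {a..b} (\<lambda>x. integral {a..x} g) g"
proof (rule primitive_on_Icc[OF assms])
  show "integral {a..x} g = integral {a..a} g + integral {a..x} g" for x by simp
qed

lemma primitive_on_norm_diff:
  assumes u: "primitive_on {a..b} u g" and xy: "x \<in> {a..b}" "y \<in> {a..b}"
    and k: "k integrable_on {a..b}" "\<And>t. t \<in> {a..b} \<Longrightarrow> norm (g t) \<le> k t"
  shows "norm (u y - u x) \<le> integral {a..b} k"
proof -
  have *: "norm (u y - u x) \<le> integral {a..b} k" if "x \<in> {a..b}" "y \<in> {a..b}" "x \<le> y" for x y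
  proof -
    note g = primitive_onD[OF u that]
    have kxy: "k integrable_on {x..y}" using that by (intro integrable_on_subinterval[OF k(1)]) auto
    have "norm (integral {x..y} g) \<le> integral {x..y} k"
      using g(1) kxy k(2) that by (intro integral_norm_bound_integral) (auto simp: absolutely_integrable_on_def)
    also have "\<dots> \<le> integral {a..b} k"
      using that order_trans[OF norm_ge_zero k(2)] by (intro integral_subset_le[OF _ kxy k(1)]) auto
    finally show ?thesis using g(2) by simp
  qed
  show ?thesis
    using *[OF xy] *[OF xy(2,1)] by (cases "x \<le> y") (auto simp: norm_minus_commute)
qed

lemma primitive_on_reflect:
  assumes "primitive_on {a..b} u g"
  shows "primitive_on {-b..-a} (\<lambda>x. u (- x)) (\<lambda>x. - g (- x))"
  unfolding primitive_on_def
proof (intro ballI impI conjI)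
  fix c d assume cd: "c \<in> {-b..-a}" "d \<in> {-b..-a}" "c \<le> d"
  then have g: "g absolutely_integrable_on {-d..-c}" "u (-c) - u (-d) = integral {-d..-c} g"
    using primitive_onD[OF assms, of "-d" "-c"] by auto
  have "(\<lambda>x. g (- x)) absolutely_integrable_on {c..d}"
    using g(1) absolutely_integrable_reflect_real[where f=g and a="-d" and b="-c"] by simp
  from absolutely_integrable_linear[OF this bounded_linear_minus[OF bounded_linear_ident]]
  show "(\<lambda>x. - g (- x)) absolutely_integrable_on {c..d}" by (simp add: o_def)
  have "integral {c..d} (\<lambda>x. g (- x)) = integral {-d..-c} g"
    using Henstock_Kurzweil_Integration.integral_reflect_real[where f=g and a="-d" and b="-c"] by simp
  then show "u (- d) - u (- c) = integral {c..d} (\<lambda>x. - g (- x))"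
    using g(2) by (simp add: algebra_simps)
qed

lemma small_integral_near:
  fixes k :: "real \<Rightarrow> real"
  assumes k: "k integrable_on {a..b}" and x: "a \<le> x" "x \<le> b" and "e > 0"
  obtains d where "d > 0"
    "\<And>c c'. \<lbrakk>a \<le> c; c \<le> x; x \<le> c'; c' \<le> b; c' - c < d\<rbrakk> \<Longrightarrow> integral {c..c'} k \<le> e"
proof -
  have "continuous_on {a..b} (\<lambda>x. integral {a..x} k)"
    by (rule indefinite_integral_continuous_1[OF k])
  then obtain d where d: "d > 0"
    "\<And>y. y \<in> {a..b} \<Longrightarrow> dist y x < d \<Longrightarrow> dist (integral {a..y} k) (integral {a..x} k) < e / 2"
    using x \<open>e > 0\<close> unfolding continuous_on_iff by (metis atLeastAtMost_iff half_gt_zero)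
  show thesis
  proof (rule that[OF d(1)])
    fix c c' assume *: "a \<le> c" "c \<le> x" "x \<le> c'" "c' \<le> b" "c' - c < d"
    have "integral {a..c} k + integral {c..c'} k = integral {a..c'} k"
      using * by (intro Henstock_Kurzweil_Integration.integral_combine integrable_on_subinterval[OF k]) auto
    moreover have "\<bar>integral {a..c} k - integral {a..x} k\<bar> < e / 2" "\<bar>integral {a..c'} k - integral {a..x} k\<bar> < e / 2"
      using d(2)[of c] d(2)[of c'] * by (auto simp: dist_real_def)
    ultimately show "integral {c..c'} k \<le> e" by linarith
  qed
qed

text \<open>Picard iteration contracts in the supremum norm because the Lipschitz coefficient
  \<open>k\<close> has integral at most 1 / 2.\<close>

lemma ode_local_solution:
  fixes G :: "real \<Rightarrow> 'a::euclidean_space \<Rightarrow> 'a"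
  assumes G: "\<And>Y. continuous_on UNIV Y \<Longrightarrow> (\<lambda>t. G t (Y t)) absolutely_integrable_on {a..b}"
    and lip: "\<And>t y y'. t \<in> {a..b} \<Longrightarrow> norm (G t y - G t y') \<le> k t * norm (y - y')"
    and k: "k integrable_on {a..b}" "\<And>t. t \<in> {a..b} \<Longrightarrow> k t \<ge> 0" "integral {a..b} k \<le> 1 / 2" and x0: "x0 \<in> {a..b}"
  obtains Y where "primitive_on {a..b} Y (\<lambda>t. G t (Y t))" "Y x0 = c"
proof -
  \<comment> \<open>The iteration runs on functions on the whole line; clamping the argument keeps
    the iterates bounded and continuous.\<close>
  define cl where "cl x = max a (min b x)" for x
  have cl: "cl x \<in> {a..b}" for x using x0 by (auto simp: cl_def)
  have cl_id: "cl x = x" if "x \<in> {a..b}" for x using that by (auto simp: cl_def)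
  define I where "I Y x = integral {a..x} (\<lambda>t. G t (Y t))" for Y x
  define T where "T Y x = c + I Y (cl x) - I Y x0" for Y x
  have prim: "primitive_on {a..b} (I Y) (\<lambda>t. G t (Y t))" if "continuous_on UNIV Y" for Y
    unfolding I_def[abs_def] by (rule primitive_on_integral[OF G[OF that]])
  obtain Y where Y: "continuous_on UNIV Y" "bounded (range Y)" "\<And>x. T Y x = Y x"
  proof (rule bounded_continuous_fixpoint[of T])
    fix Y :: "real \<Rightarrow> 'a" assume Y: "continuous_on UNIV Y" "bounded (range Y)"
    have I: "continuous_on {a..b} (I Y)" by (rule primitive_on_Icc_continuous[OF prim[OF Y(1)]])
    have "continuous_on UNIV (I Y \<circ> cl)"
      by (rule continuous_on_compose)
        (use cl in \<open>auto intro!: continuous_on_subset[OF I] continuous_intros simp: cl_def[abs_def]\<close>)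
    then have "continuous_on UNIV (T Y)" unfolding T_def[abs_def] o_def by (intro continuous_intros)
    moreover have "bounded (range (T Y))"
    proof (rule bounded_subset)
      show "bounded ((\<lambda>x. c + I Y x - I Y x0) ` {a..b})"
        using I by (intro compact_imp_bounded compact_continuous_image continuous_intros) auto
      show "range (T Y) \<subseteq> (\<lambda>x. c + I Y x - I Y x0) ` {a..b}" using cl by (auto simp: T_def)
    qed
    ultimately show "continuous_on UNIV (T Y) \<and> bounded (range (T Y))" ..
  next
    fix Y Y' :: "real \<Rightarrow> 'a" and M x
    assume Y: "continuous_on UNIV Y" "continuous_on UNIV Y'" and M: "\<And>t. norm (Y t - Y' t) \<le> M"
    have "norm ((I Y (cl x) - I Y' (cl x)) - (I Y x0 - I Y' x0)) \<le> integral {a..b} (\<lambda>t. k t * M)"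
    proof (rule primitive_on_norm_diff[OF primitive_on_diff[OF prim[OF Y(1)] prim[OF Y(2)]] x0 cl])
      show "(\<lambda>t. k t * M) integrable_on {a..b}" using k(1) by (rule integrable_on_mult_left)
      show "norm (G t (Y t) - G t (Y' t)) \<le> k t * M" if "t \<in> {a..b}" for t
        using lip[OF that, of "Y t" "Y' t"] mult_left_mono[OF M[of t] k(2)[OF that]] by linarith
    qed
    also have "\<dots> = integral {a..b} k * M" by simp
    also have "\<dots> \<le> 1 / 2 * M"
      using k(3) order_trans[OF norm_ge_zero M[of 0]] by (intro mult_right_mono)
    finally show "norm (T Y x - T Y' x) \<le> M / 2" by (simp add: T_def algebra_simps)
  qed (rule that)
  have "primitive_on {a..b} Y (\<lambda>t. G t (Y t))"
  proof (rule primitive_on_Icc[OF G[OF Y(1)]])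
    show "Y x = Y a + integral {a..x} (\<lambda>t. G t (Y t))" if "x \<in> {a..b}" for x
    proof -
      have "Y x - Y a = T Y x - T Y a" by (simp add: Y(3))
      also have "\<dots> = integral {a..x} (\<lambda>t. G t (Y t))"
        using cl_id[OF that] cl_id[of a] x0 by (simp add: T_def I_def)
      finally show ?thesis by (simp add: algebra_simps)
    qed
  qed
  moreover have "Y x0 = c" using Y(3)[of x0] cl_id[OF x0] by (simp add: T_def)
  ultimately show thesis by (rule that)
qed

text \<open>Bisection: intervals on which \<open>k\<close> has small integral are served by
  \<open>ode_local_solution\<close>, and solutions on adjacent intervals are glued at the common
  point.\<close>

lemma ode_solution:
  fixes G :: "real \<Rightarrow> 'a::euclidean_space \<Rightarrow> 'a"
  assumes G: "\<And>Y. continuous_on UNIV Y \<Longrightarrow> (\<lambda>t. G t (Y t)) absolutely_integrable_on {a..b}"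
    and lip: "\<And>t y y'. t \<in> {a..b} \<Longrightarrow> norm (G t y - G t y') \<le> k t * norm (y - y')"
    and k: "k integrable_on {a..b}" "\<And>t. t \<in> {a..b} \<Longrightarrow> k t \<ge> 0" and x0: "x0 \<in> {a..b}"
  obtains Y where "primitive_on {a..b} Y (\<lambda>t. G t (Y t))" "Y x0 = c"
proof -
  \<comment> \<open>The initial point ranges over the whole interval, because gluing may have to
    start the second piece at its left end or the first piece at its right end.\<close>
  define Q where "Q x y \<longleftrightarrow> (\<forall>x0\<in>{x..y}. \<forall>c. \<exists>Y. primitive_on {x..y} Y (\<lambda>t. G t (Y t)) \<and> Y x0 = c)" for x y
  have "a \<le> b" using x0 by auto
  then have "a \<le> a \<longrightarrow> b \<le> b \<longrightarrow> Q a b"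
  proof (rule Bolzano[where P="\<lambda>x y. a \<le> x \<longrightarrow> y \<le> b \<longrightarrow> Q x y"])
    fix x y z assume IH: "a \<le> x \<longrightarrow> y \<le> b \<longrightarrow> Q x y" "a \<le> y \<longrightarrow> z \<le> b \<longrightarrow> Q y z" "x \<le> y" "y \<le> z"
    show "a \<le> x \<longrightarrow> z \<le> b \<longrightarrow> Q x z"
    proof (intro impI)
      assume "a \<le> x" "z \<le> b"
      then have Q: "Q x y" "Q y z" using IH by auto
      \<comment> \<open>\<open>G\<close> depends on \<open>Y\<close> only through its value at
        \<open>t\<close>, so gluing the solutions glues their densities too.\<close>
      have glue: "\<exists>Y. primitive_on {x..z} Y (\<lambda>t. G t (Y t)) \<and> (\<forall>t\<in>{x..y}. Y t = Y1 t) \<and> (\<forall>t\<in>{y..z}. Y t = Y2 t)"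
        if Y: "primitive_on {x..y} Y1 (\<lambda>t. G t (Y1 t))" "primitive_on {y..z} Y2 (\<lambda>t. G t (Y2 t))" "Y1 y = Y2 y" for Y1 Y2
      proof -
        define Y where "Y t = (if t \<le> y then Y1 t else Y2 t)" for t
        have e: "Y t = Y1 t" if "t \<in> {x..y}" for t using that by (auto simp: Y_def)
        have e2: "Y t = Y2 t" if "t \<in> {y..z}" for t using that Y(3) by (auto simp: Y_def)
        have "primitive_on {x..y} Y (\<lambda>t. G t (Y t))"
          using Y(1) primitive_on_cong[of "{x..y}" Y Y1 "\<lambda>t. G t (Y t)" "\<lambda>t. G t (Y1 t)"] e by auto
        moreover have "primitive_on {y..z} Y (\<lambda>t. G t (Y t))"
          using Y(2) primitive_on_cong[of "{y..z}" Y Y2 "\<lambda>t. G t (Y t)" "\<lambda>t. G t (Y2 t)"] e2 by auto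
        ultimately have "primitive_on {x..z} Y (\<lambda>t. G t (Y t))"
          by (rule primitive_on_join) (use IH in auto)
        then show ?thesis using e e2 by blast
      qed
      show "Q x z"
        unfolding Q_def
      proof (intro ballI allI)
        fix x0 c assume x0: "x0 \<in> {x..z}"
        show "\<exists>Y. primitive_on {x..z} Y (\<lambda>t. G t (Y t)) \<and> Y x0 = c"
        proof (cases "x0 \<le> y")
          case True
          then obtain Y1 where Y1: "primitive_on {x..y} Y1 (\<lambda>t. G t (Y1 t))" "Y1 x0 = c"
            using Q(1) x0 unfolding Q_def by (meson atLeastAtMost_iff)
          obtain Y2 where Y2: "primitive_on {y..z} Y2 (\<lambda>t. G t (Y2 t))" "Y2 y = Y1 y"
            using Q(2) IH(4) unfolding Q_def by (meson atLeastAtMost_iff order_refl)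
          show ?thesis using glue[OF Y1(1) Y2(1) Y2(2)[symmetric]] True x0 Y1(2) by auto
        next
          case False
          then obtain Y2 where Y2: "primitive_on {y..z} Y2 (\<lambda>t. G t (Y2 t))" "Y2 x0 = c"
            using Q(2) x0 unfolding Q_def by (meson atLeastAtMost_iff linear)
          obtain Y1 where Y1: "primitive_on {x..y} Y1 (\<lambda>t. G t (Y1 t))" "Y1 y = Y2 y"
            using Q(1) IH(3) unfolding Q_def by (meson atLeastAtMost_iff order_refl)
          show ?thesis using glue[OF Y1(1) Y2(1) Y1(2)] False x0 Y2(2) by auto
        qed
      qed
    qed
  next
    fix x assume x: "a \<le> x" "x \<le> b"
    obtain d where d: "d > 0"
      "\<And>c c'. \<lbrakk>a \<le> c; c \<le> x; x \<le> c'; c' \<le> b; c' - c < d\<rbrakk> \<Longrightarrow> integral {c..c'} k \<le> 1 / 2"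
      by (rule small_integral_near[OF k(1) x, of "1/2"]) (simp, rule that)
    show "\<exists>d>0. \<forall>a' b'. a' \<le> x \<and> x \<le> b' \<and> b' - a' < d \<longrightarrow> a \<le> a' \<longrightarrow> b' \<le> b \<longrightarrow> Q a' b'"
    proof (intro exI conjI allI impI)
      fix a' b' assume *: "a' \<le> x \<and> x \<le> b' \<and> b' - a' < d" "a \<le> a'" "b' \<le> b"
      then have sub: "{a'..b'} \<subseteq> {a..b}" by auto
      show "Q a' b'"
        unfolding Q_def
      proof (intro ballI allI)
        fix x0 c assume x0: "x0 \<in> {a'..b'}"
        obtain Y where "primitive_on {a'..b'} Y (\<lambda>t. G t (Y t))" "Y x0 = c"
        proof (rule ode_local_solution[where G=G and a=a' and b=b' and k=k and ?x0.0=x0 and c=c])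
          show "(\<lambda>t. G t (Y t)) absolutely_integrable_on {a'..b'}" if "continuous_on UNIV Y" for Y
            using absolutely_integrable_on_subinterval[OF G[OF that] sub] .
          show "k integrable_on {a'..b'}" by (rule integrable_on_subinterval[OF k(1) sub])
          show "integral {a'..b'} k \<le> 1 / 2" using d(2)[of a' b'] * by auto
        qed (use sub x0 lip k in auto)
        then show "\<exists>Y. primitive_on {a'..b'} Y (\<lambda>t. G t (Y t)) \<and> Y x0 = c" by blast
      qed
    qed (rule d(1))
  qed
  then show thesis using x0 that unfolding Q_def by blast
qed

text \<open>Bisection again, as \<open>k\<close> is merely integrable. Where the integral
  \<open>s\<close> of \<open>k\<close> is at most 1 / 2, the maximum of \<open>n\<close> can be
  absorbed at the price of a factor \<open>1 / (1 - s)\<close>, which is at most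
  \<open>exp (2 * s)\<close>; along adjacent intervals these factors multiply. This is the origin of
  the 2 in the exponent.\<close>

lemma gronwall:
  fixes n k :: "real \<Rightarrow> real"
  assumes n: "continuous_on {a..b} n" "\<And>t. t \<in> {a..b} \<Longrightarrow> n t \<ge> 0"
    and k: "k absolutely_integrable_on {a..b}" "\<And>t. t \<in> {a..b} \<Longrightarrow> k t \<ge> 0"
    and "c \<ge> 0" and le: "\<And>x. x \<in> {a..b} \<Longrightarrow> n x \<le> c + integral {a..x} (\<lambda>t. k t * n t)"
    and x: "x \<in> {a..b}"
  shows "n x \<le> c * exp (2 * integral {a..b} k)"
proof -
  have kn: "(\<lambda>t. k t * n t) absolutely_integrable_on {a..b}"
  proof -
    have "(\<lambda>t. n t * k t) absolutely_integrable_on {a..b}"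
      by (rule absolutely_integrable_bounded_measurable_product_real[OF _ _ _ k(1)])
        (use n(1) in \<open>auto intro!: continuous_imp_measurable_on_sets_lebesgue compact_imp_bounded compact_continuous_image\<close>)
    then show ?thesis by (simp add: mult.commute)
  qed
  have ki: "k integrable_on {y..z}" "(\<lambda>t. k t * n t) integrable_on {y..z}" if "a \<le> y" "z \<le> b" for y z
    using that absolutely_integrable_on_subinterval[OF k(1), of y z] absolutely_integrable_on_subinterval[OF kn, of y z]
    by (auto simp: absolutely_integrable_on_def)
  \<comment> \<open>The second conjunct bounds the constant with which the next interval
    starts.\<close>
  define Q where "Q y z \<longleftrightarrow> (\<forall>c\<ge>0. (\<forall>t\<in>{y..z}. n t \<le> c + integral {y..t} (\<lambda>t. k t * n t)) \<longrightarrow>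
     (\<forall>t\<in>{y..z}. n t \<le> c * exp (2 * integral {y..z} k)) \<and>
     c + integral {y..z} (\<lambda>t. k t * n t) \<le> c * exp (2 * integral {y..z} k))" for y z
  have "a \<le> b" using x by auto
  then have "a \<le> a \<longrightarrow> b \<le> b \<longrightarrow> Q a b"
  proof (rule Bolzano[where P="\<lambda>x y. a \<le> x \<longrightarrow> y \<le> b \<longrightarrow> Q x y"])
    fix x y z assume IH: "a \<le> x \<longrightarrow> y \<le> b \<longrightarrow> Q x y" "a \<le> y \<longrightarrow> z \<le> b \<longrightarrow> Q y z" "x \<le> y" "y \<le> z"
    show "a \<le> x \<longrightarrow> z \<le> b \<longrightarrow> Q x z"
    proof (intro impI)
      assume axz: "a \<le> x" "z \<le> b"
      then have Q: "Q x y" "Q y z" using IH by auto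
      show "Q x z"
        unfolding Q_def
      proof (intro allI impI)
        fix c :: real assume c: "c \<ge> 0" "\<forall>t\<in>{x..z}. n t \<le> c + integral {x..t} (\<lambda>t. k t * n t)"
        define c' where "c' = c + integral {x..y} (\<lambda>t. k t * n t)"
        have split: "integral {x..y} f + integral {y..t} f = integral {x..t} f"
          if "f integrable_on {x..t}" "y \<le> t" for f :: "real \<Rightarrow> real" and t
          using that IH by (intro Henstock_Kurzweil_Integration.integral_combine) auto
        have knn: "0 \<le> integral {x..y} (\<lambda>t. k t * n t)"
          using ki[of x y] axz IH k(2) n(2) by (intro integral_nonneg) auto
        have kpos: "0 \<le> integral {y..z} k" using ki[of y z] axz IH k(2) by (intro integral_nonneg) auto
        have A: "\<forall>t\<in>{x..y}. n t \<le> c * exp (2 * integral {x..y} k)" "c' \<le> c * exp (2 * integral {x..y} k)"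
          using Q(1)[unfolded Q_def, rule_format, OF c(1)] c(2) IH by (auto simp: c'_def)
        have "\<forall>t\<in>{y..z}. n t \<le> c' + integral {y..t} (\<lambda>t. k t * n t)"
        proof
          fix t assume "t \<in> {y..z}"
          then show "n t \<le> c' + integral {y..t} (\<lambda>t. k t * n t)"
            using c(2)[rule_format, of t] IH axz split[of "\<lambda>t. k t * n t" t] ki[of x t] by (auto simp: c'_def)
        qed
        then have B: "\<forall>t\<in>{y..z}. n t \<le> c' * exp (2 * integral {y..z} k)"
            "c' + integral {y..z} (\<lambda>t. k t * n t) \<le> c' * exp (2 * integral {y..z} k)"
          using Q(2)[unfolded Q_def, rule_format, of c'] c(1) knn by (auto simp: c'_def)
        have E: "c' * exp (2 * integral {y..z} k) \<le> c * exp (2 * integral {x..z} k)"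
        proof -
          have "c' * exp (2 * integral {y..z} k) \<le> (c * exp (2 * integral {x..y} k)) * exp (2 * integral {y..z} k)"
            using A(2) by (intro mult_right_mono) auto
          also have "\<dots> = c * exp (2 * integral {x..z} k)"
            using split[of k z] ki[of x z] axz IH by (simp add: mult.assoc exp_add[symmetric] algebra_simps)
          finally show ?thesis .
        qed
        have E': "c * exp (2 * integral {x..y} k) \<le> c * exp (2 * integral {x..z} k)"
          using split[of k z] ki[of x z] axz IH kpos c(1) by (intro mult_left_mono) auto
        show "(\<forall>t\<in>{x..z}. n t \<le> c * exp (2 * integral {x..z} k)) \<and>
            c + integral {x..z} (\<lambda>t. k t * n t) \<le> c * exp (2 * integral {x..z} k)"
        proof
          show "\<forall>t\<in>{x..z}. n t \<le> c * exp (2 * integral {x..z} k)"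
          proof
            fix t assume t: "t \<in> {x..z}"
            show "n t \<le> c * exp (2 * integral {x..z} k)"
            proof (cases "t \<le> y")
              case True
              then have "n t \<le> c * exp (2 * integral {x..y} k)" using A(1) t by simp
              then show ?thesis using E' by linarith
            next
              case False
              then have "n t \<le> c' * exp (2 * integral {y..z} k)" using B(1) t by simp
              then show ?thesis using E by linarith
            qed
          qed
          show "c + integral {x..z} (\<lambda>t. k t * n t) \<le> c * exp (2 * integral {x..z} k)"
            using B(2) E split[of "\<lambda>t. k t * n t" z] ki[of x z] axz IH by (auto simp: c'_def)
        qed
      qed
    qed
  next
    fix x assume x: "a \<le> x" "x \<le> b"
    obtain d where d: "d > 0"
      "\<And>c c'. \<lbrakk>a \<le> c; c \<le> x; x \<le> c'; c' \<le> b; c' - c < d\<rbrakk> \<Longrightarrow> integral {c..c'} k \<le> 1 / 2"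
      by (rule small_integral_near[OF ki(1)[OF order_refl order_refl] x, of "1/2"]) (simp, rule that)
    show "\<exists>d>0. \<forall>a' b'. a' \<le> x \<and> x \<le> b' \<and> b' - a' < d \<longrightarrow> a \<le> a' \<longrightarrow> b' \<le> b \<longrightarrow> Q a' b'"
    proof (intro exI conjI allI impI)
      fix a' b' assume *: "a' \<le> x \<and> x \<le> b' \<and> b' - a' < d" "a \<le> a'" "b' \<le> b"
      define s where "s = integral {a'..b'} k"
      have s: "0 \<le> s" "s \<le> 1 / 2"
        using d(2)[of a' b'] * ki[of a' b'] k(2) unfolding s_def by (auto intro!: integral_nonneg)
      have n': "continuous_on {a'..b'} n" using * by (intro continuous_on_subset[OF n(1)]) auto
      obtain t0 where t0: "t0 \<in> {a'..b'}" "\<And>t. t \<in> {a'..b'} \<Longrightarrow> n t \<le> n t0"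
        using continuous_attains_sup[OF compact_Icc _ n'] * by auto
      have kn_le: "integral {a'..t} (\<lambda>t. k t * n t) \<le> s * n t0" if "t \<in> {a'..b'}" for t
      proof -
        have "integral {a'..t} (\<lambda>t. k t * n t) \<le> integral {a'..b'} (\<lambda>t. k t * n t)"
          using that * k(2) n(2) ki[of a' t] ki[of a' b'] by (intro integral_subset_le) auto
        also have "\<dots> \<le> integral {a'..b'} (\<lambda>t. k t * n t0)"
          using ki[of a' b'] * k(2) t0 by (intro integral_le integrable_on_mult_left mult_left_mono) auto
        finally show ?thesis by (simp add: s_def)
      qed
      \<comment> \<open>This is where \<open>s \<le> 1 / 2\<close> enters: it gives
        \<open>(1 + 2 * s) * (1 - s) \<ge> 1\<close>.\<close>
      have exps: "1 / (1 - s) \<le> exp (2 * s)"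
      proof -
        have "s * s \<le> s * (1 / 2)" using s by (intro mult_left_mono) auto
        then have "1 \<le> (1 + 2 * s) * (1 - s)" by (simp add: algebra_simps)
        also have "\<dots> \<le> exp (2 * s) * (1 - s)" using s by (intro mult_right_mono) auto
        finally show ?thesis using s by (simp add: field_simps)
      qed
      show "Q a' b'"
        unfolding Q_def s_def[symmetric]
      proof (intro allI impI)
        fix c :: real assume c: "c \<ge> 0" "\<forall>t\<in>{a'..b'}. n t \<le> c + integral {a'..t} (\<lambda>t. k t * n t)"
        have "n t0 \<le> c + s * n t0" using c(2) t0(1) kn_le[OF t0(1)] by force
        then have S: "n t0 \<le> c / (1 - s)" using s by (simp add: field_simps)
        have ce: "c / (1 - s) \<le> c * exp (2 * s)" using mult_left_mono[OF exps c(1)] by simp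
        have "c + s * n t0 \<le> c + s * (c / (1 - s))" using S s by (intro add_left_mono mult_left_mono)
        also have "\<dots> = c / (1 - s)" using s by (simp add: field_simps)
        finally have "c + s * n t0 \<le> c * exp (2 * s)" using ce by linarith
        moreover have "integral {a'..b'} (\<lambda>t. k t * n t) \<le> s * n t0" using kn_le[of b'] * by auto
        ultimately show "(\<forall>t\<in>{a'..b'}. n t \<le> c * exp (2 * s)) \<and> c + integral {a'..b'} (\<lambda>t. k t * n t) \<le> c * exp (2 * s)"
          using t0(2) S ce by fastforce
      qed
    qed (rule d(1))
  qed
  then show ?thesis using \<open>c \<ge> 0\<close> le x unfolding Q_def by blast
qed

lemma primitive_gronwall_forward:
  fixes Y :: "real \<Rightarrow> 'a::euclidean_space"
  assumes Y: "primitive_on {a..b} Y g"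
    and k: "k absolutely_integrable_on {a..b}" "\<And>t. t \<in> {a..b} \<Longrightarrow> k t \<ge> 0"
    and f: "f absolutely_integrable_on {a..b}" "\<And>t. t \<in> {a..b} \<Longrightarrow> f t \<ge> 0"
    and le: "\<And>t. t \<in> {a..b} \<Longrightarrow> norm (g t) \<le> k t * norm (Y t) + f t"
    and x: "x \<in> {a..b}"
  shows "norm (Y x) \<le> (norm (Y a) + integral {a..b} f) * exp (2 * integral {a..b} k)"
proof -
  have cont: "continuous_on {a..b} Y" by (rule primitive_on_Icc_continuous[OF Y])
  have kY: "(\<lambda>t. k t * norm (Y t)) absolutely_integrable_on {a..b}"
  proof -
    have "(\<lambda>t. norm (Y t) * k t) absolutely_integrable_on {a..b}"
      by (rule absolutely_integrable_bounded_measurable_product_real[OF _ _ _ k(1)])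
        (use cont in \<open>auto intro!: continuous_imp_measurable_on_sets_lebesgue compact_imp_bounded compact_continuous_image continuous_intros\<close>)
    then show ?thesis by (simp add: mult.commute)
  qed
  show ?thesis
  proof (rule gronwall[OF _ _ k _ _ x])
    show "continuous_on {a..b} (\<lambda>t. norm (Y t))" using cont by (intro continuous_intros)
    have f0: "0 \<le> integral {a..b} f" using f by (auto intro!: integral_nonneg simp: absolutely_integrable_on_def)
    then show "0 \<le> norm (Y a) + integral {a..b} f" by simp
    fix z assume z: "z \<in> {a..b}"
    have i: "f integrable_on {a..z}" "(\<lambda>t. k t * norm (Y t)) integrable_on {a..z}" "f integrable_on {a..b}"
      using z f absolutely_integrable_on_subinterval[OF f(1), of a z] absolutely_integrable_on_subinterval[OF kY, of a z]
      by (auto simp: absolutely_integrable_on_def)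
    have Yz: "primitive_on {a..z} Y g" using z by (intro primitive_on_subset[OF Y]) auto
    have "norm (Y z - Y a) \<le> integral {a..z} (\<lambda>t. k t * norm (Y t) + f t)"
      by (rule primitive_on_norm_diff[OF Yz]) (use z i le in \<open>auto intro!: Henstock_Kurzweil_Integration.integrable_add\<close>)
    also have "\<dots> = integral {a..z} (\<lambda>t. k t * norm (Y t)) + integral {a..z} f"
      using i by (intro Henstock_Kurzweil_Integration.integral_add)
    also have "integral {a..z} f \<le> integral {a..b} f"
      using z f i by (intro integral_subset_le) auto
    finally show "norm (Y z) \<le> norm (Y a) + integral {a..b} f + integral {a..z} (\<lambda>t. k t * norm (Y t))"
      using norm_triangle_ineq[of "Y z - Y a" "Y a"] by simp
  qed auto
qed

text \<open>Points to the left of \<open>x0\<close> are reached by reflecting the line.\<close>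

lemma primitive_gronwall:
  fixes Y :: "real \<Rightarrow> 'a::euclidean_space"
  assumes Y: "primitive_on {a..b} Y g"
    and k: "k absolutely_integrable_on {a..b}" "\<And>t. t \<in> {a..b} \<Longrightarrow> k t \<ge> 0"
    and f: "f absolutely_integrable_on {a..b}" "\<And>t. t \<in> {a..b} \<Longrightarrow> f t \<ge> 0"
    and le: "\<And>t. t \<in> {a..b} \<Longrightarrow> norm (g t) \<le> k t * norm (Y t) + f t"
    and x: "x \<in> {a..b}" "x0 \<in> {a..b}"
  shows "norm (Y x) \<le> (norm (Y x0) + integral {a..b} f) * exp (2 * integral {a..b} k)"
proof -
  have mono: "integral {c..d} h \<le> integral {a..b} h"
    if "h absolutely_integrable_on {a..b}" "\<And>t. t \<in> {a..b} \<Longrightarrow> h t \<ge> 0" "a \<le> c" "d \<le> b" for h :: "real \<Rightarrow> real" and c d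
  proof -
    have "h absolutely_integrable_on {c..d}" using that by (intro absolutely_integrable_on_subinterval[OF that(1)]) auto
    then show ?thesis using that by (intro integral_subset_le) (auto simp: absolutely_integrable_on_def)
  qed
  have nn: "0 \<le> integral {c..d} f" if "a \<le> c" "d \<le> b" for c d
    using absolutely_integrable_on_subinterval[OF f(1), of c d] that f(2)
    by (auto intro!: integral_nonneg simp: absolutely_integrable_on_def)
  have fin: "(norm (Y x0) + integral {c..d} f) * exp (2 * integral {c..d} k)
      \<le> (norm (Y x0) + integral {a..b} f) * exp (2 * integral {a..b} k)" if "a \<le> c" "d \<le> b" for c d
    using mono[OF f that] mono[OF k that] nn[OF that] by (intro mult_mono) auto
  show ?thesis
  proof (cases "x0 \<le> x")
    case True
    have "norm (Y x) \<le> (norm (Y x0) + integral {x0..b} f) * exp (2 * integral {x0..b} k)"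
      by (rule primitive_gronwall_forward[where g=g])
        (use True x k f le in \<open>auto intro: primitive_on_subset[OF Y] absolutely_integrable_on_subinterval[OF k(1)] absolutely_integrable_on_subinterval[OF f(1)]\<close>)
    also note fin
    finally show ?thesis using x by auto
  next
    case False
    have "primitive_on {a..x0} Y g" using x by (intro primitive_on_subset[OF Y]) auto
    from primitive_on_reflect[OF this]
    have R: "primitive_on {-x0..-a} (\<lambda>x. Y (- x)) (\<lambda>x. - g (- x))" .
    have "norm (Y (- (-x))) \<le> (norm (Y (- (-x0))) + integral {-x0..-a} (\<lambda>t. f (-t))) * exp (2 * integral {-x0..-a} (\<lambda>t. k (- t)))"
      by (rule primitive_gronwall_forward[OF R])
        (use False x k f le in \<open>auto intro: absolutely_integrable_on_subinterval[OF k(1)] absolutely_integrable_on_subinterval[OF f(1)]\<close>)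
    then have "norm (Y x) \<le> (norm (Y x0) + integral {a..x0} f) * exp (2 * integral {a..x0} k)" by simp
    also note fin
    finally show ?thesis using x by auto
  qed
qed

section \<open>Exponential kernels and solutions that are bounded on the line\<close>

section \<open>Exponential dichotomy\<close>

text \<open>Fubini's theorem is applied to the complete measure \<open>lebesgue\<close>, for which
  the coefficients are measurable.\<close>

lemma sigma_finite_lebesgue: "sigma_finite_measure (lebesgue :: real measure)"
proof
  show "\<exists>A. countable A \<and> A \<subseteq> sets lebesgue \<and> \<Union> A = space (lebesgue :: real measure) \<and>
      (\<forall>a\<in>A. emeasure lebesgue a \<noteq> \<infinity>)"
  proof (intro exI conjI)
    show "countable (range (\<lambda>n::nat. {- real n..real n}))" by simp
    show "\<Union> (range (\<lambda>n::nat. {- real n..real n})) = space lebesgue"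
    proof -
      have "\<exists>n::nat. x \<in> {- real n..real n}" for x :: real
      proof -
        obtain n :: nat where "\<bar>x\<bar> \<le> real n" using real_arch_simple by blast
        then have "- real n \<le> x \<and> x \<le> real n" by linarith
        then show ?thesis by auto
      qed
      then show ?thesis by auto
    qed
  qed auto
qed

interpretation lebesgue_pair: pair_sigma_finite "lebesgue :: real measure" "lebesgue :: real measure"
  by (simp add: pair_sigma_finite_def sigma_finite_lebesgue)

lemma measurable_lebesgue_id [measurable]: "(\<lambda>x. x) \<in> borel_measurable lebesgue"
  by (simp add: measurable_completion)

lemma nn_integral_exp_kernel:
  fixes r x :: real
  assumes "r > 0"
  shows "(\<integral>\<^sup>+t. ennreal (exp (- r * \<bar>x - t\<bar>)) \<partial>lebesgue) \<le> ennreal (2 / r)"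
proof -
  have half: "(\<integral>\<^sup>+y. ennreal (exp (- r * y)) * indicator {0..} y \<partial>lebesgue) = ennreal (1 / r)"
  proof -
    have "(\<integral>\<^sup>+y. ennreal (exp (- r * y)) * indicator {0..} y \<partial>lborel) = 0 - (- (1 / r)) * exp (- r * 0)"
    proof (rule nn_integral_FTC_atLeast)
      show "((\<lambda>y. - (1 / r) * exp (- r * y)) \<longlongrightarrow> 0) at_top"
      proof (rule tendsto_mult_right_zero)
        show "((\<lambda>y. exp (- r * y)) \<longlongrightarrow> 0) at_top"
          by (rule filterlim_compose[OF exp_at_bot],
              rule filterlim_tendsto_neg_mult_at_bot[OF tendsto_const _ filterlim_ident])
            (use assms in simp)
      qed
      show "((\<lambda>y. - (1 / r) * exp (- r * y)) has_real_derivative exp (- r * y)) (at y)" for y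
        using assms by (auto intro!: derivative_eq_intros)
    qed auto
    then show ?thesis by (simp add: nn_integral_completion)
  qed
  have "(\<integral>\<^sup>+t. ennreal (exp (- r * \<bar>x - t\<bar>)) \<partial>lebesgue) = (\<integral>\<^sup>+t. ennreal (exp (- r * \<bar>x - (x + 1 * t)\<bar>)) \<partial>lebesgue)"
    by (subst nn_integral_real_affine_lebesgue[where c=1 and t=x]) auto
  \<comment> \<open>The two half-lines share the origin, which is why this is stated as an
    inequality.\<close>
  also have "\<dots> \<le> (\<integral>\<^sup>+y. ennreal (exp (- r * y)) * indicator {0..} y +
      ennreal (exp (- r * (- y))) * indicator {0..} (- y) \<partial>lebesgue)"
    by (intro nn_integral_mono) (auto simp: indicator_def abs_if)
  also have "\<dots> = (\<integral>\<^sup>+y. ennreal (exp (- r * y)) * indicator {0..} y \<partial>lebesgue) +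
      (\<integral>\<^sup>+y. ennreal (exp (- r * (- y))) * indicator {0..} (- y) \<partial>lebesgue)"
    by (rule nn_integral_add) auto
  also have "(\<integral>\<^sup>+y. ennreal (exp (- r * (- y))) * indicator {0..} (- y) \<partial>lebesgue) =
     (\<integral>\<^sup>+y. ennreal (exp (- r * y)) * indicator {0..} y \<partial>lebesgue)"
    using nn_integral_real_affine_lebesgue[of "\<lambda>y. ennreal (exp (- r * y)) * indicator {0..} y" "-1" 0] by simp
  also have "(\<integral>\<^sup>+y. ennreal (exp (- r * y)) * indicator {0..} y \<partial>lebesgue) +
      (\<integral>\<^sup>+y. ennreal (exp (- r * y)) * indicator {0..} y \<partial>lebesgue) = ennreal (2 / r)"
    unfolding half using assms by (subst ennreal_plus[symmetric]) auto
  finally show ?thesis .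
qed

lemma exp_kernel_shift:
  fixes r x s t :: real
  assumes "r \<ge> 0"
  shows "exp (- r * \<bar>s - t\<bar>) \<le> exp (r * \<bar>x - s\<bar>) * exp (- r * \<bar>x - t\<bar>)"
proof -
  have "r * \<bar>x - t\<bar> \<le> r * (\<bar>x - s\<bar> + \<bar>s - t\<bar>)" using assms by (intro mult_left_mono) auto
  then show ?thesis by (simp add: exp_add[symmetric] algebra_simps)
qed

text \<open>\<open>b\<close> is sorted into unit windows: the factor 1 is written as the length of
  \<open>{t-1..t}\<close>, and after the integrals are exchanged the kernel is replaced by its value
  at the start \<open>s\<close> of the window \<open>{s..s+1}\<close>, at the cost of a factor
  \<open>exp r\<close>.\<close>

lemma exp_kernel_uniform_local:
  fixes b :: "real \<Rightarrow> ennreal"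
  assumes [measurable]: "b \<in> borel_measurable lebesgue" and "r > 0"
    and b: "\<And>s. (\<integral>\<^sup>+t. indicator {s..s+1} t * b t \<partial>lebesgue) \<le> D"
  shows "(\<integral>\<^sup>+t. ennreal (exp (- r * \<bar>x - t\<bar>)) * b t \<partial>lebesgue) \<le> ennreal (exp r * (2 / r)) * D"
proof -
  have "(\<integral>\<^sup>+t. ennreal (exp (- r * \<bar>x - t\<bar>)) * b t \<partial>lebesgue)
    = (\<integral>\<^sup>+t. \<integral>\<^sup>+s. indicator {t-1..t} s * (ennreal (exp (- r * \<bar>x - t\<bar>)) * b t) \<partial>lebesgue \<partial>lebesgue)"
  proof (rule nn_integral_cong)
    fix t
    have "(\<integral>\<^sup>+s. indicator {t-1..t} s * (ennreal (exp (- r * \<bar>x - t\<bar>)) * b t) \<partial>lebesgue)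
      = emeasure lebesgue {t-1..t} * (ennreal (exp (- r * \<bar>x - t\<bar>)) * b t)"
      by (subst nn_integral_multc) auto
    then show "ennreal (exp (- r * \<bar>x - t\<bar>)) * b t =
      (\<integral>\<^sup>+s. indicator {t-1..t} s * (ennreal (exp (- r * \<bar>x - t\<bar>)) * b t) \<partial>lebesgue)" by simp
  qed
  also have "\<dots> = (\<integral>\<^sup>+s. \<integral>\<^sup>+t. indicator {t-1..t} s * (ennreal (exp (- r * \<bar>x - t\<bar>)) * b t) \<partial>lebesgue \<partial>lebesgue)"
  proof (rule lebesgue_pair.Fubini')
    have "(\<lambda>(s, t). (if snd (s, t) - 1 \<le> fst (s, t) \<and> fst (s, t) \<le> snd (s, t) then 1 else 0) * (ennreal (exp (- r * \<bar>x - snd (s, t)\<bar>)) * b t))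
      \<in> borel_measurable (lebesgue \<Otimes>\<^sub>M lebesgue)"
      unfolding split_beta' by measurable
    then show "(\<lambda>(s, t). indicator {t-1..t} s * (ennreal (exp (- r * \<bar>x - t\<bar>)) * b t)) \<in> borel_measurable (lebesgue \<Otimes>\<^sub>M lebesgue)"
      by (simp add: indicator_def[abs_def] split_beta' cong: if_cong)
  qed
  also have "\<dots> \<le> (\<integral>\<^sup>+s. ennreal (exp (- r * \<bar>x - s\<bar>)) * (ennreal (exp r) * D) \<partial>lebesgue)"
  proof (rule nn_integral_mono)
    fix s
    have "(\<integral>\<^sup>+t. indicator {t-1..t} s * (ennreal (exp (- r * \<bar>x - t\<bar>)) * b t) \<partial>lebesgue)
      \<le> (\<integral>\<^sup>+t. ennreal (exp (- r * \<bar>x - s\<bar>) * exp r) * (indicator {s..s+1} t * b t) \<partial>lebesgue)"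
    proof (rule nn_integral_mono)
      fix t
      show "indicator {t-1..t} s * (ennreal (exp (- r * \<bar>x - t\<bar>)) * b t)
        \<le> ennreal (exp (- r * \<bar>x - s\<bar>) * exp r) * (indicator {s..s+1} t * b t)"
      proof (cases "t - 1 \<le> s \<and> s \<le> t")
        case True
        have "exp (- r * \<bar>x - t\<bar>) \<le> exp (r * \<bar>s - t\<bar>) * exp (- r * \<bar>x - s\<bar>)"
          using exp_kernel_shift[of r x t s] \<open>r > 0\<close>
          by (simp add: exp_add[symmetric] algebra_simps abs_minus_commute) (smt (verit, best) mult_left_mono distrib_left)
        also have "\<dots> \<le> exp (- r * \<bar>x - s\<bar>) * exp r"
          using True \<open>r > 0\<close> by (simp add: mult.commute mult_left_le)
        finally have "exp (- r * \<bar>x - t\<bar>) \<le> exp (- r * \<bar>x - s\<bar>) * exp r" .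
        then show ?thesis using True by (auto intro!: mult_right_mono ennreal_leI)
      qed (auto simp: indicator_def)
    qed
    also have "\<dots> = ennreal (exp (- r * \<bar>x - s\<bar>) * exp r) * (\<integral>\<^sup>+t. indicator {s..s+1} t * b t \<partial>lebesgue)"
      by (rule nn_integral_cmult) measurable
    also have "\<dots> \<le> ennreal (exp (- r * \<bar>x - s\<bar>)) * (ennreal (exp r) * D)"
      unfolding ennreal_mult'[OF exp_ge_zero] mult.assoc using b by (intro mult_left_mono) auto
    finally show "(\<integral>\<^sup>+t. indicator {t-1..t} s * (ennreal (exp (- r * \<bar>x - t\<bar>)) * b t) \<partial>lebesgue)
      \<le> ennreal (exp (- r * \<bar>x - s\<bar>)) * (ennreal (exp r) * D)" .
  qed
  also have "\<dots> = (\<integral>\<^sup>+s. ennreal (exp (- r * \<bar>x - s\<bar>)) \<partial>lebesgue) * (ennreal (exp r) * D)"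
    by (rule nn_integral_multc) auto
  also have "\<dots> \<le> ennreal (2 / r) * (ennreal (exp r) * D)"
    using nn_integral_exp_kernel[OF \<open>r > 0\<close>] by (intro mult_right_mono) auto
  also have "\<dots> = ennreal (exp r * (2 / r)) * D"
  proof -
    have "ennreal (exp r * (2 / r)) = ennreal (exp r) * ennreal (2 / r)"
      by (rule ennreal_mult) (use \<open>r > 0\<close> in auto)
    then show ?thesis by (simp only: mult_ac)
  qed
  finally show ?thesis .
qed

text \<open>Cauchy--Schwarz after splitting the kernel into two equal factors of rate
  \<open>r / 2\<close>.\<close>

lemma exp_kernel_square:
  fixes f :: "real \<Rightarrow> ennreal"
  assumes [measurable]: "f \<in> borel_measurable lebesgue" and "r > 0"
  shows "(\<integral>\<^sup>+t. ennreal (exp (- r * \<bar>x - t\<bar>)) * f t \<partial>lebesgue)\<^sup>2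
    \<le> ennreal (2 / r) * (\<integral>\<^sup>+t. ennreal (exp (- r * \<bar>x - t\<bar>)) * (f t)\<^sup>2 \<partial>lebesgue)"
proof -
  define h where "h t = ennreal (exp (- (r / 2) * \<bar>x - t\<bar>))" for t
  have h2: "(h t)\<^sup>2 = ennreal (exp (- r * \<bar>x - t\<bar>))" for t
    by (simp add: h_def ennreal_power exp_of_nat_mult[symmetric] algebra_simps)
  have [measurable]: "h \<in> borel_measurable lebesgue" unfolding h_def[abs_def] by measurable
  have "(\<integral>\<^sup>+t. h t * (h t * f t) \<partial>lebesgue)\<^sup>2 \<le> (\<integral>\<^sup>+t. (h t)\<^sup>2 \<partial>lebesgue) * (\<integral>\<^sup>+t. (h t * f t)\<^sup>2 \<partial>lebesgue)"
    by (rule Cauchy_Schwarz_nn_integral) auto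
  also have "\<dots> \<le> ennreal (2 / r) * (\<integral>\<^sup>+t. (h t * f t)\<^sup>2 \<partial>lebesgue)"
    unfolding h2 using nn_integral_exp_kernel[OF \<open>r > 0\<close>] by (intro mult_right_mono) auto
  finally show ?thesis
    unfolding h2[symmetric] power_mult_distrib power2_eq_square mult.assoc
    by (simp add: mult_ac)
qed

lemma exp_kernel_square_le:
  fixes f :: "real \<Rightarrow> ennreal"
  assumes [measurable]: "f \<in> borel_measurable lebesgue" and "r > 0"
  shows "(\<integral>\<^sup>+t. ennreal (exp (- r * \<bar>x - t\<bar>)) * f t \<partial>lebesgue)\<^sup>2
    \<le> ennreal (2 / r) * (\<integral>\<^sup>+t. (f t)\<^sup>2 \<partial>lebesgue)"
proof -
  have "(\<integral>\<^sup>+t. ennreal (exp (- r * \<bar>x - t\<bar>)) * (f t)\<^sup>2 \<partial>lebesgue) \<le> (\<integral>\<^sup>+t. 1 * (f t)\<^sup>2 \<partial>lebesgue)"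
    using \<open>r > 0\<close> by (intro nn_integral_mono mult_right_mono) auto
  then show ?thesis
    using order_trans[OF exp_kernel_square[OF assms] mult_left_mono] by fastforce
qed

text \<open>Schur's test: the kernel has integral at most \<open>2 / r\<close> in either
  variable.\<close>

lemma exp_kernel_schur:
  fixes f :: "real \<Rightarrow> ennreal"
  assumes [measurable]: "f \<in> borel_measurable lebesgue" and "r > 0"
  shows "(\<integral>\<^sup>+x. (\<integral>\<^sup>+t. ennreal (exp (- r * \<bar>x - t\<bar>)) * f t \<partial>lebesgue)\<^sup>2 \<partial>lebesgue)
    \<le> (ennreal (2 / r))\<^sup>2 * (\<integral>\<^sup>+t. (f t)\<^sup>2 \<partial>lebesgue)"
proof -
  have meas: "(\<lambda>(x, t). ennreal (exp (- r * \<bar>x - t\<bar>)) * (f t)\<^sup>2) \<in> borel_measurable (lebesgue \<Otimes>\<^sub>M lebesgue)"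
    unfolding split_beta' by measurable
  have "(\<integral>\<^sup>+x. (\<integral>\<^sup>+t. ennreal (exp (- r * \<bar>x - t\<bar>)) * f t \<partial>lebesgue)\<^sup>2 \<partial>lebesgue)
    \<le> (\<integral>\<^sup>+x. ennreal (2 / r) * (\<integral>\<^sup>+t. ennreal (exp (- r * \<bar>x - t\<bar>)) * (f t)\<^sup>2 \<partial>lebesgue) \<partial>lebesgue)"
    by (intro nn_integral_mono exp_kernel_square assms)
  also have "\<dots> = ennreal (2 / r) * (\<integral>\<^sup>+x. \<integral>\<^sup>+t. ennreal (exp (- r * \<bar>x - t\<bar>)) * (f t)\<^sup>2 \<partial>lebesgue \<partial>lebesgue)"
    using sigma_finite_measure.borel_measurable_nn_integral_fst[OF sigma_finite_lebesgue meas] by (intro nn_integral_cmult) simp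
  also have "(\<integral>\<^sup>+x. \<integral>\<^sup>+t. ennreal (exp (- r * \<bar>x - t\<bar>)) * (f t)\<^sup>2 \<partial>lebesgue \<partial>lebesgue)
     = (\<integral>\<^sup>+t. \<integral>\<^sup>+x. ennreal (exp (- r * \<bar>x - t\<bar>)) * (f t)\<^sup>2 \<partial>lebesgue \<partial>lebesgue)"
    by (rule lebesgue_pair.Fubini'[OF meas, symmetric])
  also have "\<dots> = (\<integral>\<^sup>+t. (\<integral>\<^sup>+x. ennreal (exp (- r * \<bar>t - x\<bar>)) \<partial>lebesgue) * (f t)\<^sup>2 \<partial>lebesgue)"
    by (intro nn_integral_cong) (subst nn_integral_multc, auto simp: abs_minus_commute)
  also have "\<dots> \<le> (\<integral>\<^sup>+t. ennreal (2 / r) * (f t)\<^sup>2 \<partial>lebesgue)"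
    by (intro nn_integral_mono mult_right_mono nn_integral_exp_kernel \<open>r > 0\<close>) auto
  also have "\<dots> = ennreal (2 / r) * (\<integral>\<^sup>+t. (f t)\<^sup>2 \<partial>lebesgue)"
    by (rule nn_integral_cmult) auto
  finally show ?thesis
    by (simp add: power2_eq_square mult.assoc mult_left_mono)
qed

text \<open>The supremum \<open>U\<close> of \<open>n\<close> against the weight \<open>exp (- r * \<bar>x - t\<bar>)\<close> is finite because \<open>n\<close> is bounded, so it
  can be absorbed in \<open>U \<le> E x + U / 2\<close>.\<close>

lemma dichotomy_gronwall:
  fixes n :: "real \<Rightarrow> real" and b E :: "real \<Rightarrow> ennreal"
  assumes [measurable]: "b \<in> borel_measurable lebesgue" "n \<in> borel_measurable lebesgue"
    and n: "\<And>x. 0 \<le> n x" "\<And>x. n x \<le> B" and "r > 0"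
    and b: "\<And>x. (\<integral>\<^sup>+t. ennreal (exp (- r * \<bar>x - t\<bar>)) * b t \<partial>lebesgue) \<le> ennreal (1 / 2)"
    and E: "\<And>x s. E s \<le> ennreal (exp (r * \<bar>x - s\<bar>)) * E x"
    and le: "\<And>s. ennreal (n s) \<le> E s + (\<integral>\<^sup>+t. ennreal (exp (- (2 * r) * \<bar>s - t\<bar>)) * (b t * ennreal (n t)) \<partial>lebesgue)"
  shows "ennreal (n x) \<le> 2 * E x"
proof -
  define U where "U = (SUP t. ennreal (exp (- r * \<bar>x - t\<bar>) * n t))"
  have "B \<ge> 0" using n order_trans by blast
  have "U \<le> ennreal B"
    unfolding U_def
  proof (rule SUP_least, rule ennreal_leI)
    fix t
    have "exp (- r * \<bar>x - t\<bar>) * n t \<le> 1 * B" using n \<open>r > 0\<close> by (intro mult_mono) auto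
    then show "exp (- r * \<bar>x - t\<bar>) * n t \<le> B" by simp
  qed
  then have U_fin: "U < \<infinity>" using order.strict_trans1 by fastforce
  have nU: "ennreal (n t) \<le> ennreal (exp (r * \<bar>x - t\<bar>)) * U" for t
  proof -
    have "ennreal (exp (- r * \<bar>x - t\<bar>) * n t) \<le> U" unfolding U_def by (rule SUP_upper) simp
    then have "ennreal (exp (r * \<bar>x - t\<bar>)) * ennreal (exp (- r * \<bar>x - t\<bar>) * n t) \<le> ennreal (exp (r * \<bar>x - t\<bar>)) * U"
      by (rule mult_left_mono) simp
    also have "ennreal (exp (r * \<bar>x - t\<bar>)) * ennreal (exp (- r * \<bar>x - t\<bar>) * n t) = ennreal (n t)"
      using n(1)[of t] by (simp add: ennreal_mult[symmetric] mult.assoc[symmetric] exp_add[symmetric])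
    finally show ?thesis .
  qed
  have "U \<le> E x + ennreal (1 / 2) * U"
    unfolding U_def
  proof (rule SUP_least)
    fix s
    have "(\<integral>\<^sup>+t. ennreal (exp (- (2 * r) * \<bar>s - t\<bar>)) * (b t * ennreal (n t)) \<partial>lebesgue)
      \<le> (\<integral>\<^sup>+t. (ennreal (exp (r * \<bar>x - s\<bar>)) * U) * (ennreal (exp (- r * \<bar>s - t\<bar>)) * b t) \<partial>lebesgue)"
    proof (rule nn_integral_mono)
      fix t
      \<comment> \<open>Of the rate \<open>2 * r\<close>, one half pays for the weight centred at
        \<open>x\<close>; the other half remains as the kernel acting on \<open>b\<close>.\<close>
      have *: "exp (- (2 * r) * \<bar>s - t\<bar>) * exp (r * \<bar>x - t\<bar>) \<le> exp (r * \<bar>x - s\<bar>) * exp (- r * \<bar>s - t\<bar>)"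
      proof -
        have "r * \<bar>x - t\<bar> \<le> r * (\<bar>x - s\<bar> + \<bar>s - t\<bar>)" using \<open>r > 0\<close> by (intro mult_left_mono) auto
        then show ?thesis by (simp add: exp_add[symmetric] algebra_simps)
      qed
      have "ennreal (exp (- (2 * r) * \<bar>s - t\<bar>)) * (b t * ennreal (n t)) \<le>
          ennreal (exp (- (2 * r) * \<bar>s - t\<bar>)) * (b t * (ennreal (exp (r * \<bar>x - t\<bar>)) * U))"
        using nU by (intro mult_left_mono) auto
      also have "\<dots> = ennreal (exp (- (2 * r) * \<bar>s - t\<bar>) * exp (r * \<bar>x - t\<bar>)) * (b t * U)"
        by (simp add: ennreal_mult mult_ac)
      also have "\<dots> \<le> ennreal (exp (r * \<bar>x - s\<bar>) * exp (- r * \<bar>s - t\<bar>)) * (b t * U)"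
        using * by (intro mult_right_mono ennreal_leI) auto
      also have "\<dots> = (ennreal (exp (r * \<bar>x - s\<bar>)) * U) * (ennreal (exp (- r * \<bar>s - t\<bar>)) * b t)"
        by (simp add: ennreal_mult mult_ac)
      finally show "ennreal (exp (- (2 * r) * \<bar>s - t\<bar>)) * (b t * ennreal (n t)) \<le>
         (ennreal (exp (r * \<bar>x - s\<bar>)) * U) * (ennreal (exp (- r * \<bar>s - t\<bar>)) * b t)" .
    qed
    also have "\<dots> = (ennreal (exp (r * \<bar>x - s\<bar>)) * U) * (\<integral>\<^sup>+t. ennreal (exp (- r * \<bar>s - t\<bar>)) * b t \<partial>lebesgue)"
      by (rule nn_integral_cmult) measurable
    also have "\<dots> \<le> (ennreal (exp (r * \<bar>x - s\<bar>)) * U) * ennreal (1 / 2)"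
      by (intro mult_left_mono b) auto
    finally have I: "(\<integral>\<^sup>+t. ennreal (exp (- (2 * r) * \<bar>s - t\<bar>)) * (b t * ennreal (n t)) \<partial>lebesgue)
       \<le> ennreal (exp (r * \<bar>x - s\<bar>)) * (U * ennreal (1 / 2))" by (simp add: mult.assoc)
    have "ennreal (n s) \<le> ennreal (exp (r * \<bar>x - s\<bar>)) * E x + ennreal (exp (r * \<bar>x - s\<bar>)) * (U * ennreal (1 / 2))"
      using order_trans[OF le add_mono[OF E I]] .
    then have "ennreal (exp (- r * \<bar>x - s\<bar>)) * ennreal (n s) \<le>
       ennreal (exp (- r * \<bar>x - s\<bar>)) * (ennreal (exp (r * \<bar>x - s\<bar>)) * (E x + U * ennreal (1 / 2)))"
      by (intro mult_left_mono) (auto simp: distrib_left)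
    also have "\<dots> = E x + U * ennreal (1 / 2)"
      by (simp add: mult.assoc[symmetric] ennreal_mult[symmetric] exp_add[symmetric])
    finally show "ennreal (exp (- r * \<bar>x - s\<bar>) * n s) \<le> E x + ennreal (1 / 2) * (SUP t. ennreal (exp (- r * \<bar>x - t\<bar>) * n t))"
      using n(1)[of s] by (simp add: ennreal_mult mult.commute U_def)
  qed
  \<comment> \<open>The absorption is done in the reals, where \<open>U / 2\<close> can be
    subtracted; for infinite \<open>E x\<close> there is nothing to show.\<close>
  have U2: "U \<le> 2 * E x"
  proof (cases "E x = \<infinity>")
    case True then show ?thesis by (simp add: ennreal_mult_top)
  next
    case False
    then obtain e where e: "E x = ennreal e" "e \<ge> 0" by (cases "E x") auto
    obtain u where u: "U = ennreal u" "u \<ge> 0" using U_fin by (cases U) auto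
    have "ennreal u \<le> ennreal (e + 1 / 2 * u)"
    proof -
      have "ennreal (1 / 2) * ennreal u = ennreal (1 / 2 * u)" by (rule ennreal_mult[symmetric]) (use u in auto)
      then show ?thesis
        using \<open>U \<le> E x + ennreal (1 / 2) * U\<close> e u by (subst ennreal_plus) auto
    qed
    then have "u \<le> 2 * e" using e u by (subst (asm) ennreal_le_iff) auto
    then have "ennreal u \<le> ennreal (2 * e)" by (rule ennreal_leI)
    then show ?thesis using e u by (simp add: ennreal_mult)
  qed
  have "ennreal (n x) \<le> U" using nU[of x] by simp
  then show ?thesis using U2 by (rule order_trans)
qed

lemma primitive_on_UNIV_continuous:
  assumes "primitive_on UNIV u g"
  shows "continuous_on UNIV u"
proof -
  have "isCont u x" for x
  proof -
    have "continuous_on {x - 1..} u"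
      by (rule primitive_on_continuous[OF primitive_on_subset[OF assms]]) simp
    then show ?thesis by (rule continuous_on_interior) simp
  qed
  then show ?thesis by (simp add: continuous_at_imp_continuous_on)
qed

lemma primitive_on_exp:
  fixes k :: complex
  shows "primitive_on UNIV (\<lambda>x. exp (k * of_real x)) (\<lambda>x. k * exp (k * of_real x))"
  unfolding primitive_on_interval_iff[OF is_interval_univ]
proof (intro ballI impI)
  fix a b :: real
  show "primitive_on {a..b} (\<lambda>x. exp (k * of_real x)) (\<lambda>x. k * exp (k * of_real x))"
    by (rule primitive_on_ftc[of "{}" "{a..b}"])
      (auto intro!: continuous_intros derivative_eq_intros has_vector_derivative_real_field)
qed

section \<open>Scalar equations with forcing and a growing or decaying free solution\<close>

locale exp_kernels =
  fixes \<kappa> :: complex and r :: real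
  assumes r_pos: "r > 0" and Re_kappa: "Re \<kappa> = r"
begin

text \<open>Under this condition the half-line integrals in \<open>right_conv\<close> and
  \<open>left_conv\<close> converge absolutely at every point.\<close>

definition admissible :: "(real \<Rightarrow> complex) \<Rightarrow> bool" where
  "admissible h \<longleftrightarrow> h \<in> borel_measurable lebesgue \<and>
     (\<forall>x. (\<integral>\<^sup>+t. ennreal (exp (- r * \<bar>x - t\<bar>)) * ennreal (cmod (h t)) \<partial>lebesgue) < \<infinity>)"

text \<open>Variation of constants: the solution of \<open>y' = \<kappa> * y - h\<close> that is
  integrated from infinity, written as a product so that \<open>primitive_on_mult\<close> yields its
  density. \<open>left_conv\<close> is the mirror image for
  \<open>y' = - \<kappa> * y + h\<close>.\<close>

definition right_conv :: "(real \<Rightarrow> complex) \<Rightarrow> real \<Rightarrow> complex" where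
  "right_conv h x = exp (\<kappa> * of_real x) * (LINT t:{x..}|lebesgue. exp (- \<kappa> * of_real t) * h t)"

definition left_conv :: "(real \<Rightarrow> complex) \<Rightarrow> real \<Rightarrow> complex" where
  "left_conv h x = exp (- \<kappa> * of_real x) * (LINT t:{..x}|lebesgue. exp (\<kappa> * of_real t) * h t)"

lemma norm_exp_kappa: "cmod (exp (\<kappa> * of_real t)) = exp (r * t)" "cmod (exp (- \<kappa> * of_real t)) = exp (- r * t)"
  by (simp_all add: Re_kappa)

lemma borel_measurable_exp_mult_of_real [measurable]: "(\<lambda>t. exp (k * complex_of_real t)) \<in> borel_measurable lebesgue"
  by (intro measurable_completion borel_measurable_continuous_onI) (auto intro!: continuous_intros)

lemma admissible_right:
  assumes "admissible h"
  shows "set_integrable lebesgue {x..} (\<lambda>t. exp (- \<kappa> * of_real t) * h t)"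
    "ennreal (cmod (right_conv h x)) \<le> (\<integral>\<^sup>+t. indicator {x..} t * (ennreal (exp (- r * \<bar>x - t\<bar>)) * ennreal (cmod (h t))) \<partial>lebesgue)"
proof -
  have [measurable]: "h \<in> borel_measurable lebesgue" using assms by (simp add: admissible_def)
  define w where "w t = indicator {x..} t *\<^sub>R (exp (- \<kappa> * of_real t) * h t)" for t
  \<comment> \<open>For \<open>t \<ge> x\<close> the weight \<open>exp (- r * t)\<close> splits into
    the kernel and \<open>exp (- r * x)\<close>; the latter cancels against the prefactor of
    \<open>right_conv\<close>.\<close>
  have w: "ennreal (cmod (w t)) = ennreal (exp (- r * x)) * (indicator {x..} t * (ennreal (exp (- r * \<bar>x - t\<bar>)) * ennreal (cmod (h t))))" for t
  proof (cases "x \<le> t")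
    case True
    then have "exp (- r * t) = exp (- r * x) * exp (- r * \<bar>x - t\<bar>)"
      by (simp add: exp_add[symmetric] algebra_simps)
    then show ?thesis
      using True unfolding w_def norm_scaleR norm_mult norm_exp_kappa
      by (simp add: ennreal_mult mult.assoc)
  qed (simp add: w_def)
  have wi: "(\<integral>\<^sup>+t. ennreal (cmod (w t)) \<partial>lebesgue) =
      ennreal (exp (- r * x)) * (\<integral>\<^sup>+t. indicator {x..} t * (ennreal (exp (- r * \<bar>x - t\<bar>)) * ennreal (cmod (h t))) \<partial>lebesgue)"
    unfolding w by (rule nn_integral_cmult) measurable
  have "(\<integral>\<^sup>+t. indicator {x..} t * (ennreal (exp (- r * \<bar>x - t\<bar>)) * ennreal (cmod (h t))) \<partial>lebesgue)
    \<le> (\<integral>\<^sup>+t. ennreal (exp (- r * \<bar>x - t\<bar>)) * ennreal (cmod (h t)) \<partial>lebesgue)"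
    by (intro nn_integral_mono) (auto simp: indicator_def)
  also have "\<dots> < \<infinity>" using assms by (simp add: admissible_def)
  finally have fin: "(\<integral>\<^sup>+t. ennreal (cmod (w t)) \<partial>lebesgue) < \<infinity>"
    unfolding wi by (simp add: ennreal_mult_less_top)
  have [measurable]: "w \<in> borel_measurable lebesgue" unfolding w_def[abs_def] by measurable
  have wint: "integrable lebesgue w" using fin by (intro integrableI_bounded) auto
  then show "set_integrable lebesgue {x..} (\<lambda>t. exp (- \<kappa> * of_real t) * h t)"
    by (simp add: set_integrable_def w_def[abs_def])
  have "ennreal (cmod (right_conv h x)) = ennreal (exp (r * x)) * ennreal (cmod (integral\<^sup>L lebesgue w))"
    unfolding right_conv_def norm_mult norm_exp_kappa
    by (simp add: ennreal_mult set_lebesgue_integral_def w_def[abs_def])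
  also have "\<dots> \<le> ennreal (exp (r * x)) * (\<integral>\<^sup>+t. ennreal (cmod (w t)) \<partial>lebesgue)"
    by (intro mult_left_mono integral_norm_bound_ennreal wint) auto
  also have "\<dots> = (\<integral>\<^sup>+t. indicator {x..} t * (ennreal (exp (- r * \<bar>x - t\<bar>)) * ennreal (cmod (h t))) \<partial>lebesgue)"
    unfolding wi by (simp add: mult.assoc[symmetric] ennreal_mult[symmetric] exp_add[symmetric])
  finally show "ennreal (cmod (right_conv h x)) \<le> (\<integral>\<^sup>+t. indicator {x..} t * (ennreal (exp (- r * \<bar>x - t\<bar>)) * ennreal (cmod (h t))) \<partial>lebesgue)" .
qed

lemma admissible_left:
  assumes "admissible h"
  shows "set_integrable lebesgue {..x} (\<lambda>t. exp (\<kappa> * of_real t) * h t)"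
    "ennreal (cmod (left_conv h x)) \<le> (\<integral>\<^sup>+t. indicator {..x} t * (ennreal (exp (- r * \<bar>x - t\<bar>)) * ennreal (cmod (h t))) \<partial>lebesgue)"
proof -
  have [measurable]: "h \<in> borel_measurable lebesgue" using assms by (simp add: admissible_def)
  define w where "w t = indicator {..x} t *\<^sub>R (exp (\<kappa> * of_real t) * h t)" for t
  have w: "ennreal (cmod (w t)) = ennreal (exp (r * x)) * (indicator {..x} t * (ennreal (exp (- r * \<bar>x - t\<bar>)) * ennreal (cmod (h t))))" for t
  proof (cases "t \<le> x")
    case True
    then have "exp (r * t) = exp (r * x) * exp (- r * \<bar>x - t\<bar>)"
      by (simp add: exp_add[symmetric] algebra_simps)
    then show ?thesis
      using True unfolding w_def norm_scaleR norm_mult norm_exp_kappa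
      by (simp add: ennreal_mult mult.assoc)
  qed (simp add: w_def)
  have wi: "(\<integral>\<^sup>+t. ennreal (cmod (w t)) \<partial>lebesgue) =
      ennreal (exp (r * x)) * (\<integral>\<^sup>+t. indicator {..x} t * (ennreal (exp (- r * \<bar>x - t\<bar>)) * ennreal (cmod (h t))) \<partial>lebesgue)"
    unfolding w by (rule nn_integral_cmult) measurable
  have "(\<integral>\<^sup>+t. indicator {..x} t * (ennreal (exp (- r * \<bar>x - t\<bar>)) * ennreal (cmod (h t))) \<partial>lebesgue)
    \<le> (\<integral>\<^sup>+t. ennreal (exp (- r * \<bar>x - t\<bar>)) * ennreal (cmod (h t)) \<partial>lebesgue)"
    by (intro nn_integral_mono) (auto simp: indicator_def)
  also have "\<dots> < \<infinity>" using assms by (simp add: admissible_def)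
  finally have fin: "(\<integral>\<^sup>+t. ennreal (cmod (w t)) \<partial>lebesgue) < \<infinity>"
    unfolding wi by (simp add: ennreal_mult_less_top)
  have [measurable]: "w \<in> borel_measurable lebesgue" unfolding w_def[abs_def] by measurable
  have wint: "integrable lebesgue w" using fin by (intro integrableI_bounded) auto
  then show "set_integrable lebesgue {..x} (\<lambda>t. exp (\<kappa> * of_real t) * h t)"
    by (simp add: set_integrable_def w_def[abs_def])
  have "ennreal (cmod (left_conv h x)) = ennreal (exp (- r * x)) * ennreal (cmod (integral\<^sup>L lebesgue w))"
    unfolding left_conv_def norm_mult norm_exp_kappa
    by (simp add: ennreal_mult set_lebesgue_integral_def w_def[abs_def])
  also have "\<dots> \<le> ennreal (exp (- r * x)) * (\<integral>\<^sup>+t. ennreal (cmod (w t)) \<partial>lebesgue)"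
    by (intro mult_left_mono integral_norm_bound_ennreal wint) auto
  also have "\<dots> = (\<integral>\<^sup>+t. indicator {..x} t * (ennreal (exp (- r * \<bar>x - t\<bar>)) * ennreal (cmod (h t))) \<partial>lebesgue)"
    unfolding wi by (simp add: mult.assoc[symmetric] ennreal_mult[symmetric] exp_add[symmetric])
  finally show "ennreal (cmod (left_conv h x)) \<le> (\<integral>\<^sup>+t. indicator {..x} t * (ennreal (exp (- r * \<bar>x - t\<bar>)) * ennreal (cmod (h t))) \<partial>lebesgue)" .
qed

text \<open>Cutting \<open>{a..}\<close> at \<open>b\<close> shows that the half-line integral is a
  primitive; the prefactor enters by the product rule.\<close>

lemma right_conv_primitive:
  assumes "admissible h"
  shows "primitive_on UNIV (right_conv h) (\<lambda>x. \<kappa> * right_conv h x - h x)"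
proof -
  define w where "w t = exp (- \<kappa> * of_real t) * h t" for t
  note wint = admissible_right(1)[OF assms, folded w_def]
  have J: "primitive_on UNIV (\<lambda>x. LINT t:{x..}|lebesgue. w t) (\<lambda>x. - w x)"
    unfolding primitive_on_def
  proof (intro ballI impI conjI)
    fix a b :: real assume ab: "a \<le> b"
    have i: "set_integrable lebesgue {a..b} w"
      by (rule set_integrable_subset[OF wint[of a]]) auto
    then show "set_integrable lebesgue {a..b} (\<lambda>x. - w x)"
      using absolutely_integrable_linear[OF i bounded_linear_minus[OF bounded_linear_ident]] by (simp add: o_def)
    have "(LINT t:{a..b} \<union> {b..}|lebesgue. w t) = (LINT t:{a..b}|lebesgue. w t) + (LINT t:{b..}|lebesgue. w t)"
    proof (rule set_integral_Un_AE)
      have "AE x in lebesgue. x \<notin> {b}" by (rule AE_not_in) simp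
      then show "AE x in lebesgue. \<not> (x \<in> {a..b} \<and> x \<in> {b..})" by eventually_elim auto
    qed (use i wint in auto)
    moreover have "{a..b} \<union> {b..} = {a..}" using ab by auto
    moreover have "(LINT t:{a..b}|lebesgue. w t) = integral {a..b} w"
      by (rule set_lebesgue_integral_eq_integral(2)[OF i])
    ultimately show "(LINT t:{b..}|lebesgue. w t) - (LINT t:{a..}|lebesgue. w t) = integral {a..b} (\<lambda>x. - w x)"
      by simp
  qed
  have "primitive_on UNIV (\<lambda>x. exp (\<kappa> * of_real x) * (LINT t:{x..}|lebesgue. w t))
      (\<lambda>x. \<kappa> * exp (\<kappa> * of_real x) * (LINT t:{x..}|lebesgue. w t) + exp (\<kappa> * of_real x) * (- w x))"
    by (rule primitive_on_mult[OF is_interval_univ primitive_on_exp J])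
  moreover have "\<kappa> * exp (\<kappa> * of_real x) * (LINT t:{x..}|lebesgue. w t) + exp (\<kappa> * of_real x) * (- w x)
     = \<kappa> * right_conv h x - h x" for x
    by (simp add: right_conv_def w_def mult.assoc[symmetric] exp_add[symmetric])
  moreover have "(\<lambda>x. exp (\<kappa> * of_real x) * (LINT t:{x..}|lebesgue. w t)) = right_conv h"
    by (simp add: right_conv_def[abs_def] w_def)
  ultimately show ?thesis by simp
qed

lemma left_conv_primitive:
  assumes "admissible h"
  shows "primitive_on UNIV (left_conv h) (\<lambda>x. - \<kappa> * left_conv h x + h x)"
proof -
  define w where "w t = exp (\<kappa> * of_real t) * h t" for t
  note wint = admissible_left(1)[OF assms, folded w_def]
  have J: "primitive_on UNIV (\<lambda>x. LINT t:{..x}|lebesgue. w t) w"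
    unfolding primitive_on_def
  proof (intro ballI impI conjI)
    fix a b :: real assume ab: "a \<le> b"
    show i: "set_integrable lebesgue {a..b} w"
      by (rule set_integrable_subset[OF wint[of b]]) auto
    have "(LINT t:{..a} \<union> {a..b}|lebesgue. w t) = (LINT t:{..a}|lebesgue. w t) + (LINT t:{a..b}|lebesgue. w t)"
    proof (rule set_integral_Un_AE)
      have "AE x in lebesgue. x \<notin> {a}" by (rule AE_not_in) simp
      then show "AE x in lebesgue. \<not> (x \<in> {..a} \<and> x \<in> {a..b})" by eventually_elim auto
    qed (use i wint in auto)
    moreover have "{..a} \<union> {a..b} = {..b}" using ab by auto
    moreover have "(LINT t:{a..b}|lebesgue. w t) = integral {a..b} w"
      by (rule set_lebesgue_integral_eq_integral(2)[OF i])
    ultimately show "(LINT t:{..b}|lebesgue. w t) - (LINT t:{..a}|lebesgue. w t) = integral {a..b} w"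
      by simp
  qed
  have "primitive_on UNIV (\<lambda>x. exp (- \<kappa> * of_real x) * (LINT t:{..x}|lebesgue. w t))
      (\<lambda>x. - \<kappa> * exp (- \<kappa> * of_real x) * (LINT t:{..x}|lebesgue. w t) + exp (- \<kappa> * of_real x) * w x)"
    by (rule primitive_on_mult[OF is_interval_univ primitive_on_exp J])
  moreover have "- \<kappa> * exp (- \<kappa> * of_real x) * (LINT t:{..x}|lebesgue. w t) + exp (- \<kappa> * of_real x) * w x
     = - \<kappa> * left_conv h x + h x" for x
    by (simp add: left_conv_def w_def mult.assoc[symmetric] exp_add[symmetric])
  moreover have "(\<lambda>x. exp (- \<kappa> * of_real x) * (LINT t:{..x}|lebesgue. w t)) = left_conv h"
    by (simp add: left_conv_def[abs_def] w_def)
  ultimately show ?thesis by simp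
qed

text \<open>The two convolutions use the kernel on half-lines that meet in a null set only, so
  together they cost one integral over the line.\<close>

lemma conv_bound:
  assumes "admissible h1" "admissible h2" "K \<in> borel_measurable lebesgue"
    and "\<And>t. ennreal (cmod (h1 t)) \<le> K t" "\<And>t. ennreal (cmod (h2 t)) \<le> K t"
  shows "ennreal (cmod (right_conv h1 x) + cmod (left_conv h2 x))
    \<le> (\<integral>\<^sup>+t. ennreal (exp (- r * \<bar>x - t\<bar>)) * K t \<partial>lebesgue)"
proof -
  note [measurable] = assms(3)
  have "ennreal (cmod (right_conv h1 x) + cmod (left_conv h2 x))
    \<le> (\<integral>\<^sup>+t. indicator {x..} t * (ennreal (exp (- r * \<bar>x - t\<bar>)) * ennreal (cmod (h1 t))) \<partial>lebesgue) +
      (\<integral>\<^sup>+t. indicator {..x} t * (ennreal (exp (- r * \<bar>x - t\<bar>)) * ennreal (cmod (h2 t))) \<partial>lebesgue)"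
    using admissible_right(2)[OF assms(1)] admissible_left(2)[OF assms(2)] by (simp add: add_mono)
  also have "\<dots> \<le> (\<integral>\<^sup>+t. indicator {x..} t * (ennreal (exp (- r * \<bar>x - t\<bar>)) * K t) \<partial>lebesgue) +
      (\<integral>\<^sup>+t. indicator {..x} t * (ennreal (exp (- r * \<bar>x - t\<bar>)) * K t) \<partial>lebesgue)"
    using assms(4,5) by (intro add_mono nn_integral_mono mult_left_mono) auto
  also have "\<dots> = (\<integral>\<^sup>+t. indicator {x..} t * (ennreal (exp (- r * \<bar>x - t\<bar>)) * K t) +
      indicator {..x} t * (ennreal (exp (- r * \<bar>x - t\<bar>)) * K t) \<partial>lebesgue)"
    by (rule nn_integral_add[symmetric]) measurable
  also have "\<dots> \<le> (\<integral>\<^sup>+t. ennreal (exp (- r * \<bar>x - t\<bar>)) * K t \<partial>lebesgue)"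
  proof (rule nn_integral_mono_AE)
    have "AE t in lebesgue. t \<notin> {x}" by (rule AE_not_in) simp
    then show "AE t in lebesgue. indicator {x..} t * (ennreal (exp (- r * \<bar>x - t\<bar>)) * K t) +
      indicator {..x} t * (ennreal (exp (- r * \<bar>x - t\<bar>)) * K t) \<le> ennreal (exp (- r * \<bar>x - t\<bar>)) * K t"
      by eventually_elim (auto simp: indicator_def)
  qed
  finally show ?thesis .
qed

lemma admissibleI:
  assumes "h \<in> borel_measurable lebesgue" "\<And>t. ennreal (cmod (h t)) \<le> K t"
    "\<And>x. (\<integral>\<^sup>+t. ennreal (exp (- r * \<bar>x - t\<bar>)) * K t \<partial>lebesgue) < \<infinity>"
  shows "admissible h"
  unfolding admissible_def
proof (intro conjI allI)
  fix x
  have "(\<integral>\<^sup>+t. ennreal (exp (- r * \<bar>x - t\<bar>)) * ennreal (cmod (h t)) \<partial>lebesgue) \<le>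
     (\<integral>\<^sup>+t. ennreal (exp (- r * \<bar>x - t\<bar>)) * K t \<partial>lebesgue)"
    using assms(2) by (intro nn_integral_mono mult_left_mono) auto
  then show "(\<integral>\<^sup>+t. ennreal (exp (- r * \<bar>x - t\<bar>)) * ennreal (cmod (h t)) \<partial>lebesgue) < \<infinity>"
    using assms(3) by (rule order.strict_trans1)
qed (rule assms)

lemma conv_diff:
  assumes "admissible h" "admissible h'"
  shows "right_conv h x - right_conv h' x = right_conv (\<lambda>t. h t - h' t) x"
    "left_conv h x - left_conv h' x = left_conv (\<lambda>t. h t - h' t) x"
  using set_integral_diff(2)[OF admissible_right(1)[OF assms(1), of x] admissible_right(1)[OF assms(2), of x]]
    set_integral_diff(2)[OF admissible_left(1)[OF assms(1), of x] admissible_left(1)[OF assms(2), of x]]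
  by (simp_all only: right_conv_def left_conv_def right_diff_distrib)

end

text \<open>The variables \<open>p = y2 + \<kappa> * y1\<close> and \<open>m = y2 - \<kappa> * y1\<close> diagonalise the unperturbed system to \<open>p' = \<kappa> * p\<close>,
  \<open>m' = - \<kappa> * m\<close>. The perturbed equation is solved by integrating \<open>p\<close> from infinity and \<open>m\<close> from \<open>N\<close>.\<close>

lemma dichotomy_solution:
  fixes \<kappa> c :: complex and s q :: "real \<Rightarrow> real" and f :: "real \<Rightarrow> complex"
  assumes mu: "\<mu> > 0" "Re \<kappa> = 2 * \<mu>"
    and meas [measurable]: "s \<in> borel_measurable lebesgue" "q \<in> borel_measurable lebesgue" "f \<in> borel_measurable lebesgue"
    and small: "\<And>x. (\<integral>\<^sup>+t. ennreal (exp (- \<mu> * \<bar>x - t\<bar>)) * ennreal (\<bar>s t\<bar> + \<bar>q t\<bar> / cmod \<kappa>) \<partial>lebesgue) \<le> ennreal (1 / 4)"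
    and f: "\<And>x. (\<integral>\<^sup>+t. ennreal (exp (- \<mu> * \<bar>x - t\<bar>)) * ennreal (cmod (f t)) \<partial>lebesgue) \<le> ennreal B"
    and zero: "\<And>t. t < N \<Longrightarrow> s t = 0 \<and> q t = 0"
  obtains y1 y2 :: "real \<Rightarrow> complex" where
    "primitive_on {N..} y1 (\<lambda>x. s x * y1 x + y2 x)"
    "primitive_on {N..} y2 (\<lambda>x. - complex_of_real (s x) * y2 x + (q x + \<kappa>\<^sup>2) * y1 x - f x)"
    "\<And>x. ennreal (cmod (y2 x + \<kappa> * y1 x) + cmod (y2 x - \<kappa> * y1 x)) \<le>
       2 * (ennreal (cmod c * exp (- \<mu> * max (x - N) 0)) +
        (\<integral>\<^sup>+t. ennreal (exp (- \<mu> * \<bar>x - t\<bar>)) * ennreal (cmod (f t)) \<partial>lebesgue))"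
    "(\<And>t. t < N \<Longrightarrow> f t = 0) \<Longrightarrow> y2 N - \<kappa> * y1 N = c"
proof -
  interpret exp_kernels \<kappa> "2 * \<mu>" using mu by unfold_locales auto
  have kappa0: "\<kappa> \<noteq> 0" using mu by auto
  \<comment> \<open>The sign of \<open>B\<close> is not prescribed, and the bounds below are added
    as nonnegative reals.\<close>
  define B' where "B' = \<bar>B\<bar>"
  have f': "(\<integral>\<^sup>+t. ennreal (exp (- \<mu> * \<bar>x - t\<bar>)) * ennreal (cmod (f t)) \<partial>lebesgue) \<le> ennreal B'" for x
    using f[of x] by (rule order_trans) (auto simp: B'_def intro: ennreal_leI)
  define b where "b t = \<bar>s t\<bar> + \<bar>q t\<bar> / cmod \<kappa>" for t
  have b0: "b t \<ge> 0" for t by (simp add: b_def)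
  have [measurable]: "b \<in> borel_measurable lebesgue" unfolding b_def[abs_def] by measurable
  \<comment> \<open>Since \<open>y1 = (p - m) / (2 * \<kappa>)\<close>, the potential contributes
    \<open>q * (p - m) / (2 * \<kappa>)\<close> to both equations. The terms \<open>s * y1\<close>
    and \<open>- s * y2\<close> combine to \<open>- s * m\<close> in the equation for
    \<open>p\<close> and to \<open>- s * p\<close> in that for \<open>m\<close>, so \<open>s\<close>
    couples each component to the other.\<close>
  define h1 where "h1 y t = q t * (fst (y t) - snd (y t)) / (2 * \<kappa>) - f t - s t * snd (y t)" for y :: "real \<Rightarrow> complex \<times> complex" and t
  define h2 where "h2 y t = q t * (fst (y t) - snd (y t)) / (2 * \<kappa>) - f t - s t * fst (y t)" for y :: "real \<Rightarrow> complex \<times> complex" and t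
  define n where "n y t = cmod (fst (y t)) + cmod (snd (y t))" for y :: "real \<Rightarrow> complex \<times> complex" and t
  have qpart: "cmod (q t * (p - m) / (2 * \<kappa>)) \<le> \<bar>q t\<bar> / cmod \<kappa> * (cmod p + cmod m)" for t and p m :: complex
  proof -
    have "cmod (q t * (p - m) / (2 * \<kappa>)) = \<bar>q t\<bar> / cmod \<kappa> * (cmod (p - m) / 2)"
      by (simp add: norm_mult norm_divide)
    also have "\<dots> \<le> \<bar>q t\<bar> / cmod \<kappa> * (cmod p + cmod m)"
      using norm_triangle_ineq4[of p m] norm_ge_zero[of p] norm_ge_zero[of m]
      by (intro mult_left_mono) (linarith, simp)
    finally show ?thesis .
  qed
  have spart: "cmod (s t * p) \<le> \<bar>s t\<bar> * (cmod p + cmod m)" "cmod (s t * m) \<le> \<bar>s t\<bar> * (cmod p + cmod m)" for t and p m :: complex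
    by (auto simp: norm_mult intro!: mult_left_mono)
  have hb: "cmod (h1 y t) \<le> cmod (f t) + b t * n y t" "cmod (h2 y t) \<le> cmod (f t) + b t * n y t" for y t
  proof -
    have *: "cmod (a - g - d) \<le> cmod g + (cmod a + cmod d)" for a g d :: complex
      using norm_triangle_ineq4[of "a - g" d] norm_triangle_ineq4[of a g] by linarith
    have "cmod (h1 y t) \<le> cmod (f t) + (cmod (q t * (fst (y t) - snd (y t)) / (2 * \<kappa>)) + cmod (s t * snd (y t)))"
      "cmod (h2 y t) \<le> cmod (f t) + (cmod (q t * (fst (y t) - snd (y t)) / (2 * \<kappa>)) + cmod (s t * fst (y t)))"
      unfolding h1_def h2_def by (rule *)+
    then show "cmod (h1 y t) \<le> cmod (f t) + b t * n y t" "cmod (h2 y t) \<le> cmod (f t) + b t * n y t"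
      using qpart[where t=t and p="fst (y t)" and m="snd (y t)"] spart[where t=t and p="fst (y t)" and m="snd (y t)"]
      unfolding n_def b_def distrib_right by linarith+
  qed
  have hd: "cmod (h1 y t - h1 y' t) \<le> b t * n (\<lambda>t. y t - y' t) t" "cmod (h2 y t - h2 y' t) \<le> b t * n (\<lambda>t. y t - y' t) t" for y y' t
  proof -
    have e1: "h1 y t - h1 y' t = q t * (fst (y t - y' t) - snd (y t - y' t)) / (2 * \<kappa>) - s t * snd (y t - y' t)"
      and e2: "h2 y t - h2 y' t = q t * (fst (y t - y' t) - snd (y t - y' t)) / (2 * \<kappa>) - s t * fst (y t - y' t)"
      using kappa0 by (simp_all add: h1_def h2_def field_simps)
    have "cmod (h1 y t - h1 y' t) \<le> cmod (q t * (fst (y t - y' t) - snd (y t - y' t)) / (2 * \<kappa>)) + cmod (s t * snd (y t - y' t))"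
      "cmod (h2 y t - h2 y' t) \<le> cmod (q t * (fst (y t - y' t) - snd (y t - y' t)) / (2 * \<kappa>)) + cmod (s t * fst (y t - y' t))"
      unfolding e1 e2 by (rule norm_triangle_ineq4)+
    then show "cmod (h1 y t - h1 y' t) \<le> b t * n (\<lambda>t. y t - y' t) t" "cmod (h2 y t - h2 y' t) \<le> b t * n (\<lambda>t. y t - y' t) t"
      using qpart[where t=t and p="fst (y t - y' t)" and m="snd (y t - y' t)"] spart[where t=t and p="fst (y t - y' t)" and m="snd (y t - y' t)"]
      unfolding n_def b_def distrib_right by linarith+
  qed
  \<comment> \<open>The kernels in \<open>T\<close> have rate \<open>2 * \<mu>\<close>, the
    hypotheses the slower rate \<mu>; the difference is the room that
    \<open>dichotomy_gronwall\<close> uses.\<close>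
  have kernel_le: "(\<integral>\<^sup>+t. ennreal (exp (- (2 * \<mu>) * \<bar>x - t\<bar>)) * g t \<partial>lebesgue)
      \<le> (\<integral>\<^sup>+t. ennreal (exp (- \<mu> * \<bar>x - t\<bar>)) * g t \<partial>lebesgue)" for x g
    using mu by (intro nn_integral_mono mult_right_mono ennreal_leI) auto
  have small': "(\<integral>\<^sup>+t. ennreal (exp (- (2 * \<mu>) * \<bar>x - t\<bar>)) * ennreal (b t * M) \<partial>lebesgue) \<le> ennreal (M / 4)"
    if "M \<ge> 0" for x M
  proof -
    have "(\<integral>\<^sup>+t. ennreal (exp (- (2 * \<mu>) * \<bar>x - t\<bar>)) * ennreal (b t * M) \<partial>lebesgue)
      \<le> (\<integral>\<^sup>+t. ennreal (exp (- \<mu> * \<bar>x - t\<bar>)) * ennreal (b t * M) \<partial>lebesgue)" by (rule kernel_le)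
    also have "\<dots> = (\<integral>\<^sup>+t. (ennreal (exp (- \<mu> * \<bar>x - t\<bar>)) * ennreal (b t)) * ennreal M \<partial>lebesgue)"
      using b0 that by (simp add: ennreal_mult mult.assoc)
    also have "\<dots> = (\<integral>\<^sup>+t. ennreal (exp (- \<mu> * \<bar>x - t\<bar>)) * ennreal (b t) \<partial>lebesgue) * ennreal M"
      by (rule nn_integral_multc) measurable
    also have "\<dots> \<le> ennreal (1 / 4) * ennreal M"
      using small[of x] by (intro mult_right_mono) (auto simp: b_def)
    also have "\<dots> = ennreal (M / 4)" using that by (subst ennreal_mult[symmetric]) auto
    finally show ?thesis .
  qed
  have small_f: "(\<integral>\<^sup>+t. ennreal (exp (- (2 * \<mu>) * \<bar>x - t\<bar>)) * (ennreal (cmod (f t)) + ennreal (b t * M)) \<partial>lebesgue) \<le> ennreal (B' + M / 4)"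
    if "M \<ge> 0" for x M
  proof -
    have "(\<integral>\<^sup>+t. ennreal (exp (- (2 * \<mu>) * \<bar>x - t\<bar>)) * (ennreal (cmod (f t)) + ennreal (b t * M)) \<partial>lebesgue)
      = (\<integral>\<^sup>+t. ennreal (exp (- (2 * \<mu>) * \<bar>x - t\<bar>)) * ennreal (cmod (f t)) \<partial>lebesgue)
      + (\<integral>\<^sup>+t. ennreal (exp (- (2 * \<mu>) * \<bar>x - t\<bar>)) * ennreal (b t * M) \<partial>lebesgue)"
      unfolding distrib_left by (rule nn_integral_add) measurable
    also have "\<dots> \<le> ennreal B' + ennreal (M / 4)"
      by (intro add_mono small' that order_trans[OF kernel_le f'])
    also have "\<dots> = ennreal (B' + M / 4)" using that by (simp add: B'_def)
    finally show ?thesis .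
  qed
  have y_meas: "(\<lambda>t. fst (y t)) \<in> borel_measurable lebesgue" "(\<lambda>t. snd (y t)) \<in> borel_measurable lebesgue"
    if "continuous_on UNIV y" for y :: "real \<Rightarrow> complex \<times> complex"
    using that by (auto intro!: measurable_completion borel_measurable_continuous_onI continuous_intros)
  have h_meas: "h1 y \<in> borel_measurable lebesgue" "h2 y \<in> borel_measurable lebesgue" if "continuous_on UNIV y" for y
  proof -
    note [measurable] = y_meas[OF that]
    show "h1 y \<in> borel_measurable lebesgue" "h2 y \<in> borel_measurable lebesgue"
      unfolding h1_def[abs_def] h2_def[abs_def] by measurable
  qed
  have hK: "ennreal (cmod (h1 y t)) \<le> ennreal (cmod (f t)) + ennreal (b t * M)" "ennreal (cmod (h2 y t)) \<le> ennreal (cmod (f t)) + ennreal (b t * M)"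
    if "\<And>t. n y t \<le> M" for y M t
  proof -
    have "b t * n y t \<le> b t * M" "0 \<le> b t * n y t" using that b0 by (auto intro!: mult_left_mono mult_nonneg_nonneg simp: n_def)
    note bM = this
    then have e: "ennreal (cmod (f t)) + ennreal (b t * M) = ennreal (cmod (f t) + b t * M)"
      by (intro ennreal_plus[symmetric]) auto
    show "ennreal (cmod (h1 y t)) \<le> ennreal (cmod (f t)) + ennreal (b t * M)" "ennreal (cmod (h2 y t)) \<le> ennreal (cmod (f t)) + ennreal (b t * M)"
      unfolding e using hb[of y t] bM by (intro ennreal_leI; linarith)+
  qed
  have n_le: "n y t \<le> 2 * M" if "\<And>t. norm (y t) \<le> M" for y t M
    using norm_fst_le[of "fst (y t)" "snd (y t)"] norm_snd_le[of "snd (y t)" "fst (y t)"] that[of t] by (simp add: n_def)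
  have bounded_n: "\<exists>M\<ge>0. \<forall>t. n y t \<le> M" if y: "bounded (range y)" for y
  proof -
    obtain M where M: "\<And>t. norm (y t) \<le> M" using y by (auto simp: bounded_iff)
    then have "0 \<le> M" using norm_ge_zero order_trans by blast
    then show ?thesis using n_le[OF M] by (intro exI[of _ "2 * M"]) auto
  qed
  have adm: "admissible (h1 y)" "admissible (h2 y)" if y: "continuous_on UNIV y" "bounded (range y)" for y
  proof -
    obtain M where M: "M \<ge> 0" "\<And>t. n y t \<le> M" using bounded_n[OF y(2)] by blast
    have fin: "(\<integral>\<^sup>+t. ennreal (exp (- (2 * \<mu>) * \<bar>x - t\<bar>)) * (ennreal (cmod (f t)) + ennreal (b t * M)) \<partial>lebesgue) < \<infinity>" for x
      using small_f[OF M(1), of x] by (rule order.strict_trans1) simp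
    show "admissible (h1 y)" "admissible (h2 y)"
      by (rule admissibleI[OF h_meas(1)[OF y(1)] hK(1)[OF M(2)] fin],
          rule admissibleI[OF h_meas(2)[OF y(1)] hK(2)[OF M(2)] fin])
  qed
  \<comment> \<open>The free decaying solution from \<open>N\<close> on, frozen at \<open>c\<close>
    before \<open>N\<close> so that it is bounded on the whole line.\<close>
  define e where "e x = c * exp (- \<kappa> * of_real (max (x - N) 0))" for x
  have e_le: "cmod (e x) = cmod c * exp (- (2 * \<mu>) * max (x - N) 0)" for x
    by (simp add: e_def norm_mult mu)
  have e_le': "cmod (e x) \<le> cmod c * exp (- \<mu> * max (x - N) 0)" for x
  proof -
    have "\<mu> * max (x - N) 0 \<le> (2 * \<mu>) * max (x - N) 0" using mu by (intro mult_right_mono) auto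
    then show ?thesis unfolding e_le by (intro mult_left_mono) auto
  qed
  define T where "T y x = (- right_conv (h1 y) x, e x + left_conv (h2 y) x)" for y x
  obtain y where y: "continuous_on UNIV y" "bounded (range y)" "\<And>x. T y x = y x"
  proof (rule bounded_continuous_fixpoint[of T])
    fix y :: "real \<Rightarrow> complex \<times> complex" assume y: "continuous_on UNIV y" "bounded (range y)"
    obtain M where M: "M \<ge> 0" "\<And>t. n y t \<le> M" using bounded_n[OF y(2)] by blast
    have "continuous_on UNIV (T y)"
      unfolding T_def[abs_def] e_def
      by (intro continuous_intros primitive_on_UNIV_continuous[OF right_conv_primitive] primitive_on_UNIV_continuous[OF left_conv_primitive] adm y)
    moreover have "norm (T y x) \<le> cmod c + (B' + M / 4)" for x
    proof -
      have "ennreal (cmod (right_conv (h1 y) x) + cmod (left_conv (h2 y) x)) \<le> ennreal (B' + M / 4)"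
        by (rule order_trans[OF conv_bound[OF adm[OF y]] small_f[OF M(1)]])
          (auto intro: hK[OF M(2)])
      then have "cmod (right_conv (h1 y) x) + cmod (left_conv (h2 y) x) \<le> B' + M / 4"
        using M(1) by (subst (asm) ennreal_le_iff) (auto simp: B'_def)
      moreover have "norm (T y x) \<le> cmod (right_conv (h1 y) x) + (cmod (e x) + cmod (left_conv (h2 y) x))"
        unfolding T_def by (rule order_trans[OF norm_Pair_le]) (auto intro: norm_triangle_ineq)
      moreover have "cmod (e x) \<le> cmod c" unfolding e_le using mu by (intro mult_left_le) auto
      ultimately show ?thesis by linarith
    qed
    then have "bounded (range (T y))" by (auto simp: bounded_iff)
    ultimately show "continuous_on UNIV (T y) \<and> bounded (range (T y))" ..
  next
    fix y y' :: "real \<Rightarrow> complex \<times> complex" and M x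
    assume y: "continuous_on UNIV y" "bounded (range y)" and y': "continuous_on UNIV y'" "bounded (range y')"
      and M: "\<And>t. norm (y t - y' t) \<le> M"
    have M0: "0 \<le> 2 * M" using order_trans[OF norm_ge_zero M[of 0]] by simp
    \<comment> \<open>\<open>n\<close> is at most twice the norm of the pair; together with the
      bound 1 / 4 on the coefficients this gives the contraction constant 1 / 2.\<close>
    have nM: "n (\<lambda>t. y t - y' t) t \<le> 2 * M" for t using n_le[of "\<lambda>t. y t - y' t" M] M by auto
    have K: "cmod (h1 y t - h1 y' t) \<le> b t * (2 * M)" "cmod (h2 y t - h2 y' t) \<le> b t * (2 * M)" for t
      using order_trans[OF hd(1) mult_left_mono[OF nM b0]] order_trans[OF hd(2) mult_left_mono[OF nM b0]] by auto
    have fin: "(\<integral>\<^sup>+t. ennreal (exp (- (2 * \<mu>) * \<bar>x - t\<bar>)) * ennreal (b t * (2 * M)) \<partial>lebesgue) < \<infinity>" for x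
      using small'[OF M0, of x] by (rule order.strict_trans1) simp
    note [measurable] = h_meas[OF y(1)] h_meas[OF y'(1)]
    have a: "admissible (\<lambda>t. h1 y t - h1 y' t)" "admissible (\<lambda>t. h2 y t - h2 y' t)"
      by (rule admissibleI[of _ "\<lambda>t. ennreal (b t * (2 * M))"]; use K fin in \<open>auto intro: ennreal_leI\<close>)+
    have "ennreal (cmod (right_conv (\<lambda>t. h1 y t - h1 y' t) x) + cmod (left_conv (\<lambda>t. h2 y t - h2 y' t) x))
        \<le> ennreal (2 * M / 4)"
      by (rule order_trans[OF conv_bound[OF a] small'[OF M0]]) (use K in \<open>auto intro: ennreal_leI\<close>)
    then have "cmod (right_conv (\<lambda>t. h1 y t - h1 y' t) x) + cmod (left_conv (\<lambda>t. h2 y t - h2 y' t) x) \<le> M / 2"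
      using M0 by (subst (asm) ennreal_le_iff) auto
    moreover have "T y x - T y' x = (- right_conv (\<lambda>t. h1 y t - h1 y' t) x, left_conv (\<lambda>t. h2 y t - h2 y' t) x)"
      unfolding T_def conv_diff(1)[OF adm(1)[OF y] adm(1)[OF y'], symmetric] conv_diff(2)[OF adm(2)[OF y] adm(2)[OF y'], symmetric]
      by simp
    ultimately show "norm (T y x - T y' x) \<le> M / 2"
      using norm_Pair_le[of "- right_conv (\<lambda>t. h1 y t - h1 y' t) x" "left_conv (\<lambda>t. h2 y t - h2 y' t) x"] by simp
  qed (rule that)
  define p where "p x = fst (y x)" for x
  define m where "m x = snd (y x)" for x
  have p: "p x = - right_conv (h1 y) x" and m: "m x = e x + left_conv (h2 y) x" for x
    using y(3)[of x] by (auto simp: p_def m_def T_def prod_eq_iff)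
  have prim_p: "primitive_on {N..} p (\<lambda>x. \<kappa> * p x + h1 y x)"
  proof -
    have "primitive_on UNIV (\<lambda>x. - right_conv (h1 y) x) (\<lambda>x. - (\<kappa> * right_conv (h1 y) x - h1 y x))"
      by (rule primitive_on_linear[OF right_conv_primitive[OF adm(1)[OF y(1,2)]] bounded_linear_minus[OF bounded_linear_ident]])
    then have "primitive_on UNIV p (\<lambda>x. \<kappa> * p x + h1 y x)" by (simp add: p[abs_def])
    then show ?thesis by (rule primitive_on_subset) simp
  qed
  have prim_m: "primitive_on {N..} m (\<lambda>x. - \<kappa> * m x + h2 y x)"
  proof -
    have "primitive_on UNIV (\<lambda>x. c * exp (\<kappa> * of_real N) * exp (- \<kappa> * of_real x) + left_conv (h2 y) x)
       (\<lambda>x. c * exp (\<kappa> * of_real N) * (- \<kappa> * exp (- \<kappa> * of_real x)) + (- \<kappa> * left_conv (h2 y) x + h2 y x))"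
      by (intro primitive_on_add primitive_on_cmult primitive_on_exp left_conv_primitive adm y)
    then have "primitive_on {N..} (\<lambda>x. c * exp (\<kappa> * of_real N) * exp (- \<kappa> * of_real x) + left_conv (h2 y) x)
       (\<lambda>x. c * exp (\<kappa> * of_real N) * (- \<kappa> * exp (- \<kappa> * of_real x)) + (- \<kappa> * left_conv (h2 y) x + h2 y x))"
      by (rule primitive_on_subset) simp
    moreover have "c * exp (\<kappa> * of_real N) * exp (- \<kappa> * of_real x) = e x" if "x \<in> {N..}" for x
      using that by (simp add: e_def mult.assoc exp_add[symmetric] algebra_simps max_def)
    ultimately show ?thesis
      by (subst primitive_on_cong[where v="\<lambda>x. c * exp (\<kappa> * of_real N) * exp (- \<kappa> * of_real x) + left_conv (h2 y) x"])
        (auto simp: m algebra_simps)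
  qed
  define y1 where "y1 x = 1 / (2 * \<kappa>) * (p x - m x)" for x
  define y2 where "y2 x = 1 / 2 * (p x + m x)" for x
  have ypm: "y2 x + \<kappa> * y1 x = p x" "y2 x - \<kappa> * y1 x = m x" for x
    using kappa0 by (simp_all add: y1_def y2_def field_simps)
  show thesis
  proof (rule that)
    have "primitive_on {N..} y1 (\<lambda>x. 1 / (2 * \<kappa>) * ((\<kappa> * p x + h1 y x) - (- \<kappa> * m x + h2 y x)))"
      unfolding y1_def[abs_def] by (intro primitive_on_cmult primitive_on_diff prim_p prim_m)
    moreover have "1 / (2 * \<kappa>) * ((\<kappa> * p x + h1 y x) - (- \<kappa> * m x + h2 y x)) = s x * y1 x + y2 x" for x
      using kappa0 by (simp add: h1_def h2_def y1_def y2_def p_def m_def field_simps)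
    ultimately show "primitive_on {N..} y1 (\<lambda>x. s x * y1 x + y2 x)" by (simp only:)
    have "primitive_on {N..} y2 (\<lambda>x. 1 / 2 * ((\<kappa> * p x + h1 y x) + (- \<kappa> * m x + h2 y x)))"
      unfolding y2_def[abs_def] by (intro primitive_on_cmult primitive_on_add prim_p prim_m)
    moreover have "1 / 2 * ((\<kappa> * p x + h1 y x) + (- \<kappa> * m x + h2 y x)) = - complex_of_real (s x) * y2 x + (q x + \<kappa>\<^sup>2) * y1 x - f x" for x
      using kappa0 by (simp add: h1_def h2_def y1_def y2_def p_def m_def field_simps power2_eq_square)
    ultimately show "primitive_on {N..} y2 (\<lambda>x. - complex_of_real (s x) * y2 x + (q x + \<kappa>\<^sup>2) * y1 x - f x)" by (simp only:)
    show "y2 N - \<kappa> * y1 N = c" if fz: "\<And>t. t < N \<Longrightarrow> f t = 0"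
    proof -
      \<comment> \<open>Before \<open>N\<close> both the coefficients and \<open>f\<close> vanish,
        so nothing has accumulated at \<open>N\<close>; the point \<open>N\<close> itself is a null
        set.\<close>
      have "indicator {..N} t *\<^sub>R (exp (\<kappa> * of_real t) * h2 y t) = 0" if "t \<noteq> N" for t
        using that zero[of t] fz[of t] by (cases "t < N") (auto simp: h2_def)
      then have "AE t in lebesgue. indicator {..N} t *\<^sub>R (exp (\<kappa> * of_real t) * h2 y t) = 0"
        using AE_not_in[of "{N}" "lebesgue :: real measure"] by auto
      then have "left_conv (h2 y) N = 0"
        unfolding left_conv_def set_lebesgue_integral_def by (simp add: integral_eq_zero_AE)
      then show ?thesis unfolding ypm m by (simp add: e_def)
    qed
    define F where "F x = (\<integral>\<^sup>+t. ennreal (exp (- \<mu> * \<bar>x - t\<bar>)) * ennreal (cmod (f t)) \<partial>lebesgue)" for x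
    define E where "E x = ennreal (cmod c * exp (- \<mu> * max (x - N) 0)) + F x" for x
    obtain M where M: "M \<ge> 0" "\<And>t. n y t \<le> M" using bounded_n[OF y(2)] by blast
    have [measurable]: "n y \<in> borel_measurable lebesgue"
    proof -
      note [measurable] = y_meas[OF y(1)]
      show ?thesis unfolding n_def[abs_def] by measurable
    qed
    have "ennreal (n y x) \<le> 2 * E x" for x
    proof (rule dichotomy_gronwall[where b="\<lambda>t. ennreal (b t)" and r=\<mu> and B=M])
      show "(\<integral>\<^sup>+t. ennreal (exp (- \<mu> * \<bar>x - t\<bar>)) * ennreal (b t) \<partial>lebesgue) \<le> ennreal (1 / 2)" for x
        using small[of x] unfolding b_def by (rule order_trans) (rule ennreal_leI, simp)
      show "E z \<le> ennreal (exp (\<mu> * \<bar>x - z\<bar>)) * E x" for x z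
        unfolding E_def distrib_left
      proof (rule add_mono)
        have "\<mu> * max (x - N) 0 \<le> \<mu> * (\<bar>x - z\<bar> + max (z - N) 0)" using mu by (intro mult_left_mono) auto
        then have "exp (- \<mu> * max (z - N) 0) \<le> exp (\<mu> * \<bar>x - z\<bar>) * exp (- \<mu> * max (x - N) 0)"
          by (simp add: exp_add[symmetric] algebra_simps)
        then have "cmod c * exp (- \<mu> * max (z - N) 0) \<le> exp (\<mu> * \<bar>x - z\<bar>) * (cmod c * exp (- \<mu> * max (x - N) 0))"
          using mult_left_mono[of _ _ "cmod c"] by (simp add: mult.left_commute)
        then show "ennreal (cmod c * exp (- \<mu> * max (z - N) 0)) \<le> ennreal (exp (\<mu> * \<bar>x - z\<bar>)) * ennreal (cmod c * exp (- \<mu> * max (x - N) 0))"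
          by (subst ennreal_mult[symmetric]) (auto intro: ennreal_leI)
        have "F z \<le> (\<integral>\<^sup>+t. ennreal (exp (\<mu> * \<bar>x - z\<bar>)) * (ennreal (exp (- \<mu> * \<bar>x - t\<bar>)) * ennreal (cmod (f t))) \<partial>lebesgue)"
          unfolding F_def
        proof (rule nn_integral_mono)
          fix t
          have "ennreal (exp (- \<mu> * \<bar>z - t\<bar>)) \<le> ennreal (exp (\<mu> * \<bar>x - z\<bar>)) * ennreal (exp (- \<mu> * \<bar>x - t\<bar>))"
            using exp_kernel_shift[of \<mu> z t x] mu by (subst ennreal_mult[symmetric]) (auto intro: ennreal_leI)
          then show "ennreal (exp (- \<mu> * \<bar>z - t\<bar>)) * ennreal (cmod (f t))
            \<le> ennreal (exp (\<mu> * \<bar>x - z\<bar>)) * (ennreal (exp (- \<mu> * \<bar>x - t\<bar>)) * ennreal (cmod (f t)))"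
            unfolding mult.assoc[symmetric] by (rule mult_right_mono) simp
        qed
        also have "\<dots> = ennreal (exp (\<mu> * \<bar>x - z\<bar>)) * F x"
          unfolding F_def by (rule nn_integral_cmult) measurable
        finally show "F z \<le> ennreal (exp (\<mu> * \<bar>x - z\<bar>)) * F x" .
      qed
      show "ennreal (n y z) \<le> E z + (\<integral>\<^sup>+t. ennreal (exp (- (2 * \<mu>) * \<bar>z - t\<bar>)) * (ennreal (b t) * ennreal (n y t)) \<partial>lebesgue)" for z
      proof -
        have nonneg: "0 \<le> n y t" for t by (simp add: n_def)
        have "n y z \<le> cmod (e z) + (cmod (right_conv (h1 y) z) + cmod (left_conv (h2 y) z))"
          unfolding n_def p_def[symmetric] m_def[symmetric] p m
          using norm_triangle_ineq[of "e z" "left_conv (h2 y) z"] by simp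
        then have "ennreal (n y z) \<le> ennreal (cmod (e z)) + ennreal (cmod (right_conv (h1 y) z) + cmod (left_conv (h2 y) z))"
          by (subst ennreal_plus[symmetric]) (auto simp del: ennreal_plus intro: ennreal_leI)
        also have "\<dots> \<le> ennreal (cmod c * exp (- \<mu> * max (z - N) 0)) +
          (\<integral>\<^sup>+t. ennreal (exp (- (2 * \<mu>) * \<bar>z - t\<bar>)) * (ennreal (cmod (f t)) + ennreal (b t) * ennreal (n y t)) \<partial>lebesgue)"
        proof (rule add_mono)
          show "ennreal (cmod (e z)) \<le> ennreal (cmod c * exp (- \<mu> * max (z - N) 0))" using e_le' by (rule ennreal_leI)
          have H: "ennreal (cmod (f t) + b t * n y t) = ennreal (cmod (f t)) + ennreal (b t) * ennreal (n y t)" for t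
            using b0 nonneg by (simp add: ennreal_mult)
          show "ennreal (cmod (right_conv (h1 y) z) + cmod (left_conv (h2 y) z)) \<le>
            (\<integral>\<^sup>+t. ennreal (exp (- (2 * \<mu>) * \<bar>z - t\<bar>)) * (ennreal (cmod (f t)) + ennreal (b t) * ennreal (n y t)) \<partial>lebesgue)"
            by (rule conv_bound[OF adm[OF y(1,2)]])
              (use ennreal_leI[OF hb(1)] ennreal_leI[OF hb(2)] in \<open>auto simp: H[symmetric]\<close>)
        qed
        also have "(\<integral>\<^sup>+t. ennreal (exp (- (2 * \<mu>) * \<bar>z - t\<bar>)) * (ennreal (cmod (f t)) + ennreal (b t) * ennreal (n y t)) \<partial>lebesgue)
          = (\<integral>\<^sup>+t. ennreal (exp (- (2 * \<mu>) * \<bar>z - t\<bar>)) * ennreal (cmod (f t)) \<partial>lebesgue) +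
            (\<integral>\<^sup>+t. ennreal (exp (- (2 * \<mu>) * \<bar>z - t\<bar>)) * (ennreal (b t) * ennreal (n y t)) \<partial>lebesgue)"
          unfolding distrib_left by (rule nn_integral_add) measurable
        also have "(\<integral>\<^sup>+t. ennreal (exp (- (2 * \<mu>) * \<bar>z - t\<bar>)) * ennreal (cmod (f t)) \<partial>lebesgue) \<le> F z"
          unfolding F_def by (rule kernel_le)
        finally show ?thesis unfolding E_def by (simp add: add.assoc add_mono)
      qed
      show "n y \<in> borel_measurable lebesgue" by measurable
      show "(\<lambda>t. ennreal (b t)) \<in> borel_measurable lebesgue" by measurable
      show "0 \<le> n y t" for t by (simp add: n_def)
    qed (use M mu in auto)
    then show "ennreal (cmod (y2 x + \<kappa> * y1 x) + cmod (y2 x - \<kappa> * y1 x)) \<le>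
       2 * (ennreal (cmod c * exp (- \<mu> * max (x - N) 0)) +
        (\<integral>\<^sup>+t. ennreal (exp (- \<mu> * \<bar>x - t\<bar>)) * ennreal (cmod (f t)) \<partial>lebesgue))" for x
      by (simp add: ypm n_def p_def m_def E_def F_def)
  qed
qed

section \<open>Existence, uniqueness and growth for the system in \<open>u\<close> and
  \<open>w\<close>\<close>

section \<open>The first-order system\<close>

lemma absolutely_integrable_mult_continuous:
  fixes h v :: "real \<Rightarrow> complex"
  assumes "h absolutely_integrable_on {a..b}" "continuous_on {a..b} v"
  shows "(\<lambda>x. h x * v x) absolutely_integrable_on {a..b}"
proof -
  have "(\<lambda>x. v x * h x) absolutely_integrable_on {a..b}"
    by (rule absolutely_integrable_bounded_measurable_product[OF bilinear_times _ _ _ assms(1)])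
      (use assms(2) in \<open>auto intro!: continuous_imp_measurable_on_sets_lebesgue compact_imp_bounded compact_continuous_image\<close>)
  then show ?thesis by (simp add: mult.commute)
qed

lemma absolutely_integrable_of_real:
  fixes f :: "real \<Rightarrow> real"
  shows
  "f absolutely_integrable_on S \<Longrightarrow> (\<lambda>x. complex_of_real (f x)) absolutely_integrable_on S"
  by (drule absolutely_integrable_linear[OF _ bounded_linear_of_real]) (simp add: o_def)

lemma absolutely_integrable_Pair:
  assumes "g absolutely_integrable_on {a..b}" "h absolutely_integrable_on {a..b::real}"
  shows "(\<lambda>x. (g x :: 'a::euclidean_space, h x :: 'b::euclidean_space)) absolutely_integrable_on {a..b}"
proof -
  have "(\<lambda>x. (g x, 0 :: 'b)) absolutely_integrable_on {a..b}"
    using absolutely_integrable_linear[OF assms(1) bounded_linear_Pair[OF bounded_linear_ident bounded_linear_zero]]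
    by (simp add: o_def)
  moreover have "(\<lambda>x. (0 :: 'a, h x)) absolutely_integrable_on {a..b}"
    using absolutely_integrable_linear[OF assms(2) bounded_linear_Pair[OF bounded_linear_zero bounded_linear_ident]]
    by (simp add: o_def)
  ultimately have "(\<lambda>x. (g x, 0) + (0, h x)) absolutely_integrable_on {a..b}" by (rule set_integral_add)
  then show ?thesis by simp
qed

lemma primitive_on_Pair:
  fixes u :: "real \<Rightarrow> 'a::euclidean_space" and v :: "real \<Rightarrow> 'b::euclidean_space"
  assumes "primitive_on S u g" "primitive_on S v h"
  shows "primitive_on S (\<lambda>x. (u x, v x)) (\<lambda>x. (g x, h x))"
proof -
  have "primitive_on S (\<lambda>x. (u x, 0) + (0, v x)) (\<lambda>x. (g x, 0) + (0, h x))"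
    by (rule primitive_on_add[OF
        primitive_on_linear[OF assms(1) bounded_linear_Pair[OF bounded_linear_ident bounded_linear_zero]]
        primitive_on_linear[OF assms(2) bounded_linear_Pair[OF bounded_linear_zero bounded_linear_ident]]])
  then show ?thesis by simp
qed

lemma norm_pair_ge: "norm (u :: complex) + norm (w :: complex) \<le> 2 * norm (u, w)"
  using norm_fst_le[of u w] norm_snd_le[of w u] by simp

text \<open>The coefficients \<open>s\<close> and \<open>q\<close> are \<open>\<sigma>\<close> and \<open>\<tau> - \<sigma>\<^sup>2\<close>, extended by zero to the real line; the quasi-derivative is the
  second component \<open>w\<close> of a solution.\<close>

locale sturm_liouville =
  fixes s q :: "real \<Rightarrow> real"
  assumes s_meas [measurable]: "s \<in> borel_measurable lebesgue"
    and q_meas [measurable]: "q \<in> borel_measurable lebesgue"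
    and s_int: "\<And>a b. s absolutely_integrable_on {a..b}"
    and s2_int: "\<And>a b. (\<lambda>x. (s x)\<^sup>2) absolutely_integrable_on {a..b}"
    and q_int: "\<And>a b. q absolutely_integrable_on {a..b}"
    and decay: "\<And>e. e > 0 \<Longrightarrow> \<exists>N\<ge>0. \<forall>x\<ge>N. (\<integral>\<^sup>+t. indicator {x..x+1} t * ennreal ((s t)\<^sup>2 + \<bar>q t\<bar>) \<partial>lebesgue) \<le> ennreal e"
begin

definition solves :: "real set \<Rightarrow> complex \<Rightarrow> (real \<Rightarrow> complex) \<Rightarrow> (real \<Rightarrow> complex) \<Rightarrow> (real \<Rightarrow> complex) \<Rightarrow> bool" where
  "solves S z f u w \<longleftrightarrow> primitive_on S u (\<lambda>x. complex_of_real (s x) * u x + w x) \<and>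
     primitive_on S w (\<lambda>x. - complex_of_real (s x) * w x + (complex_of_real (q x) - z) * u x - f x)"

lemma solves_subset: "solves S z f u w \<Longrightarrow> T \<subseteq> S \<Longrightarrow> solves T z f u w"
  unfolding solves_def using primitive_on_subset by blast

lemma solves_cong:
  assumes "is_interval S" "\<And>x. x \<in> S \<Longrightarrow> u x = u' x" "\<And>x. x \<in> S \<Longrightarrow> w x = w' x" "\<And>x. x \<in> S \<Longrightarrow> f x = f' x"
  shows "solves S z f u w \<longleftrightarrow> solves S z f' u' w'"
proof -
  have "primitive_on S u (\<lambda>x. s x * u x + w x) \<longleftrightarrow> primitive_on S u' (\<lambda>x. s x * u' x + w' x)"
    by (rule primitive_on_cong) (use assms in auto)
  moreover have "primitive_on S w (\<lambda>x. - s x * w x + (q x - z) * u x - f x) \<longleftrightarrow>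
     primitive_on S w' (\<lambda>x. - s x * w' x + (q x - z) * u' x - f' x)"
    by (rule primitive_on_cong) (use assms in auto)
  ultimately show ?thesis by (simp add: solves_def)
qed

lemma solves_add:
  assumes "solves S z f u w" "solves S z g v y"
  shows "solves S z (\<lambda>x. f x + g x) (\<lambda>x. u x + v x) (\<lambda>x. w x + y x)"
proof -
  have "primitive_on S (\<lambda>x. u x + v x) (\<lambda>x. (s x * u x + w x) + (s x * v x + y x))"
    "primitive_on S (\<lambda>x. w x + y x) (\<lambda>x. (- s x * w x + (q x - z) * u x - f x) + (- s x * y x + (q x - z) * v x - g x))"
    using assms by (auto simp: solves_def intro: primitive_on_add)
  then show ?thesis by (simp add: solves_def algebra_simps)
qed

lemma solves_cmult:
  assumes "solves S z f u w"
  shows "solves S z (\<lambda>x. c * f x) (\<lambda>x. c * u x) (\<lambda>x. c * w x)"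
proof -
  have "primitive_on S (\<lambda>x. c * u x) (\<lambda>x. c * (s x * u x + w x))"
    "primitive_on S (\<lambda>x. c * w x) (\<lambda>x. c * (- s x * w x + (q x - z) * u x - f x))"
    using assms by (auto simp: solves_def intro: primitive_on_cmult)
  then show ?thesis by (simp add: solves_def algebra_simps)
qed

lemma solves_diff:
  assumes "solves S z f u w" "solves S z g v y"
  shows "solves S z (\<lambda>x. f x - g x) (\<lambda>x. u x - v x) (\<lambda>x. w x - y x)"
  using solves_add[OF assms(1) solves_cmult[OF assms(2), of "-1"]] by simp

text \<open>A multiple of \<open>u\<close> moves between the spectral parameter and the forcing. The
  graph of the operator is described at parameter 0, and an eigenfunction for a nearby parameter
  becomes a forced solution.\<close>

lemma solves_shift:
  assumes "solves S z f u w" "\<And>x. g x = f x + (z - z') * u x"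
  shows "solves S z' g u w"
proof -
  have "- complex_of_real (s x) * w x + (complex_of_real (q x) - z) * u x - f x =
      - complex_of_real (s x) * w x + (complex_of_real (q x) - z') * u x - g x" for x
    by (simp add: assms(2) algebra_simps)
  note eq = this
  show ?thesis using assms(1) unfolding solves_def eq .
qed

lemma solves_continuous:
  assumes "solves {a..b} z f u w"
  shows "continuous_on {a..b} u" "continuous_on {a..b} w"
  using assms by (auto simp: solves_def intro: primitive_on_Icc_continuous)

lemma solves_continuous_Ici:
  assumes "solves {a..} z f u w"
  shows "continuous_on {a..} u" "continuous_on {a..} w"
  using assms by (auto simp: solves_def intro: primitive_on_continuous)

text \<open>Lipschitz coefficient of the system. The factor 2 is the price of comparing the sum of
  the moduli of \<open>u\<close> and \<open>w\<close> with the Euclidean norm of the pair.\<close>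

definition growth :: "complex \<Rightarrow> real \<Rightarrow> real" where
  "growth z t = 2 * (\<bar>s t\<bar> + \<bar>q t\<bar> + cmod z + 1)"

lemma growth_integrable: "growth z absolutely_integrable_on {a..b}"
proof -
  have "(\<lambda>t. \<bar>s t\<bar>) absolutely_integrable_on {a..b}" "(\<lambda>t. \<bar>q t\<bar>) absolutely_integrable_on {a..b}"
    using s_int[of a b] q_int[of a b] by (auto simp: absolutely_integrable_on_def)
  moreover have "(\<lambda>t. cmod z + 1) absolutely_integrable_on {a..b}"
    using absolutely_integrable_on_const[of "{a..b}"] by simp
  ultimately have "(\<lambda>t. 2 * (\<bar>s t\<bar> + \<bar>q t\<bar> + (cmod z + 1))) absolutely_integrable_on {a..b}"
    by (intro set_integrable_mult_right set_integral_add) auto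
  then show ?thesis by (simp add: growth_def[abs_def] add.assoc)
qed

lemma growth_nonneg: "0 \<le> growth z t"
  by (simp add: growth_def)

lemma solves_growth:
  assumes sol: "solves {a..b} z f u w" and f: "f absolutely_integrable_on {a..b}"
    and x: "x \<in> {a..b}" "x0 \<in> {a..b}"
  shows "cmod (u x) + cmod (w x) \<le>
    2 * (cmod (u x0) + cmod (w x0) + integral {a..b} (\<lambda>t. cmod (f t))) * exp (2 * integral {a..b} (growth z))"
proof -
  have "norm (u x, w x) \<le> (norm (u x0, w x0) + integral {a..b} (\<lambda>t. cmod (f t))) * exp (2 * integral {a..b} (growth z))"
  proof (rule primitive_gronwall[where Y="\<lambda>x. (u x, w x)", OF _ growth_integrable growth_nonneg])
    show "primitive_on {a..b} (\<lambda>x. (u x, w x)) (\<lambda>x. (s x * u x + w x, - s x * w x + (q x - z) * u x - f x))"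
      using sol by (auto simp: solves_def intro: primitive_on_Pair)
    show "(\<lambda>t. cmod (f t)) absolutely_integrable_on {a..b}"
      using f by (auto simp: absolutely_integrable_on_def)
    fix t
    have "cmod (s t * u t + w t) \<le> \<bar>s t\<bar> * cmod (u t) + cmod (w t)"
      using norm_triangle_ineq[of "s t * u t" "w t"] by (simp add: norm_mult)
    moreover have "cmod (- s t * w t + (q t - z) * u t - f t) \<le> \<bar>s t\<bar> * cmod (w t) + (\<bar>q t\<bar> + cmod z) * cmod (u t) + cmod (f t)"
    proof -
      have "cmod (- s t * w t + (q t - z) * u t - f t) \<le> cmod (- s t * w t) + cmod ((q t - z) * u t) + cmod (f t)"
        using norm_triangle_ineq4[of "- s t * w t + (q t - z) * u t" "f t"] norm_triangle_ineq[of "- s t * w t" "(q t - z) * u t"]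
        by linarith
      moreover have "cmod ((q t - z) * u t) \<le> (\<bar>q t\<bar> + cmod z) * cmod (u t)"
        unfolding norm_mult using norm_triangle_ineq4[of "of_real (q t)" z] by (intro mult_right_mono) auto
      ultimately show ?thesis by (simp add: norm_mult)
    qed
    ultimately have "norm (s t * u t + w t, - s t * w t + (q t - z) * u t - f t) \<le>
       (\<bar>s t\<bar> * cmod (u t) + cmod (w t)) + (\<bar>s t\<bar> * cmod (w t) + (\<bar>q t\<bar> + cmod z) * cmod (u t) + cmod (f t))"
      using norm_Pair_le[of "s t * u t + w t" "- s t * w t + (q t - z) * u t - f t"] by linarith
    also have "\<dots> \<le> (\<bar>s t\<bar> + \<bar>q t\<bar> + cmod z + 1) * (cmod (u t) + cmod (w t)) + cmod (f t)"
      by (simp add: algebra_simps)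
    also have "\<dots> \<le> (\<bar>s t\<bar> + \<bar>q t\<bar> + cmod z + 1) * (2 * norm (u t, w t)) + cmod (f t)"
      by (intro add_right_mono mult_left_mono norm_pair_ge) auto
    finally show "norm (s t * u t + w t, - s t * w t + (q t - z) * u t - f t) \<le> growth z t * norm (u t, w t) + cmod (f t)"
      by (simp add: growth_def algebra_simps)
  qed (use x in auto)
  also have "\<dots> \<le> (cmod (u x0) + cmod (w x0) + integral {a..b} (\<lambda>t. cmod (f t))) * exp (2 * integral {a..b} (growth z))"
    by (intro mult_right_mono add_right_mono norm_Pair_le) auto
  finally show ?thesis using norm_pair_ge[of "u x" "w x"] by linarith
qed

text \<open>Gronwall for the difference, which has no forcing and vanishes at
  \<open>x0\<close>.\<close>

lemma solves_unique:
  assumes "solves {a..b} z f u w" "solves {a..b} z f v y" "x0 \<in> {a..b}" "u x0 = v x0" "w x0 = y x0" "x \<in> {a..b}"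
  shows "u x = v x" "w x = y x"
proof -
  have "solves {a..b} z (\<lambda>x. f x - f x) (\<lambda>x. u x - v x) (\<lambda>x. w x - y x)"
    by (rule solves_diff) (use assms in auto)
  then have "solves {a..b} z (\<lambda>x. 0) (\<lambda>x. u x - v x) (\<lambda>x. w x - y x)" by simp
  from solves_growth[OF this _ assms(6,3)] assms(4,5)
  have "cmod (u x - v x) + cmod (w x - y x) \<le> 0" by simp
  then show "u x = v x" "w x = y x"
    using norm_ge_zero[of "u x - v x"] norm_ge_zero[of "w x - y x"] by (smt (verit) norm_eq_zero eq_iff_diff_eq_0)+
qed

lemma solves_unique_Ici:
  assumes sol: "solves {0..} z f u w" "solves {0..} z f v y" and "x0 \<ge> 0" "u x0 = v x0" "w x0 = y x0" "x \<ge> 0"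
  shows "u x = v x" "w x = y x"
proof -
  have "{0..max x x0} \<subseteq> {0..}" by auto
  from solves_unique[OF solves_subset[OF sol(1) this] solves_subset[OF sol(2) this], of x0 x]
  show "u x = v x" "w x = y x" using assms by auto
qed

lemma solves_exist:
  assumes f: "f absolutely_integrable_on {a..b}" and x0: "x0 \<in> {a..b}"
  obtains u w where "solves {a..b} z f u w" "u x0 = c" "w x0 = d"
proof -
  define G where "G t y = (complex_of_real (s t) * fst y + snd y,
      - complex_of_real (s t) * snd y + (complex_of_real (q t) - z) * fst y - f t)" for t and y :: "complex \<times> complex"
  obtain Y where Y: "primitive_on {a..b} Y (\<lambda>t. G t (Y t))" "Y x0 = (c, d)"
  proof (rule ode_solution[where G=G and a=a and b=b and k="growth z" and ?x0.0=x0 and c="(c, d)"])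
    fix Y :: "real \<Rightarrow> complex \<times> complex" assume "continuous_on UNIV Y"
    then have Y: "continuous_on {a..b} (\<lambda>t. fst (Y t))" "continuous_on {a..b} (\<lambda>t. snd (Y t))"
      by (auto intro!: continuous_intros intro: continuous_on_subset)
    have i: "(\<lambda>t. complex_of_real (s t)) absolutely_integrable_on {a..b}"
      "(\<lambda>t. - complex_of_real (s t)) absolutely_integrable_on {a..b}"
      "(\<lambda>t. complex_of_real (q t) - z) absolutely_integrable_on {a..b}"
    proof -
      show 1: "(\<lambda>t. complex_of_real (s t)) absolutely_integrable_on {a..b}"
        by (rule absolutely_integrable_of_real[OF s_int])
      show "(\<lambda>t. - complex_of_real (s t)) absolutely_integrable_on {a..b}"
        using absolutely_integrable_linear[OF 1 bounded_linear_minus[OF bounded_linear_ident]] by (simp add: o_def)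
      have "(\<lambda>t. z) absolutely_integrable_on {a..b}" using absolutely_integrable_on_const[of "{a..b}" z] by simp
      then show "(\<lambda>t. complex_of_real (q t) - z) absolutely_integrable_on {a..b}"
        by (rule set_integral_diff(1)[OF absolutely_integrable_of_real[OF q_int]])
    qed
    show "(\<lambda>t. G t (Y t)) absolutely_integrable_on {a..b}"
      unfolding G_def
      by (rule absolutely_integrable_Pair[OF
          set_integral_add(1)[OF absolutely_integrable_mult_continuous[OF i(1) Y(1)] absolutely_integrable_continuous_real[OF Y(2)]]
          set_integral_diff(1)[OF set_integral_add(1)[OF absolutely_integrable_mult_continuous[OF i(2) Y(2)]
            absolutely_integrable_mult_continuous[OF i(3) Y(1)]] f]])
  next
    fix t and y y' :: "complex \<times> complex"
    have "G t y - G t y' = (s t * (fst y - fst y') + (snd y - snd y'), - s t * (snd y - snd y') + (q t - z) * (fst y - fst y'))"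
      by (simp add: G_def algebra_simps)
    also have "norm \<dots> \<le> cmod (s t * (fst y - fst y') + (snd y - snd y')) + cmod (- s t * (snd y - snd y') + (q t - z) * (fst y - fst y'))"
      by (rule norm_Pair_le)
    also have "\<dots> \<le> (\<bar>s t\<bar> * cmod (fst y - fst y') + cmod (snd y - snd y')) + (\<bar>s t\<bar> * cmod (snd y - snd y') + (\<bar>q t\<bar> + cmod z) * cmod (fst y - fst y'))"
    proof (rule add_mono)
      show "cmod (s t * (fst y - fst y') + (snd y - snd y')) \<le> \<bar>s t\<bar> * cmod (fst y - fst y') + cmod (snd y - snd y')"
        using norm_triangle_ineq[of "s t * (fst y - fst y')" "snd y - snd y'"] by (simp add: norm_mult)
      have "cmod ((q t - z) * (fst y - fst y')) \<le> (\<bar>q t\<bar> + cmod z) * cmod (fst y - fst y')"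
        unfolding norm_mult using norm_triangle_ineq4[of "of_real (q t)" z] by (intro mult_right_mono) auto
      then show "cmod (- s t * (snd y - snd y') + (q t - z) * (fst y - fst y')) \<le> \<bar>s t\<bar> * cmod (snd y - snd y') + (\<bar>q t\<bar> + cmod z) * cmod (fst y - fst y')"
        using norm_triangle_ineq[of "- s t * (snd y - snd y')" "(q t - z) * (fst y - fst y')"] by (simp add: norm_mult)
    qed
    also have "\<dots> \<le> (\<bar>s t\<bar> + \<bar>q t\<bar> + cmod z + 1) * (cmod (fst y - fst y') + cmod (snd y - snd y'))"
      by (simp add: algebra_simps)
    also have "\<dots> \<le> (\<bar>s t\<bar> + \<bar>q t\<bar> + cmod z + 1) * (2 * norm (fst y - fst y', snd y - snd y'))"
      by (intro mult_left_mono norm_pair_ge) auto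
    also have "\<dots> = growth z t * norm (y - y')"
      by (simp add: growth_def minus_prod_def algebra_simps)
    finally show "norm (G t y - G t y') \<le> growth z t * norm (y - y')" .
  next
    show "growth z integrable_on {a..b}" using growth_integrable[where z=z and a=a and b=b] by (simp add: absolutely_integrable_on_def)
  qed (use x0 growth_nonneg in \<open>auto intro: that\<close>)
  show thesis
  proof (rule that)
    show "solves {a..b} z f (\<lambda>x. fst (Y x)) (\<lambda>x. snd (Y x))"
      using primitive_on_linear[OF Y(1) bounded_linear_fst] primitive_on_linear[OF Y(1) bounded_linear_snd]
      by (simp add: solves_def G_def)
  qed (use Y(2) in auto)
qed

text \<open>The dichotomy yields solutions from some \<open>N\<close> on, whereas the boundary
  condition sits at 0.\<close>

lemma solves_extend_left:
  assumes sol: "solves {N..} z f u w" and f: "f absolutely_integrable_on {0..N}" and "N \<ge> 0"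
  obtains u' w' where "solves {0..} z f u' w'" "\<And>x. x \<ge> N \<Longrightarrow> u' x = u x" "\<And>x. x \<ge> N \<Longrightarrow> w' x = w x"
proof -
  obtain v y where vy: "solves {0..N} z f v y" "v N = u N" "y N = w N"
    by (rule solves_exist[OF f, of N]) (use \<open>N \<ge> 0\<close> in auto)
  define u' where "u' x = (if x < N then v x else u x)" for x
  define w' where "w' x = (if x < N then y x else w x)" for x
  have "solves {0..N} z f u' w' \<longleftrightarrow> solves {0..N} z f v y"
    by (rule solves_cong) (use vy in \<open>auto simp: u'_def w'_def\<close>)
  moreover have "solves {N..} z f u' w' \<longleftrightarrow> solves {N..} z f u w"
    by (rule solves_cong) (auto simp: u'_def w'_def is_interval_ci)
  ultimately have "solves {0..} z f u' w'"
    using vy sol \<open>N \<ge> 0\<close> unfolding solves_def by (blast intro: primitive_on_join_Ici)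
  then show thesis by (rule that) (auto simp: u'_def w'_def)
qed

end

section \<open>Decaying, particular and homogeneous solutions in the mean square\<close>

section \<open>Square integrable solutions\<close>

text \<open>The exponential kernels integrate over the whole line, while elements of
  \<open>l2\<close> are determined on the open half-line only.\<close>

definition zero_ext :: "(real \<Rightarrow> complex) \<Rightarrow> real \<Rightarrow> complex" where
  "zero_ext f t = (if t \<in> {0<..} then f t else 0)"

lemma zero_ext_measurable:
  assumes "square_integrable f"
  shows "zero_ext f \<in> borel_measurable lebesgue"
  using assms borel_measurable_if[of "{0<..}" f] unfolding square_integrable_def zero_ext_def[abs_def] by auto

lemma norm_abs_l2_square:
  assumes "square_integrable f"
  shows "(norm (abs_l2 f))\<^sup>2 = (\<integral>x. (cmod (f x))\<^sup>2 \<partial>half_line)"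
proof -
  have "abs_l2 f \<bullet> abs_l2 f = (\<integral>x. f x \<bullet> f x \<partial>half_line)"
    by (rule inner_l2.abs_eq) (use assms in \<open>auto simp: l2_rel_def\<close>)
  then show ?thesis by (simp add: power2_norm_eq_inner)
qed

lemma nn_integral_zero_ext:
  assumes "square_integrable f"
  shows "(\<integral>\<^sup>+t. (ennreal (cmod (zero_ext f t)))\<^sup>2 \<partial>lebesgue) = ennreal ((norm (abs_l2 f))\<^sup>2)"
proof -
  have "(\<integral>\<^sup>+t. (ennreal (cmod (zero_ext f t)))\<^sup>2 \<partial>lebesgue) = (\<integral>\<^sup>+t. ennreal ((cmod (f t))\<^sup>2) * indicator {0<..} t \<partial>lebesgue)"
    by (rule nn_integral_cong) (auto simp: zero_ext_def ennreal_power)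
  also have "\<dots> = (\<integral>\<^sup>+t. ennreal ((cmod (f t))\<^sup>2) \<partial>half_line)"
    by (rule nn_integral_restrict_space[symmetric]) simp
  also have "\<dots> = ennreal (\<integral>t. (cmod (f t))\<^sup>2 \<partial>half_line)"
    by (rule nn_integral_eq_integral) (use assms in \<open>auto simp: square_integrable_def\<close>)
  finally show ?thesis by (simp add: norm_abs_l2_square[OF assms])
qed

text \<open>With extended nonnegative integrals a single estimate delivers both integrability and
  the norm bound.\<close>

lemma square_integrableI:
  assumes "f \<in> borel_measurable half_line" "C \<ge> 0"
    "(\<integral>\<^sup>+t. (ennreal (cmod (zero_ext f t)))\<^sup>2 \<partial>lebesgue) \<le> ennreal (C\<^sup>2)"
  shows "square_integrable f" "norm (abs_l2 f) \<le> C"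
proof -
  have "(\<integral>\<^sup>+t. ennreal (norm ((cmod (f t))\<^sup>2)) \<partial>half_line) = (\<integral>\<^sup>+t. ennreal ((cmod (f t))\<^sup>2) * indicator {0<..} t \<partial>lebesgue)"
    by (subst nn_integral_restrict_space) auto
  also have "\<dots> = (\<integral>\<^sup>+t. (ennreal (cmod (zero_ext f t)))\<^sup>2 \<partial>lebesgue)"
    by (rule nn_integral_cong) (auto simp: zero_ext_def ennreal_power)
  also have "\<dots> < \<infinity>" using assms(3) by (rule order.strict_trans1) simp
  finally show sq: "square_integrable f"
    using assms(1) by (auto simp: square_integrable_def intro!: integrableI_bounded)
  have "ennreal ((norm (abs_l2 f))\<^sup>2) \<le> ennreal (C\<^sup>2)"
    using assms(3) nn_integral_zero_ext[OF sq] by simp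
  then have "(norm (abs_l2 f))\<^sup>2 \<le> C\<^sup>2" by (simp add: ennreal_le_iff)
  then show "norm (abs_l2 f) \<le> C" using assms(2) power2_le_imp_le by blast
qed

lemma ennreal_power2_le_imp_le:
  assumes "I\<^sup>2 \<le> (ennreal c)\<^sup>2" "c \<ge> 0"
  shows "I \<le> ennreal c"
proof (cases I)
  case (real i)
  then have "ennreal (i\<^sup>2) \<le> ennreal (c\<^sup>2)" using assms by (simp add: ennreal_power)
  then have "i\<^sup>2 \<le> c\<^sup>2" using assms by (subst (asm) ennreal_le_iff) auto
  then have "i \<le> c" using assms(2) by (rule power2_le_imp_le)
  then show ?thesis using real by (auto intro: ennreal_leI)
next
  case top
  then show ?thesis using assms by (simp add: ennreal_power top_unique power2_eq_square ennreal_mult[symmetric])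
qed

text \<open>Cauchy--Schwarz against the indicator of the interval.\<close>

lemma zero_ext_integral_Icc:
  assumes f: "square_integrable f" and "b \<ge> 0"
  shows "zero_ext f absolutely_integrable_on {0..b}"
    "integral {0..b} (\<lambda>t. cmod (zero_ext f t)) \<le> sqrt b * norm (abs_l2 f)"
proof -
  note [measurable] = zero_ext_measurable[OF f]
  define L where "L = norm (abs_l2 f)"
  define I where "I = (\<integral>\<^sup>+t. indicator {0..b} t * ennreal (cmod (zero_ext f t)) \<partial>lebesgue)"
  have "I\<^sup>2 \<le> (\<integral>\<^sup>+t. (indicator {0..b} t)\<^sup>2 \<partial>lebesgue) * (\<integral>\<^sup>+t. (ennreal (cmod (zero_ext f t)))\<^sup>2 \<partial>lebesgue)"
    unfolding I_def by (rule Cauchy_Schwarz_nn_integral) measurable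
  also have "(\<integral>\<^sup>+t. (indicator {0..b} t)\<^sup>2 \<partial>lebesgue) = (\<integral>\<^sup>+t. indicator {0..b} t \<partial>(lebesgue :: real measure))"
    by (rule nn_integral_cong) (auto simp: indicator_def)
  also have "\<dots> = ennreal b" using \<open>b \<ge> 0\<close> by simp
  also have "(\<integral>\<^sup>+t. (ennreal (cmod (zero_ext f t)))\<^sup>2 \<partial>lebesgue) = ennreal (L\<^sup>2)"
    unfolding L_def by (rule nn_integral_zero_ext[OF f])
  also have "ennreal b * ennreal (L\<^sup>2) = (ennreal (sqrt b * L))\<^sup>2"
    using \<open>b \<ge> 0\<close> by (simp add: ennreal_power ennreal_mult[symmetric] power_mult_distrib L_def)
  finally have I: "I \<le> ennreal (sqrt b * L)"
    by (rule ennreal_power2_le_imp_le) (use \<open>b \<ge> 0\<close> in \<open>auto simp: L_def\<close>)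
  have "set_integrable lebesgue {0..b} (zero_ext f)"
    unfolding set_integrable_def
  proof (rule integrableI_bounded)
    have "(\<integral>\<^sup>+t. ennreal (norm (indicat_real {0..b} t *\<^sub>R zero_ext f t)) \<partial>lebesgue) = I"
      unfolding I_def by (rule nn_integral_cong) (auto simp: indicator_def)
    also have "\<dots> < \<infinity>" using I by (rule order.strict_trans1) simp
    finally show "(\<integral>\<^sup>+t. ennreal (norm (indicat_real {0..b} t *\<^sub>R zero_ext f t)) \<partial>lebesgue) < \<infinity>" .
  qed measurable
  then show abs: "zero_ext f absolutely_integrable_on {0..b}" .
  have ni: "set_integrable lebesgue {0..b} (\<lambda>t. cmod (zero_ext f t))"
    using abs by (auto simp: absolutely_integrable_on_def)
  have "ennreal (integral {0..b} (\<lambda>t. cmod (zero_ext f t))) = ennreal (LINT t:{0..b}|lebesgue. cmod (zero_ext f t))"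
    using set_lebesgue_integral_eq_integral(2)[OF ni] by simp
  also have "\<dots> = (\<integral>\<^sup>+t. ennreal (indicator {0..b} t *\<^sub>R cmod (zero_ext f t)) \<partial>lebesgue)"
    unfolding set_lebesgue_integral_def
    by (rule nn_integral_eq_integral[symmetric]) (use ni in \<open>auto simp: set_integrable_def\<close>)
  also have "\<dots> = I" unfolding I_def by (rule nn_integral_cong) (auto simp: indicator_def)
  finally have "ennreal (integral {0..b} (\<lambda>t. cmod (zero_ext f t))) \<le> ennreal (sqrt b * L)" using I by simp
  then show "integral {0..b} (\<lambda>t. cmod (zero_ext f t)) \<le> sqrt b * norm (abs_l2 f)"
    using \<open>b \<ge> 0\<close> by (subst (asm) ennreal_le_iff) (auto simp: L_def)
qed

context sturm_liouville
begin

text \<open>Decay controls the square of \<open>s\<close>, whereas the dichotomy needs its modulus.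
  The bound \<open>\<bar>s\<bar> \<le> D / 2 + s^2 / (2 * D)\<close> makes the modulus at most
  \<open>D\<close> in the mean over a unit interval as soon as the square is at most
  \<open>D^2\<close> in the mean; uniform smallness in the mean then passes to the kernel by
  \<open>exp_kernel_uniform_local\<close>.\<close>

lemma exp_kernel_small_tail:
  assumes "\<mu> > 0" "k > 0" "e > 0"
  obtains N where "N \<ge> 0" "\<And>x. (\<integral>\<^sup>+t. ennreal (exp (- \<mu> * \<bar>x - t\<bar>)) *
      ennreal (\<bar>if t < N then 0 else s t\<bar> + \<bar>if t < N then 0 else q t\<bar> / k) \<partial>lebesgue) \<le> ennreal e"
proof -
  \<comment> \<open>\<open>A\<close> is the constant of \<open>exp_kernel_uniform_local\<close>, and
    \<open>A * D = e\<close>. \<open>M\<close> dominates the coefficients \<open>1 / (2 * D)\<close>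
    of the square of \<open>s\<close> and \<open>1 / k\<close> of \<open>\<bar>q\<bar>\<close>; with
    \<open>M * d = D / 2\<close> the constant term may use the other half of
    \<open>D\<close>.\<close>
  define A where "A = exp \<mu> * (2 / \<mu>)"
  have A: "A > 0" using assms by (simp add: A_def)
  define D where "D = e / A"
  have D: "D > 0" using A assms by (simp add: D_def)
  define M where "M = 1 / (2 * D) + 1 / k"
  have M: "M > 0" using D assms by (simp add: M_def add_pos_pos)
  define d where "d = D / (2 * M)"
  have "d > 0" using D M by (simp add: d_def)
  obtain N where N: "N \<ge> 0" "\<And>x. x \<ge> N \<Longrightarrow> (\<integral>\<^sup>+t. indicator {x..x+1} t * ennreal ((s t)\<^sup>2 + \<bar>q t\<bar>) \<partial>lebesgue) \<le> ennreal d"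
    using decay[OF \<open>d > 0\<close>] by blast
  define b where "b t = \<bar>if t < N then 0 else s t\<bar> + \<bar>if t < N then 0 else q t\<bar> / k" for t
  have [measurable]: "b \<in> borel_measurable lebesgue" unfolding b_def[abs_def] by measurable
  have "(\<integral>\<^sup>+t. ennreal (exp (- \<mu> * \<bar>x - t\<bar>)) * ennreal (b t) \<partial>lebesgue) \<le> ennreal e" for x
  proof -
    have loc: "(\<integral>\<^sup>+t. indicator {y..y+1} t * ennreal (b t) \<partial>lebesgue) \<le> ennreal D" for y
    proof -
      \<comment> \<open>The part of the window beyond \<open>N\<close> lies in a unit window that
        starts at or after \<open>N\<close>, where decay applies.\<close>
      define y' where "y' = max y N"
      have "(\<integral>\<^sup>+t. indicator {y..y+1} t * ennreal (b t) \<partial>lebesgue) \<le>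
        (\<integral>\<^sup>+t. ennreal (D / 2) * indicator {y'..y'+1} t + ennreal M * (indicator {y'..y'+1} t * ennreal ((s t)\<^sup>2 + \<bar>q t\<bar>)) \<partial>lebesgue)"
      proof (rule nn_integral_mono)
        fix t
        show "indicator {y..y+1} t * ennreal (b t) \<le>
          ennreal (D / 2) * indicator {y'..y'+1} t + ennreal M * (indicator {y'..y'+1} t * ennreal ((s t)\<^sup>2 + \<bar>q t\<bar>))"
        proof (cases "t \<in> {y..y+1} \<and> t \<ge> N")
          case True
          have "\<bar>s t\<bar> \<le> D / 2 + 1 / (2 * D) * (s t)\<^sup>2"
          proof -
            have "0 \<le> (\<bar>s t\<bar> - D)\<^sup>2" by simp
            then have "2 * D * \<bar>s t\<bar> \<le> D * D + (s t)\<^sup>2" by (simp add: power2_eq_square algebra_simps)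
            then have "2 * D * \<bar>s t\<bar> / (2 * D) \<le> (D * D + (s t)\<^sup>2) / (2 * D)" using D by (intro divide_right_mono) auto
            then show ?thesis using D by (simp add: add_divide_distrib)
          qed
          moreover have "1 / (2 * D) * (s t)\<^sup>2 \<le> M * (s t)\<^sup>2" "\<bar>q t\<bar> / k \<le> M * \<bar>q t\<bar>"
            using D assms mult_right_mono[of "1 / (2 * D)" M "(s t)\<^sup>2"] mult_right_mono[of "1 / k" M "\<bar>q t\<bar>"]
            by (simp_all add: M_def)
          ultimately have "b t \<le> D / 2 + M * ((s t)\<^sup>2 + \<bar>q t\<bar>)"
            using True by (simp add: b_def distrib_left)
          then have "ennreal (b t) \<le> ennreal (D / 2 + M * ((s t)\<^sup>2 + \<bar>q t\<bar>))" by (rule ennreal_leI)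
          also have "\<dots> = ennreal (D / 2) + ennreal M * ennreal ((s t)\<^sup>2 + \<bar>q t\<bar>)"
            using D M by (subst ennreal_plus) (auto simp: ennreal_mult simp del: ennreal_plus)
          finally have "ennreal (b t) \<le> ennreal (D / 2) + ennreal M * ennreal ((s t)\<^sup>2 + \<bar>q t\<bar>)" .
          moreover have "t \<in> {y'..y'+1}" using True by (auto simp: y'_def)
          ultimately show ?thesis using True by (simp del: ennreal_plus)
        next
          case False
          then show ?thesis by (auto simp: b_def indicator_def)
        qed
      qed
      also have "\<dots> = (\<integral>\<^sup>+t. ennreal (D / 2) * indicator {y'..y'+1} t \<partial>lebesgue) + (\<integral>\<^sup>+t. ennreal M * (indicator {y'..y'+1} t * ennreal ((s t)\<^sup>2 + \<bar>q t\<bar>)) \<partial>lebesgue)"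
        by (rule nn_integral_add) measurable
      also have "(\<integral>\<^sup>+t. ennreal (D / 2) * indicator {y'..y'+1} t \<partial>lebesgue) = ennreal (D / 2)"
        by (subst nn_integral_cmult_indicator) auto
      also have "(\<integral>\<^sup>+t. ennreal M * (indicator {y'..y'+1} t * ennreal ((s t)\<^sup>2 + \<bar>q t\<bar>)) \<partial>lebesgue)
        = ennreal M * (\<integral>\<^sup>+t. indicator {y'..y'+1} t * ennreal ((s t)\<^sup>2 + \<bar>q t\<bar>) \<partial>lebesgue)"
        by (rule nn_integral_cmult) measurable
      also have "\<dots> \<le> ennreal M * ennreal d"
        by (intro mult_left_mono N(2)) (auto simp: y'_def)
      also have "ennreal M * ennreal d = ennreal (D / 2)"
        using M D by (simp add: ennreal_mult[symmetric] d_def)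
      also have "ennreal (D / 2) + ennreal (D / 2) = ennreal D"
        using D by (subst ennreal_plus[symmetric]) auto
      finally show ?thesis by (simp add: add_left_mono)
    qed
    have "(\<integral>\<^sup>+t. ennreal (exp (- \<mu> * \<bar>x - t\<bar>)) * ennreal (b t) \<partial>lebesgue) \<le> ennreal (exp \<mu> * (2 / \<mu>)) * ennreal D"
      by (rule exp_kernel_uniform_local[OF _ assms(1) loc]) measurable
    also have "\<dots> = ennreal e"
      unfolding A_def[symmetric] using A D assms by (simp add: ennreal_mult[symmetric] D_def)
    finally show ?thesis .
  qed
  then show thesis using N(1) that by (simp add: b_def)
qed

text \<open>The principal root of \<open>- z\<close> has nonnegative real part, and this vanishes
  only if \<open>z\<close> is a nonnegative real. The bound 1 / 4 is the smallness that
  \<open>dichotomy_solution\<close> asks for.\<close>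

lemma dichotomy_setup:
  assumes "z \<notin> complex_of_real ` {0..}"
  obtains \<kappa> \<mu> N where "\<kappa>\<^sup>2 = - z" "Re \<kappa> = 2 * \<mu>" "\<mu> > 0" "N \<ge> 0"
    "\<And>x. (\<integral>\<^sup>+t. ennreal (exp (- \<mu> * \<bar>x - t\<bar>)) *
      ennreal (\<bar>if t < N then 0 else s t\<bar> + \<bar>if t < N then 0 else q t\<bar> / cmod \<kappa>) \<partial>lebesgue) \<le> ennreal (1 / 4)"
proof -
  define \<kappa> where "\<kappa> = csqrt (- z)"
  have k2: "\<kappa>\<^sup>2 = - z" by (simp add: \<kappa>_def)
  have "Re \<kappa> \<noteq> 0"
  proof
    assume "Re \<kappa> = 0"
    then have "\<kappa>\<^sup>2 = - complex_of_real ((Im \<kappa>)\<^sup>2)"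
      by (simp add: complex_eq_iff power2_eq_square)
    then have "z = complex_of_real ((Im \<kappa>)\<^sup>2)" using k2 by simp
    then show False using assms by (metis atLeast_iff image_eqI zero_le_power2)
  qed
  moreover have "Re \<kappa> \<ge> 0" unfolding \<kappa>_def using csqrt_principal[of "- z"] by auto
  ultimately have Re: "Re \<kappa> > 0" by simp
  then have "cmod \<kappa> > 0" by auto
  obtain N where "N \<ge> 0" "\<And>x. (\<integral>\<^sup>+t. ennreal (exp (- (Re \<kappa> / 2) * \<bar>x - t\<bar>)) *
      ennreal (\<bar>if t < N then 0 else s t\<bar> + \<bar>if t < N then 0 else q t\<bar> / cmod \<kappa>) \<partial>lebesgue) \<le> ennreal (1 / 4)"
    by (rule exp_kernel_small_tail[of "Re \<kappa> / 2" "cmod \<kappa>" "1 / 4"]) (use Re \<open>cmod \<kappa> > 0\<close> in auto)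
  then show thesis using that[of \<kappa> "Re \<kappa> / 2" N] k2 Re by simp
qed

lemma norm_from_dichotomy:
  fixes y1 y2 \<kappa> :: complex
  assumes "\<kappa> \<noteq> 0" "cmod (y2 + \<kappa> * y1) + cmod (y2 - \<kappa> * y1) \<le> 2 * e"
  shows "cmod y1 \<le> e / cmod \<kappa>" "cmod y1 + cmod y2 \<le> (1 / cmod \<kappa> + 1) * e"
proof -
  have "2 * \<kappa> * y1 = (y2 + \<kappa> * y1) - (y2 - \<kappa> * y1)" by simp
  then have "cmod (2 * \<kappa> * y1) = cmod ((y2 + \<kappa> * y1) - (y2 - \<kappa> * y1))" by (rule arg_cong)
  then have "cmod (2 * \<kappa> * y1) \<le> 2 * e"
    using norm_triangle_ineq4[of "y2 + \<kappa> * y1" "y2 - \<kappa> * y1"] assms(2) by linarith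
  then have "cmod \<kappa> * cmod y1 \<le> e" by (simp add: norm_mult)
  then show 1: "cmod y1 \<le> e / cmod \<kappa>" using assms(1) by (simp add: field_simps)
  have "2 * y2 = (y2 + \<kappa> * y1) + (y2 - \<kappa> * y1)" by simp
  then have "cmod (2 * y2) \<le> 2 * e" using norm_triangle_ineq[of "y2 + \<kappa> * y1" "y2 - \<kappa> * y1"] assms(2) by simp
  then show "cmod y1 + cmod y2 \<le> (1 / cmod \<kappa> + 1) * e" using 1 by (simp add: norm_mult algebra_simps)
qed

text \<open>\<open>dichotomy_solution\<close> without forcing and with \<open>c = 1\<close>; the
  prescribed value of the decaying component at \<open>N\<close> keeps the solution
  nontrivial.\<close>

lemma weyl_solution:
  assumes z: "z \<notin> complex_of_real ` {0..}"
  obtains \<psi> \<theta> C \<mu> x0 where "solves {0..} z (\<lambda>_. 0) \<psi> \<theta>" "\<mu> > 0"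
    "\<And>x. x \<ge> 0 \<Longrightarrow> cmod (\<psi> x) + cmod (\<theta> x) \<le> C * exp (- \<mu> * x)" "x0 \<ge> 0" "\<psi> x0 \<noteq> 0 \<or> \<theta> x0 \<noteq> 0"
proof -
  obtain \<kappa> \<mu> N where k: "\<kappa>\<^sup>2 = - z" "Re \<kappa> = 2 * \<mu>" "\<mu> > 0" "N \<ge> 0"
    "\<And>x. (\<integral>\<^sup>+t. ennreal (exp (- \<mu> * \<bar>x - t\<bar>)) *
      ennreal (\<bar>if t < N then 0 else s t\<bar> + \<bar>if t < N then 0 else q t\<bar> / cmod \<kappa>) \<partial>lebesgue) \<le> ennreal (1 / 4)"
    by (rule dichotomy_setup[OF z]) (rule that)
  have k0: "\<kappa> \<noteq> 0" using k(2,3) by auto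
  define sN where "sN t = (if t < N then 0 else s t)" for t
  define qN where "qN t = (if t < N then 0 else q t)" for t
  have sNm: "sN \<in> borel_measurable lebesgue" unfolding sN_def[abs_def] by measurable
  have qNm: "qN \<in> borel_measurable lebesgue" unfolding qN_def[abs_def] by measurable
  have small: "(\<integral>\<^sup>+t. ennreal (exp (- \<mu> * \<bar>x - t\<bar>)) * ennreal (\<bar>sN t\<bar> + \<bar>qN t\<bar> / cmod \<kappa>) \<partial>lebesgue) \<le> ennreal (1 / 4)" for x
    unfolding sN_def qN_def by (rule k(5))
  have zero: "sN t = 0 \<and> qN t = 0" if "t < N" for t using that by (simp add: sN_def qN_def)
  obtain y1 y2 :: "real \<Rightarrow> complex" where y:
    "primitive_on {N..} y1 (\<lambda>x. complex_of_real (sN x) * y1 x + y2 x)"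
    "primitive_on {N..} y2 (\<lambda>x. - complex_of_real (sN x) * y2 x + (complex_of_real (qN x) + \<kappa>\<^sup>2) * y1 x - 0)"
    "\<And>x. ennreal (cmod (y2 x + \<kappa> * y1 x) + cmod (y2 x - \<kappa> * y1 x)) \<le>
       2 * (ennreal (cmod 1 * exp (- \<mu> * max (x - N) 0)) +
        (\<integral>\<^sup>+t. ennreal (exp (- \<mu> * \<bar>x - t\<bar>)) * ennreal (cmod 0) \<partial>lebesgue))"
    "y2 N - \<kappa> * y1 N = 1"
  proof (rule dichotomy_solution[where c=1 and N=N and B=0 and f="\<lambda>_. 0", OF k(3,2) sNm qNm _ small _ zero])
    show "(\<integral>\<^sup>+t. ennreal (exp (- \<mu> * \<bar>x - t\<bar>)) * ennreal (cmod 0) \<partial>lebesgue) \<le> ennreal 0" for x by simp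
  qed (simp, assumption, rule that, assumption+, simp)
  have "solves {N..} z (\<lambda>_. 0) y1 y2"
    unfolding solves_def
  proof
    show "primitive_on {N..} y1 (\<lambda>x. complex_of_real (s x) * y1 x + y2 x)"
      by (rule iffD1[OF primitive_on_cong y(1)]) (auto simp: is_interval_ci sN_def)
    show "primitive_on {N..} y2 (\<lambda>x. - complex_of_real (s x) * y2 x + (complex_of_real (q x) - z) * y1 x - 0)"
      by (rule iffD1[OF primitive_on_cong y(2)]) (auto simp: is_interval_ci k(1) sN_def qN_def)
  qed
  then obtain \<psi> \<theta> where psi: "solves {0..} z (\<lambda>_. 0) \<psi> \<theta>" "\<And>x. x \<ge> N \<Longrightarrow> \<psi> x = y1 x" "\<And>x. x \<ge> N \<Longrightarrow> \<theta> x = y2 x"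
    by (rule solves_extend_left[OF _ _ k(4)]) (simp, rule that)
  have right: "cmod (\<psi> x) + cmod (\<theta> x) \<le> (1 / cmod \<kappa> + 1) * exp (\<mu> * N) * exp (- \<mu> * x)" if "x \<ge> N" for x
  proof -
    have "ennreal (cmod (y2 x + \<kappa> * y1 x) + cmod (y2 x - \<kappa> * y1 x)) \<le> ennreal 2 * ennreal (exp (- \<mu> * (x - N)))"
    proof -
      have "max (x - N) 0 = x - N" using that by simp
      then show ?thesis using y(3)[of x] by simp
    qed
    also have "\<dots> = ennreal (2 * exp (- \<mu> * (x - N)))" by (rule ennreal_mult[symmetric]) auto
    finally have "cmod (y2 x + \<kappa> * y1 x) + cmod (y2 x - \<kappa> * y1 x) \<le> 2 * exp (- \<mu> * (x - N))"
      by (subst (asm) ennreal_le_iff) auto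
    from norm_from_dichotomy(2)[OF k0 this] show ?thesis
      using that by (simp add: psi mult.assoc exp_add[symmetric] algebra_simps)
  qed
  have "continuous_on {0..N} (\<lambda>x. cmod (\<psi> x) + cmod (\<theta> x))"
    using solves_continuous[OF solves_subset[OF psi(1), of "{0..N}"]] by (auto intro!: continuous_intros)
  then have "bounded ((\<lambda>x. cmod (\<psi> x) + cmod (\<theta> x)) ` {0..N})"
    by (intro compact_imp_bounded compact_continuous_image) auto
  then obtain M where M: "\<And>x. x \<in> {0..N} \<Longrightarrow> cmod (\<psi> x) + cmod (\<theta> x) \<le> M"
    unfolding bounded_iff by fastforce
  have M0: "M \<ge> 0" using M[of 0] k(4) norm_ge_zero[of "\<psi> 0"] norm_ge_zero[of "\<theta> 0"] by (auto simp del: norm_ge_zero)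
  \<comment> \<open>The factor \<open>exp (\<mu> * N)\<close> accounts for measuring the decay from
    0 instead of \<open>N\<close>, and it makes \<open>C * exp (- \<mu> * x)\<close> at least
    \<open>M\<close> on \<open>{0..N}\<close>.\<close>
  define C where "C = ((1 / cmod \<kappa> + 1) + M) * exp (\<mu> * N)"
  have "cmod (\<psi> x) + cmod (\<theta> x) \<le> C * exp (- \<mu> * x)" if "x \<ge> 0" for x
  proof (cases "x \<ge> N")
    case True
    have "(1 / cmod \<kappa> + 1) * exp (\<mu> * N) * exp (- \<mu> * x) \<le> C * exp (- \<mu> * x)"
      unfolding C_def using M0 by (intro mult_right_mono) auto
    then show ?thesis using right[OF True] by linarith
  next
    case False
    have "M * 1 \<le> ((1 / cmod \<kappa> + 1) + M) * exp (\<mu> * (N - x))"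
      using False k(3) M0 by (intro mult_mono) auto
    also have "\<dots> = C * exp (- \<mu> * x)" by (simp add: C_def mult.assoc exp_add[symmetric] algebra_simps)
    finally show ?thesis using M[of x] that False by simp
  qed
  moreover have "\<psi> N \<noteq> 0 \<or> \<theta> N \<noteq> 0" using y(4) psi(2,3)[of N] by auto
  ultimately show thesis using that[OF psi(1) k(3)] k(4) by blast
qed

text \<open>\<open>dichotomy_solution\<close> with \<open>c = 0\<close>. Beyond \<open>N\<close> the
  solution is dominated by the exponential kernel applied to the forcing, which Schur's test bounds
  in the mean square and Cauchy--Schwarz pointwise; the pointwise bound at \<open>N\<close> is then
  carried back to \<open>{0..N}\<close> by Gronwall.\<close>

lemma particular_solution:
  assumes z: "z \<notin> complex_of_real ` {0..}"
  obtains K where "K \<ge> 0" "\<And>f. square_integrable f \<Longrightarrow> \<exists>u w. solves {0..} z (zero_ext f) u w \<and>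
    square_integrable u \<and> norm (abs_l2 u) \<le> K * norm (abs_l2 f) \<and> cmod (u 0) + cmod (w 0) \<le> K * norm (abs_l2 f)"
proof -
  obtain \<kappa> \<mu> N where k: "\<kappa>\<^sup>2 = - z" "Re \<kappa> = 2 * \<mu>" "\<mu> > 0" "N \<ge> 0"
    "\<And>x. (\<integral>\<^sup>+t. ennreal (exp (- \<mu> * \<bar>x - t\<bar>)) *
      ennreal (\<bar>if t < N then 0 else s t\<bar> + \<bar>if t < N then 0 else q t\<bar> / cmod \<kappa>) \<partial>lebesgue) \<le> ennreal (1 / 4)"
    by (rule dichotomy_setup[OF z]) (rule that)
  have k0: "\<kappa> \<noteq> 0" using k(2,3) by auto
  define k1 where "k1 = 1 / cmod \<kappa> + 1"
  define G where "G = exp (2 * integral {0..N} (growth z))"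
  \<comment> \<open>\<open>K1\<close> bounds the solution pointwise on \<open>{0..N}\<close>: the
    value at \<open>N\<close> plus the integral of the forcing, with \<open>sqrt N\<close> from
    Cauchy--Schwarz, times the Gronwall factor. \<open>K2\<close> joins the square norms of the two
    pieces, the second with the constant of Schur's test.\<close>
  define K1 where "K1 = 2 * (k1 * sqrt (2 / \<mu>) + sqrt N) * G"
  define K2 where "K2 = sqrt (N * K1\<^sup>2 + (1 / cmod \<kappa> * (2 / \<mu>))\<^sup>2)"
  have pos: "k1 \<ge> 0" "G \<ge> 0" "K1 \<ge> 0" "K2 \<ge> 0" using k by (auto simp: k1_def G_def K1_def K2_def)
  show thesis
  proof (rule that[of "K1 + K2"])
    show "K1 + K2 \<ge> 0" using pos by simp
    fix f assume f: "square_integrable f"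
    define L where "L = norm (abs_l2 f)"
    have L0: "L \<ge> 0" by (simp add: L_def)
    note fm [measurable] = zero_ext_measurable[OF f]
    define g where "g t = (if t < N then 0 else zero_ext f t)" for t
    have gm [measurable]: "g \<in> borel_measurable lebesgue" unfolding g_def[abs_def] by measurable
    have g2: "(\<integral>\<^sup>+t. (ennreal (cmod (g t)))\<^sup>2 \<partial>lebesgue) \<le> ennreal (L\<^sup>2)"
    proof -
      have "(\<integral>\<^sup>+t. (ennreal (cmod (g t)))\<^sup>2 \<partial>lebesgue) \<le> (\<integral>\<^sup>+t. (ennreal (cmod (zero_ext f t)))\<^sup>2 \<partial>lebesgue)"
        by (intro nn_integral_mono) (auto simp: g_def)
      then show ?thesis using nn_integral_zero_ext[OF f] by (simp add: L_def)
    qed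
    define F where "F x = (\<integral>\<^sup>+t. ennreal (exp (- \<mu> * \<bar>x - t\<bar>)) * ennreal (cmod (g t)) \<partial>lebesgue)" for x
    have F_le: "F x \<le> ennreal (sqrt (2 / \<mu>) * L)" for x
    proof (rule ennreal_power2_le_imp_le)
      have "(F x)\<^sup>2 \<le> ennreal (2 / \<mu>) * (\<integral>\<^sup>+t. (ennreal (cmod (g t)))\<^sup>2 \<partial>lebesgue)"
        unfolding F_def by (rule exp_kernel_square_le[OF _ k(3)]) measurable
      also have "\<dots> \<le> ennreal (2 / \<mu>) * ennreal (L\<^sup>2)" by (intro mult_left_mono g2) auto
      also have "\<dots> = (ennreal (sqrt (2 / \<mu>) * L))\<^sup>2"
        using k(3) L0 by (simp add: ennreal_power ennreal_mult[symmetric] power_mult_distrib)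
      finally show "(F x)\<^sup>2 \<le> (ennreal (sqrt (2 / \<mu>) * L))\<^sup>2" .
    qed (use k L0 in auto)
    have F_meas: "(\<integral>\<^sup>+x. (F x)\<^sup>2 \<partial>lebesgue) \<le> (ennreal (2 / \<mu>))\<^sup>2 * ennreal (L\<^sup>2)"
    proof -
      have "(\<integral>\<^sup>+x. (F x)\<^sup>2 \<partial>lebesgue) \<le> (ennreal (2 / \<mu>))\<^sup>2 * (\<integral>\<^sup>+t. (ennreal (cmod (g t)))\<^sup>2 \<partial>lebesgue)"
        unfolding F_def by (rule exp_kernel_schur[OF _ k(3)]) measurable
      also have "\<dots> \<le> (ennreal (2 / \<mu>))\<^sup>2 * ennreal (L\<^sup>2)" by (intro mult_left_mono g2) auto
      finally show ?thesis .
    qed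
    define sN where "sN t = (if t < N then 0 else s t)" for t
    define qN where "qN t = (if t < N then 0 else q t)" for t
    have sNm: "sN \<in> borel_measurable lebesgue" unfolding sN_def[abs_def] by measurable
    have qNm: "qN \<in> borel_measurable lebesgue" unfolding qN_def[abs_def] by measurable
    have small: "(\<integral>\<^sup>+t. ennreal (exp (- \<mu> * \<bar>x - t\<bar>)) * ennreal (\<bar>sN t\<bar> + \<bar>qN t\<bar> / cmod \<kappa>) \<partial>lebesgue) \<le> ennreal (1 / 4)" for x
      unfolding sN_def qN_def by (rule k(5))
    have zero: "sN t = 0 \<and> qN t = 0" if "t < N" for t using that by (simp add: sN_def qN_def)
    obtain y1 y2 :: "real \<Rightarrow> complex" where y:
      "primitive_on {N..} y1 (\<lambda>x. complex_of_real (sN x) * y1 x + y2 x)"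
      "primitive_on {N..} y2 (\<lambda>x. - complex_of_real (sN x) * y2 x + (complex_of_real (qN x) + \<kappa>\<^sup>2) * y1 x - g x)"
      "\<And>x. ennreal (cmod (y2 x + \<kappa> * y1 x) + cmod (y2 x - \<kappa> * y1 x)) \<le>
         2 * (ennreal (cmod 0 * exp (- \<mu> * max (x - N) 0)) + F x)"
    proof (rule dichotomy_solution[where c=0 and N=N, OF k(3,2) sNm qNm gm small F_le[unfolded F_def] zero])
    qed (assumption, rule that, assumption, assumption, simp only: F_def)
    have "solves {N..} z (zero_ext f) y1 y2"
      unfolding solves_def
    proof
      show "primitive_on {N..} y1 (\<lambda>x. complex_of_real (s x) * y1 x + y2 x)"
        by (rule iffD1[OF primitive_on_cong y(1)]) (auto simp: is_interval_ci sN_def)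
      show "primitive_on {N..} y2 (\<lambda>x. - complex_of_real (s x) * y2 x + (complex_of_real (q x) - z) * y1 x - zero_ext f x)"
        by (rule iffD1[OF primitive_on_cong y(2)]) (auto simp: is_interval_ci k(1) g_def sN_def qN_def)
    qed
    then obtain u w where u: "solves {0..} z (zero_ext f) u w" "\<And>x. x \<ge> N \<Longrightarrow> u x = y1 x" "\<And>x. x \<ge> N \<Longrightarrow> w x = y2 x"
      by (rule solves_extend_left[OF _ zero_ext_integral_Icc(1)[OF f k(4)] k(4)]) (rule that)
    have n_le: "ennreal (cmod (y2 x + \<kappa> * y1 x) + cmod (y2 x - \<kappa> * y1 x)) \<le> 2 * F x" for x
      using y(3)[of x] by simp
    have uN: "cmod (u N) + cmod (w N) \<le> k1 * (sqrt (2 / \<mu>) * L)"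
    proof -
      have "ennreal (cmod (y2 N + \<kappa> * y1 N) + cmod (y2 N - \<kappa> * y1 N)) \<le> ennreal 2 * ennreal (sqrt (2 / \<mu>) * L)"
        using order_trans[OF n_le mult_left_mono[OF F_le]] by simp
      also have "\<dots> = ennreal (2 * (sqrt (2 / \<mu>) * L))" using k L0 by (intro ennreal_mult[symmetric]) auto
      finally have "cmod (y2 N + \<kappa> * y1 N) + cmod (y2 N - \<kappa> * y1 N) \<le> 2 * (sqrt (2 / \<mu>) * L)"
        using k L0 by (subst (asm) ennreal_le_iff) auto
      from norm_from_dichotomy(2)[OF k0 this] show ?thesis by (simp add: u k1_def)
    qed
    have left: "cmod (u x) + cmod (w x) \<le> K1 * L" if "x \<in> {0..N}" for x
    proof -
      have "cmod (u x) + cmod (w x) \<le> 2 * (cmod (u N) + cmod (w N) + integral {0..N} (\<lambda>t. cmod (zero_ext f t))) * G"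
        unfolding G_def
        by (rule solves_growth[OF solves_subset[OF u(1)] zero_ext_integral_Icc(1)[OF f k(4)] that]) (use k in auto)
      also have "\<dots> \<le> 2 * (k1 * (sqrt (2 / \<mu>) * L) + sqrt N * L) * G"
        using uN zero_ext_integral_Icc(2)[OF f k(4)] pos
        by (intro mult_right_mono mult_left_mono add_mono) (auto simp: L_def)
      also have "\<dots> = K1 * L" by (simp add: K1_def algebra_simps)
      finally show ?thesis .
    qed
    \<comment> \<open>The two pieces are dominated by functions with separate supports or sources,
      so that the square norm splits into \<open>N\<close> times a constant and a Schur
      term.\<close>
    have u_pt: "(ennreal (cmod (zero_ext u x)))\<^sup>2 \<le> ennreal ((K1 * L)\<^sup>2) * indicator {0..N} x + ennreal ((1 / cmod \<kappa>)\<^sup>2) * (F x)\<^sup>2" for x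
    proof (cases "x \<le> N")
      case True
      have "(cmod (zero_ext u x))\<^sup>2 \<le> (K1 * L)\<^sup>2 * indicator {0..N} x"
      proof (cases "x > 0")
        case x: True
        then have "cmod (u x) \<le> K1 * L" using left[of x] True norm_ge_zero[of "w x"] by (auto simp del: norm_ge_zero)
        then show ?thesis using x True by (auto simp: zero_ext_def intro: power_mono)
      qed (auto simp: zero_ext_def)
      then have "ennreal ((cmod (zero_ext u x))\<^sup>2) \<le> ennreal ((K1 * L)\<^sup>2 * indicator {0..N} x)" by (rule ennreal_leI)
      also have "\<dots> = ennreal ((K1 * L)\<^sup>2) * indicator {0..N} x" by (simp add: ennreal_mult' ennreal_indicator)
      finally show ?thesis by (simp add: ennreal_power add_increasing2)
    next
      case False
      have "ennreal (cmod (y1 x)) \<le> ennreal (1 / cmod \<kappa>) * F x"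
      proof (cases "F x")
        case (real r)
        have "ennreal (cmod (y2 x + \<kappa> * y1 x) + cmod (y2 x - \<kappa> * y1 x)) \<le> ennreal (2 * r)"
          using n_le[of x] real by (simp add: ennreal_mult)
        then have "cmod (y2 x + \<kappa> * y1 x) + cmod (y2 x - \<kappa> * y1 x) \<le> 2 * r"
          using real by (subst (asm) ennreal_le_iff) auto
        from norm_from_dichotomy(1)[OF k0 this] have "ennreal (cmod (y1 x)) \<le> ennreal (1 / cmod \<kappa> * r)"
          by (intro ennreal_leI) simp
        also have "\<dots> = ennreal (1 / cmod \<kappa>) * F x" unfolding real by (rule ennreal_mult) (use real in auto)
        finally show ?thesis .
      next
        case top
        then show ?thesis using k0 by (simp add: ennreal_mult_top)
      qed
      then have "(ennreal (cmod (y1 x)))\<^sup>2 \<le> (ennreal (1 / cmod \<kappa>) * F x)\<^sup>2" by (intro power_mono) auto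
      also have "\<dots> = ennreal ((1 / cmod \<kappa>)\<^sup>2) * (F x)\<^sup>2" by (simp add: power_mult_distrib ennreal_power)
      finally show ?thesis using False k(4) u(2)[of x] by (simp add: zero_ext_def)
    qed
    have Fm: "F \<in> borel_measurable lebesgue"
    proof -
      have "(\<lambda>(x, t). ennreal (exp (- \<mu> * \<bar>x - t\<bar>)) * ennreal (cmod (g t))) \<in> borel_measurable (lebesgue \<Otimes>\<^sub>M lebesgue)"
        unfolding split_beta' by measurable
      from sigma_finite_measure.borel_measurable_nn_integral_fst[OF sigma_finite_lebesgue this]
      show ?thesis by (simp add: F_def[abs_def])
    qed
    have "(\<integral>\<^sup>+x. (ennreal (cmod (zero_ext u x)))\<^sup>2 \<partial>lebesgue)
      \<le> (\<integral>\<^sup>+x. ennreal ((K1 * L)\<^sup>2) * indicator {0..N} x + ennreal ((1 / cmod \<kappa>)\<^sup>2) * (F x)\<^sup>2 \<partial>lebesgue)"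
      by (rule nn_integral_mono) (rule u_pt)
    also have "\<dots> = (\<integral>\<^sup>+x. ennreal ((K1 * L)\<^sup>2) * indicator {0..N} x \<partial>lebesgue) + (\<integral>\<^sup>+x. ennreal ((1 / cmod \<kappa>)\<^sup>2) * (F x)\<^sup>2 \<partial>lebesgue)"
      by (rule nn_integral_add) (use Fm in measurable)
    also have "(\<integral>\<^sup>+x. ennreal ((K1 * L)\<^sup>2) * indicator {0..N} x \<partial>lebesgue) = ennreal ((K1 * L)\<^sup>2) * ennreal N"
      using k(4) by (subst nn_integral_cmult_indicator) auto
    also have "(\<integral>\<^sup>+x. ennreal ((1 / cmod \<kappa>)\<^sup>2) * (F x)\<^sup>2 \<partial>lebesgue) = ennreal ((1 / cmod \<kappa>)\<^sup>2) * (\<integral>\<^sup>+x. (F x)\<^sup>2 \<partial>lebesgue)"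
      by (rule nn_integral_cmult) (use Fm in measurable)
    also have "\<dots> \<le> ennreal ((1 / cmod \<kappa>)\<^sup>2) * ((ennreal (2 / \<mu>))\<^sup>2 * ennreal (L\<^sup>2))"
      by (intro mult_left_mono F_meas) auto
    also have "ennreal ((K1 * L)\<^sup>2) * ennreal N + ennreal ((1 / cmod \<kappa>)\<^sup>2) * ((ennreal (2 / \<mu>))\<^sup>2 * ennreal (L\<^sup>2))
       = ennreal ((K1 * L)\<^sup>2 * N + (1 / cmod \<kappa>)\<^sup>2 * ((2 / \<mu>)\<^sup>2 * L\<^sup>2))"
    proof -
      have "ennreal ((K1 * L)\<^sup>2) * ennreal N = ennreal ((K1 * L)\<^sup>2 * N)"
        by (rule ennreal_mult[symmetric]) (use k(4) in auto)
      moreover have "(ennreal (2 / \<mu>))\<^sup>2 * ennreal (L\<^sup>2) = ennreal ((2 / \<mu>)\<^sup>2 * L\<^sup>2)"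
        using k(3) by (subst ennreal_power, simp) (rule ennreal_mult[symmetric], auto)
      moreover have "ennreal ((1 / cmod \<kappa>)\<^sup>2) * ennreal ((2 / \<mu>)\<^sup>2 * L\<^sup>2) = ennreal ((1 / cmod \<kappa>)\<^sup>2 * ((2 / \<mu>)\<^sup>2 * L\<^sup>2))"
        by (rule ennreal_mult[symmetric]) auto
      ultimately show ?thesis using k(4) by (simp only:) (rule ennreal_plus[symmetric], auto)
    qed
    also have "(K1 * L)\<^sup>2 * N + (1 / cmod \<kappa>)\<^sup>2 * ((2 / \<mu>)\<^sup>2 * L\<^sup>2) = (K2 * L)\<^sup>2"
      using k(3,4) by (simp add: K2_def power_mult_distrib algebra_simps power_divide)
    finally have "(\<integral>\<^sup>+x. (ennreal (cmod (zero_ext u x)))\<^sup>2 \<partial>lebesgue) \<le> ennreal ((K2 * L)\<^sup>2)"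
      by (simp add: add_left_mono)
    moreover have "u \<in> borel_measurable half_line"
      by (rule continuous_imp_measurable_on_sets_lebesgue[OF continuous_on_subset[OF solves_continuous_Ici(1)[OF u(1)]]])
        auto
    ultimately have "square_integrable u" "norm (abs_l2 u) \<le> K2 * L"
      using square_integrableI[of u "K2 * L"] pos L0 by auto
    moreover have "K2 * L \<le> (K1 + K2) * L" "cmod (u 0) + cmod (w 0) \<le> (K1 + K2) * L"
      using left[of 0] k(4) pos L0 by (auto simp: distrib_right add_increasing2)
    ultimately show "\<exists>u w. solves {0..} z (zero_ext f) u w \<and> square_integrable u \<and>
        norm (abs_l2 u) \<le> (K1 + K2) * norm (abs_l2 f) \<and> cmod (u 0) + cmod (w 0) \<le> (K1 + K2) * norm (abs_l2 f)"
      using u(1) unfolding L_def by (intro exI[of _ u] exI[of _ w]) auto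
  qed
qed

lemma primitive_on_cnj: "primitive_on S u g \<Longrightarrow> primitive_on S (\<lambda>x. cnj (u x)) (\<lambda>x. cnj (g x))"
  by (rule primitive_on_linear[OF _ bounded_linear_cnj])

lemma solves_cnj:
  assumes "solves S z f u w"
  shows "solves S (cnj z) (\<lambda>x. cnj (f x)) (\<lambda>x. cnj (u x)) (\<lambda>x. cnj (w x))"
  using assms primitive_on_cnj[of S u] primitive_on_cnj[of S w] by (fastforce simp: solves_def)

text \<open>Lagrange's identity: the terms with \<open>s\<close> and \<open>q\<close> cancel and
  only the spectral parameters remain.\<close>

lemma wronskian_primitive:
  assumes S: "is_interval S" and u: "solves S z (\<lambda>_. 0) u w" and v: "solves S z' (\<lambda>_. 0) v y"
  shows "primitive_on S (\<lambda>x. u x * y x - w x * v x) (\<lambda>x. (z - z') * (u x * v x))"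
proof -
  have U: "primitive_on S u (\<lambda>x. complex_of_real (s x) * u x + w x)"
    "primitive_on S w (\<lambda>x. - complex_of_real (s x) * w x + (complex_of_real (q x) - z) * u x - 0)"
    using u by (auto simp: solves_def)
  have V: "primitive_on S v (\<lambda>x. complex_of_real (s x) * v x + y x)"
    "primitive_on S y (\<lambda>x. - complex_of_real (s x) * y x + (complex_of_real (q x) - z') * v x - 0)"
    using v by (auto simp: solves_def)
  have "primitive_on S (\<lambda>x. u x * y x - w x * v x)
    (\<lambda>x. ((complex_of_real (s x) * u x + w x) * y x + u x * (- complex_of_real (s x) * y x + (complex_of_real (q x) - z') * v x - 0))
      - ((- complex_of_real (s x) * w x + (complex_of_real (q x) - z) * u x - 0) * v x + w x * (complex_of_real (s x) * v x + y x)))"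
    by (rule primitive_on_diff[OF primitive_on_mult[OF S U(1) V(2)] primitive_on_mult[OF S U(2) V(1)]])
  moreover have "((complex_of_real (s x) * u x + w x) * y x + u x * (- complex_of_real (s x) * y x + (complex_of_real (q x) - z') * v x - 0))
      - ((- complex_of_real (s x) * w x + (complex_of_real (q x) - z) * u x - 0) * v x + w x * (complex_of_real (s x) * v x + y x))
      = (z - z') * (u x * v x)" for x
    by (simp add: algebra_simps)
  ultimately show ?thesis by (simp only:)
qed

text \<open>The \<open>L\<^sup>2\<close> norm of \<open>u\<close> does not control \<open>w\<close>. Integrating by parts against the weight
  \<open>(x - a) * (a + 1 - x)\<close>, which vanishes at the endpoints and has integral 1/6, eliminates \<open>w\<close> from the Wronskian.\<close>

lemma wronskian_average:
  assumes u: "solves {a..a+1} z (\<lambda>_. 0) u w" and v: "solves {a..a+1} z (\<lambda>_. 0) v y"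
    and W: "\<And>x. x \<in> {a..a+1} \<Longrightarrow> u x * y x - w x * v x = W"
  shows "((\<lambda>x. u x * (complex_of_real ((x - a) * (a + 1 - x)) * (2 * (y x + complex_of_real (s x) * v x))
      + complex_of_real (a + 1 - x - (x - a)) * v x)) has_integral W / 6) {a..a+1}"
proof -
  define \<eta> where "\<eta> x = complex_of_real ((x - a) * (a + 1 - x))" for x
  define \<eta>' where "\<eta>' x = complex_of_real (a + 1 - x - (x - a))" for x
  have eta: "primitive_on {a..a+1} \<eta> \<eta>'"
    unfolding \<eta>_def \<eta>'_def
    by (rule primitive_on_ftc[of "{}" "{a..a+1}"])
      (auto intro!: continuous_intros derivative_eq_intros has_vector_derivative_of_real simp: has_real_derivative_iff_has_vector_derivative[symmetric])
  have U: "primitive_on {a..a+1} u (\<lambda>x. complex_of_real (s x) * u x + w x)" using u by (auto simp: solves_def)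
  have V: "primitive_on {a..a+1} v (\<lambda>x. complex_of_real (s x) * v x + y x)" using v by (auto simp: solves_def)
  define g where "g x = (\<eta>' x * v x + \<eta> x * (complex_of_real (s x) * v x + y x)) * u x + (\<eta> x * v x) * (complex_of_real (s x) * u x + w x)" for x
  have P: "primitive_on {a..a+1} (\<lambda>x. (\<eta> x * v x) * u x) g"
    unfolding g_def by (intro primitive_on_mult eta U V) auto
  note g = primitive_onD[OF P, of a "a+1"]
  have "(g has_integral 0) {a..a+1}"
    using g integrable_integral[of g "{a..a+1}"] by (auto simp: absolutely_integrable_on_def \<eta>_def)
  moreover have "((\<lambda>x. \<eta> x * W) has_integral (W / 6)) {a..a+1}"
  proof -
    have "((\<lambda>x. (x - a) * (a + 1 - x)) has_integral ((a + 1 - a)\<^sup>2 / 2 - (a + 1 - a) ^ 3 / 3) - ((a - a)\<^sup>2 / 2 - (a - a) ^ 3 / 3)) {a..a+1}"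
    proof (rule fundamental_theorem_of_calculus)
      fix x
      have "((\<lambda>x. (x - a)\<^sup>2 / 2 - (x - a) ^ 3 / 3) has_real_derivative (x - a) * (a + 1 - x)) (at x within {a..a+1})"
        by (auto intro!: derivative_eq_intros simp: power2_eq_square field_simps)
      then show "((\<lambda>x. (x - a)\<^sup>2 / 2 - (x - a) ^ 3 / 3) has_vector_derivative (x - a) * (a + 1 - x)) (at x within {a..a+1})"
        by (simp add: has_real_derivative_iff_has_vector_derivative)
    qed simp
    then have "((\<lambda>x. (x - a) * (a + 1 - x)) has_integral 1 / 6) {a..a+1}" by simp
    then have "((complex_of_real \<circ> (\<lambda>x. (x - a) * (a + 1 - x))) has_integral complex_of_real (1 / 6)) {a..a+1}"
      by (rule has_integral_linear[OF _ bounded_linear_of_real])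
    then have "(\<eta> has_integral (1 / 6)) {a..a+1}" by (simp add: o_def \<eta>_def[abs_def])
    from has_integral_mult_left[OF this, of W] show ?thesis by simp
  qed
  ultimately have "((\<lambda>x. g x + \<eta> x * W) has_integral (0 + W / 6)) {a..a+1}"
    by (rule has_integral_add)
  then have "((\<lambda>x. g x + \<eta> x * W) has_integral W / 6) {a..a+1}" by simp
  then show ?thesis
  proof (rule has_integral_eq[rotated])
    fix x assume "x \<in> {a..a+1}"
    from W[OF this] have W': "\<eta> x * W = \<eta> x * (u x * y x) - \<eta> x * (w x * v x)"
      by (simp add: right_diff_distrib[symmetric])
    show "g x + \<eta> x * W = u x * (complex_of_real ((x - a) * (a + 1 - x)) * (2 * (y x + complex_of_real (s x) * v x))
      + complex_of_real (a + 1 - x - (x - a)) * v x)"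
      unfolding W' g_def \<eta>_def[symmetric] \<eta>'_def[symmetric] by (simp add: algebra_simps)
  qed
qed

text \<open>The Wronskian of \<open>u\<close> and \<psi> is constant. Its weighted mean over
  \<open>{a..a+1}\<close> involves \<open>u\<close>, \<psi> and \<theta> but not \<open>w\<close>,
  and tends to 0 with the decay of \<psi> and \<theta>. A vanishing Wronskian makes the data at
  \<open>x0\<close> proportional, and uniqueness does the rest.\<close>

lemma homogeneous_l2_multiple:
  assumes z: "solves {0..} z (\<lambda>_. 0) \<psi> \<theta>" and mu: "\<mu> > 0"
    and dec: "\<And>x. x \<ge> 0 \<Longrightarrow> cmod (\<psi> x) + cmod (\<theta> x) \<le> C * exp (- \<mu> * x)"
    and x0: "x0 \<ge> 0" "\<psi> x0 \<noteq> 0 \<or> \<theta> x0 \<noteq> 0"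
    and u: "solves {0..} z (\<lambda>_. 0) u w" "square_integrable u"
  obtains c where "\<And>x. x \<ge> 0 \<Longrightarrow> u x = c * \<psi> x" "\<And>x. x \<ge> 0 \<Longrightarrow> w x = c * \<theta> x"
proof -
  define W where "W = u 0 * \<theta> 0 - w 0 * \<psi> 0"
  have Wconst: "u x * \<theta> x - w x * \<psi> x = W" if "x \<ge> 0" for x
    using primitive_onD(2)[OF wronskian_primitive[OF is_interval_ci u(1) z], of 0 x] that by (simp add: W_def)
  define L where "L = (norm (abs_l2 u))\<^sup>2"
  have "cmod (\<psi> 0) + cmod (\<theta> 0) \<le> C" using dec[of 0] by simp
  then have C0: "C \<ge> 0" using norm_ge_zero[of "\<psi> 0"] norm_ge_zero[of "\<theta> 0"] by linarith
  obtain N where N: "N \<ge> 0" "\<And>x. x \<ge> N \<Longrightarrow> (\<integral>\<^sup>+t. indicator {x..x+1} t * ennreal ((s t)\<^sup>2 + \<bar>q t\<bar>) \<partial>lebesgue) \<le> ennreal 1"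
    using decay[of 1] by auto
  have bound: "cmod W / 6 \<le> C * exp (- \<mu> * a) * (2 * L + 20)" if a: "a \<ge> N" "a > 0" for a
  proof -
    have sub: "{a..a+1} \<subseteq> {0..}" using a by auto
    define h where "h x = u x * (complex_of_real ((x - a) * (a + 1 - x)) * (2 * (\<theta> x + complex_of_real (s x) * \<psi> x))
      + complex_of_real (a + 1 - x - (x - a)) * \<psi> x)" for x
    have hint: "(h has_integral W / 6) {a..a+1}"
      unfolding h_def by (rule wronskian_average[OF solves_subset[OF u(1) sub] solves_subset[OF z sub]]) (use Wconst a in auto)
    \<comment> \<open>Apart from the decaying factor, only the squares of \<open>u\<close> and
      \<open>s\<close> and a constant occur, and their integrals over unit intervals stay bounded as
      \<open>a\<close> grows.\<close>
    define k where "k x = C * exp (- \<mu> * a) * (2 * (cmod (u x))\<^sup>2 + 2 * (s x)\<^sup>2 + 10)" for x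
    have hk: "cmod (h x) \<le> k x" if x: "x \<in> {a..a+1}" for x
    proof -
      have x0: "x \<ge> 0" using x a by auto
      define e where "e = C * exp (- \<mu> * a)"
      have "exp (- \<mu> * x) \<le> exp (- \<mu> * a)" using x mu by auto
      then have "C * exp (- \<mu> * x) \<le> e" unfolding e_def using C0 by (rule mult_left_mono)
      then have pt: "cmod (\<psi> x) \<le> e" "cmod (\<theta> x) \<le> e"
        using dec[OF x0] norm_ge_zero[of "\<psi> x"] norm_ge_zero[of "\<theta> x"] by linarith+
      have e0: "e \<ge> 0" using pt(1) norm_ge_zero order_trans by blast
      have e1: "cmod (complex_of_real ((x - a) * (a + 1 - x))) \<le> 1" "cmod (complex_of_real (a + 1 - x - (x - a))) \<le> 1"
        using x by (auto simp del: of_real_mult of_real_diff of_real_add simp: abs_mult intro!: mult_le_one)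
      have "cmod (h x) \<le> cmod (u x) * (cmod (complex_of_real ((x - a) * (a + 1 - x))) * (2 * (cmod (\<theta> x) + \<bar>s x\<bar> * cmod (\<psi> x)))
        + cmod (complex_of_real (a + 1 - x - (x - a))) * cmod (\<psi> x))"
        unfolding h_def norm_mult
        by (intro mult_left_mono order_trans[OF norm_triangle_ineq] add_mono)
          (auto simp: norm_mult intro!: mult_left_mono order_trans[OF norm_triangle_ineq])
      also have "\<dots> \<le> cmod (u x) * (1 * (2 * (e + \<bar>s x\<bar> * e)) + 1 * e)"
        using pt e0 e1 by (intro mult_left_mono add_mono mult_mono) auto
      also have "\<dots> = e * (cmod (u x) * (3 + 2 * \<bar>s x\<bar>))" by (simp add: algebra_simps)
      also have "\<dots> \<le> e * (2 * (cmod (u x))\<^sup>2 + 2 * (s x)\<^sup>2 + 10)"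
      proof (rule mult_left_mono[OF _ e0])
        have "0 \<le> (cmod (u x) - 3 / 2)\<^sup>2" "0 \<le> (cmod (u x) - \<bar>s x\<bar>)\<^sup>2" by simp_all
        then have "3 * cmod (u x) \<le> (cmod (u x))\<^sup>2 + 10" "2 * (cmod (u x) * \<bar>s x\<bar>) \<le> (cmod (u x))\<^sup>2 + (s x)\<^sup>2"
          by (simp_all add: power2_eq_square algebra_simps)
        moreover have "cmod (u x) * (3 + 2 * \<bar>s x\<bar>) = 3 * cmod (u x) + 2 * (cmod (u x) * \<bar>s x\<bar>)"
          by (simp add: algebra_simps)
        ultimately show "cmod (u x) * (3 + 2 * \<bar>s x\<bar>) \<le> 2 * (cmod (u x))\<^sup>2 + 2 * (s x)\<^sup>2 + 10"
          using zero_le_power2[of "s x"] by linarith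
      qed
      finally show ?thesis by (simp add: k_def e_def)
    qed
    have ui: "(\<lambda>x. (cmod (u x))\<^sup>2) integrable_on {a..a+1}"
      using solves_continuous_Ici(1)[OF u(1)] sub
      by (intro integrable_continuous_real continuous_intros) (auto intro: continuous_on_subset)
    have si: "(\<lambda>x. (s x)\<^sup>2) integrable_on {a..a+1}" using s2_int[of a "a+1"] by (auto simp: absolutely_integrable_on_def)
    have I1: "integral {a..a+1} (\<lambda>x. (cmod (u x))\<^sup>2) \<le> L"
    proof -
      have ih: "integrable half_line (\<lambda>x. (cmod (u x))\<^sup>2)" using u(2) by (simp add: square_integrable_def)
      then have "(\<lambda>x. (cmod (u x))\<^sup>2) integrable_on {0<..}" by (rule integrable_on_lebesgue_on) simp
      then have "integral {a..a+1} (\<lambda>x. (cmod (u x))\<^sup>2) \<le> integral {0<..} (\<lambda>x. (cmod (u x))\<^sup>2)"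
        using ui a by (intro integral_subset_le) auto
      also have "\<dots> = L"
        using lebesgue_integral_eq_integral[OF ih] by (simp add: L_def norm_abs_l2_square[OF u(2)])
      finally show ?thesis .
    qed
    have I2: "integral {a..a+1} (\<lambda>x. (s x)\<^sup>2) \<le> 1"
    proof -
      have "ennreal (integral {a..a+1} (\<lambda>x. (s x)\<^sup>2)) = (\<integral>\<^sup>+t. ennreal (indicator {a..a+1} t *\<^sub>R (s t)\<^sup>2) \<partial>lebesgue)"
        using set_lebesgue_integral_eq_integral(2)[OF s2_int[of a "a+1"]] s2_int[of a "a+1"]
        by (subst nn_integral_eq_integral) (auto simp: set_integrable_def set_lebesgue_integral_def)
      also have "\<dots> \<le> (\<integral>\<^sup>+t. indicator {a..a+1} t * ennreal ((s t)\<^sup>2 + \<bar>q t\<bar>) \<partial>lebesgue)"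
        by (intro nn_integral_mono) (auto simp: indicator_def simp del: ennreal_plus intro: ennreal_leI)
      also have "\<dots> \<le> ennreal 1" using N(2) a by blast
      finally show ?thesis by (subst (asm) ennreal_le_iff) auto
    qed
    have "k integrable_on {a..a+1}"
      unfolding k_def using ui si
      by (intro integrable_on_mult_right Henstock_Kurzweil_Integration.integrable_add integrable_const_ivl)
    then have "cmod (integral {a..a+1} h) \<le> integral {a..a+1} k"
      using hint hk by (intro integral_norm_bound_integral) auto
    also have "integral {a..a+1} k = C * exp (- \<mu> * a) * (2 * integral {a..a+1} (\<lambda>x. (cmod (u x))\<^sup>2) + 2 * integral {a..a+1} (\<lambda>x. (s x)\<^sup>2) + 10)"
    proof -
      have "((\<lambda>x. 2 * (cmod (u x))\<^sup>2 + 2 * (s x)\<^sup>2 + 10) has_integral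
        (2 * integral {a..a+1} (\<lambda>x. (cmod (u x))\<^sup>2) + 2 * integral {a..a+1} (\<lambda>x. (s x)\<^sup>2) + 10 * (a + 1 - a))) {a..a+1}"
        using has_integral_const_real[of "10::real" a "a+1"]
        by (intro has_integral_add has_integral_mult_right integrable_integral ui si) (simp add: mult.commute)
      then have "((\<lambda>x. 2 * (cmod (u x))\<^sup>2 + 2 * (s x)\<^sup>2 + 10) has_integral
        (2 * integral {a..a+1} (\<lambda>x. (cmod (u x))\<^sup>2) + 2 * integral {a..a+1} (\<lambda>x. (s x)\<^sup>2) + 10)) {a..a+1}"
        by simp
      from has_integral_mult_right[OF this, of "C * exp (- \<mu> * a)"] show ?thesis
        unfolding k_def by (rule integral_unique)
    qed
    also have "\<dots> \<le> C * exp (- \<mu> * a) * (2 * L + 20)"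
      using I1 I2 C0 by (intro mult_left_mono) auto
    finally show ?thesis using integral_unique[OF hint] by (simp add: norm_divide)
  qed
  have "((\<lambda>a. C * exp (- \<mu> * a) * (2 * L + 20)) \<longlongrightarrow> C * 0 * (2 * L + 20)) at_top"
    by (intro tendsto_intros filterlim_compose[OF exp_at_bot] filterlim_tendsto_neg_mult_at_bot[OF tendsto_const _ filterlim_ident])
      (use mu in auto)
  then have "cmod W / 6 \<le> C * 0 * (2 * L + 20)"
  proof (rule tendsto_lowerbound)
    show "\<forall>\<^sub>F a in at_top. cmod W / 6 \<le> C * exp (- \<mu> * a) * (2 * L + 20)"
      using eventually_gt_at_top[of "max N 0"] by eventually_elim (rule bound, auto)
  qed simp
  then have W0: "W = 0" by simp
  \<comment> \<open>Whichever entry is nonzero at \<open>x0\<close> fixes the factor; the vanishing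
    Wronskian yields the other entry.\<close>
  define c where "c = (if \<psi> x0 \<noteq> 0 then u x0 / \<psi> x0 else w x0 / \<theta> x0)"
  have "u x0 * \<theta> x0 = w x0 * \<psi> x0" using Wconst[OF x0(1)] W0 by simp
  then have c: "u x0 = c * \<psi> x0" "w x0 = c * \<theta> x0"
    using x0(2) by (auto simp: c_def field_simps)
  have cz: "solves {0..} z (\<lambda>_. 0) (\<lambda>x. c * \<psi> x) (\<lambda>x. c * \<theta> x)" using solves_cmult[OF z, of c] by simp
  show thesis
    by (rule that[of c]) (use solves_unique_Ici[OF u(1) cz x0(1) c] in auto)
qed

end

section \<open>Passage between the graph \<open>H\<close> and solutions of the system\<close>

section \<open>The operator in terms of the first-order system\<close>

lemma greaterThan_subset_Ici: "{0<..} \<subseteq> {0::real..}"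
  by auto

lemma AE_half_line_iff: "(AE x in half_line. P x) \<longleftrightarrow> (AE x in lebesgue. x \<in> {0<..} \<longrightarrow> P x)"
  by (rule AE_restrict_space_iff) simp

lemma continuous_on_AE_eq:
  fixes f g :: "real \<Rightarrow> complex"
  assumes f: "continuous_on {0<..} f" and g: "continuous_on {0<..} g"
    and eq: "AE x in half_line. f x = g x" and x: "x > 0"
  shows "f x = g x"
proof (rule ccontr)
  assume ne: "f x \<noteq> g x"
  define S where "S = {0<..} \<inter> (\<lambda>x. f x - g x) -` (- {0})"
  have "open S"
    unfolding S_def by (rule continuous_open_preimage[OF continuous_on_diff[OF f g]]) auto
  moreover have "x \<in> S" using ne x by (simp add: S_def)
  ultimately have "\<not> negligible S" using open_not_negligible by blast
  moreover have "negligible S"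
  proof -
    have "AE x in lebesgue. x \<notin> S"
      using eq unfolding AE_half_line_iff by eventually_elim (auto simp: S_def)
    then show ?thesis
      by (simp add: negligible_iff_null_sets completion.AE_iff_null_sets) 
  qed
  ultimately show False by blast
qed

lemma square_integrable_AE_cong:
  assumes f: "square_integrable f" and eq: "AE x in half_line. f x = g x"
  shows "square_integrable g" "abs_l2 g = abs_l2 f"
proof -
  have "AE x in lebesgue. zero_ext f x = zero_ext g x"
    using eq unfolding AE_half_line_iff by eventually_elim (auto simp: zero_ext_def)
  from borel_measurable_AE[OF zero_ext_measurable[OF f] this]
  have "zero_ext g \<in> borel_measurable half_line" by (rule measurable_restrict_space1)
  then have gm: "g \<in> borel_measurable half_line"
    by (rule measurable_cong[THEN iffD1, rotated]) (simp add: zero_ext_def)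
  have "AE x in half_line. (cmod (f x))\<^sup>2 = (cmod (g x))\<^sup>2" using eq by eventually_elim simp
  then have "integrable half_line (\<lambda>x. (cmod (g x))\<^sup>2)"
    using f gm integrable_cong_AE[of "\<lambda>x. (cmod (f x))\<^sup>2" half_line "\<lambda>x. (cmod (g x))\<^sup>2"]
    by (auto simp: square_integrable_def)
  then show g: "square_integrable g" using gm by (simp add: square_integrable_def)
  have "l2_rel f g" using f g eq by (simp add: l2_rel_def)
  then show "abs_l2 g = abs_l2 f" by (metis Quotient_l2 Quotient_rel_abs)
qed

lemma square_integrable_cong:
  assumes "square_integrable f" "\<And>x. x > 0 \<Longrightarrow> f x = g x"
  shows "square_integrable g" "abs_l2 g = abs_l2 f"
  using square_integrable_AE_cong[OF assms(1), of g] assms(2) by (auto simp: AE_half_line_iff)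

lemma abs_l2_eqD:
  assumes "square_integrable f" "square_integrable g" "abs_l2 f = abs_l2 g"
  shows "AE x in half_line. f x = g x"
proof -
  have "l2_rel f g"
    using assms Quotient_rel[OF Quotient_l2, of f g] by (simp add: l2_rel_def)
  then show ?thesis by (simp add: l2_rel_def)
qed

lemma abs_l2_add:
  "square_integrable f \<Longrightarrow> square_integrable g \<Longrightarrow> abs_l2 f + abs_l2 g = abs_l2 (\<lambda>x. f x + g x)"
  by (rule plus_l2.abs_eq) (auto simp: l2_rel_def)

lemma abs_l2_scaleC: "square_integrable f \<Longrightarrow> c *\<^sub>C abs_l2 f = abs_l2 (\<lambda>x. c * f x)"
  by (rule scaleC.abs_eq) (auto simp: l2_rel_def)

lemma abs_l2_inner:
  assumes "square_integrable f" "square_integrable g"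
  shows "abs_l2 f \<bullet> abs_l2 g = (\<integral>x. f x \<bullet> g x \<partial>half_line)"
  by (rule inner_l2.abs_eq) (use assms in \<open>auto simp: l2_rel_def\<close>)

lemma abs_l2_cases:
  obtains f where "square_integrable f" "p = abs_l2 f"
proof -
  have "l2_rel (rep_l2 p) (rep_l2 p)" by (rule Quotient_rep_reflp[OF Quotient_l2])
  then show thesis
    using that[of "rep_l2 p"] by (simp add: l2_rel_def Quotient_abs_rep[OF Quotient_l2])
qed

text \<open>\<open>quasi_derivative\<close> is picked by \<open>SOME\<close>; uniqueness identifies
  it, on the open half-line, with the second component of a solution.\<close>

lemma is_quasi_derivative_unique:
  assumes "is_quasi_derivative \<sigma> u w" "is_quasi_derivative \<sigma> u w'" "x > 0"
  shows "w x = w' x"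
proof (rule continuous_on_AE_eq[OF _ _ _ assms(3)])
  have c: "continuous_on {0<..} v" if "AC_loc v" for v
  proof -
    have P: "primitive_on {0<..} v (\<lambda>x. vector_derivative v (at x))" using that by (simp add: AC_loc_iff_primitive)
    have "isCont v x" if "x > 0" for x
    proof -
      have "{x / 2..} \<subseteq> {0<..}" using that by auto
      from primitive_on_continuous[OF primitive_on_subset[OF P this]] show ?thesis
        by (rule continuous_on_interior) (use that in simp)
    qed
    then show ?thesis by (simp add: continuous_at_imp_continuous_on)
  qed
  show "continuous_on {0<..} w" "continuous_on {0<..} w'"
    using assms(1,2) by (auto simp: is_quasi_derivative_def intro: c)
  have "AE x in half_line. w x = vector_derivative u (at x) - complex_of_real (\<sigma> x) * u x"
    "AE x in half_line. w' x = vector_derivative u (at x) - complex_of_real (\<sigma> x) * u x"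
    using assms(1,2) by (auto simp: is_quasi_derivative_def)
  then show "AE x in half_line. w x = w' x" by eventually_elim simp
qed

lemma Lim_at_right_0:
  fixes u v :: "real \<Rightarrow> complex"
  assumes "continuous_on {0..} u" "\<And>x. x > 0 \<Longrightarrow> v x = u x"
  shows "Lim (at_right 0) v = u 0"
proof (rule tendsto_Lim)
  have "(u \<longlongrightarrow> u 0) (at 0 within {0..})" using assms(1) by (auto simp: continuous_on_def)
  then have "(u \<longlongrightarrow> u 0) (at_right 0)" by (rule tendsto_within_subset) auto
  moreover have "\<forall>\<^sub>F x in at_right 0. u x = v x"
    using eventually_at_right_less[of 0] by eventually_elim (simp add: assms(2))
  ultimately show "(v \<longlongrightarrow> u 0) (at_right 0)" by (rule Lim_transform_eventually)
qed simp

locale half_line_operator = sturm_liouville +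
  fixes \<sigma> \<tau> :: "real \<Rightarrow> real" and \<alpha> :: real
  assumes s_eq: "\<And>t. t > 0 \<Longrightarrow> s t = \<sigma> t" and q_eq: "\<And>t. t > 0 \<Longrightarrow> q t = \<tau> t - (\<sigma> t)\<^sup>2"
begin

definition boundary :: "(real \<Rightarrow> complex) \<Rightarrow> (real \<Rightarrow> complex) \<Rightarrow> complex" where
  "boundary u w = u 0 * complex_of_real (cos \<alpha>) + w 0 * complex_of_real (sin \<alpha>)"

text \<open>\<open>zero_ext\<close> puts 0 at the origin; a density may be changed on this null
  set.\<close>

lemma solves_forcing_cong:
  assumes "solves {0..} z f u w" "\<And>x. x > 0 \<Longrightarrow> f x = g x"
  shows "solves {0..} z g u w"
  unfolding solves_def
proof
  have "AE x in lebesgue. x \<notin> {0::real}" by (rule AE_not_in) simp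
  then have "AE x in lebesgue. x \<in> {0..} \<longrightarrow> - complex_of_real (s x) * w x + (complex_of_real (q x) - z) * u x - f x =
      - complex_of_real (s x) * w x + (complex_of_real (q x) - z) * u x - g x"
    by eventually_elim (auto simp: assms(2))
  then show "primitive_on {0..} w (\<lambda>x. - complex_of_real (s x) * w x + (complex_of_real (q x) - z) * u x - g x)"
    by (rule primitive_on_AE_cong[rotated]) (use assms(1) in \<open>auto simp: solves_def is_interval_ci\<close>)
qed (use assms(1) in \<open>simp add: solves_def\<close>)

lemma solves_in_H:
  assumes sol: "solves {0..} 0 (zero_ext f) u w" and sq: "square_integrable u" "square_integrable f"
    and bc: "boundary u w = 0"
  shows "(abs_l2 u, abs_l2 f) \<in> H \<sigma> \<tau> \<alpha>"
proof -
  have pu: "primitive_on {0<..} u (\<lambda>x. complex_of_real (s x) * u x + w x)"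
    and pw: "primitive_on {0<..} w (\<lambda>x. - complex_of_real (s x) * w x + (complex_of_real (q x) - 0) * u x - zero_ext f x)"
    using solves_subset[OF sol greaterThan_subset_Ici] by (auto simp: solves_def)
  have AEpos: "AE x in half_line. x > 0" by (simp add: AE_half_line_iff)
  have qd: "is_quasi_derivative \<sigma> u w"
    unfolding is_quasi_derivative_def
  proof
    show "AC_loc w" by (rule primitive_on_imp_AC_loc[OF pw])
    show "AE x in half_line. w x = vector_derivative u (at x) - complex_of_real (\<sigma> x) * u x"
      using primitive_on_AE_derivative_Ioi[OF pu] AEpos
      by eventually_elim (simp add: vector_derivative_at s_eq)
  qed
  define w' where "w' = quasi_derivative \<sigma> u"
  have qd': "is_quasi_derivative \<sigma> u w'"
    unfolding w'_def quasi_derivative_def by (rule someI[of "is_quasi_derivative \<sigma> u", OF qd])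
  have w'_eq: "w' x = w x" if "x > 0" for x
    by (rule is_quasi_derivative_unique[OF qd' qd that])
  have "AE x in half_line. f x = ell \<sigma> \<tau> u x"
    using primitive_on_AE_derivative_Ioi[OF pw] AEpos
  proof eventually_elim
    fix x assume d: "(w has_vector_derivative - complex_of_real (s x) * w x + (complex_of_real (q x) - 0) * u x - zero_ext f x) (at x)" and x: "x > 0"
    \<comment> \<open>\<open>w'\<close> and \<open>w\<close> agree on the open half-line only, so
      the derivative is transported on that open set.\<close>
    from d have "(w' has_vector_derivative - complex_of_real (s x) * w x + (complex_of_real (q x) - 0) * u x - zero_ext f x) (at x)"
      by (rule has_vector_derivative_transform_within_open[of _ _ _ "{0<..}"]) (use x w'_eq in auto)
    then have "vector_derivative w' (at x) = - complex_of_real (s x) * w x + (complex_of_real (q x) - 0) * u x - zero_ext f x"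
      by (rule vector_derivative_at)
    then show "f x = ell \<sigma> \<tau> u x"
      using x w'_eq[OF x] by (simp add: ell_def w'_def[symmetric] s_eq q_eq zero_ext_def algebra_simps)
  qed
  note ell = square_integrable_AE_cong[OF sq(2) this]
  have "u \<in> dom_H \<sigma> \<tau> \<alpha>"
    unfolding dom_H_def
  proof (intro CollectI conjI)
    show "u \<in> \<DD> \<sigma>" using qd primitive_on_imp_AC_loc[OF pu] by (auto simp: \<DD>_def)
    have "Lim (at_right 0) u = u 0" "Lim (at_right 0) (quasi_derivative \<sigma> u) = w 0"
      using Lim_at_right_0[OF solves_continuous_Ici(1)[OF sol]] Lim_at_right_0[OF solves_continuous_Ici(2)[OF sol]] w'_eq
      by (auto simp: w'_def)
    then show "Lim (at_right 0) u * complex_of_real (cos \<alpha>) + Lim (at_right 0) (quasi_derivative \<sigma> u) * complex_of_real (sin \<alpha>) = 0"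
      using bc by (simp add: boundary_def)
  qed (use sq ell in auto)
  then show ?thesis unfolding H_def using ell(2) by (intro CollectI exI[of _ u]) auto
qed

text \<open>An element of the domain is known on the open half-line. Solving from the point 1 down
  to 0 gives a solution on the closed half-line, which agrees with the given one by uniqueness and
  is continuous at 0; so the one-sided limits in the boundary condition are its values at 0.\<close>

lemma in_H_solves:
  assumes "(p, v) \<in> H \<sigma> \<tau> \<alpha>"
  obtains u w f where "solves {0..} 0 (zero_ext f) u w" "square_integrable u" "square_integrable f"
    "p = abs_l2 u" "v = abs_l2 f" "boundary u w = 0"
proof -
  obtain u0 where u0: "u0 \<in> dom_H \<sigma> \<tau> \<alpha>" "p = abs_l2 u0" "v = abs_l2 (ell \<sigma> \<tau> u0)"
    using assms by (auto simp: H_def)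
  define f where "f = ell \<sigma> \<tau> u0"
  define w0 where "w0 = quasi_derivative \<sigma> u0"
  have d: "square_integrable u0" "u0 \<in> \<DD> \<sigma>" "square_integrable f"
    "Lim (at_right 0) u0 * complex_of_real (cos \<alpha>) + Lim (at_right 0) w0 * complex_of_real (sin \<alpha>) = 0"
    using u0(1) by (auto simp: dom_H_def f_def w0_def)
  have AEpos: "AE x in half_line. x > 0" by (simp add: AE_half_line_iff)
  have ac: "AC_loc u0" and qd: "is_quasi_derivative \<sigma> u0 w0"
    using d(2) unfolding w0_def quasi_derivative_def by (auto simp: \<DD>_def intro: someI[of "is_quasi_derivative \<sigma> u0"])
  have pu: "primitive_on {0<..} u0 (\<lambda>x. vector_derivative u0 (at x))" using ac by (simp add: AC_loc_iff_primitive)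
  have pw: "primitive_on {0<..} w0 (\<lambda>x. vector_derivative w0 (at x))"
    using qd by (simp add: AC_loc_iff_primitive is_quasi_derivative_def)
  have "solves {0<..} 0 (zero_ext f) u0 w0"
    unfolding solves_def
  proof
    have "AE x in half_line. w0 x = vector_derivative u0 (at x) - complex_of_real (\<sigma> x) * u0 x"
      using qd by (simp add: is_quasi_derivative_def)
    then have "AE x in lebesgue. x \<in> {0<..} \<longrightarrow> vector_derivative u0 (at x) = complex_of_real (s x) * u0 x + w0 x"
      unfolding AE_half_line_iff by eventually_elim (auto simp: s_eq)
    then show "primitive_on {0<..} u0 (\<lambda>x. complex_of_real (s x) * u0 x + w0 x)"
      by (rule primitive_on_AE_cong[OF pu]) (simp add: is_interval_oi)
    show "primitive_on {0<..} w0 (\<lambda>x. - complex_of_real (s x) * w0 x + (complex_of_real (q x) - 0) * u0 x - zero_ext f x)"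
      by (rule iffD1[OF primitive_on_cong pw])
        (auto simp: is_interval_oi f_def zero_ext_def ell_def w0_def s_eq q_eq)
  qed
  note sol0 = this
  have "solves {1..} 0 (zero_ext f) u0 w0" by (rule solves_subset[OF sol0]) auto
  then obtain u w where uw: "solves {0..} 0 (zero_ext f) u w" "\<And>x. x \<ge> 1 \<Longrightarrow> u x = u0 x" "\<And>x. x \<ge> 1 \<Longrightarrow> w x = w0 x"
    by (rule solves_extend_left[OF _ zero_ext_integral_Icc(1)[OF d(3)]]) (auto intro: that)
  have eq: "u x = u0 x" "w x = w0 x" if "x > 0" for x
  proof -
    have "solves {x..max x 1} 0 (zero_ext f) u w" "solves {x..max x 1} 0 (zero_ext f) u0 w0"
      using that by (auto intro: solves_subset[OF uw(1)] solves_subset[OF sol0])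
    from solves_unique[OF this, of "max x 1" x] uw(2,3)[of "max x 1"]
    show "u x = u0 x" "w x = w0 x" by auto
  qed
  note su = square_integrable_cong[OF d(1), of u]
  have "Lim (at_right 0) u0 = u 0" "Lim (at_right 0) w0 = w 0"
    using Lim_at_right_0[OF solves_continuous_Ici(1)[OF uw(1)], of u0] Lim_at_right_0[OF solves_continuous_Ici(2)[OF uw(1)], of w0] eq
    by auto
  then have "boundary u w = 0" using d(4) by (simp add: boundary_def)
  then show thesis
    by (rule that[OF uw(1) _ d(3), rotated 3]) (use su eq u0 in \<open>auto simp: f_def\<close>)
qed

lemma H_add:
  assumes "(p, v) \<in> H \<sigma> \<tau> \<alpha>" "(p', v') \<in> H \<sigma> \<tau> \<alpha>"
  shows "(p + p', v + v') \<in> H \<sigma> \<tau> \<alpha>"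
proof -
  obtain u w f where 1: "solves {0..} 0 (zero_ext f) u w" "square_integrable u" "square_integrable f"
    "p = abs_l2 u" "v = abs_l2 f" "boundary u w = 0" by (rule in_H_solves[OF assms(1)])
  obtain u' w' f' where 2: "solves {0..} 0 (zero_ext f') u' w'" "square_integrable u'" "square_integrable f'"
    "p' = abs_l2 u'" "v' = abs_l2 f'" "boundary u' w' = 0" by (rule in_H_solves[OF assms(2)])
  have "(\<lambda>x. zero_ext f x + zero_ext f' x) = zero_ext (\<lambda>x. f x + f' x)" by (auto simp: zero_ext_def)
  then have "solves {0..} 0 (zero_ext (\<lambda>x. f x + f' x)) (\<lambda>x. u x + u' x) (\<lambda>x. w x + w' x)"
    using solves_add[OF 1(1) 2(1)] by simp
  note solves_in_H[OF this square_integrable_add[OF 1(2) 2(2)] square_integrable_add[OF 1(3) 2(3)]]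
  moreover have "boundary (\<lambda>x. u x + u' x) (\<lambda>x. w x + w' x) = boundary u w + boundary u' w'"
    by (simp add: boundary_def algebra_simps)
  ultimately show ?thesis using 1 2 by (simp add: abs_l2_add)
qed

lemma H_scaleC:
  assumes "(p, v) \<in> H \<sigma> \<tau> \<alpha>"
  shows "(c *\<^sub>C p, c *\<^sub>C v) \<in> H \<sigma> \<tau> \<alpha>"
proof -
  obtain u w f where 1: "solves {0..} 0 (zero_ext f) u w" "square_integrable u" "square_integrable f"
    "p = abs_l2 u" "v = abs_l2 f" "boundary u w = 0" by (rule in_H_solves[OF assms(1)])
  have "(\<lambda>x. c * zero_ext f x) = zero_ext (\<lambda>x. c * f x)" by (auto simp: zero_ext_def)
  then have "solves {0..} 0 (zero_ext (\<lambda>x. c * f x)) (\<lambda>x. c * u x) (\<lambda>x. c * w x)"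
    using solves_cmult[OF 1(1), of c] by simp
  from solves_in_H[OF this square_integrable_scale[OF 1(2)] square_integrable_scale[OF 1(3)]]
  have "c * boundary u w = 0 \<Longrightarrow> (abs_l2 (\<lambda>x. c * u x), abs_l2 (\<lambda>x. c * f x)) \<in> H \<sigma> \<tau> \<alpha>"
    by (simp add: boundary_def algebra_simps)
  then show ?thesis using 1 by (simp add: abs_l2_scaleC)
qed

lemma solves_shift_in_H:
  assumes sol: "solves {0..} z (zero_ext f) u w" and sq: "square_integrable u" "square_integrable f"
    and bc: "boundary u w = 0"
  shows "(abs_l2 u, abs_l2 f + z *\<^sub>C abs_l2 u) \<in> H \<sigma> \<tau> \<alpha>"
proof -
  have "solves {0..} 0 (\<lambda>x. zero_ext f x + (z - 0) * u x) u w" by (rule solves_shift[OF sol]) simp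
  then have "solves {0..} 0 (zero_ext (\<lambda>x. f x + z * u x)) u w"
    by (rule solves_forcing_cong) (simp add: zero_ext_def)
  from solves_in_H[OF this sq(1) square_integrable_add[OF sq(2) square_integrable_scale[OF sq(1)]] bc]
  show ?thesis using sq by (simp add: abs_l2_add abs_l2_scaleC square_integrable_scale)
qed

lemma eigenvector_solves:
  assumes "(p, z *\<^sub>C p) \<in> H \<sigma> \<tau> \<alpha>"
  obtains u w where "solves {0..} z (\<lambda>_. 0) u w" "square_integrable u" "p = abs_l2 u" "boundary u w = 0"
proof -
  obtain u w f where 1: "solves {0..} 0 (zero_ext f) u w" "square_integrable u" "square_integrable f"
    "p = abs_l2 u" "z *\<^sub>C p = abs_l2 f" "boundary u w = 0" by (rule in_H_solves[OF assms(1)])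
  have "abs_l2 f = abs_l2 (\<lambda>x. z * u x)" using 1 by (simp add: abs_l2_scaleC)
  from abs_l2_eqD[OF 1(3) square_integrable_scale[OF 1(2)] this]
  have AE: "AE x in lebesgue. x \<in> {0<..} \<longrightarrow> f x = z * u x" by (simp add: AE_half_line_iff)
  have "solves {0..} z (\<lambda>_. 0) u w"
    unfolding solves_def
  proof
    have "AE x in lebesgue. x \<notin> {0::real}" by (rule AE_not_in) simp
    with AE have "AE x in lebesgue. x \<in> {0..} \<longrightarrow> - complex_of_real (s x) * w x + (complex_of_real (q x) - 0) * u x - zero_ext f x =
      - complex_of_real (s x) * w x + (complex_of_real (q x) - z) * u x - 0"
      by eventually_elim (auto simp: zero_ext_def algebra_simps)
    then show "primitive_on {0..} w (\<lambda>x. - complex_of_real (s x) * w x + (complex_of_real (q x) - z) * u x - 0)"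
      by (rule primitive_on_AE_cong[rotated]) (use 1(1) in \<open>auto simp: solves_def is_interval_ci\<close>)
  qed (use 1(1) in \<open>simp add: solves_def\<close>)
  then show thesis using that 1 by blast
qed

end

section \<open>Resolvent criterion, orthogonality of eigenfunctions, isolation of
  eigenvalues\<close>

section \<open>The spectrum outside the nonnegative reals\<close>

lemma scaleR_eq_scaleC: "r *\<^sub>R (p :: l2) = complex_of_real r *\<^sub>C p"
  by (simp add: scaleR_l2_def)

interpretation scaleC: vector_space scaleC
  by (rule vector_space_scaleC)

lemma norm_scaleC: "norm (c *\<^sub>C p) = cmod c * norm p"
proof -
  obtain f where f: "square_integrable f" "p = abs_l2 f" by (rule abs_l2_cases)
  have "(norm (c *\<^sub>C p))\<^sup>2 = (\<integral>x. (cmod c)\<^sup>2 * (cmod (f x))\<^sup>2 \<partial>half_line)"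
    using f by (simp add: abs_l2_scaleC norm_abs_l2_square square_integrable_scale norm_mult power_mult_distrib)
  also have "\<dots> = (cmod c * norm p)\<^sup>2"
    using f by (simp add: norm_abs_l2_square power_mult_distrib)
  finally show ?thesis by (rule power2_eq_imp_eq) auto
qed

text \<open>The resolvent is picked pointwise; injectivity makes the choice unique, and uniqueness
  together with linearity of the graph makes the map linear.\<close>

lemma resolvent_setI:
  assumes add: "\<And>p v p' v'. (p, v) \<in> T \<Longrightarrow> (p', v') \<in> T \<Longrightarrow> (p + p', v + v') \<in> T"
    and scale: "\<And>c p v. (p, v) \<in> T \<Longrightarrow> (c *\<^sub>C p, c *\<^sub>C v) \<in> T"
    and inj: "\<And>p. (p, z *\<^sub>C p) \<in> T \<Longrightarrow> p = 0"
    and surj: "\<And>f. \<exists>p v. (p, v) \<in> T \<and> f = v - z *\<^sub>C p \<and> norm p \<le> K * norm f"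
  shows "z \<in> resolvent_set T"
proof -
  have unique: "p = p'" if "(p, v) \<in> T" "(p', v') \<in> T" "v - z *\<^sub>C p = v' - z *\<^sub>C p'" for p v p' v'
  proof -
    have "(p + (- 1) *\<^sub>C p', v + (- 1) *\<^sub>C v') \<in> T" by (rule add[OF that(1) scale[OF that(2)]])
    then have "(p - p', v - v') \<in> T" by simp
    moreover have "v - v' = z *\<^sub>C (p - p')" using that(3) by (simp add: scaleC.scale_right_diff_distrib algebra_simps)
    ultimately show ?thesis using inj[of "p - p'"] by simp
  qed
  from surj have "\<forall>f. \<exists>p. \<exists>v. (p, v) \<in> T \<and> f = v - z *\<^sub>C p \<and> norm p \<le> K * norm f" by blast
  from choice[OF this] obtain R where "\<forall>f. \<exists>v. (R f, v) \<in> T \<and> f = v - z *\<^sub>C R f \<and> norm (R f) \<le> K * norm f" by blast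
  from choice[OF this] obtain V where V: "\<And>f. (R f, V f) \<in> T" "\<And>f. f = V f - z *\<^sub>C R f" "\<And>f. norm (R f) \<le> K * norm f"
    by blast
  have R: "R f = u \<longleftrightarrow> (\<exists>v. (u, v) \<in> T \<and> f = v - z *\<^sub>C u)" for f u
    using V(1)[of f] V(2)[of f] unique by metis
  have "bounded_linear R"
  proof (rule bounded_linear_intro)
    show "R (f + g) = R f + R g" for f g
    proof -
      have "V f + V g - z *\<^sub>C (R f + R g) = (V f - z *\<^sub>C R f) + (V g - z *\<^sub>C R g)"
        by (simp add: scaleC.scale_right_distrib)
      then have "f + g = V f + V g - z *\<^sub>C (R f + R g)" using V(2)[of f] V(2)[of g] by simp
      then show ?thesis unfolding R using add[OF V(1)[of f] V(1)[of g]] by blast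
    qed
    show "R (r *\<^sub>R f) = r *\<^sub>R R f" for r f
    proof -
      have "complex_of_real r *\<^sub>C f = complex_of_real r *\<^sub>C V f - z *\<^sub>C complex_of_real r *\<^sub>C R f"
        using arg_cong[OF V(2)[of f], of "\<lambda>h. complex_of_real r *\<^sub>C h"]
        by (simp add: scaleC.scale_right_diff_distrib scaleC.scale_left_commute)
      then show ?thesis unfolding R scaleR_eq_scaleC using scale[OF V(1)[of f]] by blast
    qed
    show "norm (R f) \<le> norm f * K" for f using V(3)[of f] by (simp add: mult.commute)
  qed
  then show ?thesis using R unfolding resolvent_set_def by blast
qed

text \<open>The estimate that a Weyl sequence violates.\<close>

lemma resolvent_set_bound:
  assumes "z \<in> resolvent_set T"
  obtains K where "K > 0" "\<And>p v. (p, v) \<in> T \<Longrightarrow> norm p \<le> norm (v - z *\<^sub>C p) * K"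
proof -
  obtain R where R: "bounded_linear R" "\<And>f u. R f = u \<longleftrightarrow> (\<exists>v. (u, v) \<in> T \<and> f = v - z *\<^sub>C u)"
    using assms unfolding resolvent_set_def by blast
  obtain K where K: "K > 0" "\<And>f. norm (R f) \<le> norm f * K" using bounded_linear.pos_bounded[OF R(1)] by blast
  show thesis
  proof (rule that[OF K(1)])
    fix p v assume "(p, v) \<in> T"
    then have "R (v - z *\<^sub>C p) = p" using R(2) by blast
    then show "norm p \<le> norm (v - z *\<^sub>C p) * K" using K(2) by metis
  qed
qed

lemma integrable_mult_cnj:
  assumes f: "square_integrable f" and g: "square_integrable g"
  shows "integrable half_line (\<lambda>x. f x * cnj (g x))"
proof (rule Bochner_Integration.integrable_bound)
  show "integrable half_line (\<lambda>x. (cmod (f x))\<^sup>2 + (cmod (g x))\<^sup>2)"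
    using f g by (auto simp: square_integrable_def)
  have [measurable]: "f \<in> borel_measurable half_line" "g \<in> borel_measurable half_line"
    using f g by (auto simp: square_integrable_def)
  have [measurable]: "(\<lambda>x. cnj (g x)) \<in> borel_measurable half_line"
    by (rule borel_measurable_continuous_on[of cnj g]) (auto intro: continuous_intros)
  show "(\<lambda>x. f x * cnj (g x)) \<in> borel_measurable half_line" by measurable
  have "cmod (f x) * cmod (g x) \<le> (cmod (f x))\<^sup>2 + (cmod (g x))\<^sup>2" for x
    using zero_le_power2[of "cmod (f x) - cmod (g x)"]
      zero_le_power2[of "cmod (f x)"] zero_le_power2[of "cmod (g x)"]
    unfolding power2_diff by linarith
  then show "AE x in half_line. norm (f x * cnj (g x)) \<le> norm ((cmod (f x))\<^sup>2 + (cmod (g x))\<^sup>2)"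
    by (auto simp: norm_mult)
qed

text \<open>The inner product of \<open>l2\<close> is real. Orthogonality to all complex multiples
  of an eigenfunction needs the complex integral, of which the inner product is the real
  part.\<close>

lemma abs_l2_inner_Re:
  assumes f: "square_integrable f" and g: "square_integrable g"
  shows "abs_l2 f \<bullet> abs_l2 g = Re (\<integral>x. f x * cnj (g x) \<partial>half_line)"
proof -
  have "(\<integral>x. f x \<bullet> g x \<partial>half_line) = (\<integral>x. Re (f x * cnj (g x)) \<partial>half_line)"
    by (simp add: inner_complex_def)
  also have "\<dots> = Re (\<integral>x. f x * cnj (g x) \<partial>half_line)"
    by (rule integral_bounded_linear[OF bounded_linear_Re integrable_mult_cnj[OF f g]])
  finally show ?thesis by (simp add: abs_l2_inner[OF f g])
qed

context half_line_operator
begin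

text \<open>Decay of both components is included because the Wronskian has to vanish at infinity,
  and square integrability of \<open>u\<close> does not by itself bound \<open>w\<close>.\<close>

definition eigenfunction :: "complex \<Rightarrow> (real \<Rightarrow> complex) \<Rightarrow> (real \<Rightarrow> complex) \<Rightarrow> bool" where
  "eigenfunction z u w \<longleftrightarrow> solves {0..} z (\<lambda>_. 0) u w \<and> square_integrable u \<and> boundary u w = 0 \<and>
     (\<exists>C \<mu>. \<mu> > 0 \<and> (\<forall>x\<ge>0. cmod (u x) + cmod (w x) \<le> C * exp (- \<mu> * x)))"

text \<open>Green's formula: over \<open>{0..b}\<close> the left-hand side is the increment of the
  Wronskian of \<open>u\<close> with the conjugate of \<open>v\<close>, which vanishes at 0 by the
  boundary conditions and tends to 0 by decay.\<close>

lemma eigenfunctions_orthogonal: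
  assumes u: "eigenfunction z u w" and v: "eigenfunction z' v y"
  shows "(z - cnj z') * (\<integral>x. u x * cnj (v x) \<partial>half_line) = 0"
proof -
  obtain C \<mu> where C: "\<mu> > 0" "\<And>x. x \<ge> 0 \<Longrightarrow> cmod (u x) + cmod (w x) \<le> C * exp (- \<mu> * x)"
    using u by (auto simp: eigenfunction_def)
  obtain C' \<mu>' where C': "\<mu>' > 0" "\<And>x. x \<ge> 0 \<Longrightarrow> cmod (v x) + cmod (y x) \<le> C' * exp (- \<mu>' * x)"
    using v by (auto simp: eigenfunction_def)
  define g where "g x = u x * cnj (v x)" for x
  define W where "W x = u x * cnj (y x) - w x * cnj (v x)" for x
  have "solves {0..} (cnj z') (\<lambda>_. 0) (\<lambda>x. cnj (v x)) (\<lambda>x. cnj (y x))"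
    using solves_cnj[of "{0..}" z' "\<lambda>_. 0" v y] v by (simp add: eigenfunction_def)
  then have P: "primitive_on {0..} W (\<lambda>x. (z - cnj z') * g x)"
    unfolding W_def[abs_def] g_def using u by (intro wronskian_primitive) (auto simp: eigenfunction_def is_interval_ci)
  \<comment> \<open>The two boundary conditions combine to \<open>W 0\<close> times the cosine and
    to \<open>W 0\<close> times the sine, which have no common zero. Conjugation keeps the condition
    on \<open>v\<close>, as \<alpha> is real.\<close>
  have W0: "W 0 = 0"
  proof -
    have 1: "u 0 * complex_of_real (cos \<alpha>) + w 0 * complex_of_real (sin \<alpha>) = 0"
      using u by (simp add: eigenfunction_def boundary_def)
    have "v 0 * complex_of_real (cos \<alpha>) + y 0 * complex_of_real (sin \<alpha>) = 0"
      using v by (simp add: eigenfunction_def boundary_def)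
    then have 2: "cnj (v 0) * complex_of_real (cos \<alpha>) + cnj (y 0) * complex_of_real (sin \<alpha>) = 0"
      by (metis complex_cnj_add complex_cnj_complex_of_real complex_cnj_mult complex_cnj_zero)
    have "W 0 * complex_of_real (cos \<alpha>) = (u 0 * complex_of_real (cos \<alpha>) + w 0 * complex_of_real (sin \<alpha>)) * cnj (y 0)
       - (cnj (v 0) * complex_of_real (cos \<alpha>) + cnj (y 0) * complex_of_real (sin \<alpha>)) * w 0"
      by (simp add: W_def algebra_simps)
    then have c: "W 0 * complex_of_real (cos \<alpha>) = 0" using 1 2 by simp
    have "W 0 * complex_of_real (sin \<alpha>) = (cnj (v 0) * complex_of_real (cos \<alpha>) + cnj (y 0) * complex_of_real (sin \<alpha>)) * u 0
       - (u 0 * complex_of_real (cos \<alpha>) + w 0 * complex_of_real (sin \<alpha>)) * cnj (v 0)"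
      by (simp add: W_def algebra_simps)
    then have d: "W 0 * complex_of_real (sin \<alpha>) = 0" using 1 2 by simp
    show ?thesis using c d sin_zero_abs_cos_one[of \<alpha>] by auto
  qed
  have gint: "integrable half_line g"
    unfolding g_def using u v by (intro integrable_mult_cnj) (auto simp: eigenfunction_def)
  have lim1: "((\<lambda>b. (z - cnj z') * integral {0..b} g) \<longlongrightarrow> (z - cnj z') * (\<integral>x. g x \<partial>half_line)) at_top"
  proof (intro tendsto_intros)
    \<comment> \<open>The Wronskian is expressed by gauge integrals over \<open>{0..b}\<close>, the
      inner product by a Lebesgue integral over \<open>half_line\<close>; \<open>g0\<close> brings
      both under the measure \<open>lebesgue\<close>.\<close>
    define g0 where "g0 = zero_ext g"
    have g0: "set_integrable lebesgue {0..} g0"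
    proof -
      have "integrable lebesgue (\<lambda>x. indicator {0<..} x *\<^sub>R g x)"
        using gint integrable_restrict_space[of "{0<..}" lebesgue g] by simp
      moreover have "(\<lambda>x. indicator {0<..} x *\<^sub>R g x) = (\<lambda>x. indicator {0..} x *\<^sub>R g0 x)"
        by (auto simp: g0_def zero_ext_def indicator_def)
      ultimately show ?thesis by (simp add: set_integrable_def)
    qed
    have "((\<lambda>b. LINT x:{0..b}|lebesgue. g0 x) \<longlongrightarrow> (LINT x:{0..}|lebesgue. g0 x)) at_top"
      by (rule tendsto_set_lebesgue_integral_at_top[OF _ g0]) auto
    moreover have "(LINT x:{0..}|lebesgue. g0 x) = (\<integral>x. g x \<partial>half_line)"
    proof -
      have "(\<integral>x. g x \<partial>half_line) = (\<integral>x. indicator {0<..} x *\<^sub>R g x \<partial>lebesgue)"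
        by (rule integral_restrict_space) simp
      also have "(\<lambda>x. indicator {0<..} x *\<^sub>R g x) = (\<lambda>x. indicator {0..} x *\<^sub>R g0 x)"
        by (auto simp: g0_def zero_ext_def indicator_def)
      finally show ?thesis by (simp add: set_lebesgue_integral_def)
    qed
    moreover have "(LINT x:{0..b}|lebesgue. g0 x) = integral {0..b} g" for b
    proof -
      have "(LINT x:{0..b}|lebesgue. g0 x) = integral {0..b} g0"
        by (rule set_lebesgue_integral_eq_integral(2)) (rule set_integrable_subset[OF g0], auto)
      also have "\<dots> = integral {0..b} g"
        by (rule integral_spike[of "{0}"]) (auto simp: g0_def zero_ext_def)
      finally show ?thesis .
    qed
    ultimately show "((\<lambda>b. integral {0..b} g) \<longlongrightarrow> (\<integral>x. g x \<partial>half_line)) at_top" by simp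
  qed
  have Wb: "W b = (z - cnj z') * integral {0..b} g" if "b \<ge> 0" for b
    using primitive_onD(2)[OF P, of 0 b] that W0 by simp
  have "(W \<longlongrightarrow> 0) at_top"
  proof (rule Lim_null_comparison)
    show "\<forall>\<^sub>F b in at_top. norm (W b) \<le> 2 * (C * exp (- \<mu> * b) * (C' * exp (- \<mu>' * b)))"
      using eventually_ge_at_top[of 0]
    proof eventually_elim
      fix b :: real assume b: "b \<ge> 0"
      have e: "cmod (u b) \<le> C * exp (- \<mu> * b)" "cmod (w b) \<le> C * exp (- \<mu> * b)"
        "cmod (v b) \<le> C' * exp (- \<mu>' * b)" "cmod (y b) \<le> C' * exp (- \<mu>' * b)"
        using C(2)[OF b] C'(2)[OF b] norm_ge_zero[of "u b"] norm_ge_zero[of "w b"] norm_ge_zero[of "v b"] norm_ge_zero[of "y b"]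
        by linarith+
      have "norm (W b) \<le> cmod (u b) * cmod (y b) + cmod (w b) * cmod (v b)"
        unfolding W_def using norm_triangle_ineq4[of "u b * cnj (y b)" "w b * cnj (v b)"] by (simp add: norm_mult)
      also have "\<dots> \<le> (C * exp (- \<mu> * b)) * (C' * exp (- \<mu>' * b)) + (C * exp (- \<mu> * b)) * (C' * exp (- \<mu>' * b))"
        using e order_trans[OF norm_ge_zero e(1)] by (intro add_mono mult_mono) auto
      finally show "norm (W b) \<le> 2 * (C * exp (- \<mu> * b) * (C' * exp (- \<mu>' * b)))" by (simp only: mult_2)
    qed
    have ex: "((\<lambda>b. exp (- m * b)) \<longlongrightarrow> 0) at_top" if "m > 0" for m :: real
      by (rule filterlim_compose[OF exp_at_bot], rule filterlim_tendsto_neg_mult_at_bot[OF tendsto_const _ filterlim_ident])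
        (use that in simp)
    have "((\<lambda>b. 2 * (C * exp (- \<mu> * b) * (C' * exp (- \<mu>' * b)))) \<longlongrightarrow> 2 * (C * 0 * (C' * 0))) at_top"
      by (intro tendsto_intros ex C(1) C'(1))
    then show "((\<lambda>b. 2 * (C * exp (- \<mu> * b) * (C' * exp (- \<mu>' * b)))) \<longlongrightarrow> 0) at_top" by simp
  qed
  moreover have "\<forall>\<^sub>F b in at_top. W b = (z - cnj z') * integral {0..b} g"
    by (rule eventually_mono[OF eventually_ge_at_top[of 0] Wb])
  ultimately have "((\<lambda>b. (z - cnj z') * integral {0..b} g) \<longlongrightarrow> 0) at_top"
    by (rule Lim_transform_eventually)
  then show ?thesis
    using tendsto_unique[OF trivial_limit_at_top_linorder lim1] by (simp add: g_def)
qed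

text \<open>\<open>u\<close> vanishes on the open half-line by continuity, then \<open>w\<close> by
  the first equation, and uniqueness from the point 1 reaches the endpoint 0.\<close>

lemma solution_zero:
  assumes sol: "solves {0..} z (\<lambda>_. 0) u w" and sq: "square_integrable u" and 0: "abs_l2 u = 0" and x: "x \<ge> 0"
  shows "u x = 0" "w x = 0"
proof -
  have "abs_l2 u = abs_l2 (\<lambda>_. 0)" using 0 by (simp add: zero_l2_def)
  from abs_l2_eqD[OF sq square_integrable_zero this] have AE: "AE x in half_line. u x = 0" .
  have cu: "continuous_on {0<..} u"
    by (rule continuous_on_subset[OF solves_continuous_Ici(1)[OF sol] greaterThan_subset_Ici])
  have cw: "continuous_on {0<..} w"
    by (rule continuous_on_subset[OF solves_continuous_Ici(2)[OF sol] greaterThan_subset_Ici])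
  have u0: "u x = 0" if "x > 0" for x
    by (rule continuous_on_AE_eq[OF cu _ AE that]) simp
  have "primitive_on {0<..} u (\<lambda>x. complex_of_real (s x) * u x + w x)"
    using solves_subset[OF sol greaterThan_subset_Ici] by (simp add: solves_def)
  then have "primitive_on {0<..} (\<lambda>_. 0) w"
    by (rule iffD1[OF primitive_on_cong, rotated 3]) (auto simp: u0 is_interval_oi)
  from primitive_on_AE_derivative_Ioi[OF this]
  have "AE x in half_line. w x = 0"
    by eventually_elim (metis has_vector_derivative_const vector_derivative_unique_at)
  from continuous_on_AE_eq[OF cw _ this, of 1] have "w 1 = 0" by simp
  moreover have "u 1 = 0" using u0[of 1] by simp
  moreover have "solves {0..} z (\<lambda>_. 0) (\<lambda>_. 0) (\<lambda>_. 0)" using solves_cmult[OF sol, of 0] by simp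
  ultimately show "u x = 0" "w x = 0"
    using solves_unique_Ici[OF sol, of "\<lambda>_. 0" "\<lambda>_. 0" 1 x] x by auto
qed

lemma exp_decay_square_integrable:
  assumes "continuous_on {0..} u" "\<mu> > 0" "\<And>x. x \<ge> 0 \<Longrightarrow> cmod (u x) \<le> C * exp (- \<mu> * x)"
  shows "square_integrable u"
proof (rule square_integrableI(1))
  show "u \<in> borel_measurable half_line"
    by (rule continuous_imp_measurable_on_sets_lebesgue[OF continuous_on_subset[OF assms(1) greaterThan_subset_Ici]]) auto
  have C: "C \<ge> 0" using assms(3)[of 0] order_trans[OF norm_ge_zero] by fastforce
  \<comment> \<open>The square of the exponential bound is the kernel of rate
    \<open>2 * \<mu>\<close> centred at 0.\<close>
  have "(\<integral>\<^sup>+t. (ennreal (cmod (zero_ext u t)))\<^sup>2 \<partial>lebesgue) \<le> (\<integral>\<^sup>+t. ennreal (C\<^sup>2) * ennreal (exp (- (2 * \<mu>) * \<bar>0 - t\<bar>)) \<partial>lebesgue)"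
  proof (rule nn_integral_mono)
    fix t
    show "(ennreal (cmod (zero_ext u t)))\<^sup>2 \<le> ennreal (C\<^sup>2) * ennreal (exp (- (2 * \<mu>) * \<bar>0 - t\<bar>))"
    proof (cases "t > 0")
      case True
      have "(cmod (u t))\<^sup>2 \<le> (C * exp (- \<mu> * t))\<^sup>2" using assms(3)[of t] True by (intro power_mono) auto
      also have "\<dots> = C\<^sup>2 * exp (- (2 * \<mu>) * \<bar>0 - t\<bar>)"
        using True by (simp add: power_mult_distrib exp_double[symmetric] mult.assoc)
      finally have "ennreal ((cmod (u t))\<^sup>2) \<le> ennreal (C\<^sup>2 * exp (- (2 * \<mu>) * \<bar>0 - t\<bar>))" by (rule ennreal_leI)
      then show ?thesis using True by (simp add: zero_ext_def ennreal_power ennreal_mult)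
    qed (simp add: zero_ext_def)
  qed
  also have "\<dots> = ennreal (C\<^sup>2) * (\<integral>\<^sup>+t. ennreal (exp (- (2 * \<mu>) * \<bar>0 - t\<bar>)) \<partial>lebesgue)"
    by (rule nn_integral_cmult) measurable
  also have "\<dots> \<le> ennreal (C\<^sup>2) * ennreal (2 / (2 * \<mu>))"
    by (intro mult_left_mono nn_integral_exp_kernel) (use assms(2) in auto)
  also have "\<dots> = ennreal (C\<^sup>2 * (2 / (2 * \<mu>)))" using assms(2) by (intro ennreal_mult[symmetric]) auto
  also have "\<dots> = ennreal ((sqrt (C\<^sup>2 * (2 / (2 * \<mu>))))\<^sup>2)" using assms(2) by simp
  finally show "(\<integral>\<^sup>+t. (ennreal (cmod (zero_ext u t)))\<^sup>2 \<partial>lebesgue) \<le> ennreal ((sqrt (C\<^sup>2 * (2 / (2 * \<mu>))))\<^sup>2)" .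
qed (use assms(2) in simp)

lemma weyl_cases:
  assumes z: "z \<notin> complex_of_real ` {0..}"
  obtains "z \<in> resolvent_set (H \<sigma> \<tau> \<alpha>)"
  | \<psi> \<theta> where "eigenfunction z \<psi> \<theta>" "abs_l2 \<psi> \<noteq> 0"
      "\<And>u w. solves {0..} z (\<lambda>_. 0) u w \<Longrightarrow> square_integrable u \<Longrightarrow> \<exists>c. \<forall>x\<ge>0. u x = c * \<psi> x"
proof -
  obtain \<psi> \<theta> C \<mu> x0 where psi: "solves {0..} z (\<lambda>_. 0) \<psi> \<theta>" "\<mu> > 0"
    "\<And>x. x \<ge> 0 \<Longrightarrow> cmod (\<psi> x) + cmod (\<theta> x) \<le> C * exp (- \<mu> * x)" "x0 \<ge> 0" "\<psi> x0 \<noteq> 0 \<or> \<theta> x0 \<noteq> 0"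
    by (rule weyl_solution[OF z]) (rule that)
  have sq: "square_integrable \<psi>"
  proof (rule exp_decay_square_integrable[OF solves_continuous_Ici(1)[OF psi(1)] psi(2)])
    show "cmod (\<psi> x) \<le> C * exp (- \<mu> * x)" if "x \<ge> 0" for x
      using psi(3)[OF that] norm_ge_zero[of "\<theta> x"] by linarith
  qed
  have ne: "abs_l2 \<psi> \<noteq> 0" using solution_zero[OF psi(1) sq _ psi(4)] psi(5) by auto
  show thesis
  proof (cases "boundary \<psi> \<theta> = 0")
    case True
    have eig: "eigenfunction z \<psi> \<theta>" using psi True sq by (auto simp: eigenfunction_def)
    have "\<exists>c. \<forall>x\<ge>0. u x = c * \<psi> x" if uw: "solves {0..} z (\<lambda>_. 0) u w" "square_integrable u" for u w
      by (rule homogeneous_l2_multiple[OF psi(1,2) _ psi(4,5) uw]) (use psi(3) in blast)+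
    with eig ne show thesis by (rule that(2))
  next
    case False
    obtain K where K: "K \<ge> 0" "\<And>f. square_integrable f \<Longrightarrow> \<exists>u w. solves {0..} z (zero_ext f) u w \<and>
      square_integrable u \<and> norm (abs_l2 u) \<le> K * norm (abs_l2 f) \<and> cmod (u 0) + cmod (w 0) \<le> K * norm (abs_l2 f)"
      by (rule particular_solution[OF z]) (rule that)
    \<comment> \<open>The multiple of \<psi> in the correction is the boundary value of the
      particular solution divided by that of \<psi>, up to sign; \<open>K\<close> bounds the
      former.\<close>
    define K' where "K' = K + K / cmod (boundary \<psi> \<theta>) * norm (abs_l2 \<psi>)"
    have "z \<in> resolvent_set (H \<sigma> \<tau> \<alpha>)"
    proof (rule resolvent_setI[where K=K'])
      fix p assume "(p, z *\<^sub>C p) \<in> H \<sigma> \<tau> \<alpha>"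
      then obtain u w where u: "solves {0..} z (\<lambda>_. 0) u w" "square_integrable u" "p = abs_l2 u" "boundary u w = 0"
        by (rule eigenvector_solves)
      obtain c where c: "\<And>x. x \<ge> 0 \<Longrightarrow> u x = c * \<psi> x" "\<And>x. x \<ge> 0 \<Longrightarrow> w x = c * \<theta> x"
        by (rule homogeneous_l2_multiple[OF psi(1,2) _ psi(4,5) u(1,2)], rule psi(3), assumption, rule that)
      have "c * boundary \<psi> \<theta> = 0" using u(4) c[of 0] by (simp add: boundary_def algebra_simps)
      then have "c = 0" using False by simp
      then have "abs_l2 (\<lambda>_. 0) = abs_l2 u" using square_integrable_cong(2)[OF u(2), of "\<lambda>_. 0"] c(1) by auto
      then show "p = 0" using u(3) by (simp add: zero_l2_def)
    next
      fix f
      obtain f0 where f0: "square_integrable f0" "f = abs_l2 f0" by (rule abs_l2_cases)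
      obtain u w where u: "solves {0..} z (zero_ext f0) u w" "square_integrable u"
        "norm (abs_l2 u) \<le> K * norm f" "cmod (u 0) + cmod (w 0) \<le> K * norm f"
        using K(2)[OF f0(1)] f0(2) by blast
      define c where "c = - boundary u w / boundary \<psi> \<theta>"
      have sol: "solves {0..} z (zero_ext f0) (\<lambda>x. u x + c * \<psi> x) (\<lambda>x. w x + c * \<theta> x)"
        using solves_add[OF u(1) solves_cmult[OF psi(1), of c]] by simp
      have bc: "boundary (\<lambda>x. u x + c * \<psi> x) (\<lambda>x. w x + c * \<theta> x) = 0"
      proof -
        have "boundary (\<lambda>x. u x + c * \<psi> x) (\<lambda>x. w x + c * \<theta> x) = boundary u w + c * boundary \<psi> \<theta>"
          by (simp add: boundary_def algebra_simps)
        then show ?thesis using False by (simp add: c_def)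
      qed
      have sq2: "square_integrable (\<lambda>x. u x + c * \<psi> x)"
        by (rule square_integrable_add[OF u(2) square_integrable_scale[OF sq]])
      have "cmod (boundary u w) \<le> cmod (u 0) * \<bar>cos \<alpha>\<bar> + cmod (w 0) * \<bar>sin \<alpha>\<bar>"
        unfolding boundary_def using norm_triangle_ineq[of "u 0 * complex_of_real (cos \<alpha>)" "w 0 * complex_of_real (sin \<alpha>)"]
        by (simp add: norm_mult)
      also have "\<dots> \<le> cmod (u 0) * 1 + cmod (w 0) * 1" by (intro add_mono mult_left_mono) auto
      finally have "cmod (boundary u w) \<le> K * norm f" using u(4) by simp
      then have "cmod c \<le> K * norm f / cmod (boundary \<psi> \<theta>)"
        by (simp add: c_def norm_divide divide_right_mono)
      then have "cmod c * norm (abs_l2 \<psi>) \<le> K * norm f / cmod (boundary \<psi> \<theta>) * norm (abs_l2 \<psi>)" by (rule mult_right_mono) simp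
      moreover have "norm (abs_l2 (\<lambda>x. u x + c * \<psi> x)) \<le> norm (abs_l2 u) + cmod c * norm (abs_l2 \<psi>)"
        using norm_triangle_ineq[of "abs_l2 u" "c *\<^sub>C abs_l2 \<psi>"]
        by (simp add: abs_l2_scaleC[OF sq] abs_l2_add[OF u(2) square_integrable_scale[OF sq]] norm_scaleC[symmetric])
      ultimately have "norm (abs_l2 (\<lambda>x. u x + c * \<psi> x)) \<le> K' * norm f"
        using u(3) by (simp add: K'_def algebra_simps)
      then show "\<exists>p v. (p, v) \<in> H \<sigma> \<tau> \<alpha> \<and> f = v - z *\<^sub>C p \<and> norm p \<le> K' * norm f"
        using solves_shift_in_H[OF sol sq2 f0(1) bc] f0(2) by (intro exI conjI) auto
    qed (auto intro: H_add H_scaleC)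
    then show thesis by (rule that(1))
  qed
qed

lemma eigenfunction_in_H:
  assumes "eigenfunction z u w"
  shows "(abs_l2 u, z *\<^sub>C abs_l2 u) \<in> H \<sigma> \<tau> \<alpha>"
proof -
  have u: "solves {0..} z (\<lambda>_. 0) u w" "square_integrable u" "boundary u w = 0"
    using assms by (auto simp: eigenfunction_def)
  have "zero_ext (\<lambda>_. 0) = (\<lambda>_. 0)" by (auto simp: zero_ext_def)
  then have "(abs_l2 u, abs_l2 (\<lambda>_. 0) + z *\<^sub>C abs_l2 u) \<in> H \<sigma> \<tau> \<alpha>"
    using solves_shift_in_H[of z "\<lambda>_. 0" u w] u square_integrable_zero by simp
  moreover have "abs_l2 (\<lambda>_. 0) = 0" by (simp add: zero_l2_def)
  ultimately show ?thesis by simp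
qed

text \<open>Green's formula for \<open>u\<close> with itself, whose square norm is not 0.\<close>

lemma eigenvalue_real:
  assumes "eigenfunction z u w" "abs_l2 u \<noteq> 0"
  shows "cnj z = z"
proof -
  have sq: "square_integrable u" using assms by (simp add: eigenfunction_def)
  have "abs_l2 u \<bullet> abs_l2 u \<noteq> 0" using assms(2) by simp
  then have "(\<integral>x. u x * cnj (u x) \<partial>half_line) \<noteq> 0" unfolding abs_l2_inner_Re[OF sq sq] by auto
  then show ?thesis using eigenfunctions_orthogonal[OF assms(1,1)] by simp
qed

lemma spectrum_outside_discrete:
  assumes z: "z \<notin> complex_of_real ` {0..}" and spec: "z \<in> spectrum (H \<sigma> \<tau> \<alpha>)"
  shows "z \<in> discrete_spectrum (H \<sigma> \<tau> \<alpha>)"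
proof -
  obtain \<psi> \<theta> where psi: "eigenfunction z \<psi> \<theta>" "abs_l2 \<psi> \<noteq> 0"
      "\<And>u w. solves {0..} z (\<lambda>_. 0) u w \<Longrightarrow> square_integrable u \<Longrightarrow> \<exists>c. \<forall>x\<ge>0. u x = c * \<psi> x"
    using weyl_cases[OF z] spec unfolding spectrum_def by (metis ComplD)
  have psi': "square_integrable \<psi>" "solves {0..} z (\<lambda>_. 0) \<psi> \<theta>" using psi(1) by (auto simp: eigenfunction_def)
  have z_real: "cnj z = z" by (rule eigenvalue_real[OF psi(1,2)])
  have eig: "abs_l2 \<psi> \<in> eigenspace (H \<sigma> \<tau> \<alpha>) z" using eigenfunction_in_H[OF psi(1)] by (simp add: eigenspace_def)
  have fin: "eigenspace (H \<sigma> \<tau> \<alpha>) z \<subseteq> module.span scaleC {abs_l2 \<psi>}"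
  proof
    fix p assume "p \<in> eigenspace (H \<sigma> \<tau> \<alpha>) z"
    then have "(p, z *\<^sub>C p) \<in> H \<sigma> \<tau> \<alpha>" by (simp add: eigenspace_def)
    then obtain u w where u: "solves {0..} z (\<lambda>_. 0) u w" "square_integrable u" "p = abs_l2 u" "boundary u w = 0"
      by (rule eigenvector_solves)
    obtain c where c: "\<And>x. x \<ge> 0 \<Longrightarrow> u x = c * \<psi> x" using psi(3)[OF u(1,2)] by blast
    then have "abs_l2 (\<lambda>x. c * \<psi> x) = abs_l2 u" by (intro square_integrable_cong(2)[OF u(2)]) simp
    then have "p = c *\<^sub>C abs_l2 \<psi>" using u(3) by (simp add: abs_l2_scaleC[OF psi'(1)])
    then show "p \<in> module.span scaleC {abs_l2 \<psi>}"
      by (simp add: scaleC.span_base scaleC.span_scale)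
  qed
  have "\<not> z islimpt spectrum (H \<sigma> \<tau> \<alpha>)"
  proof
    assume lim: "z islimpt spectrum (H \<sigma> \<tau> \<alpha>)"
    obtain K where K: "K \<ge> 0" "\<And>f. square_integrable f \<Longrightarrow> \<exists>u w. solves {0..} z (zero_ext f) u w \<and>
      square_integrable u \<and> norm (abs_l2 u) \<le> K * norm (abs_l2 f) \<and> cmod (u 0) + cmod (w 0) \<le> K * norm (abs_l2 f)"
      by (rule particular_solution[OF z]) (rule that)
    \<comment> \<open>The ray is closed, so spectral points near \<open>z\<close> stay off it and
      have exponentially decaying eigenfunctions as well.\<close>
    have "closed (complex_of_real ` {0..})"
      by (intro closed_injective_linear_image closed_atLeast) (auto simp: linear_iff inj_on_def scaleR_conv_of_real)
    then obtain e where e: "e > 0" "ball z e \<inter> complex_of_real ` {0..} = {}"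
      using z by (metis (no_types, lifting) ComplI open_Compl open_contains_ball disjoint_eq_subset_Compl)
    \<comment> \<open>The radius \<open>1 / (K + 1)\<close> forces
      \<open>K * cmod (z' - z) < 1\<close>, against the estimate reached at the end.\<close>
    define d where "d = min e (1 / (K + 1))"
    have "d > 0" using e K by (simp add: d_def)
    then obtain z' where z': "z' \<in> spectrum (H \<sigma> \<tau> \<alpha>)" "z' \<noteq> z" "dist z' z < d"
      using lim unfolding islimpt_approachable by blast
    have "z' \<notin> complex_of_real ` {0..}" using e(2) z'(3) by (auto simp: d_def dist_commute)
    then obtain v y where v: "eigenfunction z' v y" "abs_l2 v \<noteq> 0"
      using weyl_cases[of z'] z'(1) unfolding spectrum_def by (metis ComplD)
    have v': "square_integrable v" "solves {0..} z' (\<lambda>_. 0) v y" using v(1) by (auto simp: eigenfunction_def)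
    define f where "f x = (z' - z) * v x" for x
    have f: "square_integrable f" "abs_l2 f = (z' - z) *\<^sub>C abs_l2 v"
      unfolding f_def using v'(1) by (auto simp: abs_l2_scaleC square_integrable_scale)
    obtain u w where u: "solves {0..} z (zero_ext f) u w" "square_integrable u" "norm (abs_l2 u) \<le> K * norm (abs_l2 f)"
      using K(2)[OF f(1)] by blast
    have "solves {0..} z (\<lambda>x. 0 + (z' - z) * v x) v y" by (rule solves_shift[OF v'(2)]) simp
    then have "solves {0..} z (zero_ext f) v y"
      by (rule solves_forcing_cong) (simp add: zero_ext_def f_def)
    from solves_diff[OF this u(1)] have "solves {0..} z (\<lambda>_. 0) (\<lambda>x. v x - u x) (\<lambda>x. y x - w x)" by simp
    moreover have "square_integrable (\<lambda>x. v x - u x)"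
      using square_integrable_add[OF v'(1) square_integrable_scale[OF u(2), of "-1"]] by simp
    ultimately obtain c where c: "\<And>x. x \<ge> 0 \<Longrightarrow> v x - u x = c * \<psi> x" using psi(3) by blast
    have "abs_l2 v = abs_l2 (\<lambda>x. u x + c * \<psi> x)"
    proof (rule square_integrable_cong(2))
      show "square_integrable (\<lambda>x. u x + c * \<psi> x)"
        by (rule square_integrable_add[OF u(2) square_integrable_scale[OF psi'(1)]])
      show "u x + c * \<psi> x = v x" if "x > 0" for x using c[of x] that by (simp add: algebra_simps)
    qed
    then have split: "abs_l2 v = abs_l2 u + c *\<^sub>C abs_l2 \<psi>"
      by (simp add: abs_l2_add abs_l2_scaleC u(2) psi'(1) square_integrable_scale)
    have "(z' - cnj z) * (\<integral>x. v x * cnj (\<psi> x) \<partial>half_line) = 0" by (rule eigenfunctions_orthogonal[OF v(1) psi(1)])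
    \<comment> \<open>As \<open>z\<close> is real, the factor is \<open>z' - z\<close>, which is not
      0.\<close>
    then have orth: "(\<integral>x. v x * cnj (\<psi> x) \<partial>half_line) = 0" using z'(2) z_real by simp
    have "abs_l2 v \<bullet> (c *\<^sub>C abs_l2 \<psi>) = Re (\<integral>x. v x * cnj (c * \<psi> x) \<partial>half_line)"
      unfolding abs_l2_scaleC[OF psi'(1)] by (rule abs_l2_inner_Re[OF v'(1) square_integrable_scale[OF psi'(1)]])
    also have "(\<integral>x. v x * cnj (c * \<psi> x) \<partial>half_line) = (\<integral>x. cnj c * (v x * cnj (\<psi> x)) \<partial>half_line)"
      by (simp add: mult_ac)
    also have "\<dots> = 0" using orth by simp
    finally have "abs_l2 v \<bullet> abs_l2 v = abs_l2 v \<bullet> abs_l2 u"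
      by (subst (2) split) (simp add: inner_add_right)
    then have "(norm (abs_l2 v))\<^sup>2 \<le> norm (abs_l2 v) * norm (abs_l2 u)"
      using norm_cauchy_schwarz[of "abs_l2 v" "abs_l2 u"] by (simp add: power2_norm_eq_inner)
    then have "norm (abs_l2 v) \<le> norm (abs_l2 u)" using v(2) by (simp add: power2_eq_square)
    also have "\<dots> \<le> K * (cmod (z' - z) * norm (abs_l2 v))" using u(3) by (simp add: f(2) norm_scaleC)
    finally have "1 \<le> K * cmod (z' - z)" using v(2) by (simp add: mult.assoc[symmetric])
    also have "\<dots> \<le> K * (1 / (K + 1))" using z'(3) K(1) by (intro mult_left_mono) (auto simp: d_def dist_norm)
    also have "\<dots> < 1" using K(1) by (simp add: field_simps)
    finally show False by simp
  qed
  then show ?thesis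
    unfolding discrete_spectrum_def using spec eig fin psi(2) by blast
qed

section \<open>Approximate eigenfunctions far out on the half-line\<close>

section \<open>Weyl sequences\<close>

lemma decay_integral:
  assumes "d > 0"
  obtains N where "N \<ge> 0" "\<And>x (m::nat). x \<ge> N \<Longrightarrow> integral {x..x + m} (\<lambda>t. (s t)\<^sup>2 + \<bar>q t\<bar>) \<le> m * d"
proof -
  obtain N where N: "N \<ge> 0" "\<And>x. x \<ge> N \<Longrightarrow> (\<integral>\<^sup>+t. indicator {x..x+1} t * ennreal ((s t)\<^sup>2 + \<bar>q t\<bar>) \<partial>lebesgue) \<le> ennreal d"
    using decay[OF assms] by blast
  define g where "g t = (s t)\<^sup>2 + \<bar>q t\<bar>" for t
  have gi: "g absolutely_integrable_on {a..b}" for a b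
  proof -
    have "(\<lambda>t. \<bar>q t\<bar>) absolutely_integrable_on {a..b}" using q_int[of a b] by (auto simp: absolutely_integrable_on_def)
    then show ?thesis unfolding g_def[abs_def] by (intro set_integral_add s2_int)
  qed
  have one: "integral {x..x+1} g \<le> d" if "x \<ge> N" for x
  proof -
    have "ennreal (integral {x..x+1} g) = (\<integral>\<^sup>+t. ennreal (indicator {x..x+1} t *\<^sub>R g t) \<partial>lebesgue)"
      using set_lebesgue_integral_eq_integral(2)[OF gi[of x "x+1"]] gi[of x "x+1"]
      by (subst nn_integral_eq_integral) (auto simp: set_integrable_def set_lebesgue_integral_def g_def)
    also have "\<dots> = (\<integral>\<^sup>+t. indicator {x..x+1} t * ennreal ((s t)\<^sup>2 + \<bar>q t\<bar>) \<partial>lebesgue)"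
      by (intro nn_integral_cong) (simp add: indicator_def g_def)
    also have "\<dots> \<le> ennreal d" by (rule N(2)[OF that])
    finally show ?thesis using assms by (subst (asm) ennreal_le_iff) auto
  qed
  show thesis
  proof (rule that[OF N(1)])
    fix x and m :: nat assume x: "x \<ge> N"
    have "integral {x..x + real m} g \<le> real m * d"
    proof (induction m)
      case (Suc m)
      have "integral {x..x + real m} g + integral {x + real m..x + real m + 1} g = integral {x..x + real m + 1} g"
        using gi[of x "x + real m + 1"]
        by (intro Henstock_Kurzweil_Integration.integral_combine) (auto simp: absolutely_integrable_on_def)
      moreover have "integral {x + real m..x + real m + 1} g \<le> d" using x by (intro one) auto
      ultimately show ?case using Suc by (simp add: algebra_simps)
    qed simp
    then show "integral {x..x + real m} (\<lambda>t. (s t)\<^sup>2 + \<bar>q t\<bar>) \<le> real m * d" by (simp add: g_def[abs_def])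
  qed
qed

text \<open>For fixed \<open>m\<close>, decay makes the total over \<open>m\<close> unit intervals
  as small as desired by going far enough out; the modulus of \<open>s\<close> is again reached
  through its square.\<close>

lemma small_on_long_interval:
  fixes m :: nat
  assumes "e > 0" "m \<ge> 1"
  obtains a :: real where "a \<ge> 1" "integral {a..a + m} (\<lambda>t. \<bar>s t\<bar> + \<bar>q t\<bar>) \<le> e" "integral {a..a + m} (\<lambda>t. (s t)\<^sup>2) \<le> 1"
proof -
  \<comment> \<open>\<open>m * c = e / 2\<close> serves the constant term of
    \<open>\<bar>s\<bar> \<le> c + s^2 / c\<close>; \<open>d\<close> makes the remaining terms at
    most \<open>e / 2\<close> and the integral of the square at most 1.\<close>
  define c where "c = e / (2 * m)"
  have c: "c > 0" using assms by (simp add: c_def)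
  define d where "d = min (1 / m) (e / (2 * m * (1 / c + 1)))"
  have c1: "1 / c + 1 > 0" using c by (simp add: add_pos_pos)
  have d: "d > 0" using assms c1 by (simp add: d_def)
  obtain N where N: "N \<ge> 0" "\<And>x (m::nat). x \<ge> N \<Longrightarrow> integral {x..x + m} (\<lambda>t. (s t)\<^sup>2 + \<bar>q t\<bar>) \<le> m * d"
    by (rule decay_integral[OF d]) (rule that)
  \<comment> \<open>\<open>a \<ge> 1\<close> keeps the interval away from the boundary point
    0.\<close>
  define a where "a = N + 1"
  have aq: "(\<lambda>t. \<bar>q t\<bar>) absolutely_integrable_on {a..a + m}" "(\<lambda>t. \<bar>s t\<bar>) absolutely_integrable_on {a..a + m}"
    using q_int[of a "a+m"] s_int[of a "a+m"] by (auto simp: absolutely_integrable_on_def)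
  have i: "(\<lambda>t. (s t)\<^sup>2) integrable_on {a..a + m}" "(\<lambda>t. \<bar>q t\<bar>) integrable_on {a..a + m}" "(\<lambda>t. \<bar>s t\<bar>) integrable_on {a..a + m}"
    using s2_int[of a "a+m"] aq by (auto simp: absolutely_integrable_on_def)
  have g: "integral {a..a + m} (\<lambda>t. (s t)\<^sup>2 + \<bar>q t\<bar>) \<le> m * d" using N(2)[of a m] by (simp add: a_def)
  have gi: "(\<lambda>t. (s t)\<^sup>2 + \<bar>q t\<bar>) integrable_on {a..a + m}" using i by (intro Henstock_Kurzweil_Integration.integrable_add)
  have "integral {a..a + m} (\<lambda>t. (s t)\<^sup>2) \<le> integral {a..a + m} (\<lambda>t. (s t)\<^sup>2 + \<bar>q t\<bar>)"
    using i gi by (intro integral_le) auto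
  also have "\<dots> \<le> m * (1 / m)" using g assms by (rule_tac order_trans[OF g]) (intro mult_left_mono, auto simp: d_def)
  finally have 2: "integral {a..a + m} (\<lambda>t. (s t)\<^sup>2) \<le> 1" using assms by simp
  have "integral {a..a + m} (\<lambda>t. \<bar>s t\<bar> + \<bar>q t\<bar>) \<le> integral {a..a + m} (\<lambda>t. c + (1 / c + 1) * ((s t)\<^sup>2 + \<bar>q t\<bar>))"
  proof (rule integral_le)
    show "(\<lambda>t. c + (1 / c + 1) * ((s t)\<^sup>2 + \<bar>q t\<bar>)) integrable_on {a..a + m}"
      by (rule Henstock_Kurzweil_Integration.integrable_add[OF integrable_const_ivl integrable_on_mult_right[OF gi]])
    fix t
    have "\<bar>s t\<bar> \<le> c + (1 / c) * (s t)\<^sup>2"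
    proof -
      have "0 \<le> (\<bar>s t\<bar> - c)\<^sup>2" "0 \<le> c * \<bar>s t\<bar>" using c by auto
      then have "c * \<bar>s t\<bar> \<le> c * c + (s t)\<^sup>2" by (simp add: power2_eq_square algebra_simps)
      then have "c * \<bar>s t\<bar> / c \<le> (c * c + (s t)\<^sup>2) / c" using c by (intro divide_right_mono) auto
      then show ?thesis using c by (simp add: add_divide_distrib)
    qed
    moreover have "0 \<le> (s t)\<^sup>2" "0 \<le> (1 / c) * \<bar>q t\<bar>" using c by auto
    ultimately have "\<bar>s t\<bar> + \<bar>q t\<bar> \<le> c + (1 / c) * (s t)\<^sup>2 + (s t)\<^sup>2 + (1 / c) * \<bar>q t\<bar> + \<bar>q t\<bar>" by linarith
    then show "\<bar>s t\<bar> + \<bar>q t\<bar> \<le> c + (1 / c + 1) * ((s t)\<^sup>2 + \<bar>q t\<bar>)" by (simp add: algebra_simps)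
  qed (use i in \<open>auto intro!: Henstock_Kurzweil_Integration.integrable_add\<close>)
  also have "\<dots> = m * c + (1 / c + 1) * integral {a..a + m} (\<lambda>t. (s t)\<^sup>2 + \<bar>q t\<bar>)"
    using gi by (subst Henstock_Kurzweil_Integration.integral_add) (auto intro!: integrable_on_mult_right)
  also have "\<dots> \<le> m * c + (1 / c + 1) * (m * d)" using g c1 by (intro add_left_mono mult_left_mono) auto
  also have "\<dots> \<le> m * c + (1 / c + 1) * (m * (e / (2 * m * (1 / c + 1))))"
    using c1 by (intro add_left_mono mult_left_mono) (auto simp: d_def)
  also have "\<dots> = e"
  proof -
    have "r * (real m * (e / (2 * real m * r))) = e / 2" if "r > 0" for r
      using that assms(2) by (simp add: field_simps)
    from this[OF c1] have "(1 / c + 1) * (real m * (e / (2 * real m * (1 / c + 1)))) = e / 2" .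
    moreover have "real m * c = e / 2" using assms(2) by (simp add: c_def)
    ultimately show ?thesis by (simp only: of_nat_mult of_nat_numeral field_sum_of_halves)
  qed
  finally show thesis using that[of a] 2 N(1) by (simp add: a_def)
qed

text \<open>Gronwall for the difference from the free pair \<open>f0\<close>, \<open>f1\<close>,
  that is \<open>exp (\<i> * k * (x - a))\<close> and its derivative. The Gronwall factor can be
  bounded in terms of \<open>k\<close> and the length \<open>m\<close>, independently of the
  position \<open>a\<close>, so smallness of the coefficients far out overcomes it.\<close>

lemma solves_close_to_free:
  fixes k :: real and m :: nat
  assumes k: "k \<ge> 0" and m: "m \<ge> 1"
  obtains a :: real and v y where "a \<ge> 1" "integral {a..a + real m} (\<lambda>t. (s t)\<^sup>2) \<le> 1"
    "solves {a..a + real m} (of_real (k\<^sup>2)) (\<lambda>_. 0) v y"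
    "\<And>x. x \<in> {a..a + real m} \<Longrightarrow> 1 / 2 \<le> cmod (v x) \<and> cmod (v x) \<le> 2 \<and> cmod (y x) \<le> k + 1"
proof -
  define z where "z = complex_of_real (k\<^sup>2)"
  \<comment> \<open>\<open>E\<close> bounds the Gronwall factor on an interval of length
    \<open>m\<close> as soon as \<open>e \<le> 1\<close>; the second entry of \<open>e\<close> makes
    the error \<open>(1 + k) * e * E\<close> at most 1 / 2.\<close>
  define E where "E = exp (2 * (2 + 2 * (k\<^sup>2 + 1) * m))"
  define e where "e = min 1 (1 / (2 * (1 + k) * E))"
  have e: "e > 0" using k by (simp add: e_def E_def)
  obtain a :: real where a: "a \<ge> 1" "integral {a..a + real m} (\<lambda>t. \<bar>s t\<bar> + \<bar>q t\<bar>) \<le> e" "integral {a..a + real m} (\<lambda>t. (s t)\<^sup>2) \<le> 1"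
    by (rule small_on_long_interval[OF e m]) (rule that)
  obtain v y where vy: "solves {a..a + real m} z (\<lambda>_. 0) v y" "v a = 1" "y a = \<i> * of_real k"
    by (rule solves_exist[where f="\<lambda>_. 0" and a=a and b="a + real m" and ?x0.0=a and z=z and c=1 and d="\<i> * of_real k"]) auto
  define f0 where "f0 x = exp (\<i> * of_real k * of_real (x - a))" for x
  define f1 where "f1 x = \<i> * of_real k * f0 x" for x
  have n0: "cmod (f0 x) = 1" for x
  proof -
    have "f0 x = exp (\<i> * complex_of_real (k * (x - a)))" by (simp add: f0_def mult.assoc)
    then show ?thesis by (simp only: norm_exp_i_times)
  qed
  have n1: "cmod (f1 x) = k" for x using k by (simp add: f1_def norm_mult n0)
  have p0: "primitive_on {a..a + real m} f0 f1"
    unfolding f1_def f0_def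
    by (rule primitive_on_ftc[of "{}" "{a..a+m}"])
      (auto intro!: continuous_intros derivative_eq_intros has_vector_derivative_real_field)
  have "primitive_on {a..a + real m} f1 (\<lambda>x. \<i> * of_real k * f1 x)"
    using primitive_on_cmult[OF p0, of "\<i> * of_real k"] by (simp add: f1_def[abs_def])
  moreover have "\<i> * of_real k * f1 x = - z * f0 x" for x
  proof -
    have "\<i> * of_real k * f1 x = (\<i> * \<i>) * (complex_of_real k * complex_of_real k * f0 x)"
      unfolding f1_def by (simp only: mult_ac)
    then show ?thesis by (simp add: z_def power2_eq_square)
  qed
  ultimately have p1: "primitive_on {a..a + real m} f1 (\<lambda>x. - z * f0 x)" by simp
  define Y where "Y x = (v x - f0 x, y x - f1 x)" for x
  define g where "g x = (complex_of_real (s x) * v x + y x - f1 x,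
     - complex_of_real (s x) * y x + (complex_of_real (q x) - z) * v x - 0 - (- z * f0 x))" for x
  have PY: "primitive_on {a..a + real m} Y g"
    unfolding Y_def g_def using vy(1) p0 p1 by (intro primitive_on_Pair primitive_on_diff) (auto simp: solves_def)
  have aq: "(\<lambda>t. \<bar>q t\<bar>) absolutely_integrable_on {a..a + real m}" "(\<lambda>t. \<bar>s t\<bar>) absolutely_integrable_on {a..a + real m}"
    using q_int[of a "a + real m"] s_int[of a "a + real m"] by (auto simp: absolutely_integrable_on_def)
  then have si: "(\<lambda>t. \<bar>s t\<bar> + \<bar>q t\<bar>) absolutely_integrable_on {a..a + real m}" by (intro set_integral_add) auto
  then have si': "(\<lambda>t. \<bar>s t\<bar> + \<bar>q t\<bar>) integrable_on {a..a + real m}" by (auto simp: absolutely_integrable_on_def)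
  \<comment> \<open>Bounds the residuals \<open>s * f0\<close>, \<open>s * f1\<close> and
    \<open>q * f0\<close> of the free pair, where \<open>f0\<close> has modulus 1 and
    \<open>f1\<close> modulus \<open>k\<close>.\<close>
  define f where "f t = (1 + k) * (\<bar>s t\<bar> + \<bar>q t\<bar>)" for t
  have close: "norm (Y x) \<le> 1 / 2" if x: "x \<in> {a..a + real m}" for x
  proof -
    have "norm (Y x) \<le> (norm (Y a) + integral {a..a + real m} f) * exp (2 * integral {a..a + real m} (growth z))"
    proof (rule primitive_gronwall[OF PY growth_integrable growth_nonneg])
      show "f absolutely_integrable_on {a..a + real m}" unfolding f_def[abs_def] by (intro set_integrable_mult_right si)
      show "0 \<le> f t" for t using k by (simp add: f_def)
      fix t
      define A where "A = cmod (v t - f0 t)"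
      define B where "B = cmod (y t - f1 t)"
      have eq: "complex_of_real (s t) * v t + y t - f1 t = complex_of_real (s t) * (v t - f0 t) + (y t - f1 t) + complex_of_real (s t) * f0 t"
        by (simp add: algebra_simps)
      have "cmod (complex_of_real (s t) * v t + y t - f1 t) \<le> \<bar>s t\<bar> * A + B + \<bar>s t\<bar>"
        unfolding eq using norm_triangle_ineq[of "complex_of_real (s t) * (v t - f0 t) + (y t - f1 t)" "complex_of_real (s t) * f0 t"]
          norm_triangle_ineq[of "complex_of_real (s t) * (v t - f0 t)" "y t - f1 t"]
        unfolding norm_mult n0 norm_of_real A_def B_def by linarith
      moreover have "cmod (- complex_of_real (s t) * y t + (complex_of_real (q t) - z) * v t - 0 - (- z * f0 t)) \<le>
          \<bar>s t\<bar> * B + (\<bar>q t\<bar> + cmod z) * A + \<bar>s t\<bar> * k + \<bar>q t\<bar>"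
      proof -
        have "- complex_of_real (s t) * y t + (complex_of_real (q t) - z) * v t - 0 - (- z * f0 t) =
          - complex_of_real (s t) * (y t - f1 t) + (complex_of_real (q t) - z) * (v t - f0 t) - complex_of_real (s t) * f1 t + complex_of_real (q t) * f0 t"
          by (simp add: algebra_simps)
        also have "cmod \<dots> \<le> cmod (complex_of_real (s t) * (y t - f1 t)) + cmod ((complex_of_real (q t) - z) * (v t - f0 t)) +
            cmod (complex_of_real (s t) * f1 t) + cmod (complex_of_real (q t) * f0 t)"
          using norm_triangle_ineq[of "- complex_of_real (s t) * (y t - f1 t) + (complex_of_real (q t) - z) * (v t - f0 t) - complex_of_real (s t) * f1 t" "complex_of_real (q t) * f0 t"]
            norm_triangle_ineq4[of "- complex_of_real (s t) * (y t - f1 t) + (complex_of_real (q t) - z) * (v t - f0 t)" "complex_of_real (s t) * f1 t"]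
            norm_triangle_ineq[of "- complex_of_real (s t) * (y t - f1 t)" "(complex_of_real (q t) - z) * (v t - f0 t)"]
          by simp
        also have "\<dots> \<le> \<bar>s t\<bar> * B + (\<bar>q t\<bar> + cmod z) * A + \<bar>s t\<bar> * k + \<bar>q t\<bar>"
          unfolding norm_mult n0 n1 A_def[symmetric] B_def[symmetric]
          using norm_triangle_ineq4[of "of_real (q t)" z] k by (intro add_mono mult_right_mono) (auto simp: A_def B_def)
        finally show ?thesis .
      qed
      ultimately have "norm (g t) \<le> (\<bar>s t\<bar> * A + B + \<bar>s t\<bar>) + (\<bar>s t\<bar> * B + (\<bar>q t\<bar> + cmod z) * A + \<bar>s t\<bar> * k + \<bar>q t\<bar>)"
        unfolding g_def by (rule order_trans[OF norm_Pair_le add_mono])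
      also have "\<dots> \<le> (\<bar>s t\<bar> + \<bar>q t\<bar> + cmod z + 1) * (A + B) + f t"
        using k by (simp add: f_def A_def B_def algebra_simps)
      also have "\<dots> \<le> (\<bar>s t\<bar> + \<bar>q t\<bar> + cmod z + 1) * (2 * norm (Y t)) + f t"
        unfolding A_def B_def Y_def by (intro add_right_mono mult_left_mono norm_pair_ge) auto
      finally show "norm (g t) \<le> growth z t * norm (Y t) + f t" by (simp add: growth_def algebra_simps)
    qed (use x m in auto)
    also have "\<dots> \<le> ((1 + k) * e) * E"
    proof (rule mult_mono)
      have "Y a = 0" by (simp add: Y_def f0_def f1_def vy zero_prod_def)
      moreover have "integral {a..a + real m} f = (1 + k) * integral {a..a + real m} (\<lambda>t. \<bar>s t\<bar> + \<bar>q t\<bar>)"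
        unfolding f_def by (rule integral_mult_right)
      ultimately show "norm (Y a) + integral {a..a + real m} f \<le> (1 + k) * e"
        using a(2) k by (simp add: mult_left_mono)
      have "integral {a..a + real m} (growth z) = integral {a..a + real m} (\<lambda>t. 2 * (\<bar>s t\<bar> + \<bar>q t\<bar>) + 2 * (cmod z + 1))"
        by (simp add: growth_def[abs_def] algebra_simps)
      also have "\<dots> = integral {a..a + real m} (\<lambda>t. 2 * (\<bar>s t\<bar> + \<bar>q t\<bar>)) + integral {a..a + real m} (\<lambda>t. 2 * (cmod z + 1))"
        by (rule Henstock_Kurzweil_Integration.integral_add[OF integrable_on_mult_right[OF si'] integrable_const_ivl])
      also have "\<dots> = 2 * integral {a..a + real m} (\<lambda>t. \<bar>s t\<bar> + \<bar>q t\<bar>) + 2 * (cmod z + 1) * m"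
        unfolding integral_mult_right by simp
      also have "\<dots> \<le> 2 * 1 + 2 * (k\<^sup>2 + 1) * m"
        using a(2) by (intro add_mono mult_left_mono) (auto simp: e_def z_def norm_power)
      finally show "exp (2 * integral {a..a + real m} (growth z)) \<le> E" by (simp add: E_def)
      show "0 \<le> (1 + k) * e" using k e by simp
    qed simp
    also have "\<dots> \<le> (1 + k) * (1 / (2 * (1 + k) * E)) * E"
      using k by (intro mult_right_mono mult_left_mono) (auto simp: e_def E_def)
    also have "\<dots> = 1 / 2"
    proof -
      have "r * (1 / (2 * r * E)) * E = 1 / 2" if "r > 0" for r
      proof -
        have "E \<noteq> 0" by (simp add: E_def)
        then show ?thesis using that by simp
      qed
      from this[of "1 + k"] k show ?thesis by linarith
    qed
    finally show ?thesis .
  qed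
  show thesis
  proof (rule that[OF a(1,3)])
    show "solves {a..a + real m} (of_real (k\<^sup>2)) (\<lambda>_. 0) v y" using vy(1) by (simp add: z_def)
    fix x assume "x \<in> {a..a + real m}"
    note c = close[OF this]
    have "cmod (v x - f0 x) \<le> 1 / 2" "cmod (y x - f1 x) \<le> 1 / 2"
      using norm_fst_le[of "v x - f0 x" "y x - f1 x"] norm_snd_le[of "y x - f1 x" "v x - f0 x"] c unfolding Y_def by linarith+
    then show "1 / 2 \<le> cmod (v x) \<and> cmod (v x) \<le> 2 \<and> cmod (y x) \<le> k + 1"
      using n0[of x] n1[of x] norm_triangle_ineq2[of "f0 x" "v x"] norm_triangle_ineq2[of "v x" "f0 x"]
        norm_triangle_ineq2[of "y x" "f1 x"] norm_minus_commute[of "f0 x" "v x"] by auto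
  qed
qed

lemma solves_zero: "solves S z (\<lambda>_. 0) (\<lambda>_. 0) (\<lambda>_. 0)"
  by (simp add: solves_def primitive_on_def)

text \<open>The quasi-derivative of \<open>\<phi> * v\<close> is
  \<open>\<phi> * y + \<phi>' * v\<close>, where \<open>s\<close> has cancelled. Hence every term of
  the forcing carries a derivative of the cut-off, and \<open>s\<close> occurs
  undifferentiated.\<close>

lemma solves_cutoff:
  assumes sol: "solves {a..b} z (\<lambda>_. 0) v y" and ab: "0 \<le> a" "a \<le> b"
    and p: "primitive_on {a..b} \<phi> \<phi>'" "primitive_on {a..b} \<phi>' \<phi>''"
    and zero: "\<And>x. x \<notin> {a<..<b} \<Longrightarrow> \<phi> x = 0 \<and> \<phi>' x = 0 \<and> \<phi>'' x = 0"
  shows "solves {0..} z (\<lambda>x. (- 2 * \<phi>' x * y x - \<phi>'' x * v x) + complex_of_real (s x) * (- 2 * \<phi>' x * v x))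
    (\<lambda>x. \<phi> x * v x) (\<lambda>x. \<phi> x * y x + \<phi>' x * v x)" (is "solves _ _ ?f ?u ?w")
proof -
  have V: "primitive_on {a..b} v (\<lambda>x. complex_of_real (s x) * v x + y x)"
    "primitive_on {a..b} y (\<lambda>x. - complex_of_real (s x) * y x + (complex_of_real (q x) - z) * v x - 0)"
    using sol by (auto simp: solves_def)
  have I: "is_interval {a..b}" by simp
  have mid: "solves {a..b} z ?f ?u ?w"
    unfolding solves_def
  proof
    have "primitive_on {a..b} ?u (\<lambda>x. \<phi>' x * v x + \<phi> x * (complex_of_real (s x) * v x + y x))"
      by (rule primitive_on_mult[OF I p(1) V(1)])
    then show "primitive_on {a..b} ?u (\<lambda>x. complex_of_real (s x) * ?u x + ?w x)"
      by (simp add: algebra_simps)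
    have "primitive_on {a..b} ?w (\<lambda>x. (\<phi>' x * y x + \<phi> x * (- complex_of_real (s x) * y x + (complex_of_real (q x) - z) * v x - 0))
       + (\<phi>'' x * v x + \<phi>' x * (complex_of_real (s x) * v x + y x)))"
      by (rule primitive_on_add[OF primitive_on_mult[OF I p(1) V(2)] primitive_on_mult[OF I p(2) V(1)]])
    then show "primitive_on {a..b} ?w (\<lambda>x. - complex_of_real (s x) * ?w x + (complex_of_real (q x) - z) * ?u x - ?f x)"
      by (simp add: algebra_simps)
  qed
  \<comment> \<open>Off the support of the cut-off the pair is the zero solution, which glues to the
    middle piece on both sides.\<close>
  have out: "solves S z ?f ?u ?w" if "is_interval S" "\<And>x. x \<in> S \<Longrightarrow> x \<notin> {a<..<b}" for S
    by (rule iffD1[OF solves_cong[OF that(1)] solves_zero]) (use zero that(2) in auto)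
  have "solves {0..a} z ?f ?u ?w" "solves {b..} z ?f ?u ?w"
    by (rule out; auto simp: is_interval_ci)+
  then show ?thesis
    using mid ab unfolding solves_def
    by (meson primitive_on_join_Ici order_trans)
qed

text \<open>On an interval of length \<open>L\<close>, the cut-off \<open>\<phi> = ((x - a) * (b - x))^3\<close> yields \<open>u = \<phi> * v\<close> with
  \<open>\<parallel>u\<parallel>\<^sup>2\<close> at least of order \<open>L^13\<close>, whereas the square norm of its image under \<open>H - z\<close> is at most of order \<open>L^11\<close>.\<close>

lemma spectrum_contains_nonneg:
  fixes k :: real
  assumes k: "k \<ge> 0"
  shows "complex_of_real (k\<^sup>2) \<in> spectrum (H \<sigma> \<tau> \<alpha>)"
proof (rule ccontr)
  define z where "z = complex_of_real (k\<^sup>2)"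
  assume "complex_of_real (k\<^sup>2) \<notin> spectrum (H \<sigma> \<tau> \<alpha>)"
  then have "z \<in> resolvent_set (H \<sigma> \<tau> \<alpha>)" by (simp add: spectrum_def z_def)
  then obtain K where K: "K > 0" "\<And>p v. (p, v) \<in> H \<sigma> \<tau> \<alpha> \<Longrightarrow> norm p \<le> norm (v - z *\<^sub>C p) * K"
    by (rule resolvent_set_bound) (rule that)
  \<comment> \<open>The square of a sum of three terms costs the factor 3; the squared coefficients
    are \<open>36 * (k + 1)^2\<close>, 576 from the second derivative of the cut-off and 144 from
    the term with \<open>s\<close>, and 576 + 144 = 720.\<close>
  define C where "C = 3 * (36 * (k + 1)\<^sup>2 + 720)"
  \<comment> \<open>On the middle half of the interval the cut-off is at least
    \<open>(3 / 16 * L^2)^3 = 27 / 4096 * L^6\<close> and \<open>v\<close> has modulus at least 1 /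
    2; this half has length \<open>L / 2\<close>.\<close>
  define c where "c = ((27 / 4096)\<^sup>2 / 8 :: real)"
  have c: "c > 0" by (simp add: c_def)
  have main: "c * (real m)\<^sup>2 \<le> K\<^sup>2 * C" if m: "m \<ge> 1" for m :: nat
  proof -
    define L where "L = real m"
    have L: "L \<ge> 1" using m by (simp add: L_def)
    obtain a v y where raw: "a \<ge> 1" "integral {a..a + real m} (\<lambda>t. (s t)\<^sup>2) \<le> 1"
      "solves {a..a + real m} (complex_of_real (k\<^sup>2)) (\<lambda>_. 0) v y"
      "\<And>x. x \<in> {a..a + real m} \<Longrightarrow> 1 / 2 \<le> cmod (v x) \<and> cmod (v x) \<le> 2 \<and> cmod (y x) \<le> k + 1"
      by (rule solves_close_to_free[OF k m]) (rule that)
    note a = raw(1-3)[folded L_def z_def] and vb = raw(4)[folded L_def]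
    define b where "b = a + L"
    have ab: "0 \<le> a" "a \<le> b" "a < b" using a L by (auto simp: b_def)
    define P where "P x = (x - a) * (b - x)" for x
    \<comment> \<open>With the third power the second derivative, too, vanishes at \<open>a\<close>
      and \<open>b\<close>, as \<open>solves_cutoff\<close> requires.\<close>
    define \<phi> where "\<phi> x = complex_of_real (if x \<in> {a..b} then (P x)^3 else 0)" for x
    define \<phi>' where "\<phi>' x = complex_of_real (if x \<in> {a..b} then 3 * (P x)\<^sup>2 * (a + b - 2 * x) else 0)" for x
    define \<phi>'' where "\<phi>'' x = complex_of_real (if x \<in> {a..b} then 6 * P x * (a + b - 2 * x)\<^sup>2 - 6 * (P x)\<^sup>2 else 0)" for x
    have I: "is_interval {a..b}" by simp
    have dP: "(P has_real_derivative (a + b - 2 * x)) (at x)" for x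
      unfolding P_def[abs_def] by (auto intro!: derivative_eq_intros)
    have cP: "continuous_on S P" for S unfolding P_def[abs_def] by (intro continuous_intros)
    have p1: "primitive_on {a..b} \<phi> \<phi>'"
    proof -
      have "primitive_on {a..b} (\<lambda>x. complex_of_real ((P x)^3)) (\<lambda>x. complex_of_real (3 * (P x)\<^sup>2 * (a + b - 2 * x)))"
      proof (rule primitive_on_ftc[of "{}" "{a..b}"])
        show "((\<lambda>x. complex_of_real ((P x)^3)) has_vector_derivative complex_of_real (3 * (P x)\<^sup>2 * (a + b - 2 * x))) (at x)" for x
          by (rule has_vector_derivative_of_real)
            (auto simp: has_real_derivative_iff_has_vector_derivative[symmetric] intro!: derivative_eq_intros dP)
      qed (auto intro!: continuous_intros cP disjI2)
      then show ?thesis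
        by (rule iffD1[OF primitive_on_cong, rotated 3]) (auto simp: \<phi>_def \<phi>'_def)
    qed
    have p2: "primitive_on {a..b} \<phi>' \<phi>''"
    proof -
      have "primitive_on {a..b} (\<lambda>x. complex_of_real (3 * (P x)\<^sup>2 * (a + b - 2 * x))) (\<lambda>x. complex_of_real (6 * P x * (a + b - 2 * x)\<^sup>2 - 6 * (P x)\<^sup>2))"
      proof (rule primitive_on_ftc[of "{}" "{a..b}"])
        show "((\<lambda>x. complex_of_real (3 * (P x)\<^sup>2 * (a + b - 2 * x))) has_vector_derivative complex_of_real (6 * P x * (a + b - 2 * x)\<^sup>2 - 6 * (P x)\<^sup>2)) (at x)" for x
          by (rule has_vector_derivative_of_real)
            (auto simp: has_real_derivative_iff_has_vector_derivative[symmetric] power2_eq_square algebra_simps intro!: derivative_eq_intros dP)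
      qed (auto intro!: continuous_intros cP disjI2)
      then show ?thesis
        by (rule iffD1[OF primitive_on_cong, rotated 3]) (auto simp: \<phi>'_def \<phi>''_def)
    qed
    have zero: "\<phi> x = 0 \<and> \<phi>' x = 0 \<and> \<phi>'' x = 0" if "x \<notin> {a<..<b}" for x
    proof (cases "x \<in> {a..b}")
      case True
      then have "x = a \<or> x = b" using that by auto
      then have "P x = 0" by (auto simp: P_def)
      then show ?thesis by (simp add: \<phi>_def \<phi>'_def \<phi>''_def)
    qed (auto simp: \<phi>_def \<phi>'_def \<phi>''_def)
    have vs: "solves {a..b} z (\<lambda>_. 0) v y" using a(3) by (simp add: b_def)
    define A where "A x = - 2 * \<phi>' x * y x - \<phi>'' x * v x" for x
    define B where "B x = - 2 * \<phi>' x * v x" for x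
    define f where "f x = A x + complex_of_real (s x) * B x" for x
    define u where "u x = \<phi> x * v x" for x
    define w where "w x = \<phi> x * y x + \<phi>' x * v x" for x
    have sol: "solves {0..} z f u w"
      unfolding f_def A_def B_def u_def w_def by (rule solves_cutoff[OF vs ab(1,2) p1 p2 zero])
    have bc: "boundary u w = 0" using zero[of 0] a(1) by (simp add: boundary_def u_def w_def)
    have Pb: "0 \<le> P x" "P x \<le> L\<^sup>2" "\<bar>a + b - 2 * x\<bar> \<le> L" if "x \<in> {a..b}" for x
    proof -
      show "0 \<le> P x" using that by (simp add: P_def)
      have "P x \<le> L * L" unfolding P_def using that by (intro mult_mono) (auto simp: b_def)
      then show "P x \<le> L\<^sup>2" by (simp add: power2_eq_square)
      show "\<bar>a + b - 2 * x\<bar> \<le> L" using that by (auto simp: b_def)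
    qed
    have phi_b: "cmod (\<phi> x) \<le> L^6" "cmod (\<phi>' x) \<le> 3 * L^5" "cmod (\<phi>'' x) \<le> 12 * L^4" for x
    proof -
      have "cmod (\<phi> x) \<le> L^6 \<and> cmod (\<phi>' x) \<le> 3 * L^5 \<and> cmod (\<phi>'' x) \<le> 12 * L^4"
      proof (cases "x \<in> {a..b}")
        case True
        note Pb = Pb[OF True]
        have 3: "(P x)^3 \<le> (L\<^sup>2)^3" and 2: "(P x)\<^sup>2 \<le> (L\<^sup>2)\<^sup>2" 
          by (rule power_mono[OF Pb(2,1)])+
        have D: "(a + b - 2 * x)\<^sup>2 \<le> L\<^sup>2" using power_mono[OF Pb(3), of 2] by simp
        have "cmod (\<phi> x) = (P x)^3" using True Pb(1) by (simp add: \<phi>_def norm_power del: of_real_power)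
        moreover have "(L\<^sup>2)^3 = L^6" by (simp flip: power_mult)
        moreover have "cmod (\<phi>' x) = 3 * (P x)\<^sup>2 * \<bar>a + b - 2 * x\<bar>"
          unfolding \<phi>'_def norm_of_real using True by (simp add: abs_mult)
        moreover have "3 * (P x)\<^sup>2 * \<bar>a + b - 2 * x\<bar> \<le> 3 * (L\<^sup>2)\<^sup>2 * L"
          using 2 Pb(3) L by (intro mult_mono) auto
        moreover have "3 * (L\<^sup>2)\<^sup>2 * L = 3 * L^5" by (simp add: power2_eq_square eval_nat_numeral)
        moreover have "cmod (\<phi>'' x) \<le> 6 * P x * (a + b - 2 * x)\<^sup>2 + 6 * (P x)\<^sup>2"
        proof -
          have "0 \<le> 6 * P x * (a + b - 2 * x)\<^sup>2" using Pb(1) by simp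
          then show ?thesis unfolding \<phi>''_def norm_of_real using True by (simp add: abs_le_iff)
        qed
        moreover have "6 * P x * (a + b - 2 * x)\<^sup>2 + 6 * (P x)\<^sup>2 \<le> 6 * L\<^sup>2 * L\<^sup>2 + 6 * (L\<^sup>2)\<^sup>2"
          using Pb D 2 L by (intro add_mono mult_mono) auto
        moreover have "6 * L\<^sup>2 * L\<^sup>2 + 6 * (L\<^sup>2)\<^sup>2 = 12 * L^4" by (simp add: power2_eq_square eval_nat_numeral)
        ultimately show ?thesis using 3 by (intro conjI) linarith+
      next
        case False
        then show ?thesis using L by (auto simp: \<phi>_def \<phi>'_def \<phi>''_def)
      qed
      then show "cmod (\<phi> x) \<le> L^6" "cmod (\<phi>' x) \<le> 3 * L^5" "cmod (\<phi>'' x) \<le> 12 * L^4" by auto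
    qed
    have cont: "continuous_on {a..b} v" "continuous_on {a..b} y" "continuous_on {a..b} \<phi>'" "continuous_on {a..b} \<phi>''"
    proof -
      show "continuous_on {a..b} v" "continuous_on {a..b} y" by (rule solves_continuous[OF vs])+
      show "continuous_on {a..b} \<phi>'" by (rule primitive_on_Icc_continuous[OF p2])
      have "continuous_on {a..b} (\<lambda>x. complex_of_real (6 * P x * (a + b - 2 * x)\<^sup>2 - 6 * (P x)\<^sup>2))"
        by (intro continuous_intros cP)
      then show "continuous_on {a..b} \<phi>''" by (rule continuous_on_eq) (simp add: \<phi>''_def)
    qed
    \<comment> \<open>\<open>v\<close> and \<open>y\<close> are controlled on \<open>{a..b}\<close>
      only; the derivatives of the cut-off supply the zeros outside.\<close>
    have meas_ext: "h \<in> borel_measurable lebesgue" if "continuous_on {a..b} h" "\<And>x. x \<notin> {a..b} \<Longrightarrow> h x = 0" for h :: "real \<Rightarrow> complex"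
    proof -
      have "h \<in> borel_measurable (lebesgue_on {a..b})"
        by (rule continuous_imp_measurable_on_sets_lebesgue[OF that(1)]) simp
      then have "(\<lambda>x. if x \<in> {a..b} then h x else 0) \<in> borel_measurable lebesgue"
        by (rule borel_measurable_if_I) simp
      moreover have "(\<lambda>x. if x \<in> {a..b} then h x else 0) = h" using that(2) by auto
      ultimately show ?thesis by simp
    qed
    have zero': "\<phi> x = 0 \<and> \<phi>' x = 0 \<and> \<phi>'' x = 0" if "x \<notin> {a..b}" for x using zero that by auto
    have [measurable]: "A \<in> borel_measurable lebesgue" "B \<in> borel_measurable lebesgue"
      unfolding A_def[abs_def] B_def[abs_def]
      by (rule meas_ext; use zero' in \<open>auto intro!: continuous_intros cont\<close>)+
    have fm: "f \<in> borel_measurable lebesgue" unfolding f_def[abs_def] by measurable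
    \<comment> \<open>There is no pointwise bound on \<open>s\<close>, so its square is kept here
      and integrated afterwards.\<close>
    have f_pt: "(cmod (f x))\<^sup>2 \<le> indicator {a..b} x * (3 * (36 * (k + 1)\<^sup>2 * L^10 + 576 * L^8) + 432 * L^10 * (s x)\<^sup>2)" for x
    proof (cases "x \<in> {a..b}")
      case True
      then have v: "cmod (v x) \<le> 2" "cmod (y x) \<le> k + 1" using vb[of x] by (auto simp: b_def)
      have "cmod (f x) \<le> 2 * cmod (\<phi>' x) * cmod (y x) + cmod (\<phi>'' x) * cmod (v x) + \<bar>s x\<bar> * (2 * cmod (\<phi>' x) * cmod (v x))"
        unfolding f_def A_def B_def
        using norm_triangle_ineq[of "- 2 * \<phi>' x * y x - \<phi>'' x * v x" "complex_of_real (s x) * (- 2 * \<phi>' x * v x)"]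
          norm_triangle_ineq4[of "- 2 * \<phi>' x * y x" "\<phi>'' x * v x"]
        by (simp add: norm_mult)
      also have "\<dots> \<le> 2 * (3 * L^5) * (k + 1) + 12 * L^4 * 2 + \<bar>s x\<bar> * (2 * (3 * L^5) * 2)"
        using phi_b[of x] v k L by (intro add_mono mult_mono) auto
      finally have le: "cmod (f x) \<le> 6 * L^5 * (k + 1) + 24 * L^4 + 12 * L^5 * \<bar>s x\<bar>" by (simp add: algebra_simps)
      have sq3: "(p + q + r)\<^sup>2 \<le> 3 * (p\<^sup>2 + q\<^sup>2 + r\<^sup>2)" for p q r :: real
        using zero_le_power2[of "p - q"] zero_le_power2[of "q - r"] zero_le_power2[of "p - r"]
        unfolding power2_eq_square by (simp add: algebra_simps)
      have "(cmod (f x))\<^sup>2 \<le> (6 * L^5 * (k + 1) + 24 * L^4 + 12 * L^5 * \<bar>s x\<bar>)\<^sup>2"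
        by (rule power_mono[OF le]) simp
      also have "\<dots> \<le> 3 * ((6 * L^5 * (k + 1))\<^sup>2 + (24 * L^4)\<^sup>2 + (12 * L^5 * \<bar>s x\<bar>)\<^sup>2)" by (rule sq3)
      also have "\<dots> = 3 * (36 * (k + 1)\<^sup>2 * L^10 + 576 * L^8) + 432 * L^10 * (s x)\<^sup>2"
      proof -
        have "(6 * L^5 * (k + 1))\<^sup>2 = 36 * (k + 1)\<^sup>2 * L^10" "(24 * L^4)\<^sup>2 = 576 * L^8"
          "(12 * L^5 * \<bar>s x\<bar>)\<^sup>2 = 144 * L^10 * (s x)\<^sup>2"
          by (simp_all add: power_mult_distrib flip: power_mult)
        then show ?thesis by (simp only:) simp
      qed
      finally show ?thesis using True by simp
    next
      case False
      then show ?thesis using zero'[OF False] by (simp add: f_def A_def B_def)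
    qed
    have f_int: "(\<integral>\<^sup>+t. (ennreal (cmod (zero_ext f t)))\<^sup>2 \<partial>lebesgue) \<le> ennreal ((sqrt (C * L^11))\<^sup>2)"
    proof -
      define M where "M = 3 * (36 * (k + 1)\<^sup>2 * L^10 + 576 * L^8)"
      define G where "G x = M + 432 * L^10 * (s x)\<^sup>2" for x
      have G0: "G x \<ge> 0" for x using L by (simp add: G_def M_def)
      have G: "G absolutely_integrable_on {a..b}"
        unfolding G_def[abs_def] using absolutely_integrable_on_const[of "{a..b}" M]
        by (intro set_integral_add set_integrable_mult_right s2_int) auto
      have "(\<integral>\<^sup>+t. (ennreal (cmod (zero_ext f t)))\<^sup>2 \<partial>lebesgue) \<le> (\<integral>\<^sup>+t. ennreal (indicator {a..b} t *\<^sub>R G t) \<partial>lebesgue)"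
      proof (rule nn_integral_mono)
        fix t
        have "(cmod (zero_ext f t))\<^sup>2 \<le> indicator {a..b} t *\<^sub>R G t"
          using f_pt[of t] G0[of t] by (auto simp: zero_ext_def G_def M_def)
        then show "(ennreal (cmod (zero_ext f t)))\<^sup>2 \<le> ennreal (indicator {a..b} t *\<^sub>R G t)"
          by (simp only: ennreal_power norm_ge_zero) (rule ennreal_leI)
      qed
      also have "\<dots> = ennreal (integral {a..b} G)"
        using set_lebesgue_integral_eq_integral(2)[OF G] G G0
        by (subst nn_integral_eq_integral) (auto simp: set_integrable_def set_lebesgue_integral_def)
      also have "\<dots> \<le> ennreal (C * L^11)"
      proof (rule ennreal_leI)
        have s2: "(\<lambda>t. (s t)\<^sup>2) integrable_on {a..b}" using s2_int[of a b] by (auto simp: absolutely_integrable_on_def)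
        have "integral {a..b} G = L * M + 432 * L^10 * integral {a..b} (\<lambda>t. (s t)\<^sup>2)"
          unfolding G_def using s2 ab by (subst Henstock_Kurzweil_Integration.integral_add) (auto simp: b_def intro!: integrable_on_mult_right)
        also have "\<dots> \<le> L * M + 432 * L^10 * 1"
          using a(2) L by (intro add_left_mono mult_left_mono) (auto simp: b_def)
        also have "\<dots> = 3 * (36 * (k + 1)\<^sup>2 * L^11 + 576 * L^9 + 144 * L^10)"
          by (simp add: M_def algebra_simps eval_nat_numeral)
        also have "\<dots> \<le> 3 * (36 * (k + 1)\<^sup>2 * L^11 + 576 * L^11 + 144 * L^11)"
          using L by (intro mult_left_mono add_mono power_increasing) auto
        also have "\<dots> = C * L^11" by (simp add: C_def algebra_simps)
        finally show "integral {a..b} G \<le> C * L^11" .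
      qed
      also have "C * L^11 = (sqrt (C * L^11))\<^sup>2" using L by (simp add: C_def)
      finally show ?thesis .
    qed
    note fsq = square_integrableI[OF measurable_restrict_space1[OF fm] _ f_int]
    have f_sq: "square_integrable f" and f_norm: "norm (abs_l2 f) \<le> sqrt (C * L^11)"
      using fsq L by (auto simp: C_def)
    have ucont: "continuous_on {0..} u" by (rule solves_continuous_Ici(1)[OF sol])
    have um: "u \<in> borel_measurable half_line"
      by (rule continuous_imp_measurable_on_sets_lebesgue[OF continuous_on_subset[OF ucont greaterThan_subset_Ici]]) auto
    have u_int: "(\<integral>\<^sup>+t. (ennreal (cmod (zero_ext u t)))\<^sup>2 \<partial>lebesgue) \<le> ennreal ((sqrt ((2 * L^6)\<^sup>2 * L))\<^sup>2)"
    proof -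
      have "(\<integral>\<^sup>+t. (ennreal (cmod (zero_ext u t)))\<^sup>2 \<partial>lebesgue) \<le> (\<integral>\<^sup>+t. ennreal ((2 * L^6)\<^sup>2) * indicator {a..b} t \<partial>lebesgue)"
      proof (rule nn_integral_mono)
        fix t
        show "(ennreal (cmod (zero_ext u t)))\<^sup>2 \<le> ennreal ((2 * L^6)\<^sup>2) * indicator {a..b} t"
        proof (cases "t \<in> {a..b}")
          case True
          have "cmod (u t) \<le> L^6 * 2"
            unfolding u_def norm_mult using phi_b(1)[of t] vb[of t] True L by (intro mult_mono) (auto simp: b_def)
          then have "cmod (zero_ext u t) \<le> 2 * L^6" using L by (auto simp: zero_ext_def)
          then have "(cmod (zero_ext u t))\<^sup>2 \<le> (2 * L^6)\<^sup>2" by (intro power_mono) auto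
          then have "ennreal ((cmod (zero_ext u t))\<^sup>2) \<le> ennreal ((2 * L^6)\<^sup>2)" by (rule ennreal_leI)
          then show ?thesis using True by (simp add: ennreal_power)
        next
          case False
          then show ?thesis using zero'[OF False] by (simp add: zero_ext_def u_def)
        qed
      qed
      also have "\<dots> = ennreal ((2 * L^6)\<^sup>2) * ennreal L"
        using ab by (subst nn_integral_cmult_indicator) (auto simp: b_def)
      also have "\<dots> = ennreal ((2 * L^6)\<^sup>2 * L)" using L by (intro ennreal_mult[symmetric]) auto
      also have "(2 * L^6)\<^sup>2 * L = (sqrt ((2 * L^6)\<^sup>2 * L))\<^sup>2" using L by simp
      finally show ?thesis .
    qed
    have u_sq: "square_integrable u" using square_integrableI(1)[OF um _ u_int] L by auto
    have lower: "c * L^13 \<le> (norm (abs_l2 u))\<^sup>2"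
    proof -
      have ih: "integrable half_line (\<lambda>x. (cmod (u x))\<^sup>2)" using u_sq by (simp add: square_integrable_def)
      then have ui: "(\<lambda>x. (cmod (u x))\<^sup>2) integrable_on {0<..}" by (rule integrable_on_lebesgue_on) simp
      \<comment> \<open>The middle half of the interval; there \<open>P x\<close> equals
        \<open>3 / 16 * L^2\<close> plus the nonnegative product
        \<open>(x - a1) * (b1 - x)\<close>.\<close>
      define a1 where "a1 = a + L / 4"
      define b1 where "b1 = a + 3 * L / 4"
      have ab1: "a1 \<le> b1" "b1 - a1 = L / 2" "{a1..b1} \<subseteq> {a..b}" "{a1..b1} \<subseteq> {0<..}"
        using L a(1) by (auto simp: a1_def b1_def b_def)
      have ui1: "(\<lambda>x. (cmod (u x))\<^sup>2) integrable_on {a1..b1}"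
        by (rule integrable_on_subinterval[OF ui ab1(4)])
      have "c * L^13 = (b1 - a1) * ((27 / 4096 * L^6) * (1 / 2))\<^sup>2"
        unfolding ab1(2) c_def by (simp add: power2_eq_square eval_nat_numeral)
      also have "\<dots> = integral {a1..b1} (\<lambda>x. ((27 / 4096 * L^6) * (1 / 2))\<^sup>2)" using ab1(1) by simp
      also have "\<dots> \<le> integral {a1..b1} (\<lambda>x. (cmod (u x))\<^sup>2)"
      proof (rule integral_le[OF _ ui1])
        fix x assume x: "x \<in> {a1..b1}"
        then have xab: "x \<in> {a..b}" using ab1(3) by blast
        have "3 / 16 * L\<^sup>2 \<le> P x"
        proof -
          have "0 \<le> (x - a1) * (b1 - x)" using x by (intro mult_nonneg_nonneg) auto
          moreover have "P x = 3 / 16 * L\<^sup>2 + (x - a1) * (b1 - x)"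
            by (simp add: P_def a1_def b1_def b_def field_simps power2_eq_square)
          ultimately show ?thesis by simp
        qed
        then have "(3 / 16 * L\<^sup>2)^3 \<le> (P x)^3" by (rule power_mono) simp
        also have "(3 / 16 * L\<^sup>2)^3 = 27 / 4096 * L^6" by (simp add: power2_eq_square eval_nat_numeral)
        also have "(P x)^3 = cmod (\<phi> x)" using xab Pb(1)[OF xab] by (simp add: \<phi>_def norm_power del: of_real_power)
        finally have "(27 / 4096 * L^6) * (1 / 2) \<le> cmod (u x)"
          unfolding u_def norm_mult using vb[of x] xab L by (intro mult_mono) (auto simp: b_def)
        then show "((27 / 4096 * L^6) * (1 / 2))\<^sup>2 \<le> (cmod (u x))\<^sup>2" by (rule power_mono) (use L in simp)
      qed (rule integrable_const_ivl)
      also have "\<dots> \<le> integral {0<..} (\<lambda>x. (cmod (u x))\<^sup>2)"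
        by (rule integral_subset_le[OF ab1(4) ui1 ui]) simp
      also have "\<dots> = (norm (abs_l2 u))\<^sup>2"
        using lebesgue_integral_eq_integral[OF ih] by (simp add: norm_abs_l2_square[OF u_sq])
      finally show ?thesis .
    qed
    have "solves {0..} z (zero_ext f) u w" by (rule solves_forcing_cong[OF sol]) (simp add: zero_ext_def)
    from solves_shift_in_H[OF this u_sq f_sq bc] K(2)
    have "norm (abs_l2 u) \<le> norm (abs_l2 f) * K" by fastforce
    also have "\<dots> \<le> sqrt (C * L^11) * K" using f_norm K(1) by (intro mult_right_mono) auto
    finally have "(norm (abs_l2 u))\<^sup>2 \<le> (sqrt (C * L^11) * K)\<^sup>2" by (rule power_mono) simp
    also have "\<dots> = K\<^sup>2 * C * L^11" using L by (simp add: power_mult_distrib C_def)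
    finally have "c * L^13 \<le> K\<^sup>2 * C * L^11" using lower by linarith
    \<comment> \<open>Cancelling \<open>L^11\<close> leaves a bound on \<open>L^2\<close> by a
      constant that does not depend on \<open>m\<close>.\<close>
    moreover have "c * L^13 = c * L\<^sup>2 * L^11" by (simp add: eval_nat_numeral)
    ultimately have "c * L\<^sup>2 * L^11 \<le> K\<^sup>2 * C * L^11" by simp
    then show ?thesis using L by (simp add: L_def)
  qed
  obtain m :: nat where m: "K\<^sup>2 * C / c < real m" using reals_Archimedean2 by blast
  have "K\<^sup>2 * C / c \<ge> 0" using c by (simp add: C_def)
  then have m1: "real m \<ge> 1" "m \<ge> 1" using m by (auto simp: Suc_le_eq)
  have "real m \<le> (real m)\<^sup>2" using m1(1) by (simp add: power2_eq_square)
  then have "K\<^sup>2 * C / c < (real m)\<^sup>2" using m by linarith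
  then have "K\<^sup>2 * C < c * (real m)\<^sup>2" using c by (simp add: field_simps)
  then show False using main[OF m1(2)] by linarith
qed

text \<open>A nonnegative point is a limit of larger points of the spectrum, so it cannot belong to
  the discrete spectrum, whether or not it is an eigenvalue.\<close>

lemma essential_spectrum_eq: "essential_spectrum (H \<sigma> \<tau> \<alpha>) = complex_of_real ` {0..}"
proof
  show "essential_spectrum (H \<sigma> \<tau> \<alpha>) \<subseteq> complex_of_real ` {0..}"
    using spectrum_outside_discrete by (auto simp: essential_spectrum_def)
  have spec: "complex_of_real l \<in> spectrum (H \<sigma> \<tau> \<alpha>)" if "l \<ge> 0" for l
    using spectrum_contains_nonneg[of "sqrt l"] that by simp
  show "complex_of_real ` {0..} \<subseteq> essential_spectrum (H \<sigma> \<tau> \<alpha>)"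
  proof
    fix z assume "z \<in> complex_of_real ` {0..}"
    then obtain l where l: "l \<ge> 0" "z = complex_of_real l" by auto
    have "z islimpt spectrum (H \<sigma> \<tau> \<alpha>)"
      unfolding islimpt_approachable
    proof (intro allI impI)
      fix e :: real assume "e > 0"
      have "dist (complex_of_real (l + e / 2)) z = e / 2"
        using \<open>e > 0\<close> unfolding l(2) dist_of_real by (simp add: dist_real_def)
      then show "\<exists>x'\<in>spectrum (H \<sigma> \<tau> \<alpha>). x' \<noteq> z \<and> dist x' z < e"
        using spec[of "l + e / 2"] l(1) \<open>e > 0\<close>
        by (intro bexI[of _ "complex_of_real (l + e / 2)"]) auto
    qed
    then show "z \<in> essential_spectrum (H \<sigma> \<tau> \<alpha>)"
      using spec[OF l(1)] l(2) by (auto simp: essential_spectrum_def discrete_spectrum_def)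
  qed
qed

end

section \<open>From the hypotheses on the coefficients to the locale\<close>

section \<open>Uniformly locally integrable coefficients\<close>

text \<open>The bound is available for windows that start to the right of 0. The interval from
  \<open>inverse (Suc i)\<close> to \<open>n\<close> is covered by \<open>n\<close> such windows
  whatever \<open>i\<close> is, and monotone convergence in \<open>i\<close> reaches 0.\<close>

lemma uniformly_locally_integrable:
  fixes g :: "real \<Rightarrow> real"
  assumes g [measurable]: "g \<in> borel_measurable lebesgue"
    and bound: "\<And>x. x > 0 \<Longrightarrow> (\<integral>\<^sup>+t. ennreal \<bar>g t\<bar> * indicator {x..x+1} t \<partial>lebesgue) \<le> ennreal M"
    and zero: "\<And>t. t \<le> 0 \<Longrightarrow> g t = 0"
  shows "g absolutely_integrable_on {a..b}"
proof -
  have unit: "(\<integral>\<^sup>+t. ennreal \<bar>g t\<bar> * indicator {x..x + real n} t \<partial>lebesgue) \<le> of_nat n * ennreal M" if x: "x > 0" for x n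
  proof (induction n)
    case 0
    have "(\<integral>\<^sup>+t. ennreal \<bar>g t\<bar> * indicator {x} t \<partial>lebesgue) = (\<integral>\<^sup>+t. 0 \<partial>(lebesgue :: real measure))"
    proof (rule nn_integral_cong_AE)
      have "AE t in lebesgue. t \<noteq> x" by (intro AE_completion AE_lborel_singleton)
      then show "AE t in lebesgue. ennreal \<bar>g t\<bar> * indicator {x} t = 0" by eventually_elim simp
    qed
    then show ?case by simp
  next
    case (Suc n)
    have "(\<integral>\<^sup>+t. ennreal \<bar>g t\<bar> * indicator {x..x + real (Suc n)} t \<partial>lebesgue)
        \<le> (\<integral>\<^sup>+t. ennreal \<bar>g t\<bar> * indicator {x..x + real n} t + ennreal \<bar>g t\<bar> * indicator {x + real n..x + real n + 1} t \<partial>lebesgue)"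
      by (rule nn_integral_mono) (auto simp: indicator_def)
    also have "\<dots> = (\<integral>\<^sup>+t. ennreal \<bar>g t\<bar> * indicator {x..x + real n} t \<partial>lebesgue)
        + (\<integral>\<^sup>+t. ennreal \<bar>g t\<bar> * indicator {x + real n..x + real n + 1} t \<partial>lebesgue)"
      by (rule nn_integral_add) measurable
    also have "\<dots> \<le> of_nat n * ennreal M + ennreal M" using x by (intro add_mono Suc bound) auto
    finally show ?case by (simp add: distrib_right add.commute)
  qed
  obtain n :: nat where n: "\<bar>a\<bar> + \<bar>b\<bar> < real n" using reals_Archimedean2 by blast
  define f where "f i t = ennreal \<bar>g t\<bar> * indicator {inverse (real (Suc i))..real n} t" for i t
  have inc: "incseq f"
  proof (intro incseq_SucI le_funI)
    fix i t
    have le: "inverse (real (Suc (Suc i))) \<le> inverse (real (Suc i))" by (intro le_imp_inverse_le) auto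
    have "indicator {inverse (real (Suc i))..real n} t \<le> (indicator {inverse (real (Suc (Suc i)))..real n} t :: ennreal)"
      by (auto split: split_indicator simp del: of_nat_Suc intro: order_trans[OF le])
    then show "f i t \<le> f (Suc i) t" unfolding f_def by (rule mult_left_mono) simp
  qed
  have "(\<integral>\<^sup>+t. norm (indicator {a..b} t *\<^sub>R g t) \<partial>lebesgue) \<le> (\<integral>\<^sup>+t. (SUP i. f i t) \<partial>lebesgue)"
  proof (rule nn_integral_mono)
    fix t
    show "ennreal (norm (indicator {a..b} t *\<^sub>R g t)) \<le> (SUP i. f i t)"
    proof (cases "t \<in> {a..b} \<and> t > 0")
      case True
      then obtain i where "inverse (real (Suc i)) < t" using reals_Archimedean by blast
      then have "ennreal (norm (indicator {a..b} t *\<^sub>R g t)) \<le> f i t" 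
        using True n by (auto simp: f_def indicator_def)
      also have "\<dots> \<le> (SUP i. f i t)" by (rule SUP_upper) simp
      finally show ?thesis .
    qed (use zero[of t] in \<open>auto simp: indicator_def\<close>)
  qed
  also have "\<dots> = (SUP i. \<integral>\<^sup>+t. f i t \<partial>lebesgue)"
    by (rule nn_integral_monotone_convergence_SUP[OF inc]) (simp add: f_def[abs_def])
  also have "\<dots> \<le> of_nat n * ennreal M"
  proof (rule SUP_least)
    fix i
    have "(\<integral>\<^sup>+t. f i t \<partial>lebesgue) \<le> (\<integral>\<^sup>+t. ennreal \<bar>g t\<bar> * indicator {inverse (real (Suc i))..inverse (real (Suc i)) + real n} t \<partial>lebesgue)"
      unfolding f_def by (intro nn_integral_mono mult_left_mono) (auto simp: indicator_def intro: order_trans)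
    also have "\<dots> \<le> of_nat n * ennreal M" by (rule unit) simp
    finally show "(\<integral>\<^sup>+t. f i t \<partial>lebesgue) \<le> of_nat n * ennreal M" .
  qed
  also have "\<dots> < \<infinity>" by (simp add: ennreal_mult_less_top of_nat_less_top)
  finally show ?thesis unfolding set_integrable_def by (intro integrableI_bounded) measurable
qed

lemma SUP_nn_integral_bound:
  fixes g h :: "real \<Rightarrow> real"
  assumes "(SUP x\<in>{0<..}. \<integral>\<^sup>+t. ennreal (g t) \<partial>lebesgue_on {x..x+1}) < \<infinity>"
    and "\<And>t. t > 0 \<Longrightarrow> \<bar>h t\<bar> = g t"
  obtains M where "\<And>x. x > 0 \<Longrightarrow> (\<integral>\<^sup>+t. ennreal \<bar>h t\<bar> * indicator {x..x+1} t \<partial>lebesgue) \<le> ennreal M"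
proof -
  from assms(1) obtain M where M: "(SUP x\<in>{0<..}. \<integral>\<^sup>+t. ennreal (g t) \<partial>lebesgue_on {x..x+1}) = ennreal M"
    by (cases "SUP x\<in>{0<..}. \<integral>\<^sup>+t. ennreal (g t) \<partial>lebesgue_on {x..x+1}") auto
  show thesis
  proof (rule that)
    fix x :: real assume x: "x > 0"
    have "(\<integral>\<^sup>+t. ennreal \<bar>h t\<bar> * indicator {x..x+1} t \<partial>lebesgue) = (\<integral>\<^sup>+t. ennreal (g t) * indicator {x..x+1} t \<partial>lebesgue)"
      by (rule nn_integral_cong) (use x assms(2) in \<open>auto simp: indicator_def\<close>)
    also have "\<dots> = (\<integral>\<^sup>+t. ennreal (g t) \<partial>lebesgue_on {x..x+1})"
      by (rule nn_integral_restrict_space[symmetric]) simp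
    also have "\<dots> \<le> ennreal M" unfolding M[symmetric] using x by (intro SUP_upper) simp
    finally show "(\<integral>\<^sup>+t. ennreal \<bar>h t\<bar> * indicator {x..x+1} t \<partial>lebesgue) \<le> ennreal M" .
  qed
qed

theorem lemma1p7:
  fixes \<sigma> \<tau> :: "real \<Rightarrow> real" and \<alpha> :: real
  assumes "\<sigma> \<in> borel_measurable (lebesgue_on {0<..})"
    and "\<tau> \<in> borel_measurable (lebesgue_on {0<..})"
    and "(SUP x\<in>{0<..}. \<integral>\<^sup>+t. ennreal ((\<sigma> t)\<^sup>2) \<partial>lebesgue_on {x..x+1}) < \<infinity>"
    and "(SUP x\<in>{0<..}. \<integral>\<^sup>+t. ennreal \<bar>\<tau> t\<bar> \<partial>lebesgue_on {x..x+1}) < \<infinity>"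
    and "((\<lambda>x::real. \<integral>\<^sup>+t. ennreal ((\<sigma> t)\<^sup>2 + \<bar>\<tau> t\<bar>) \<partial>lebesgue_on {x..x+1}) \<longlongrightarrow> 0) at_top"
    and "\<alpha> \<in> {0..<pi}"
  shows "essential_spectrum (H \<sigma> \<tau> \<alpha>) = complex_of_real ` {0..}"
proof -
  \<comment> \<open>The coefficients are given on the open half-line; the value 0 elsewhere yields
    measurable functions on the line that are integrable across the origin.\<close>
  define s where "s t = (if t \<in> {0<..} then \<sigma> t else 0)" for t
  define r where "r t = (if t \<in> {0<..} then \<tau> t else 0)" for t
  define q where "q t = r t - (s t)\<^sup>2" for t
  have sm [measurable]: "s \<in> borel_measurable lebesgue" and rm [measurable]: "r \<in> borel_measurable lebesgue"
    unfolding s_def[abs_def] r_def[abs_def] by (rule borel_measurable_if_I[OF assms(1)], simp, rule borel_measurable_if_I[OF assms(2)], simp)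
  obtain M where M: "\<And>x. x > 0 \<Longrightarrow> (\<integral>\<^sup>+t. ennreal \<bar>(s t)\<^sup>2\<bar> * indicator {x..x+1} t \<partial>lebesgue) \<le> ennreal M"
    by (rule SUP_nn_integral_bound[OF assms(3), of "\<lambda>t. (s t)\<^sup>2"]) (auto simp: s_def)
  obtain M' where M': "\<And>x. x > 0 \<Longrightarrow> (\<integral>\<^sup>+t. ennreal \<bar>r t\<bar> * indicator {x..x+1} t \<partial>lebesgue) \<le> ennreal M'"
    by (rule SUP_nn_integral_bound[OF assms(4), of r]) (auto simp: r_def)
  have s2: "(\<lambda>t. (s t)\<^sup>2) absolutely_integrable_on {a..b}" for a b
    by (rule uniformly_locally_integrable[OF _ M], measurable) (simp add: s_def)
  have r: "r absolutely_integrable_on {a..b}" for a b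
    by (rule uniformly_locally_integrable[OF rm M']) (simp_all add: r_def)
  have qm: "q \<in> borel_measurable lebesgue" unfolding q_def[abs_def] by measurable
  interpret half_line_operator s q \<sigma> \<tau> \<alpha>
  proof
    \<comment> \<open>Local integrability of \<open>s\<close> follows from that of its square by
      \<open>\<bar>s\<bar> \<le> 1 + s^2\<close>.\<close>
    show "s absolutely_integrable_on {a..b}" for a b
    proof (rule set_integrable_bound)
      show "(\<lambda>t. 1 + (s t)\<^sup>2) absolutely_integrable_on {a..b}"
        by (intro set_integral_add s2) (rule absolutely_integrable_on_const, simp)
      have "\<bar>y\<bar> \<le> 1 + y\<^sup>2" for y :: real
        using zero_le_power2[of "\<bar>y\<bar> - 1"] zero_le_power2[of y] by (simp add: power2_diff)
      then show "AE t in lebesgue. t \<in> {a..b} \<longrightarrow> norm (s t) \<le> norm (1 + (s t)\<^sup>2)"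
        by (auto intro: order_trans[OF _ abs_ge_self])
    qed (simp add: set_borel_measurable_def)
    show "q absolutely_integrable_on {a..b}" for a b
      unfolding q_def[abs_def] by (rule set_integral_diff(1)[OF r s2])
    show "\<exists>N\<ge>0. \<forall>x\<ge>N. (\<integral>\<^sup>+t. indicator {x..x+1} t * ennreal ((s t)\<^sup>2 + \<bar>q t\<bar>) \<partial>lebesgue) \<le> ennreal e" if e: "e > 0" for e
    proof -
      \<comment> \<open>Passing from \<tau> to \<open>q\<close> at most doubles the integrand, hence
        \<open>e / 2\<close>.\<close>
      have "eventually (\<lambda>x. (\<integral>\<^sup>+t. ennreal ((\<sigma> t)\<^sup>2 + \<bar>\<tau> t\<bar>) \<partial>lebesgue_on {x..x+1}) < ennreal (e / 2)) at_top"
        using e by (intro order_tendstoD(2)[OF assms(5)]) simp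
      \<comment> \<open>Below, \<open>N\<close> is raised to at least 1, so that the windows lie in
        the open half-line, where \<open>s\<close> and \<open>r\<close> are the given
        coefficients.\<close>
      then obtain N where N: "\<And>x. x \<ge> N \<Longrightarrow> (\<integral>\<^sup>+t. ennreal ((\<sigma> t)\<^sup>2 + \<bar>\<tau> t\<bar>) \<partial>lebesgue_on {x..x+1}) < ennreal (e / 2)"
        unfolding eventually_at_top_linorder by blast
      have "(\<integral>\<^sup>+t. indicator {x..x+1} t * ennreal ((s t)\<^sup>2 + \<bar>q t\<bar>) \<partial>lebesgue) \<le> ennreal e" if x: "x \<ge> max N 1" for x
      proof -
        have "(\<integral>\<^sup>+t. indicator {x..x+1} t * ennreal ((s t)\<^sup>2 + \<bar>q t\<bar>) \<partial>lebesgue)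
            \<le> (\<integral>\<^sup>+t. 2 * (ennreal ((s t)\<^sup>2 + \<bar>r t\<bar>) * indicator {x..x+1} t) \<partial>lebesgue)"
        proof (rule nn_integral_mono)
          fix t
          have "\<bar>q t\<bar> \<le> \<bar>r t\<bar> + (s t)\<^sup>2" unfolding q_def by (rule order_trans[OF abs_triangle_ineq4]) simp
          then have "ennreal ((s t)\<^sup>2 + \<bar>q t\<bar>) \<le> ennreal (2 * ((s t)\<^sup>2 + \<bar>r t\<bar>))" by (intro ennreal_leI) simp
          also have "\<dots> = 2 * ennreal ((s t)\<^sup>2 + \<bar>r t\<bar>)" by (subst ennreal_mult) auto
          finally show "indicator {x..x+1} t * ennreal ((s t)\<^sup>2 + \<bar>q t\<bar>) \<le> 2 * (ennreal ((s t)\<^sup>2 + \<bar>r t\<bar>) * indicator {x..x+1} t)"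
            by (simp add: indicator_def)
        qed
        also have "\<dots> = 2 * (\<integral>\<^sup>+t. ennreal ((s t)\<^sup>2 + \<bar>r t\<bar>) * indicator {x..x+1} t \<partial>lebesgue)"
          by (rule nn_integral_cmult) measurable
        also have "(\<integral>\<^sup>+t. ennreal ((s t)\<^sup>2 + \<bar>r t\<bar>) * indicator {x..x+1} t \<partial>lebesgue)
            = (\<integral>\<^sup>+t. ennreal ((\<sigma> t)\<^sup>2 + \<bar>\<tau> t\<bar>) * indicator {x..x+1} t \<partial>lebesgue)"
          by (rule nn_integral_cong) (use x in \<open>auto simp: indicator_def s_def r_def\<close>)
        also have "\<dots> = (\<integral>\<^sup>+t. ennreal ((\<sigma> t)\<^sup>2 + \<bar>\<tau> t\<bar>) \<partial>lebesgue_on {x..x+1})"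
          by (rule nn_integral_restrict_space[symmetric]) simp
        also have "2 * \<dots> \<le> 2 * ennreal (e / 2)" using N[of x] x by (intro mult_left_mono) auto
        also have "\<dots> = ennreal (2 * (e / 2))" using e by (subst ennreal_mult) auto
        finally show ?thesis by simp
      qed
      then show ?thesis by (intro exI[of _ "max N 1"]) auto
    qed
  qed (rule sm qm s2 | simp add: q_def s_def r_def)+
  show ?thesis by (rule essential_spectrum_eq)
qed

end
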